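(* Let $n\ge2$, let $\Omega\subset\mathbb{R}^n$ be a bounded Lipschitz domain, let $\frac12<s<1$, $\phi\in H^{-s+\frac12}(\partial\Omega)$ and $u=\mathcal{S}_s\phi$. Then for every open ball $B_R$ centered at the origin with radius $R$ such that $\Omega\subset B_{R/2}$, $$\|u\|_{H^s(B_R)}\le c_R\|\phi\|_{H^{-s+\frac12}(\partial\Omega)},$$ where $c_R$ is independent of $\phi$. Moreover, for all $F\in C_c^\infty(B_R)$, $$\int_{B_R}F(x)u(x)\,dx=\Big\langle\phi,\int_{B_R}F(x)\Gamma_{2s}(x-\cdot)\,dx\Big\rangle.$$
   Context: $\partial\Omega$ carries surface measure $dQ$. $\Gamma_{2s}(x)=c(n,s)|x|^{-(n-2s)}$ is the Riesz kernel of order $2s$, with $c(n,s)>0$ chosen so that its Fourier transform is $|\xi|^{-2s}$. For $0<\alpha<1$, $H^\alpha(\partial\Omega)$ is the space of $\phi\in L^2(\partial\Omega)$ with $\int_{\partial\Omega}\int_{\partial\Omega}\frac{|\phi(P)-\phi(Q)|^2}{|P-Q|^{n-1+2\alpha}}dPdQ<\infty$, $H^{-\alpha}(\partial\Omega)=(H^\alpha(\partial\Omega))^*$, and $\langle\cdot,\cdot\rangle$ is the pairing between $H^{-\alpha}(\partial\Omega)$ and $H^\alpha(\partial\Omega)$ (in the last formula the function $\int_{B_R}F(x)\Gamma_{2s}(x-\cdot)dx$ is restricted to $\partial\Omega$, where it lies in $H^{s-\frac12}(\partial\Omega)$). $\mathcal{S}_s\phi(x)=\langle\phi,\Gamma_{2s}(x-\cdot)\rangle$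 for $x\in\mathbb{R}^n\setminus\partial\Omega$ (equal to $\int_{\partial\Omega}\Gamma_{2s}(x-Q)\phi(Q)dQ$ for $\phi\in L^2(\partial\Omega)$). For $0<s<1$, $H^s(B_R)$ is the space of $v\in L^2(B_R)$ with $\int_{B_R}\int_{B_R}\frac{|v(x)-v(y)|^2}{|x-y|^{n+2s}}dydx<\infty$. *)

theory Defs
  imports "HOL-Analysis.Analysis"
begin

text \<open>Coordinate-free version of the usual definition: an open connected set such that
near every boundary point P, after choosing a unit direction e (the "vertical" axis),
Omega coincides inside a cylinder around P with the region strictly above the graph of a
Lipschitz function g of the component orthogonal to e.\<close>

definition lipschitz_domain :: "(real^'n) set \<Rightarrow> bool" where
  "lipschitz_domain \<Omega> \<longleftrightarrow> open \<Omega> \<and> connected \<Omega> \<and> \<Omega> \<noteq> {} \<and>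
    (\<forall>P\<in>frontier \<Omega>. \<exists>(e::real^'n) (r::real) (h::real) (L::real) (g::real^'n \<Rightarrow> real).
       norm e = 1 \<and> r > 0 \<and> h > 0 \<and> L-lipschitz_on UNIV g \<and>
       (let C = {x. norm ((x - P) - ((x - P) \<bullet> e) *\<^sub>R e) < r \<and> \<bar>(x - P) \<bullet> e\<bar> < h}
        in \<Omega> \<inter> C = {x \<in> C. x \<bullet> e > g (x - (x \<bullet> e) *\<^sub>R e)}))"

definition hausdorff_pre :: "real \<Rightarrow> real \<Rightarrow> ('a::metric_space) set \<Rightarrow> ennreal" where
  "hausdorff_pre d \<delta> A =
     (INF C \<in> {C :: nat \<Rightarrow> 'a set. A \<subseteq> (\<Union>i. C i) \<and> (\<forall>i. bounded (C i) \<and> diameter (C i) < \<delta>)}.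
        (\<Sum>i. ennreal (unit_ball_vol d * (diameter (C i) / 2) powr d)))"

definition hausdorff_outer :: "real \<Rightarrow> ('a::metric_space) set \<Rightarrow> ennreal" where
  "hausdorff_outer d A = (SUP \<delta> \<in> {0<..}. hausdorff_pre d \<delta> A)"

definition surface_measure :: "(real^'n) set \<Rightarrow> (real^'n) measure" where
  "surface_measure \<Omega> =
     measure_of (frontier \<Omega>) (sets (restrict_space borel (frontier \<Omega>)))
       (hausdorff_outer (real CARD('n) - 1))"

definition gagliardo_bd :: "real \<Rightarrow> (real^'n) set \<Rightarrow> (real^'n \<Rightarrow> real) \<Rightarrow> ennreal" where
  "gagliardo_bd \<alpha> \<Omega> \<psi> =
     (\<integral>\<^sup>+ P. (\<integral>\<^sup>+ Q. ennreal ((\<psi> P - \<psi> Q)\<^sup>2 / norm (P - Q) powr (real CARD('n) - 1 + 2 * \<alpha>))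
        \<partial>surface_measure \<Omega>) \<partial>surface_measure \<Omega>)"

definition L2sq_bd :: "(real^'n) set \<Rightarrow> (real^'n \<Rightarrow> real) \<Rightarrow> ennreal" where
  "L2sq_bd \<Omega> \<psi> = (\<integral>\<^sup>+ P. ennreal ((\<psi> P)\<^sup>2) \<partial>surface_measure \<Omega>)"

definition H_bd :: "real \<Rightarrow> (real^'n) set \<Rightarrow> (real^'n \<Rightarrow> real) set" where
  "H_bd \<alpha> \<Omega> = {\<psi>. \<psi> \<in> borel_measurable (surface_measure \<Omega>) \<and>
                    L2sq_bd \<Omega> \<psi> < \<infinity> \<and> gagliardo_bd \<alpha> \<Omega> \<psi> < \<infinity>}"

definition H_bd_norm :: "real \<Rightarrow> (real^'n) set \<Rightarrow> (real^'n \<Rightarrow> real) \<Rightarrow> real" where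
  "H_bd_norm \<alpha> \<Omega> \<psi> = sqrt (enn2real (L2sq_bd \<Omega> \<psi> + gagliardo_bd \<alpha> \<Omega> \<psi>))"

text \<open>H^{-alpha}(boundary) = dual of H^alpha(boundary): bounded linear functionals on it
(only their values on H^alpha matter).\<close>
definition H_bd_dual :: "real \<Rightarrow> (real^'n) set \<Rightarrow> ((real^'n \<Rightarrow> real) \<Rightarrow> real) set" where
  "H_bd_dual \<alpha> \<Omega> = {l.
     (\<forall>\<psi>1\<in>H_bd \<alpha> \<Omega>. \<forall>\<psi>2\<in>H_bd \<alpha> \<Omega>. \<forall>a b::real.
        l (\<lambda>P. a * \<psi>1 P + b * \<psi>2 P) = a * l \<psi>1 + b * l \<psi>2) \<and>
     (\<exists>K. \<forall>\<psi>\<in>H_bd \<alpha> \<Omega>. \<bar>l \<psi>\<bar> \<le> K * H_bd_norm \<alpha> \<Omega> \<psi>)}"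

definition H_bd_dual_norm :: "real \<Rightarrow> (real^'n) set \<Rightarrow> ((real^'n \<Rightarrow> real) \<Rightarrow> real) \<Rightarrow> real" where
  "H_bd_dual_norm \<alpha> \<Omega> l = Sup {\<bar>l \<psi>\<bar> | \<psi>. \<psi> \<in> H_bd \<alpha> \<Omega> \<and> H_bd_norm \<alpha> \<Omega> \<psi> \<le> 1}"

text \<open>c(n,s) = Gamma(n/2 - s) / (4^s pi^(n/2) Gamma(s)): the constant for which the Fourier
transform (convention  f^(xi) = integral f(x) e^(-i x.xi) dx) of c |x|^(-(n-2s)) is |xi|^(-2s).\<close>
definition riesz_const :: "nat \<Rightarrow> real \<Rightarrow> real" where
  "riesz_const n s = Gamma (real n / 2 - s) / (4 powr s * pi powr (real n / 2) * Gamma s)"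

definition riesz_kernel :: "real \<Rightarrow> real^'n \<Rightarrow> real" where
  "riesz_kernel s x = riesz_const CARD('n) s * norm x powr (- (real CARD('n) - 2 * s))"

definition single_layer ::
    "real \<Rightarrow> ((real^'n \<Rightarrow> real) \<Rightarrow> real) \<Rightarrow> real^'n \<Rightarrow> real" where
  "single_layer s l x = l (\<lambda>Q. riesz_kernel s (x - Q))"

definition Hs_ball_sq :: "real \<Rightarrow> real \<Rightarrow> (real^'n \<Rightarrow> real) \<Rightarrow> ennreal" where
  "Hs_ball_sq s R v =
     (\<integral>\<^sup>+ x. ennreal ((v x)\<^sup>2) \<partial>lebesgue_on (ball 0 R)) +
     (\<integral>\<^sup>+ x. (\<integral>\<^sup>+ y. ennreal ((v x - v y)\<^sup>2 / norm (x - y) powr (real CARD('n) + 2 * s))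
        \<partial>lebesgue_on (ball 0 R)) \<partial>lebesgue_on (ball 0 R))"

definition Hs_ball :: "real \<Rightarrow> real \<Rightarrow> (real^'n \<Rightarrow> real) set" where
  "Hs_ball s R = {v. v \<in> borel_measurable (lebesgue_on (ball 0 R)) \<and> Hs_ball_sq s R v < \<infinity>}"

definition Hs_ball_norm :: "real \<Rightarrow> real \<Rightarrow> (real^'n \<Rightarrow> real) \<Rightarrow> real" where
  "Hs_ball_norm s R v = sqrt (enn2real (Hs_ball_sq s R v))"

fun partial_iter :: "'n list \<Rightarrow> (real^'n \<Rightarrow> real) \<Rightarrow> real^'n \<Rightarrow> real" where
  "partial_iter [] f = f"
| "partial_iter (i # is) f = (\<lambda>x. frechet_derivative (partial_iter is f) (at x) (axis i 1))"

definition smooth_fun :: "(real^'n \<Rightarrow> real) \<Rightarrow> bool" where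
  "smooth_fun f \<longleftrightarrow> (\<forall>is x. partial_iter is f differentiable (at x))"

definition test_functions :: "(real^'n) set \<Rightarrow> (real^'n \<Rightarrow> real) set" where
  "test_functions U = {F. smooth_fun F \<and> compact (closure {x. F x \<noteq> 0})
                          \<and> closure {x. F x \<noteq> 0} \<subseteq> U}"

end

theory Submission
  imports Defs
begin

text \<open>Write \<open>\<Gamma> = |\<cdot>|\<^sup>-\<^sup>t\<close> with \<open>t = N - 2s\<close>, and \<open>[v]\<close> for the Gagliardo seminorm of order \<open>s\<close> on the whole
  space. By duality the bound on \<open>u\<close> reduces to bounds on \<open>\<Gamma> * f\<close> in \<open>H\<^sup>s\<^sup>-\<^sup>1\<^sup>/\<^sup>2\<close> of the boundary: for \<open>f\<close> in
  \<open>L\<^sup>2\<close>, and for \<open>f\<close> a fractional divergence of some \<open>G\<close> in \<open>L\<^sup>2\<close> of pairs. No Fourier analysis is needed. The energy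
  \<open>[\<Gamma> * f]\<^sup>2\<close> is an absolutely convergent quadratic form in \<open>f\<close> whose kernel is covariant under similarities, so
  it equals \<open>c \<integral> f (\<Gamma> * f)\<close>; hence \<open>[\<Gamma> * f]\<^sup>2 = c \<integral> G D(\<Gamma> * f)\<close>, which bounds \<open>[\<Gamma> * f]\<close> by \<open>|c|\<close> times the norm of \<open>G\<close>.
  A trace inequality, proved by comparing values with averages over dyadic balls, passes to the boundary; it
  uses only that the surface measure of a ball of radius \<open>r\<close> is at most a constant times \<open>r\<close> to the power
  \<open>N - 1\<close>, which for a Lipschitz domain follows by covering graphs with boxes. Since \<open>u\<close> is regular away
  from the boundary, the functional is first interchanged with integrals at distance at least \<open>\<delta>\<close> from the
  boundary; the resulting bounds do not depend on \<open>\<delta>\<close>.\<close>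

subsection \<open>Radial integrals\<close>

text \<open>The estimate closes on itself. Let \<open>B\<close> be the squared norm of the truncated
  potential, in L^2 or as a Gagliardo integral. Testing the functional against that same potential
  gives B = l(\<Gamma> * f) for a suitable density f, and the boundary bounds turn this into B \<le>
  \<Lambda> * sqrt (C * B). Cancelling the root requires B to be finite beforehand, and the
  interchange of functional and integral uses uniform bounds on the kernel, which fail at the
  boundary; the truncation at \<delta> answers both needs. The range of s enters through exponents.
  From s > 1/2 comes t + 1 < N, so potentials of bounded densities are Lipschitz and have pointwise
  boundary values; also 2^(2s-1) > 1, which leaves room for the absorption in the trace inequality.
  From s < 1 comes the convergence of the local integrals. The Lipschitz constant of a potential
  never reaches the final constants: it only certifies that the sum to be absorbed is
  finite.\<close>

lemma ennreal_le_suminf: "f i \<le> (\<Sum>j. f j)" for f :: "nat \<Rightarrow> ennreal"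
  using sum_le_suminf[of f "{i}"] by simp

lemma dyadic_ex:
  fixes x :: real assumes "1 \<le> x"
  shows "\<exists>n::nat. 2 ^ n \<le> x \<and> x < 2 ^ Suc n"
proof -
  define m where "m = (LEAST m. x < 2 ^ m)"
  have ex: "\<exists>m. x < 2 ^ m" by (rule real_arch_pow) simp
  have m: "x < 2 ^ m" unfolding m_def using ex by (rule LeastI_ex)
  have "m \<noteq> 0" using m assms by (intro notI) simp
  then obtain n where n: "m = Suc n" by (cases m) auto
  have "\<not> x < 2 ^ n" using not_less_Least[of n "\<lambda>m. x < 2 ^ m"] n unfolding m_def[symmetric] by simp
  then show ?thesis using m n by (intro exI[of _ n]) auto
qed

lemma suminf_ennreal_geometric:
  assumes "0 \<le> c" "0 \<le> q" "q < 1"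
  shows "(\<Sum>j. ennreal (c * q ^ j)) = ennreal (c / (1 - q))"
  using assms by (subst suminf_ennreal2)
    (auto simp: suminf_mult suminf_geometric summable_geometric intro!: summable_mult)

lemma two_powr_power: "(2 ^ j :: real) powr a = (2 powr a) ^ j"
  by (simp add: powr_realpow[symmetric] powr_powr mult.commute)

text \<open>Concentric balls replace annuli: the power is at most the sum of constants on the balls
  of radius r / 2^j, so only upper bounds on the measure of balls are used. The resulting series has
  ratio 2^(a-d), less than 1 because a < d. It serves for Lebesgue measure and for the boundary
  measure alike.\<close>

lemma nn_integral_radial_inside:
  fixes M :: "'a::metric_space measure"
  assumes sets: "sets M = sets borel" and "0 \<le> A" "0 < r" "0 \<le> a" "a < d"
    and growth: "\<And>r. 0 < r \<Longrightarrow> emeasure M (cball x r) \<le> ennreal (A * r powr d)"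
  shows "(\<integral>\<^sup>+y. ennreal (dist x y powr (-a)) * indicator (cball x r) y \<partial>M)
     \<le> ennreal (A * 2 powr a / (1 - 2 powr (a - d)) * r powr (d - a))"
proof -
  define c where "c j = 2 powr a * (r / 2 ^ j) powr (-a)" for j :: nat
  have c0: "c j \<ge> 0" for j unfolding c_def by simp
  have pw: "ennreal (dist x y powr (-a)) * indicator (cball x r) y
      \<le> (\<Sum>j. ennreal (c j) * indicator (cball x (r / 2 ^ j)) y)" (is "?L \<le> ?R") for y
  proof (cases "y \<in> cball x r \<and> y \<noteq> x")
    \<comment> \<open>The centre itself contributes nothing, because \<open>0 powr _\<close> is
      0.\<close>
    case False then show ?thesis by (auto simp: indicator_def)
  next
    case True
    then have d: "0 < dist x y" "dist x y \<le> r" by (auto)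
    then obtain n where n: "2 ^ n \<le> r / dist x y" "r / dist x y < 2 ^ Suc n"
      using dyadic_ex[of "r / dist x y"] by (auto simp: field_simps)
    have 1: "dist x y \<le> r / 2 ^ n" using n d by (simp add: field_simps)
    have 2: "r / 2 ^ n / 2 \<le> dist x y" using n d by (simp add: field_simps)
    have "dist x y powr (-a) \<le> (r / 2 ^ n / 2) powr (-a)"
      using 2 d assms by (intro powr_mono2') auto
    also have "\<dots> = c n" unfolding c_def using assms
      by (simp add: powr_divide powr_minus powr_mult)
    finally have "?L \<le> ennreal (c n) * indicator (cball x (r / 2 ^ n)) y"
      using 1 True by (auto simp: indicator_def intro!: ennreal_leI)
    also have "\<dots> \<le> ?R" by (rule ennreal_le_suminf)
    finally show ?thesis .
  qed
  have "(\<integral>\<^sup>+y. ennreal (dist x y powr (-a)) * indicator (cball x r) y \<partial>M)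
     \<le> (\<integral>\<^sup>+y. (\<Sum>j. ennreal (c j) * indicator (cball x (r / 2 ^ j)) y) \<partial>M)"
    by (intro nn_integral_mono pw)
  also have "\<dots> = (\<Sum>j. \<integral>\<^sup>+y. ennreal (c j) * indicator (cball x (r / 2 ^ j)) y \<partial>M)"
    by (intro nn_integral_suminf borel_measurable_times_ennreal borel_measurable_const borel_measurable_indicator) (simp add: sets)
  also have "\<dots> = (\<Sum>j. ennreal (c j) * emeasure M (cball x (r / 2 ^ j)))"
    using sets by (intro suminf_cong nn_integral_cmult_indicator) auto
  also have "\<dots> \<le> (\<Sum>j. ennreal (c j) * ennreal (A * (r / 2 ^ j) powr d))"
    using assms by (intro suminf_le mult_left_mono growth) auto
  also have "\<dots> = (\<Sum>j. ennreal (A * 2 powr a * r powr (d - a) * (2 powr (a - d)) ^ j))"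
  proof (intro suminf_cong)
    fix j :: nat
    have "(r / 2 ^ j) powr (-a) * (r / 2 ^ j) powr d = r powr (d - a) * (2 powr (a - d)) ^ j"
      using assms by (simp add: powr_add[symmetric] powr_divide two_powr_power[symmetric] powr_minus_divide[symmetric] powr_diff field_simps)
    then show "ennreal (c j) * ennreal (A * (r / 2 ^ j) powr d) = ennreal (A * 2 powr a * r powr (d - a) * (2 powr (a - d)) ^ j)"
      using c0[of j] by (subst ennreal_mult'[symmetric]) (auto simp: c_def algebra_simps)
  qed
  also have "\<dots> = ennreal (A * 2 powr a * r powr (d - a) / (1 - 2 powr (a - d)))"
    using assms by (intro suminf_ennreal_geometric) (auto intro!: powr_less_one)
  finally show ?thesis by (simp add: field_simps)
qed

text \<open>The same argument with growing balls: the shell from r 2^j to r 2^(j+1) is enclosed in a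
  ball of its outer radius, and the ratio is now 2^(d-a).\<close>

lemma nn_integral_radial_outside:
  fixes M :: "'a::metric_space measure"
  assumes sets: "sets M = sets borel" and "0 \<le> A" "0 < r" "0 \<le> d" "d < a"
    and growth: "\<And>r. 0 < r \<Longrightarrow> emeasure M (cball x r) \<le> ennreal (A * r powr d)"
  shows "(\<integral>\<^sup>+y. ennreal (dist x y powr (-a)) * indicator (- ball x r) y \<partial>M)
     \<le> ennreal (A * 2 powr d / (1 - 2 powr (d - a)) * r powr (d - a))"
proof -
  define c where "c j = (r * 2 ^ j) powr (-a)" for j :: nat
  have c0: "c j \<ge> 0" for j unfolding c_def by simp
  have pw: "ennreal (dist x y powr (-a)) * indicator (- ball x r) y
      \<le> (\<Sum>j. ennreal (c j) * indicator (cball x (2 * (r * 2 ^ j))) y)" (is "?L \<le> ?R") for y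
  proof (cases "y \<in> - ball x r")
    case False then show ?thesis by (auto simp: indicator_def)
  next
    case True
    then have d: "r \<le> dist x y" by (auto)
    then obtain n where n: "2 ^ n \<le> dist x y / r" "dist x y / r < 2 ^ Suc n"
      using dyadic_ex[of "dist x y / r"] assms by (auto simp: field_simps)
    have 1: "dist x y \<le> 2 * (r * 2 ^ n)" using n assms by (simp add: field_simps)
    have 2: "r * 2 ^ n \<le> dist x y" using n assms by (simp add: field_simps)
    have "dist x y powr (-a) \<le> c n" unfolding c_def
      using 2 d assms by (intro powr_mono2') auto
    then have "?L \<le> ennreal (c n) * indicator (cball x (2 * (r * 2 ^ n))) y"
      using 1 True by (auto simp: indicator_def intro!: ennreal_leI)
    also have "\<dots> \<le> ?R" by (rule ennreal_le_suminf)
    finally show ?thesis .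
  qed
  have "(\<integral>\<^sup>+y. ennreal (dist x y powr (-a)) * indicator (- ball x r) y \<partial>M)
     \<le> (\<integral>\<^sup>+y. (\<Sum>j. ennreal (c j) * indicator (cball x (2 * (r * 2 ^ j))) y) \<partial>M)"
    by (intro nn_integral_mono pw)
  also have "\<dots> = (\<Sum>j. \<integral>\<^sup>+y. ennreal (c j) * indicator (cball x (2 * (r * 2 ^ j))) y \<partial>M)"
    by (intro nn_integral_suminf borel_measurable_times_ennreal borel_measurable_const borel_measurable_indicator) (simp add: sets)
  also have "\<dots> = (\<Sum>j. ennreal (c j) * emeasure M (cball x (2 * (r * 2 ^ j))))"
    using sets by (intro suminf_cong nn_integral_cmult_indicator) auto
  also have "\<dots> \<le> (\<Sum>j. ennreal (c j) * ennreal (A * (2 * (r * 2 ^ j)) powr d))"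
    using assms by (intro suminf_le mult_left_mono growth) auto
  also have "\<dots> = (\<Sum>j. ennreal (A * 2 powr d * r powr (d - a) * (2 powr (d - a)) ^ j))"
  proof (intro suminf_cong)
    fix j :: nat
    have "(r * 2 ^ j) powr (-a) * (2 * (r * 2 ^ j)) powr d = 2 powr d * r powr (d - a) * (2 powr (d - a)) ^ j"
      using assms by (simp add: powr_mult two_powr_power[symmetric] powr_minus_divide powr_diff field_simps)
    then show "ennreal (c j) * ennreal (A * (2 * (r * 2 ^ j)) powr d) = ennreal (A * 2 powr d * r powr (d - a) * (2 powr (d - a)) ^ j)"
      using c0[of j] by (subst ennreal_mult'[symmetric]) (auto simp: c_def algebra_simps)
  qed
  also have "\<dots> = ennreal (A * 2 powr d * r powr (d - a) / (1 - 2 powr (d - a)))"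
    using assms by (intro suminf_ennreal_geometric) (auto intro!: powr_less_one)
  finally show ?thesis by (simp add: field_simps)
qed

lemma lborel_growth:
  fixes x :: "'a::euclidean_space"
  assumes "0 < r"
  shows "emeasure lborel (cball x r) \<le> ennreal (unit_ball_vol (real DIM('a)) * r powr real DIM('a))"
  using assms by (simp add: emeasure_cball powr_realpow)

lemma lborel_radial_inside:
  assumes "0 \<le> a" "a < real DIM('a::euclidean_space)"
  obtains C where "0 \<le> C" "\<And>(x::'a) r. 0 < r \<Longrightarrow>
    (\<integral>\<^sup>+y. ennreal (norm (x - y) powr (-a)) * indicator (cball x r) y \<partial>lborel) \<le> ennreal (C * r powr (real DIM('a) - a))"
proof -
  let ?C = "unit_ball_vol (real DIM('a)) * 2 powr a / (1 - 2 powr (a - real DIM('a)))"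
  have "(2::real) powr (a - real DIM('a)) < 1" using assms by (intro powr_less_one) auto
  then have "0 \<le> ?C" by (intro divide_nonneg_nonneg mult_nonneg_nonneg) auto
  moreover have "(\<integral>\<^sup>+y. ennreal (norm (x - y) powr (-a)) * indicator (cball x r) y \<partial>lborel) \<le> ennreal (?C * r powr (real DIM('a) - a))"
    if "0 < r" for x :: 'a and r
    using that assms nn_integral_radial_inside[OF sets_lborel unit_ball_vol_nonneg[OF of_nat_0_le_iff] _ _ _ lborel_growth, of r a x]
    by (simp add: dist_norm)
  ultimately show ?thesis by (rule that)
qed

lemma lborel_radial_outside:
  assumes "real DIM('a::euclidean_space) < a"
  obtains C where "0 \<le> C" "\<And>(x::'a) r. 0 < r \<Longrightarrow>
    (\<integral>\<^sup>+y. ennreal (norm (x - y) powr (-a)) * indicator (- ball x r) y \<partial>lborel) \<le> ennreal (C * r powr (real DIM('a) - a))"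
proof -
  let ?C = "unit_ball_vol (real DIM('a)) * 2 powr real DIM('a) / (1 - 2 powr (real DIM('a) - a))"
  have "(2::real) powr (real DIM('a) - a) < 1" using assms by (intro powr_less_one) auto
  then have "0 \<le> ?C" by (intro divide_nonneg_nonneg mult_nonneg_nonneg) auto
  moreover have "(\<integral>\<^sup>+y. ennreal (norm (x - y) powr (-a)) * indicator (- ball x r) y \<partial>lborel) \<le> ennreal (?C * r powr (real DIM('a) - a))"
    if "0 < r" for x :: 'a and r
    using that assms nn_integral_radial_outside[OF sets_lborel unit_ball_vol_nonneg[OF of_nat_0_le_iff] _ _ _ lborel_growth, of r a x]
    by (simp add: dist_norm)
  ultimately show ?thesis by (rule that)
qed

lemma nn_integral_cmult_le:
  assumes "f \<in> borel_measurable M" "integral\<^sup>N M f \<le> ennreal b" "0 \<le> c"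
  shows "(\<integral>\<^sup>+x. ennreal c * f x \<partial>M) \<le> ennreal (c * b)"
  using assms by (simp add: nn_integral_cmult ennreal_mult' mult_left_mono)

lemma ennreal_add_le:
  assumes "x \<le> ennreal a" "y \<le> ennreal b" "0 \<le> a" "0 \<le> b"
  shows "x + y \<le> ennreal (a + b)"
  using add_mono[OF assms(1,2)] assms by simp

text \<open>With r half the distance of \<open>P\<close> and \<open>Q\<close>, a point within r of
  one centre is at least r from the other, so one factor freezes. Elsewhere the nearer centre
  dominates both factors and leaves the single exponent a + c outside a ball, integrable at infinity
  since a + c > N.\<close>

lemma riesz_composition:
  assumes "0 \<le> a" "a < real DIM('a::euclidean_space)" "0 \<le> c" "c < real DIM('a)" "real DIM('a) < a + c"
  obtains K where "0 \<le> K" "\<And>P Q :: 'a. P \<noteq> Q \<Longrightarrow>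
    (\<integral>\<^sup>+x. ennreal (norm (x - P) powr (-a) * norm (x - Q) powr (-c)) \<partial>lborel)
      \<le> ennreal (K * norm (P - Q) powr (real DIM('a) - a - c))"
proof -
  let ?N = "real DIM('a)"
  obtain C1 where C1: "0 \<le> C1" "\<And>(x::'a) r. 0 < r \<Longrightarrow>
    (\<integral>\<^sup>+y. ennreal (norm (x - y) powr (-a)) * indicator (cball x r) y \<partial>lborel) \<le> ennreal (C1 * r powr (?N - a))"
    by (rule lborel_radial_inside[OF assms(1,2)], rule that)
  obtain C2 where C2: "0 \<le> C2" "\<And>(x::'a) r. 0 < r \<Longrightarrow>
    (\<integral>\<^sup>+y. ennreal (norm (x - y) powr (-c)) * indicator (cball x r) y \<partial>lborel) \<le> ennreal (C2 * r powr (?N - c))"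
    by (rule lborel_radial_inside[OF assms(3,4)], rule that)
  obtain C3 where C3: "0 \<le> C3" "\<And>(x::'a) r. 0 < r \<Longrightarrow>
    (\<integral>\<^sup>+y. ennreal (norm (x - y) powr (-(a+c))) * indicator (- ball x r) y \<partial>lborel) \<le> ennreal (C3 * r powr (?N - (a + c)))"
    by (rule lborel_radial_outside[OF assms(5)], rule that)
  define K where "K = (C1 + C2 + 2 * C3) * 2 powr (a + c - ?N)"
  have "0 \<le> K" using C1 C2 C3 by (simp add: K_def)
  moreover have "(\<integral>\<^sup>+x. ennreal (norm (x - P) powr (-a) * norm (x - Q) powr (-c)) \<partial>lborel)
      \<le> ennreal (K * norm (P - Q) powr (?N - a - c))" if PQ: "P \<noteq> Q" for P Q :: 'a
  proof -
    define r where "r = norm (P - Q) / 2"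
    have r: "0 < r" using PQ by (simp add: r_def)
    have tri: "2 * r \<le> norm (P - x) + norm (Q - x)" for x
      unfolding r_def using norm_triangle_ineq4[of "P - x" "Q - x"] by simp
    have split: "z powr (-(a+c)) = z powr (-a) * z powr (-c)" for z :: real
      by (simp add: powr_add[symmetric])
    define fA where "fA x = ennreal (r powr (-c)) * (ennreal (norm (P - x) powr (-a)) * indicator (cball P r) x)" for x
    define fB where "fB x = ennreal (r powr (-a)) * (ennreal (norm (Q - x) powr (-c)) * indicator (cball Q r) x)" for x
    define fC where "fC x = ennreal (norm (P - x) powr (-(a+c))) * indicator (- ball P r) x" for x
    define fD where "fD x = ennreal (norm (Q - x) powr (-(a+c))) * indicator (- ball Q r) x" for x
    have pw: "ennreal (norm (x - P) powr (-a) * norm (x - Q) powr (-c)) \<le> fA x + fB x + fC x + fD x" (is "?L \<le> _") for x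
    proof -
      consider "norm (P - x) \<le> r" | "norm (Q - x) \<le> r" | "r < norm (P - x)" "norm (P - x) \<le> norm (Q - x)"
        | "r < norm (Q - x)" "norm (Q - x) \<le> norm (P - x)" by linarith
      then show ?thesis
      proof cases
        case 1
        then have "norm (Q - x) powr (-c) \<le> r powr (-c)" using tri[of x] r assms by (intro powr_mono2') auto
        then have "norm (x - P) powr (-a) * norm (x - Q) powr (-c) \<le> r powr (-c) * norm (P - x) powr (-a)"
          unfolding mult.commute[of "r powr (-c)"] norm_minus_commute[of x] by (rule mult_left_mono) simp
        then have "?L \<le> fA x" unfolding fA_def using 1 by (auto simp: dist_norm ennreal_mult'[symmetric] intro!: ennreal_leI)
        then show ?thesis by (simp add: add_increasing2)
      next
        case 2
        then have "norm (P - x) powr (-a) \<le> r powr (-a)" using tri[of x] r assms by (intro powr_mono2') auto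
        then have "norm (x - P) powr (-a) * norm (x - Q) powr (-c) \<le> r powr (-a) * norm (Q - x) powr (-c)"
          by (simp add: norm_minus_commute mult_right_mono)
        then have "?L \<le> fB x" unfolding fB_def using 2 by (auto simp: dist_norm ennreal_mult'[symmetric] intro!: ennreal_leI)
        then show ?thesis by (simp add: add_increasing add_increasing2)
      next
        case 3
        then have "norm (Q - x) powr (-c) \<le> norm (P - x) powr (-c)" using r assms by (intro powr_mono2') auto
        then have "norm (x - P) powr (-a) * norm (x - Q) powr (-c) \<le> norm (P - x) powr (-(a+c))"
          unfolding split norm_minus_commute[of x] by (intro mult_left_mono) auto
        then have "?L \<le> fC x" unfolding fC_def using 3 by (auto simp: dist_norm intro!: ennreal_leI)
        then show ?thesis by (simp add: add_increasing add_increasing2)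
      next
        case 4
        then have "norm (P - x) powr (-a) \<le> norm (Q - x) powr (-a)" using r assms by (intro powr_mono2') auto
        then have "norm (x - P) powr (-a) * norm (x - Q) powr (-c) \<le> norm (Q - x) powr (-(a+c))"
          unfolding split norm_minus_commute[of x] by (intro mult_right_mono) auto
        then have "?L \<le> fD x" unfolding fD_def using 4 by (auto simp: dist_norm intro!: ennreal_leI)
        then show ?thesis by (simp add: add_increasing add_increasing2)
      qed
    qed
    have A: "integral\<^sup>N lborel fA \<le> ennreal (r powr (-c) * (C1 * r powr (?N - a)))" unfolding fA_def
      by (intro nn_integral_cmult_le C1(2)[OF r] borel_measurable_times_ennreal borel_measurable_indicator) auto
    have B: "integral\<^sup>N lborel fB \<le> ennreal (r powr (-a) * (C2 * r powr (?N - c)))" unfolding fB_def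
      by (intro nn_integral_cmult_le C2(2)[OF r] borel_measurable_times_ennreal borel_measurable_indicator) auto
    have C: "integral\<^sup>N lborel fC \<le> ennreal (C3 * r powr (?N - (a + c)))" unfolding fC_def
      by (rule C3(2)[OF r])
    have D: "integral\<^sup>N lborel fD \<le> ennreal (C3 * r powr (?N - (a + c)))" unfolding fD_def
      by (rule C3(2)[OF r])
    have [measurable]: "fA \<in> borel_measurable borel" "fB \<in> borel_measurable borel"
      "fC \<in> borel_measurable borel" "fD \<in> borel_measurable borel"
      unfolding fA_def[abs_def] fB_def[abs_def] fC_def[abs_def] fD_def[abs_def]
      by (intro borel_measurable_times_ennreal borel_measurable_indicator borel_measurable_const; simp)+
    have "(\<integral>\<^sup>+x. ennreal (norm (x - P) powr (-a) * norm (x - Q) powr (-c)) \<partial>lborel)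
      \<le> (\<integral>\<^sup>+x. fA x + fB x + fC x + fD x \<partial>lborel)"
      by (intro nn_integral_mono pw)
    also have "\<dots> = integral\<^sup>N lborel fA + integral\<^sup>N lborel fB + integral\<^sup>N lborel fC + integral\<^sup>N lborel fD"
      by (simp add: nn_integral_add)
    also have "\<dots> \<le> ennreal (r powr (-c) * (C1 * r powr (?N - a)) + r powr (-a) * (C2 * r powr (?N - c))
        + C3 * r powr (?N - (a + c)) + C3 * r powr (?N - (a + c)))"
      using C1(1) C2(1) C3(1)
      by (intro ennreal_add_le A B C D add_nonneg_nonneg mult_nonneg_nonneg powr_ge_zero)
    also have "r powr (-c) * (C1 * r powr (?N - a)) = C1 * r powr (?N - a - c)"
      using r by (simp add: powr_add[symmetric] algebra_simps)
    also have "r powr (-a) * (C2 * r powr (?N - c)) = C2 * r powr (?N - a - c)"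
      using r by (simp add: powr_add[symmetric] algebra_simps)
    also have "C1 * r powr (?N - a - c) + C2 * r powr (?N - a - c) + C3 * r powr (?N - (a + c)) + C3 * r powr (?N - (a + c))
       = (C1 + C2 + 2 * C3) * r powr (?N - a - c)" by (simp add: algebra_simps)
    also have "r powr (?N - a - c) = 2 powr (a + c - ?N) * norm (P - Q) powr (?N - a - c)"
    proof -
      have "2 powr (a + c - ?N) * 2 powr (?N - a - c) = (1::real)"
        by (simp add: powr_add[symmetric])
      then show ?thesis using r unfolding r_def by (simp add: powr_divide field_simps)
    qed
    finally show ?thesis by (simp add: K_def mult.assoc)
  qed
  ultimately show ?thesis by (rule that)
qed

section \<open>Differences of the kernel at two points\<close>

lemma powr_diff_bound:
  fixes r r' :: real
  assumes "0 \<le> r" "0 \<le> r'" "\<bar>r - r'\<bar> \<le> \<rho>" "0 < t"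
  shows "\<bar>r powr (-t) - r' powr (-t)\<bar> \<le> max 1 t * (r powr (-t) * min 1 (\<rho> / r) + r' powr (-t) * min 1 (\<rho> / r'))"
  using assms
proof (induction r r' rule: linorder_wlog)
  case (sym a b)
  then show ?case by (simp add: abs_minus_commute add.commute)
next
  case (le r r')
  have m0: "0 \<le> r' powr (-t) * min 1 (\<rho> / r')" using le by (auto simp: min_def)
  show ?case
  proof (cases "r = 0")
    \<comment> \<open>Both \<open>0 powr (-t)\<close> and \<open>\<rho> / 0\<close> are 0, so the
      summand at \<open>r\<close> vanishes and the one at \<open>r'\<close> has to carry the bound;
      there \<rho> \<ge> r', hence the minimum is 1.\<close>
    case True
    show ?thesis
    proof (cases "r' = 0")
      case False
      then have "min 1 (\<rho> / r') = 1" using True le by (auto simp: min_def field_simps)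
      then have "\<bar>r powr (-t) - r' powr (-t)\<bar> = 1 * (r' powr (-t) * min 1 (\<rho> / r'))" using True by simp
      also have "\<dots> \<le> max 1 t * (r' powr (-t) * min 1 (\<rho> / r'))" by (intro mult_right_mono m0) simp
      finally show ?thesis using True by simp
    qed (use True in simp)
  next
    case False
    then have r: "0 < r" "0 < r'" using le by auto
    have mono: "r' powr (-t) \<le> r powr (-t)" using r le by (intro powr_mono2') auto
    \<comment> \<open>A Bernoulli inequality for negative exponents: with z = r' / r, ln z is at
      most z - 1, and 1 - t ln z is at most z^(-t).\<close>
    have "1 - t * (r' / r - 1) \<le> 1 - t * ln (r' / r)"
      using r le ln_le_minus_one[of "r' / r"] by simp
    also have "\<dots> \<le> exp (- (t * ln (r' / r)))" using exp_ge_add_one_self[of "- (t * ln (r' / r))"] by simp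
    also have "\<dots> = (r' / r) powr (-t)" using r by (simp add: powr_def)
    finally have "r powr (-t) * (1 - (r' / r) powr (-t)) \<le> r powr (-t) * (t * (r' / r - 1))"
      by (intro mult_left_mono) auto
    also have "r powr (-t) * (1 - (r' / r) powr (-t)) = r powr (-t) - r' powr (-t)"
      using r by (simp add: powr_divide right_diff_distrib)
    also have "r powr (-t) * (t * (r' / r - 1)) \<le> t * (r powr (-t) * (\<rho> / r))"
    proof -
      have "(r' - r) / r \<le> \<rho> / r" using r le by (intro divide_right_mono) auto
      then have "r' / r - 1 \<le> \<rho> / r" using r by (simp add: diff_divide_distrib)
      then have "(t * r powr (-t)) * (r' / r - 1) \<le> (t * r powr (-t)) * (\<rho> / r)"
        using le by (intro mult_left_mono) auto
      then show ?thesis by (simp only: ac_simps)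
    qed
    also have "\<dots> \<le> max 1 t * (r powr (-t) * (\<rho> / r))" using r le by (intro mult_right_mono) auto
    finally have 1: "r powr (-t) - r' powr (-t) \<le> max 1 t * (r powr (-t) * (\<rho> / r))" .
    have "r powr (-t) - r' powr (-t) \<le> 1 * r powr (-t)" by simp
    also have "\<dots> \<le> max 1 t * r powr (-t)" by (intro mult_right_mono) auto
    finally have "r powr (-t) - r' powr (-t) \<le> max 1 t * (r powr (-t) * min 1 (\<rho> / r))"
      using 1 by (auto simp: min_def)
    also have "\<dots> \<le> max 1 t * (r powr (-t) * min 1 (\<rho> / r) + r' powr (-t) * min 1 (\<rho> / r'))"
      using m0 by (intro mult_left_mono) auto
    finally show ?thesis using mono by simp
  qed
qed

text \<open>The Riesz kernel without its constant, which is put back only for the concrete potential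
  at the end. By the convention for \<open>powr\<close> its value at 0 is 0.\<close>

definition rker :: "real \<Rightarrow> 'a::real_normed_vector \<Rightarrow> real" where
  "rker t x = norm x powr (-t)"

lemma rker_nonneg [simp]: "0 \<le> rker t x" by (simp add: rker_def)

lemma rker_commute: "rker t (x - y) = rker t (y - x)" by (simp add: rker_def norm_minus_commute)

lemma rker_measurable [measurable]: "rker t \<in> borel_measurable borel"
  unfolding rker_def[abs_def] by measurable

text \<open>Each summand keeps the better of two bounds: the trivial one when the shift |a - b|
  exceeds the distance to the singularity, the mean value bound otherwise. The first alone fails on
  the diagonal of the energy integral, the second alone fails at infinity.\<close>

lemma rker_diff_bound:
  assumes "0 < t"
  shows "\<bar>rker t a - rker t b\<bar> \<le> max 1 t *
    (norm a powr (-t) * min 1 (norm (a - b) / norm a) + norm b powr (-t) * min 1 (norm (a - b) / norm b))"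
  unfolding rker_def using assms norm_triangle_ineq3[of a b] by (intro powr_diff_bound) auto

lemma rker_diff_bound1:
  assumes "0 < t"
  shows "\<bar>rker t a - rker t b\<bar> \<le> max 1 t * norm (a - b) * (rker (t+1) a + rker (t+1) b)"
proof -
  have *: "norm c powr (-t) * min 1 (norm (a - b) / norm c) \<le> norm (a - b) * rker (t+1) c" for c :: 'a
  proof (cases "c = 0")
    case False
    have "norm c powr (-t) * min 1 (norm (a - b) / norm c) \<le> norm c powr (-t) * (norm (a - b) / norm c)"
      by (intro mult_left_mono) auto
    also have "\<dots> = norm (a - b) * rker (t+1) c" using False
      by (simp add: rker_def powr_diff powr_minus_divide powr_add field_simps)
    finally show ?thesis .
  qed (simp add: rker_def)
  have "\<bar>rker t a - rker t b\<bar> \<le> max 1 t * (norm (a - b) * rker (t+1) a + norm (a - b) * rker (t+1) b)"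
    by (rule order_trans[OF rker_diff_bound[OF assms]]) (intro mult_left_mono add_mono *; simp)
  then show ?thesis by (simp add: algebra_simps)
qed

lemma rker_bound_away:
  assumes "0 < \<delta>" "\<delta> \<le> norm a" "0 \<le> t"
  shows "rker t a \<le> \<delta> powr (-t)"
  unfolding rker_def using assms by (intro powr_mono2') auto

lemma rker_lipschitz_away:
  assumes "0 < t" "0 < \<delta>" "\<delta> \<le> norm a" "\<delta> \<le> norm b"
  shows "\<bar>rker t a - rker t b\<bar> \<le> 2 * max 1 t * \<delta> powr (-(t+1)) * norm (a - b)"
proof -
  have "\<bar>rker t a - rker t b\<bar> \<le> max 1 t * norm (a - b) * (rker (t+1) a + rker (t+1) b)"
    by (rule rker_diff_bound1) fact
  also have "\<dots> \<le> max 1 t * norm (a - b) * (\<delta> powr (-(t+1)) + \<delta> powr (-(t+1)))"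
    using assms by (intro mult_left_mono add_mono rker_bound_away) auto
  finally show ?thesis by (simp add: algebra_simps)
qed

subsection \<open>Similarity invariance of Lebesgue measure\<close>

text \<open>Uniqueness of Haar measure by Tonelli: the integral of 1_A(x + y) 1_B(y) over the
  product of \<open>M\<close> and \<open>lborel\<close>, with B the unit ball, factors once by
  invariance of \<open>M\<close> and once by invariance of \<open>lborel\<close>. Finiteness on
  balls supplies sigma-finiteness.\<close>

lemma lborel_eqI_translation_invariant:
  fixes M :: "'a::euclidean_space measure"
  assumes sets [measurable_cong, simp]: "sets M = sets borel"
    and inv: "\<And>c. distr M borel ((+) c) = M"
    and ball1: "emeasure M (ball 0 1) = emeasure lborel (ball 0 1 :: 'a set)"
    and finite: "\<And>r. emeasure M (ball 0 r) < \<infinity>"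
  shows "M = lborel"
proof -
  interpret M: sigma_finite_measure M
  proof
    have "x \<in> (\<Union>n. ball 0 (real n))" for x :: 'a
      using reals_Archimedean2[of "norm x"] by auto
    then show "\<exists>A. countable A \<and> A \<subseteq> sets M \<and> \<Union> A = space M \<and> (\<forall>a\<in>A. emeasure M a \<noteq> \<infinity>)"
      using finite sets_eq_imp_space_eq[OF sets]
      by (intro exI[of _ "range (\<lambda>n. ball 0 (real n))"]) (auto simp: less_top)
  qed
  interpret P: pair_sigma_finite M lborel ..
  have [simp]: "space M = UNIV" using sets_eq_imp_space_eq[OF sets] by simp
  have ball: "emeasure M (ball y 1) = emeasure lborel (ball 0 1 :: 'a set)" for y
  proof -
    have "emeasure M (ball y 1) = emeasure (distr M borel ((+) y)) (ball y 1)" by (simp add: inv)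
    also have "\<dots> = emeasure M ((+) y -` ball y 1 \<inter> space M)" by (subst emeasure_distr) auto
    also have "(+) y -` ball y 1 \<inter> space M = ball 0 1" by (auto simp: dist_norm norm_minus_commute)
    finally show ?thesis by (simp add: ball1)
  qed
  show ?thesis
  proof (rule measure_eqI)
    fix A assume "A \<in> sets M"
    then have A [measurable]: "A \<in> sets borel" by simp
    let ?b = "emeasure lborel (ball 0 1 :: 'a set)"
    have B [measurable]: "ball (0::'a) 1 \<in> sets borel" by simp
    have "emeasure M A * ?b = (\<integral>\<^sup>+y. emeasure M A * indicator (ball (0::'a) 1) y \<partial>lborel)"
      by (subst nn_integral_cmult_indicator) simp_all
    also have "\<dots> = (\<integral>\<^sup>+y. (\<integral>\<^sup>+x. indicator A (y + x) * indicator (ball 0 1) y \<partial>M) \<partial>lborel)"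
    proof (rule nn_integral_cong)
      fix y :: 'a
      have "emeasure M A = emeasure (distr M borel ((+) y)) A" by (simp add: inv)
      also have "\<dots> = (\<integral>\<^sup>+x. indicator A x \<partial>distr M borel ((+) y))" by simp
      also have "\<dots> = (\<integral>\<^sup>+x. indicator A (y + x) \<partial>M)" by (subst nn_integral_distr) auto
      finally show "emeasure M A * indicator (ball 0 1) y = (\<integral>\<^sup>+x. indicator A (y + x) * indicator (ball 0 1) y \<partial>M)"
        by (simp add: nn_integral_multc)
    qed
    also have "\<dots> = (\<integral>\<^sup>+x. (\<integral>\<^sup>+y. indicator A (y + x) * indicator (ball 0 1) y \<partial>lborel) \<partial>M)"
      by (rule P.Fubini') measurable
    also have "\<dots> = (\<integral>\<^sup>+x. (\<integral>\<^sup>+y. indicator A y * indicator (ball 0 1) (y - x) \<partial>lborel) \<partial>M)"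
    proof (rule nn_integral_cong)
      fix x :: 'a
      have "(\<integral>\<^sup>+y. indicator A y * indicator (ball 0 1) (y - x) \<partial>lborel)
          = (\<integral>\<^sup>+y. indicator A y * indicator (ball 0 1) (y - x) \<partial>distr lborel borel ((+) x))"
        by (simp add: lborel_distr_plus)
      also have "\<dots> = (\<integral>\<^sup>+y. indicator A (y + x) * indicator (ball 0 1) y \<partial>lborel)"
        by (subst nn_integral_distr) (auto simp: add.commute)
      finally show "(\<integral>\<^sup>+y. indicator A (y + x) * indicator (ball 0 1) y \<partial>lborel) = (\<integral>\<^sup>+y. indicator A y * indicator (ball 0 1) (y - x) \<partial>lborel)" ..
    qed
    also have "\<dots> = (\<integral>\<^sup>+y. (\<integral>\<^sup>+x. indicator A y * indicator (ball 0 1) (y - x) \<partial>M) \<partial>lborel)"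
      by (rule P.Fubini'[symmetric]) measurable
    also have "\<dots> = (\<integral>\<^sup>+y. indicator A y * ?b \<partial>lborel)"
    proof (rule nn_integral_cong)
      fix y :: 'a
      have "indicator (ball 0 1) (y - x) = (indicator (ball y 1) x :: ennreal)" for x
        by (auto simp: indicator_def dist_norm norm_minus_commute)
      then have "(\<integral>\<^sup>+x. indicator A y * indicator (ball 0 1) (y - x) \<partial>M) = (\<integral>\<^sup>+x. indicator A y * indicator (ball y 1) x \<partial>M)"
        by simp
      also have "\<dots> = indicator A y * emeasure M (ball y 1)"
        by (subst nn_integral_cmult_indicator) auto
      finally show "(\<integral>\<^sup>+x. indicator A y * indicator (ball 0 1) (y - x) \<partial>M) = indicator A y * ?b"
        by (simp add: ball)
    qed
    also have "\<dots> = emeasure lborel A * ?b" by (simp add: nn_integral_multc)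
    finally have eq: "emeasure M A * ?b = emeasure lborel A * ?b" .
    have "?b \<noteq> 0" "?b \<noteq> \<infinity>"
      using less_imp_neq[OF unit_ball_vol_pos[OF of_nat_0_le_iff, of "DIM('a)"], symmetric] by (simp_all add: emeasure_ball)
    then show "emeasure M A = emeasure lborel A"
      using eq by (metis ennreal_mult_cancel_left mult.commute infinity_ennreal_def)
  qed simp
qed

text \<open>An orthogonal map preserves the balls around 0, is onto, and carries translation by
  \<open>d\<close> to translation by \<open>T d\<close>; so the image measure meets the uniqueness
  criterion.\<close>

lemma distr_lborel_orthogonal_transformation:
  fixes T :: "'a::euclidean_space \<Rightarrow> 'a"
  assumes T: "orthogonal_transformation T"
  shows "distr lborel borel T = lborel"
proof (rule lborel_eqI_translation_invariant)
  have lin: "linear T" using T by (rule orthogonal_transformation_linear)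
  then have [measurable]: "T \<in> borel_measurable borel"
    by (intro borel_measurable_continuous_onI linear_continuous_on linear_conv_bounded_linear[THEN iffD1])
  have vim: "T -` ball 0 r = ball 0 r" for r using orthogonal_transformation_norm[OF T] by auto
  show "emeasure (distr lborel borel T) (ball 0 1) = emeasure lborel (ball 0 1 :: 'a set)"
    by (subst emeasure_distr) (auto simp: vim)
  show "emeasure (distr lborel borel T) (ball 0 r) < \<infinity>" for r
    using emeasure_lborel_ball_finite[of "0::'a" r] by (subst emeasure_distr) (auto simp: vim)
  show "distr (distr lborel borel T) borel ((+) c) = distr lborel borel T" for c
  proof -
    obtain d where d: "T d = c" using orthogonal_transformation_surj[OF T] by (metis surjD)
    have "distr (distr lborel borel T) borel ((+) c) = distr lborel borel (\<lambda>x. T (d + x))"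
      by (subst distr_distr) (auto simp: o_def linear_add[OF lin] d)
    also have "\<dots> = distr (distr lborel borel ((+) d)) borel T"
      by (subst distr_distr) (auto simp: o_def)
    finally show ?thesis by (simp add: lborel_distr_plus)
  qed
qed simp

lemma lborel_integral_similarity:
  fixes T :: "'a::euclidean_space \<Rightarrow> 'a" and f :: "'a \<Rightarrow> real"
  assumes T: "orthogonal_transformation T" and c: "0 < c" and f [measurable]: "f \<in> borel_measurable borel"
  shows "(LINT x|lborel. f x) = c ^ DIM('a) * (LINT x|lborel. f (P + c *\<^sub>R T x))"
proof -
  have [measurable]: "T \<in> borel_measurable borel"
    using orthogonal_transformation_linear[OF T]
    by (intro borel_measurable_continuous_onI linear_continuous_on linear_conv_bounded_linear[THEN iffD1])
  have "(LINT x|lborel. f x) = (LINT x|density (distr lborel borel (\<lambda>x. P + c *\<^sub>R x)) (\<lambda>_. \<bar>c\<bar>^DIM('a)). f x)"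
    using lborel_affine[of c P] c by (metis less_irrefl)
  also have "\<dots> = (LINT x|distr lborel borel (\<lambda>x. P + c *\<^sub>R x). c ^ DIM('a) * f x)"
    using c by (subst integral_real_density) auto
  also have "\<dots> = c ^ DIM('a) * (LINT x|lborel. f (P + c *\<^sub>R x))"
    by (subst integral_distr) auto
  also have "(LINT x|lborel. f (P + c *\<^sub>R x)) = (LINT x|distr lborel borel T. f (P + c *\<^sub>R x))"
    by (simp add: distr_lborel_orthogonal_transformation[OF T])
  also have "\<dots> = (LINT x|lborel. f (P + c *\<^sub>R T x))"
    by (subst integral_distr) auto
  finally show ?thesis .
qed

text \<open>The Householder reflection in the hyperplane orthogonal to w = a - b. Equal norms give 2
  (a . w) = w . w, which is why it sends \<open>a\<close> exactly to \<open>b\<close>.\<close>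

lemma ex_orthogonal_transformation:
  fixes a b :: "'a::euclidean_space"
  assumes "norm a = norm b"
  obtains T where "orthogonal_transformation T" "T a = b"
proof (cases "a = b")
  case True then show ?thesis by (intro that[of "\<lambda>x. x"]) auto
next
  case False
  define w where "w = a - b"
  define T where "T x = x - (2 * (x \<bullet> w) / (w \<bullet> w)) *\<^sub>R w" for x
  have w: "w \<bullet> w \<noteq> 0" using False by (simp add: w_def)
  have ab: "a \<bullet> a = b \<bullet> b" using assms by (simp add: norm_eq)
  have "linear T" unfolding T_def
    by (rule linearI) (auto simp: inner_add_left algebra_simps add_divide_distrib)
  moreover have "T x \<bullet> T y = x \<bullet> y" for x y
    using w unfolding T_def by (simp add: inner_diff_left inner_diff_right inner_commute field_simps)
  ultimately have "orthogonal_transformation T" by (simp add: orthogonal_transformation_def)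
  moreover have "2 * (a \<bullet> w) = w \<bullet> w" using ab by (simp add: w_def inner_diff_left inner_diff_right inner_commute)
  then have "T a = b" using w by (simp add: T_def w_def)
  ultimately show ?thesis by (rule that)
qed

text \<open>The polarised Gagliardo integrand of two translates of the kernel, with poles
  \<open>P\<close> and \<open>Q\<close>. Integrated in \<open>x\<close> and \<open>y\<close> it is
  the kernel of the quadratic form that sends a density to the energy of its potential.\<close>

definition ekern :: "real \<Rightarrow> real \<Rightarrow> 'a::real_normed_vector \<Rightarrow> 'a \<Rightarrow> 'a \<Rightarrow> 'a \<Rightarrow> real" where
  "ekern t b P Q x y = (rker t (x - P) - rker t (y - P)) * (rker t (x - Q) - rker t (y - Q)) * norm (x - y) powr (-b)"

lemma ekern_measurable [measurable (raw)]:
  fixes f g h k :: "'b \<Rightarrow> 'a::euclidean_space"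
  assumes [measurable]: "f \<in> borel_measurable M" "g \<in> borel_measurable M" "h \<in> borel_measurable M" "k \<in> borel_measurable M"
  shows "(\<lambda>z. ekern t b (f z) (g z) (h z) (k z)) \<in> borel_measurable M"
  unfolding ekern_def by measurable

text \<open>Some similarity takes 0 to \<open>P\<close> and the unit vector \<open>e\<close> to
  \<open>Q\<close>, so the integral for the pair 0, \<open>e\<close> determines all others. The
  exponent counts 2N from the two volume elements, -2t from the two kernels and -b from the
  weight.\<close>

lemma energy_kernel_homogeneous:
  obtains c where "\<And>P Q :: 'a::euclidean_space. P \<noteq> Q \<Longrightarrow>
    (LINT x|lborel. LINT y|lborel. ekern t b P Q x y) = c * norm (P - Q) powr (2 * real DIM('a) - 2 * t - b)"
proof -
  obtain e :: 'a where "e \<in> Basis" by (meson ex_in_conv nonempty_Basis)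
  then have e: "norm e = 1" by simp
  have "(LINT x|lborel. LINT y|lborel. ekern t b P Q x y) =
     (LINT x|lborel. LINT y|lborel. ekern t b 0 e x y) * norm (P - Q) powr (2 * real DIM('a) - 2 * t - b)"
    if "P \<noteq> Q" for P Q :: 'a
  proof -
    define c where "c = norm (P - Q)"
    have c: "0 < c" using that by (simp add: c_def)
    obtain T where T: "orthogonal_transformation T" "T e = (1 / c) *\<^sub>R (Q - P)"
      using ex_orthogonal_transformation[of e "(1 / c) *\<^sub>R (Q - P)"] e c
      by (auto simp: c_def norm_minus_commute)
    have lin: "linear T" using T by (simp add: orthogonal_transformation_linear)
    have n: "norm (c *\<^sub>R T z) = c * norm z" for z
      using c orthogonal_transformation_norm[OF T(1)] by simp
    have d1: "(P + c *\<^sub>R T x) - P = c *\<^sub>R T x" for x by simp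
    have d2: "(P + c *\<^sub>R T x) - Q = c *\<^sub>R T (x - e)" for x
      using c by (simp add: linear_diff[OF lin] T(2) algebra_simps)
    have d3: "(P + c *\<^sub>R T x) - (P + c *\<^sub>R T y) = c *\<^sub>R T (x - y)" for x y
      by (simp add: linear_diff[OF lin] algebra_simps)
    have k: "rker t (c *\<^sub>R T z) = c powr (-t) * rker t z" for z
      unfolding rker_def n using c by (simp add: powr_mult)
    have E: "ekern t b P Q (P + c *\<^sub>R T x) (P + c *\<^sub>R T y) = c powr (- 2 * t - b) * ekern t b 0 e x y" for x y
    proof -
      have "c powr (- 2 * t - b) = c powr (-t) * c powr (-t) * c powr (-b)"
        by (simp add: powr_add[symmetric])
      moreover have "norm (c *\<^sub>R T (x - y)) powr (-b) = c powr (-b) * norm (x - y) powr (-b)"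
        unfolding n using c by (simp add: powr_mult)
      ultimately show ?thesis unfolding ekern_def d1 d2 d3 k by (simp add: algebra_simps)
    qed
    have "(LINT x|lborel. LINT y|lborel. ekern t b P Q x y) =
       c ^ DIM('a) * (LINT x|lborel. LINT y|lborel. ekern t b P Q (P + c *\<^sub>R T x) y)"
      by (rule lborel_integral_similarity[OF T(1) c]) measurable
    also have "\<dots> = c ^ DIM('a) * (LINT x|lborel. c ^ DIM('a) * (LINT y|lborel. ekern t b P Q (P + c *\<^sub>R T x) (P + c *\<^sub>R T y)))"
    proof -
      have "(LINT y|lborel. ekern t b P Q (P + c *\<^sub>R T x) y) = c ^ DIM('a) * (LINT y|lborel. ekern t b P Q (P + c *\<^sub>R T x) (P + c *\<^sub>R T y))" for x
        by (rule lborel_integral_similarity[OF T(1) c]) measurable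
      then show ?thesis by simp
    qed
    also have "\<dots> = (c ^ DIM('a) * (c ^ DIM('a) * c powr (- 2 * t - b))) * (LINT x|lborel. LINT y|lborel. ekern t b 0 e x y)"
      by (simp add: E)
    also have "c ^ DIM('a) * (c ^ DIM('a) * c powr (- 2 * t - b)) = c powr (2 * real DIM('a) - 2 * t - b)"
      using c by (simp add: powr_realpow[symmetric] powr_add[symmetric] algebra_simps)
    finally show ?thesis by (simp add: c_def mult.commute)
  qed
  then show ?thesis by (rule that)
qed

subsection \<open>The energy kernel\<close>

text \<open>Splitting at |x - y| = q leaves the exponent N + 2s - 2 inside, below N as s < 1, and N
  + 2s outside, above N as s > 0.\<close>

lemma nn_integral_truncated_kernel:
  assumes "1/2 < s" "s < 1" "2 \<le> DIM('a::euclidean_space)"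
  obtains C where "0 \<le> C" "\<And>(x::'a) q. 0 < q \<Longrightarrow>
    (\<integral>\<^sup>+y. ennreal (min 1 ((norm (x - y) / q)\<^sup>2) * norm (x - y) powr (- (real DIM('a) + 2 * s))) \<partial>lborel)
      \<le> ennreal (C * q powr (- 2 * s))"
proof -
  let ?N = "real DIM('a)"
  have N: "2 \<le> ?N" using assms(3) by simp
  define p where "p = ?N + 2 * s - 2"
  define b where "b = ?N + 2 * s"
  have a: "0 \<le> p" "p < ?N" "?N < b" using assms N by (auto simp: p_def b_def)
  obtain C1 where C1: "0 \<le> C1" "\<And>(x::'a) r. 0 < r \<Longrightarrow>
    (\<integral>\<^sup>+y. ennreal (norm (x - y) powr (-p)) * indicator (cball x r) y \<partial>lborel) \<le> ennreal (C1 * r powr (?N - p))"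
    by (rule lborel_radial_inside[OF a(1,2)], rule that)
  obtain C2 where C2: "0 \<le> C2" "\<And>(x::'a) r. 0 < r \<Longrightarrow>
    (\<integral>\<^sup>+y. ennreal (norm (x - y) powr (-b)) * indicator (- ball x r) y \<partial>lborel) \<le> ennreal (C2 * r powr (?N - b))"
    by (rule lborel_radial_outside[OF a(3)], rule that)
  have "(\<integral>\<^sup>+y. ennreal (min 1 ((norm (x - y) / q)\<^sup>2) * norm (x - y) powr (- b)) \<partial>lborel)
      \<le> ennreal ((C1 + C2) * q powr (- 2 * s))" if q: "0 < q" for x :: 'a and q
  proof -
    define f where "f y = ennreal (norm (x - y) powr (-p)) * indicator (cball x q) y" for y
    define g where "g y = ennreal (norm (x - y) powr (-b)) * indicator (- ball x q) y" for y
    have [measurable]: "f \<in> borel_measurable borel" "g \<in> borel_measurable borel"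
      unfolding f_def[abs_def] g_def[abs_def]
      by (intro borel_measurable_times_ennreal borel_measurable_indicator borel_measurable_const; simp)+
    have pw: "ennreal (min 1 ((norm (x - y) / q)\<^sup>2) * norm (x - y) powr (- b)) \<le> ennreal (q powr (-2)) * f y + g y" for y
    proof (cases "norm (x - y) \<le> q")
      case True
      have "min 1 ((norm (x - y) / q)\<^sup>2) * norm (x - y) powr (- b) \<le> (norm (x - y) / q)\<^sup>2 * norm (x - y) powr (- b)"
        by (intro mult_right_mono) auto
      also have "\<dots> = q powr (-2) * norm (x - y) powr (-p)"
      proof (cases "x = y")
        case False
        have e: "-p = 2 + -b" by (simp add: p_def b_def)
        have "norm (x - y) powr (-p) = norm (x - y) powr 2 * norm (x - y) powr (- b)"
          by (simp only: e powr_add)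
        moreover have "norm (x - y) powr 2 = (norm (x - y))\<^sup>2" using False by simp
        moreover have "q powr (-2) = 1 / q\<^sup>2" using q by (simp add: powr_minus_divide)
        ultimately show ?thesis by (simp add: power_divide)
      qed simp
      finally have "ennreal (min 1 ((norm (x - y) / q)\<^sup>2) * norm (x - y) powr (- b)) \<le> ennreal (q powr (-2)) * f y"
        using True by (simp add: f_def dist_norm ennreal_mult'[symmetric] ennreal_leI)
      then show ?thesis by (simp add: add_increasing2)
    next
      case False
      have "min 1 ((norm (x - y) / q)\<^sup>2) * norm (x - y) powr (- b) \<le> 1 * norm (x - y) powr (- b)"
        by (intro mult_right_mono) auto
      then have "ennreal (min 1 ((norm (x - y) / q)\<^sup>2) * norm (x - y) powr (- b)) \<le> g y"
        using False by (simp add: g_def dist_norm ennreal_leI)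
      then show ?thesis by (simp add: add_increasing)
    qed
    have F: "(\<integral>\<^sup>+y. ennreal (q powr (-2)) * f y \<partial>lborel) \<le> ennreal (q powr (-2) * (C1 * q powr (?N - p)))"
    proof (rule nn_integral_cmult_le)
      show "(\<integral>\<^sup>+y. f y \<partial>lborel) \<le> ennreal (C1 * q powr (?N - p))"
        using C1(2)[OF q, of x] by (simp add: f_def)
    qed simp_all
    have G: "(\<integral>\<^sup>+y. g y \<partial>lborel) \<le> ennreal (C2 * q powr (?N - b))"
      using C2(2)[OF q, of x] by (simp add: g_def)
    have "(\<integral>\<^sup>+y. ennreal (min 1 ((norm (x - y) / q)\<^sup>2) * norm (x - y) powr (- b)) \<partial>lborel)
        \<le> (\<integral>\<^sup>+y. ennreal (q powr (-2)) * f y + g y \<partial>lborel)" by (intro nn_integral_mono pw)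
    also have "\<dots> = (\<integral>\<^sup>+y. ennreal (q powr (-2)) * f y \<partial>lborel) + (\<integral>\<^sup>+y. g y \<partial>lborel)"
      by (intro nn_integral_add) auto
    also have "\<dots> \<le> ennreal (q powr (-2) * (C1 * q powr (?N - p)) + C2 * q powr (?N - b))"
      using C1(1) C2(1) by (intro ennreal_add_le F G) auto
    also have "q powr (-2) * (C1 * q powr (?N - p)) = C1 * q powr (-2 * s)"
      using q by (simp add: powr_add[symmetric] p_def)
    also have "q powr (?N - b) = q powr (-2 * s)" by (simp add: b_def)
    finally show ?thesis by (simp add: algebra_simps)
  qed
  then show ?thesis using C1(1) C2(1) by (intro that[of "C1 + C2"]) (auto simp: b_def)
qed

text \<open>One summand of \<open>rker_diff_bound\<close>, with \<open>a\<close> the position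
  relative to the pole and \<rho> the shift.\<close>

definition mker :: "real \<Rightarrow> 'a::real_normed_vector \<Rightarrow> real \<Rightarrow> real" where
  "mker t a \<rho> = norm a powr (-t) * min 1 (\<rho> / norm a)"

lemma mker_nonneg: "0 \<le> \<rho> \<Longrightarrow> 0 \<le> mker t a \<rho>" by (simp add: mker_def)

text \<open>From min 1 z \<le> z^\<theta> for 0 \<le> \<theta> \<le> 1. The exponent \<theta> buys
  decay on the diagonal x = y at the price of a stronger singularity at the pole.\<close>

lemma mker_le_powr:
  assumes "0 \<le> \<rho>" "0 \<le> \<theta>" "\<theta> \<le> 1"
  shows "mker t a \<rho> \<le> norm a powr (-(t + \<theta>)) * \<rho> powr \<theta>"
proof (cases "a = 0")
  case False
  have "min 1 (\<rho> / norm a) \<le> (\<rho> / norm a) powr \<theta>"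
  proof (cases "\<rho> / norm a \<le> 1")
    case True
    then have "(\<rho> / norm a) powr 1 \<le> (\<rho> / norm a) powr \<theta>"
      using assms by (intro powr_mono') auto
    then show ?thesis using assms by simp
  next
    case F: False
    then have "1 \<le> (\<rho> / norm a) powr \<theta>" using assms by (intro ge_one_powr_ge_zero) auto
    then show ?thesis by simp
  qed
  then have "mker t a \<rho> \<le> norm a powr (-t) * (\<rho> / norm a) powr \<theta>"
    unfolding mker_def by (intro mult_left_mono) auto
  also have "\<dots> = norm a powr (-(t + \<theta>)) * \<rho> powr \<theta>"
    using False assms by (simp add: powr_divide powr_diff powr_add powr_minus_divide)
  finally show ?thesis .
qed (simp add: mker_def)

text \<open>Two truncations at the radii |a| and |b| merge into one at their geometric mean, the
  form that \<open>nn_integral_truncated_kernel\<close> integrates.\<close>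

lemma mker_mult_le:
  assumes "0 \<le> \<rho>"
  shows "mker t a \<rho> * mker t b \<rho> \<le> norm a powr (-t) * norm b powr (-t) * min 1 ((\<rho> / sqrt (norm a * norm b))\<^sup>2)"
proof (cases "a = 0 \<or> b = 0")
  case False
  have "min 1 p * min 1 q \<le> min 1 (p * q)" if "0 \<le> p" "0 \<le> q" for p q :: real
    using that mult_mono[of "min 1 p" 1 "min 1 q" 1] mult_mono[of "min 1 p" p "min 1 q" q] by auto
  from this[of "\<rho> / norm a" "\<rho> / norm b"]
  have "min 1 (\<rho> / norm a) * min 1 (\<rho> / norm b) \<le> min 1 ((\<rho> / sqrt (norm a * norm b))\<^sup>2)"
    using assms False by (simp add: power_divide power2_eq_square)
  then have "norm a powr (-t) * norm b powr (-t) * (min 1 (\<rho> / norm a) * min 1 (\<rho> / norm b)) \<le>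
     norm a powr (-t) * norm b powr (-t) * min 1 ((\<rho> / sqrt (norm a * norm b))\<^sup>2)"
    by (intro mult_left_mono) auto
  then show ?thesis unfolding mker_def by (simp add: ac_simps)
qed (auto simp: mker_def)

lemma mker_measurable [measurable (raw)]:
  fixes f :: "'b \<Rightarrow> 'a::euclidean_space"
  assumes [measurable]: "f \<in> borel_measurable M" "g \<in> borel_measurable M"
  shows "(\<lambda>z. mker t (f z) (g z)) \<in> borel_measurable M"
  unfolding mker_def by measurable

text \<open>The products in which both factors are centred at the same variable are handled by the
  truncated kernel; the mixed ones are iterated Riesz compositions, which converge thanks to an
  interpolation exponent strictly between \<open>s\<close> and \<open>1\<close>.\<close>

lemma energy_diag_part:
  assumes "1/2 < s" "s < 1" "2 \<le> DIM('a::euclidean_space)"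
  defines "t \<equiv> real DIM('a) - 2 * s" and "b \<equiv> real DIM('a) + 2 * s"
  obtains K where "0 \<le> K" "\<And>P Q :: 'a. P \<noteq> Q \<Longrightarrow>
    (\<integral>\<^sup>+x. \<integral>\<^sup>+y. ennreal (mker t (x - P) (norm (x - y)) * mker t (x - Q) (norm (x - y)) * norm (x - y) powr (-b)) \<partial>lborel \<partial>lborel)
      \<le> ennreal (K * norm (P - Q) powr (-t))"
proof -
  let ?N = "real DIM('a)"
  have N: "2 \<le> ?N" using assms(3) by simp
  obtain C where C: "0 \<le> C" "\<And>(x::'a) q. 0 < q \<Longrightarrow>
    (\<integral>\<^sup>+y. ennreal (min 1 ((norm (x - y) / q)\<^sup>2) * norm (x - y) powr (- b)) \<partial>lborel)
      \<le> ennreal (C * q powr (- 2 * s))"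
    by (rule nn_integral_truncated_kernel[OF assms(1-3), folded b_def], rule that)
  have e: "0 \<le> ?N - s" "?N - s < ?N" "?N < (?N - s) + (?N - s)" using assms N by auto
  obtain K where K: "0 \<le> K" "\<And>P Q :: 'a. P \<noteq> Q \<Longrightarrow>
    (\<integral>\<^sup>+x. ennreal (norm (x - P) powr (-(?N - s)) * norm (x - Q) powr (-(?N - s))) \<partial>lborel)
      \<le> ennreal (K * norm (P - Q) powr (?N - (?N - s) - (?N - s)))" by (rule riesz_composition[OF e(1,2,1,2,3)], rule that)
  have "(\<integral>\<^sup>+x. \<integral>\<^sup>+y. ennreal (mker t (x - P) (norm (x - y)) * mker t (x - Q) (norm (x - y)) * norm (x - y) powr (-b)) \<partial>lborel \<partial>lborel)
      \<le> ennreal (C * K * norm (P - Q) powr (-t))" if PQ: "P \<noteq> Q" for P Q :: 'a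
  proof -
    have inner: "(\<integral>\<^sup>+y. ennreal (mker t (x - P) (norm (x - y)) * mker t (x - Q) (norm (x - y)) * norm (x - y) powr (-b)) \<partial>lborel)
        \<le> ennreal C * ennreal (norm (x - P) powr (-(?N - s)) * norm (x - Q) powr (-(?N - s)))" for x
    proof (cases "x = P \<or> x = Q")
      case True then show ?thesis by (auto simp: mker_def)
    next
      case False
      define q where "q = sqrt (norm (x - P) * norm (x - Q))"
      have q: "0 < q" using False by (simp add: q_def)
      define h where "h = norm (x - P) powr (-t) * norm (x - Q) powr (-t)"
      have h0: "0 \<le> h" by (simp add: h_def)
      have "(\<integral>\<^sup>+y. ennreal (mker t (x - P) (norm (x - y)) * mker t (x - Q) (norm (x - y)) * norm (x - y) powr (-b)) \<partial>lborel)
        \<le> (\<integral>\<^sup>+y. ennreal h * ennreal (min 1 ((norm (x - y) / q)\<^sup>2) * norm (x - y) powr (- b)) \<partial>lborel)"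
      proof (intro nn_integral_mono)
        fix y
        have "mker t (x - P) (norm (x - y)) * mker t (x - Q) (norm (x - y)) \<le> h * min 1 ((norm (x - y) / q)\<^sup>2)"
          unfolding h_def q_def by (rule mker_mult_le) simp
        then have "mker t (x - P) (norm (x - y)) * mker t (x - Q) (norm (x - y)) * norm (x - y) powr (-b)
            \<le> h * min 1 ((norm (x - y) / q)\<^sup>2) * norm (x - y) powr (-b)" by (rule mult_right_mono) simp
        then show "ennreal (mker t (x - P) (norm (x - y)) * mker t (x - Q) (norm (x - y)) * norm (x - y) powr (-b))
           \<le> ennreal h * ennreal (min 1 ((norm (x - y) / q)\<^sup>2) * norm (x - y) powr (- b))"
          using h0 by (simp add: ennreal_mult'[symmetric] mult.assoc ennreal_leI)
      qed
      also have "\<dots> \<le> ennreal (h * (C * q powr (- 2 * s)))"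
        by (intro nn_integral_cmult_le C q h0) auto
      \<comment> \<open>Since q is the root of the product of the two distances, q^(-2s) gives each
        pole the extra exponent s; both then carry t + s = N - s.\<close>
      also have "h * (C * q powr (- 2 * s)) = C * (norm (x - P) powr (-(?N - s)) * norm (x - Q) powr (-(?N - s)))"
      proof -
        have "q powr (- 2 * s) = ((norm (x - P) * norm (x - Q)) powr (1/2)) powr (- 2 * s)"
          by (simp add: q_def powr_half_sqrt)
        also have "\<dots> = (norm (x - P) * norm (x - Q)) powr (- s)" by (simp only: powr_powr) simp
        finally have "q powr (- 2 * s) = norm (x - P) powr (-s) * norm (x - Q) powr (-s)" by (simp add: powr_mult)
        moreover have "norm z powr (-(?N - s)) = norm z powr (-t) * norm z powr (-s)" for z :: 'a
          by (simp add: powr_add[symmetric] t_def)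
        ultimately show ?thesis by (simp add: h_def ac_simps)
      qed
      finally show ?thesis using C(1) by (simp add: ennreal_mult')
    qed
    have "(\<integral>\<^sup>+x. \<integral>\<^sup>+y. ennreal (mker t (x - P) (norm (x - y)) * mker t (x - Q) (norm (x - y)) * norm (x - y) powr (-b)) \<partial>lborel \<partial>lborel)
      \<le> (\<integral>\<^sup>+x. ennreal C * ennreal (norm (x - P) powr (-(?N - s)) * norm (x - Q) powr (-(?N - s))) \<partial>lborel)"
      by (intro nn_integral_mono inner)
    also have "\<dots> \<le> ennreal (C * (K * norm (P - Q) powr (?N - (?N - s) - (?N - s))))"
      by (intro nn_integral_cmult_le K PQ C) auto
    also have "?N - (?N - s) - (?N - s) = - t" by (simp add: t_def)
    finally show ?thesis by (simp add: mult.assoc)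
  qed
  then show ?thesis using C(1) K(1) by (intro that[of "C * K"]) auto
qed

lemma energy_cross_part:
  assumes "1/2 < s" "s < 1" "2 \<le> DIM('a::euclidean_space)"
  defines "t \<equiv> real DIM('a) - 2 * s" and "b \<equiv> real DIM('a) + 2 * s"
  obtains K where "0 \<le> K" "\<And>P Q :: 'a. P \<noteq> Q \<Longrightarrow>
    (\<integral>\<^sup>+x. \<integral>\<^sup>+y. ennreal (mker t (x - P) (norm (x - y)) * mker t (y - Q) (norm (x - y)) * norm (x - y) powr (-b)) \<partial>lborel \<partial>lborel)
      \<le> ennreal (K * norm (P - Q) powr (-t))"
proof -
  let ?N = "real DIM('a)"
  have N: "2 \<le> ?N" using assms(3) by simp
  \<comment> \<open>s < \<theta> makes the remaining diagonal exponent N + 2s - 2\<theta> less than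
    N, and \<theta> < 2s makes the pole exponent N - 2s + \<theta> less than N; the midpoint of s
    and 1 satisfies both.\<close>
  define \<theta> where "\<theta> = (1 + s) / 2"
  have th: "0 \<le> \<theta>" "\<theta> \<le> 1" "s < \<theta>" "\<theta> < 2 * s" using assms by (auto simp: \<theta>_def)
  define a where "a = t + \<theta>"
  define d where "d = b - 2 * \<theta>"
  have 1: "0 \<le> d" "d < ?N" "0 \<le> a" "a < ?N" "?N < d + a" "0 \<le> d + a - ?N" "d + a - ?N < ?N" "?N < a + (d + a - ?N)"
    using th assms N unfolding a_def d_def t_def b_def by auto
  obtain K1 where K1: "0 \<le> K1" "\<And>P Q :: 'a. P \<noteq> Q \<Longrightarrow>
    (\<integral>\<^sup>+x. ennreal (norm (x - P) powr (-d) * norm (x - Q) powr (-a)) \<partial>lborel)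
      \<le> ennreal (K1 * norm (P - Q) powr (?N - d - a))" by (rule riesz_composition[OF 1(1-5)], rule that)
  obtain K2 where K2: "0 \<le> K2" "\<And>P Q :: 'a. P \<noteq> Q \<Longrightarrow>
    (\<integral>\<^sup>+x. ennreal (norm (x - P) powr (-a) * norm (x - Q) powr (-(d + a - ?N))) \<partial>lborel)
      \<le> ennreal (K2 * norm (P - Q) powr (?N - a - (d + a - ?N)))" by (rule riesz_composition[OF 1(3,4,6-8)], rule that)
  have "(\<integral>\<^sup>+x. \<integral>\<^sup>+y. ennreal (mker t (x - P) (norm (x - y)) * mker t (y - Q) (norm (x - y)) * norm (x - y) powr (-b)) \<partial>lborel \<partial>lborel)
      \<le> ennreal (K1 * K2 * norm (P - Q) powr (-t))" if PQ: "P \<noteq> Q" for P Q :: 'a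
  proof -
    have inner: "(\<integral>\<^sup>+y. ennreal (mker t (x - P) (norm (x - y)) * mker t (y - Q) (norm (x - y)) * norm (x - y) powr (-b)) \<partial>lborel)
        \<le> ennreal K1 * ennreal (norm (x - P) powr (-a) * norm (x - Q) powr (-(d + a - ?N)))" if "x \<noteq> Q" for x
    proof -
      have "(\<integral>\<^sup>+y. ennreal (mker t (x - P) (norm (x - y)) * mker t (y - Q) (norm (x - y)) * norm (x - y) powr (-b)) \<partial>lborel)
        \<le> (\<integral>\<^sup>+y. ennreal (norm (x - P) powr (-a)) * ennreal (norm (y - x) powr (-d) * norm (y - Q) powr (-a)) \<partial>lborel)"
      proof (intro nn_integral_mono)
        fix y
        have "mker t (x - P) (norm (x - y)) * mker t (y - Q) (norm (x - y)) * norm (x - y) powr (-b)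
          \<le> (norm (x - P) powr (-a) * norm (x - y) powr \<theta>) * (norm (y - Q) powr (-a) * norm (x - y) powr \<theta>) * norm (x - y) powr (-b)"
          unfolding a_def using th by (intro mult_right_mono mult_mono mker_le_powr mker_nonneg) auto
        also have "\<dots> = norm (x - P) powr (-a) * (norm (x - y) powr (-d) * norm (y - Q) powr (-a))"
        proof -
          have "norm (x - y) powr (-d) = norm (x - y) powr \<theta> * norm (x - y) powr \<theta> * norm (x - y) powr (-b)"
            by (simp add: powr_add[symmetric] d_def)
          then show ?thesis by simp
        qed
        finally show "ennreal (mker t (x - P) (norm (x - y)) * mker t (y - Q) (norm (x - y)) * norm (x - y) powr (-b))
           \<le> ennreal (norm (x - P) powr (-a)) * ennreal (norm (y - x) powr (-d) * norm (y - Q) powr (-a))"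
          by (simp add: ennreal_mult'[symmetric] norm_minus_commute[of x y] ennreal_leI)
      qed
      also have "\<dots> \<le> ennreal (norm (x - P) powr (-a) * (K1 * norm (x - Q) powr (?N - d - a)))"
        by (intro nn_integral_cmult_le K1 that) auto
      also have "norm (x - P) powr (-a) * (K1 * norm (x - Q) powr (?N - d - a)) = K1 * (norm (x - P) powr (-a) * norm (x - Q) powr (-(d + a - ?N)))"
        by (simp add: algebra_simps)
      finally show ?thesis using K1(1) by (simp add: ennreal_mult')
    qed
    have "(\<integral>\<^sup>+x. \<integral>\<^sup>+y. ennreal (mker t (x - P) (norm (x - y)) * mker t (y - Q) (norm (x - y)) * norm (x - y) powr (-b)) \<partial>lborel \<partial>lborel)
      \<le> (\<integral>\<^sup>+x. ennreal K1 * ennreal (norm (x - P) powr (-a) * norm (x - Q) powr (-(d + a - ?N))) \<partial>lborel)"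
      \<comment> \<open>The inner composition has the poles \<open>x\<close> and \<open>Q\<close>,
        which must differ.\<close>
      using AE_lborel_singleton[of Q] by (intro nn_integral_mono_AE) (erule eventually_mono, rule inner)
    also have "\<dots> \<le> ennreal (K1 * (K2 * norm (P - Q) powr (?N - a - (d + a - ?N))))"
      by (intro nn_integral_cmult_le K2 PQ K1) auto
    also have "?N - a - (d + a - ?N) = - t" by (simp add: t_def a_def d_def b_def)
    finally show ?thesis by (simp add: mult.assoc)
  qed
  then show ?thesis using K1(1) K2(1) by (intro that[of "K1 * K2"]) auto
qed

text \<open>Each of the two differences is bounded by two \<open>mker\<close> terms, so four
  products arise. Swapping \<open>P\<close> and \<open>Q\<close> exchanges the two mixed ones,
  swapping \<open>x\<close> and \<open>y\<close> the two diagonal ones.\<close>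

lemma energy_kernel_finite:
  assumes "1/2 < s" "s < 1" "2 \<le> DIM('a::euclidean_space)"
  defines "t \<equiv> real DIM('a) - 2 * s" and "b \<equiv> real DIM('a) + 2 * s"
  obtains K where "0 \<le> K" "\<And>P Q :: 'a. P \<noteq> Q \<Longrightarrow>
    (\<integral>\<^sup>+z. ennreal \<bar>ekern t b P Q (fst z) (snd z)\<bar> \<partial>(lborel \<Otimes>\<^sub>M lborel)) \<le> ennreal (K * norm (P - Q) powr (-t))"
proof -
  let ?N = "real DIM('a)"
  have t: "0 < t" using assms by (simp add: t_def)
  obtain K1 where K1: "0 \<le> K1" "\<And>P Q :: 'a. P \<noteq> Q \<Longrightarrow>
    (\<integral>\<^sup>+x. \<integral>\<^sup>+y. ennreal (mker t (x - P) (norm (x - y)) * mker t (x - Q) (norm (x - y)) * norm (x - y) powr (-b)) \<partial>lborel \<partial>lborel)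
      \<le> ennreal (K1 * norm (P - Q) powr (-t))"
    by (rule energy_diag_part[OF assms(1-3), folded t_def b_def], rule that)
  obtain K2 where K2: "0 \<le> K2" "\<And>P Q :: 'a. P \<noteq> Q \<Longrightarrow>
    (\<integral>\<^sup>+x. \<integral>\<^sup>+y. ennreal (mker t (x - P) (norm (x - y)) * mker t (y - Q) (norm (x - y)) * norm (x - y) powr (-b)) \<partial>lborel \<partial>lborel)
      \<le> ennreal (K2 * norm (P - Q) powr (-t))"
    by (rule energy_cross_part[OF assms(1-3), folded t_def b_def], rule that)
  define D where "D = (max 1 t)\<^sup>2"
  have "(\<integral>\<^sup>+z. ennreal \<bar>ekern t b P Q (fst z) (snd z)\<bar> \<partial>(lborel \<Otimes>\<^sub>M lborel))
      \<le> ennreal (D * (2 * K1 + 2 * K2) * norm (P - Q) powr (-t))" if PQ: "P \<noteq> Q" for P Q :: 'a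
  proof -
    define L where "L = norm (P - Q) powr (-t)"
    define g where "g A B x y = ennreal (mker t A (norm (x - y)) * mker t B (norm (x - y)) * norm (x - y) powr (-b))" for A B x y :: 'a
    have gsym: "g A B x y = g B A y x" for A B x y by (simp add: g_def norm_minus_commute mult.commute)
    have [measurable]: "(\<lambda>z. g (f1 z) (f2 z) (fst z) (snd z)) \<in> borel_measurable (lborel \<Otimes>\<^sub>M lborel)"
      if [measurable]: "f1 \<in> borel_measurable (lborel \<Otimes>\<^sub>M lborel)" "f2 \<in> borel_measurable (lborel \<Otimes>\<^sub>M lborel)" for f1 f2
      unfolding g_def by measurable
    define F1 where "F1 z = g (fst z - P) (fst z - Q) (fst z) (snd z)" for z
    define F2 where "F2 z = g (fst z - P) (snd z - Q) (fst z) (snd z)" for z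
    define F3 where "F3 z = g (snd z - P) (fst z - Q) (fst z) (snd z)" for z
    define F4 where "F4 z = g (snd z - P) (snd z - Q) (fst z) (snd z)" for z
    have [measurable]: "F1 \<in> borel_measurable (lborel \<Otimes>\<^sub>M lborel)" "F2 \<in> borel_measurable (lborel \<Otimes>\<^sub>M lborel)"
       "F3 \<in> borel_measurable (lborel \<Otimes>\<^sub>M lborel)" "F4 \<in> borel_measurable (lborel \<Otimes>\<^sub>M lborel)"
      unfolding F1_def F2_def F3_def F4_def by measurable
    have I1: "integral\<^sup>N (lborel \<Otimes>\<^sub>M lborel) F1 \<le> ennreal (K1 * L)"
      unfolding L_def by (subst lborel.nn_integral_fst[symmetric]) (auto simp: F1_def g_def intro!: K1 PQ)
    have I2: "integral\<^sup>N (lborel \<Otimes>\<^sub>M lborel) F2 \<le> ennreal (K2 * L)"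
      unfolding L_def by (subst lborel.nn_integral_fst[symmetric]) (auto simp: F2_def g_def intro!: K2 PQ)
    have I3: "integral\<^sup>N (lborel \<Otimes>\<^sub>M lborel) F3 \<le> ennreal (K2 * L)"
      unfolding L_def using K2(2)[of Q P] PQ
      by (subst lborel.nn_integral_fst[symmetric]) (auto simp: F3_def gsym[of "_ - P"] g_def norm_minus_commute mult.commute)
    have I4: "integral\<^sup>N (lborel \<Otimes>\<^sub>M lborel) F4 \<le> ennreal (K1 * L)"
      unfolding L_def using K1(2)[of P Q] PQ
      by (subst lborel_pair.nn_integral_snd[symmetric]) (auto simp: F4_def g_def norm_minus_commute)
    have pw: "ennreal \<bar>ekern t b P Q (fst z) (snd z)\<bar> \<le> ennreal D * (F1 z + F2 z + F3 z + F4 z)" for z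
    proof -
      obtain x y where z: "z = (x, y)" by (cases z)
      let ?r = "norm (x - y)"
      have b1: "\<bar>rker t (x - R) - rker t (y - R)\<bar> \<le> max 1 t * (mker t (x - R) ?r + mker t (y - R) ?r)" for R
        using rker_diff_bound[OF t, of "x - R" "y - R"] by (simp add: mker_def)
      have "\<bar>ekern t b P Q x y\<bar> \<le> (max 1 t * (mker t (x - P) ?r + mker t (y - P) ?r)) * (max 1 t * (mker t (x - Q) ?r + mker t (y - Q) ?r)) * ?r powr (-b)"
        unfolding ekern_def abs_mult
        by (intro mult_mono b1) (auto intro!: mult_nonneg_nonneg add_nonneg_nonneg mker_nonneg)
      also have "\<dots> = D * (mker t (x - P) ?r * mker t (x - Q) ?r * ?r powr (-b) + mker t (x - P) ?r * mker t (y - Q) ?r * ?r powr (-b)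
           + mker t (y - P) ?r * mker t (x - Q) ?r * ?r powr (-b) + mker t (y - P) ?r * mker t (y - Q) ?r * ?r powr (-b))"
        unfolding D_def by (simp only: power2_eq_square distrib_left distrib_right ac_simps)
      finally have "ennreal \<bar>ekern t b P Q x y\<bar> \<le> ennreal (D * (mker t (x - P) ?r * mker t (x - Q) ?r * ?r powr (-b) + mker t (x - P) ?r * mker t (y - Q) ?r * ?r powr (-b)
           + mker t (y - P) ?r * mker t (x - Q) ?r * ?r powr (-b) + mker t (y - P) ?r * mker t (y - Q) ?r * ?r powr (-b)))" by (rule ennreal_leI)
      also have "\<dots> = ennreal D * (F1 z + F2 z + F3 z + F4 z)"
        by (simp add: z F1_def F2_def F3_def F4_def g_def mker_nonneg D_def ennreal_mult')
      finally show ?thesis by (simp add: z)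
    qed
    have "(\<integral>\<^sup>+z. ennreal \<bar>ekern t b P Q (fst z) (snd z)\<bar> \<partial>(lborel \<Otimes>\<^sub>M lborel))
       \<le> (\<integral>\<^sup>+z. ennreal D * (F1 z + F2 z + F3 z + F4 z) \<partial>(lborel \<Otimes>\<^sub>M lborel))" by (intro nn_integral_mono pw)
    also have "\<dots> \<le> ennreal (D * (K1 * L + K2 * L + K2 * L + K1 * L))"
    proof (rule nn_integral_cmult_le)
      have "integral\<^sup>N (lborel \<Otimes>\<^sub>M lborel) (\<lambda>z. F1 z + F2 z + F3 z + F4 z) = 
        integral\<^sup>N (lborel \<Otimes>\<^sub>M lborel) F1 + integral\<^sup>N (lborel \<Otimes>\<^sub>M lborel) F2 + integral\<^sup>N (lborel \<Otimes>\<^sub>M lborel) F3 + integral\<^sup>N (lborel \<Otimes>\<^sub>M lborel) F4"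
        by (simp add: nn_integral_add)
      also have "\<dots> \<le> ennreal (K1 * L + K2 * L + K2 * L + K1 * L)"
        using K1(1) K2(1) by (intro ennreal_add_le I1 I2 I3 I4) (auto simp: L_def)
      finally show "integral\<^sup>N (lborel \<Otimes>\<^sub>M lborel) (\<lambda>z. F1 z + F2 z + F3 z + F4 z) \<le> ennreal (K1 * L + K2 * L + K2 * L + K1 * L)" .
    qed (auto simp: D_def)
    also have "D * (K1 * L + K2 * L + K2 * L + K1 * L) = D * (2 * K1 + 2 * K2) * L" by (simp add: algebra_simps)
    finally show ?thesis by (simp add: L_def)
  qed
  then show ?thesis using K1(1) K2(1) by (intro that[of "D * (2 * K1 + 2 * K2)"]) (auto simp: D_def)
qed

subsection \<open>Riesz potentials of bounded functions\<close>

text \<open>Densities for which the potentials are Lipschitz and the interchanges of integrals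
  converge absolutely. The radius is a parameter because the constants of the L^2 estimates depend
  on it.\<close>

definition bounded_supp :: "real \<Rightarrow> ('a::euclidean_space \<Rightarrow> real) \<Rightarrow> bool" where
  "bounded_supp \<rho> f \<longleftrightarrow> f \<in> borel_measurable borel \<and> (\<exists>M. \<forall>x. \<bar>f x\<bar> \<le> M) \<and> (\<forall>x. \<rho> \<le> norm x \<longrightarrow> f x = 0)"

lemma bounded_supp_measurable [measurable_dest]: "bounded_supp \<rho> f \<Longrightarrow> f \<in> borel_measurable borel"
  by (simp add: bounded_supp_def)

lemma bounded_supp_boundE:
  assumes "bounded_supp \<rho> f"
  obtains M where "0 \<le> M" "\<And>x. \<bar>f x\<bar> \<le> M" "\<And>x. \<bar>f x\<bar> \<le> M * indicator (ball 0 \<rho>) x"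
proof -
  obtain M where M: "\<And>x. \<bar>f x\<bar> \<le> M" and z: "\<And>x. \<rho> \<le> norm x \<Longrightarrow> f x = 0"
    using assms by (auto simp: bounded_supp_def)
  have "0 \<le> M" using M[of 0] by linarith
  then show ?thesis using M z by (intro that[of M]) (auto simp: indicator_def)
qed

text \<open>Uniform in the pole \<open>z\<close>: within distance 1 of it the radial integral
  applies, farther away the kernel is at most 1 and the volume of the ball suffices.\<close>

lemma kernel_ball_bound:
  assumes "0 \<le> a" "a < real DIM('a::euclidean_space)"
  obtains S where "0 < S" "\<And>z::'a. (\<integral>\<^sup>+x. ennreal (rker a (x - z)) * indicator (ball 0 \<rho>) x \<partial>lborel) \<le> ennreal S"
proof -
  obtain C where C: "0 \<le> C" "\<And>(x::'a) r. 0 < r \<Longrightarrow>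
    (\<integral>\<^sup>+y. ennreal (norm (x - y) powr (-a)) * indicator (cball x r) y \<partial>lborel) \<le> ennreal (C * r powr (real DIM('a) - a))"
    by (rule lborel_radial_inside[OF assms], rule that)
  define V where "V = measure lborel (ball (0::'a) \<rho>)"
  have V: "emeasure lborel (ball (0::'a) \<rho>) = ennreal V" "0 \<le> V"
    unfolding V_def using emeasure_lborel_ball_finite[of "0::'a" \<rho>] by (auto simp: emeasure_eq_ennreal_measure less_top)
  have "(\<integral>\<^sup>+x. ennreal (rker a (x - z)) * indicator (ball 0 \<rho>) x \<partial>lborel) \<le> ennreal (C + V + 1)" for z :: 'a
  proof -
    define f where "f x = ennreal (norm (z - x) powr (-a)) * indicator (cball z 1) x" for x
    have [measurable]: "f \<in> borel_measurable borel" unfolding f_def[abs_def]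
      by (intro borel_measurable_times_ennreal borel_measurable_indicator borel_measurable_const; simp)
    have F: "(\<integral>\<^sup>+x. f x \<partial>lborel) \<le> ennreal C" using C(2)[of 1 z] by (simp add: f_def)
    have pw: "ennreal (rker a (x - z)) * indicator (ball 0 \<rho>) x \<le> f x + indicator (ball 0 \<rho>) x" for x
    proof (cases "norm (z - x) \<le> 1")
      case True
      then have "ennreal (rker a (x - z)) * indicator (ball 0 \<rho>) x \<le> f x * 1"
        by (auto simp: f_def rker_def dist_norm norm_minus_commute indicator_def)
      then show ?thesis by (simp add: add_increasing2)
    next
      case False
      then have "rker a (x - z) \<le> 1 powr (-a)" unfolding rker_def norm_minus_commute[of x z]
        using assms by (intro powr_mono2') auto
      then have "ennreal (rker a (x - z)) * indicator (ball 0 \<rho>) x \<le> 1 * indicator (ball 0 \<rho>) x"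
        by (intro mult_right_mono) (auto simp: ennreal_le_1)
      then show ?thesis by (simp add: add_increasing)
    qed
    have "(\<integral>\<^sup>+x. ennreal (rker a (x - z)) * indicator (ball 0 \<rho>) x \<partial>lborel) \<le> (\<integral>\<^sup>+x. f x + indicator (ball 0 \<rho>) x \<partial>lborel)"
      by (intro nn_integral_mono pw)
    also have "\<dots> = (\<integral>\<^sup>+x. f x \<partial>lborel) + ennreal V"
      using V by (subst nn_integral_add) (auto intro: borel_measurable_indicator)
    also have "\<dots> \<le> ennreal (C + V)" using C(1) V by (intro ennreal_add_le F) auto
    also have "\<dots> \<le> ennreal (C + V + 1)" by (rule ennreal_leI) simp
    finally show ?thesis .
  qed
  then show ?thesis using C(1) V(2) by (intro that[of "C + V + 1"]) auto
qed

lemma kernel_potential_bound: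
  assumes f: "bounded_supp \<rho> f" and M: "0 \<le> M" "\<And>x. \<bar>f x\<bar> \<le> M * indicator (ball 0 \<rho>) x"
    and S: "(\<integral>\<^sup>+x. ennreal (rker a (x - z)) * indicator (ball 0 \<rho>) x \<partial>lborel) \<le> ennreal S" "0 \<le> S"
  shows "(\<integral>\<^sup>+x. ennreal \<bar>f x * rker a (x - z)\<bar> \<partial>lborel) \<le> ennreal (M * S)"
    and "integrable lborel (\<lambda>x. f x * rker a (x - z))"
    and "\<bar>LINT x|lborel. f x * rker a (x - z)\<bar> \<le> M * S"
proof -
  note [measurable] = bounded_supp_measurable[OF f]
  have "(\<integral>\<^sup>+x. ennreal \<bar>f x * rker a (x - z)\<bar> \<partial>lborel) \<le> (\<integral>\<^sup>+x. ennreal M * (ennreal (rker a (x - z)) * indicator (ball 0 \<rho>) x) \<partial>lborel)"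
  proof (intro nn_integral_mono)
    fix x
    have "\<bar>f x * rker a (x - z)\<bar> \<le> M * indicator (ball 0 \<rho>) x * rker a (x - z)"
      unfolding abs_mult by (intro mult_mono M) (auto simp: M)
    then have "ennreal \<bar>f x * rker a (x - z)\<bar> \<le> ennreal (M * indicator (ball 0 \<rho>) x * rker a (x - z))" by (rule ennreal_leI)
    also have "\<dots> = ennreal M * (ennreal (rker a (x - z)) * indicator (ball 0 \<rho>) x)"
      using M(1) by (auto simp: indicator_def ennreal_mult')
    finally show "ennreal \<bar>f x * rker a (x - z)\<bar> \<le> ennreal M * (ennreal (rker a (x - z)) * indicator (ball 0 \<rho>) x)" .
  qed
  also have "\<dots> \<le> ennreal (M * S)"
    by (intro nn_integral_cmult_le S M borel_measurable_times_ennreal borel_measurable_indicator) auto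
  finally show *: "(\<integral>\<^sup>+x. ennreal \<bar>f x * rker a (x - z)\<bar> \<partial>lborel) \<le> ennreal (M * S)" .
  show i: "integrable lborel (\<lambda>x. f x * rker a (x - z))"
  proof (rule integrableI_bounded)
    show "(\<integral>\<^sup>+x. ennreal (norm (f x * rker a (x - z))) \<partial>lborel) < \<infinity>"
      using le_less_trans[OF *, of \<infinity>] by simp
  qed measurable
  have "ennreal \<bar>LINT x|lborel. f x * rker a (x - z)\<bar> \<le> ennreal (M * S)"
    using integral_norm_bound_ennreal[OF i] * by (simp add: order_trans)
  then show "\<bar>LINT x|lborel. f x * rker a (x - z)\<bar> \<le> M * S"
    using M(1) S(2) by (simp add: ennreal_le_iff)
qed

definition rpot :: "real \<Rightarrow> ('a::euclidean_space \<Rightarrow> real) \<Rightarrow> 'a \<Rightarrow> real" where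
  "rpot t f z = (LINT x|lborel. f x * rker t (x - z))"

lemma rker_integrable:
  assumes "bounded_supp \<rho> f" "0 \<le> a" "a < real DIM('a::euclidean_space)"
  shows "integrable lborel (\<lambda>x::'a. f x * rker a (x - z))"
proof -
  obtain S where S: "0 < S" "\<And>z::'a. (\<integral>\<^sup>+x. ennreal (rker a (x - z)) * indicator (ball 0 \<rho>) x \<partial>lborel) \<le> ennreal S"
    by (rule kernel_ball_bound[OF assms(2,3)], rule that)
  obtain M where M: "0 \<le> M" "\<And>x. \<bar>f x\<bar> \<le> M" "\<And>x. \<bar>f x\<bar> \<le> M * indicator (ball 0 \<rho>) x"
    by (rule bounded_supp_boundE[OF assms(1)], rule that)
  show ?thesis using S by (intro kernel_potential_bound[OF assms(1) M(1,3)]) auto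
qed

text \<open>Differentiating the kernel costs one power, so t + 1 < N makes the potential of a
  bounded density Lipschitz. This gives it pointwise values on the boundary and the a priori
  finiteness behind the absorption in the trace inequality.\<close>

lemma rpot_lipschitz:
  assumes f: "bounded_supp \<rho> f" and t: "0 < t" "t + 1 < real DIM('a::euclidean_space)"
  obtains L where "\<And>z z'::'a. \<bar>rpot t f z - rpot t f z'\<bar> \<le> L * norm (z - z')"
proof -
  have t': "0 \<le> t + 1" "0 \<le> t" "t < real DIM('a)" using t by auto
  obtain S where S: "0 < S" "\<And>z::'a. (\<integral>\<^sup>+x. ennreal (rker (t+1) (x - z)) * indicator (ball 0 \<rho>) x \<partial>lborel) \<le> ennreal S"
    by (rule kernel_ball_bound[OF t'(1) t(2)], rule that)
  obtain M where M: "0 \<le> M" "\<And>x. \<bar>f x\<bar> \<le> M" "\<And>x. \<bar>f x\<bar> \<le> M * indicator (ball 0 \<rho>) x"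
    by (rule bounded_supp_boundE[OF f], rule that)
  define g where "g x = \<bar>f x\<bar>" for x
  have g: "bounded_supp \<rho> g" using f unfolding bounded_supp_def g_def by auto
  have Mg: "\<And>x. \<bar>g x\<bar> \<le> M * indicator (ball 0 \<rho>) x" using M(3) by (simp add: g_def)
  have ig: "integrable lborel (\<lambda>x. g x * rker (t+1) (x - z))" "\<bar>LINT x|lborel. g x * rker (t+1) (x - z)\<bar> \<le> M * S" for z
    using kernel_potential_bound(2,3)[OF g M(1) Mg S(2)] S(1) by auto
  have "\<bar>rpot t f z - rpot t f z'\<bar> \<le> (max 1 t * (M * S + M * S)) * norm (z - z')" for z z'
  proof -
    let ?c = "max 1 t * norm (z - z')"
    note i = rker_integrable[OF f t'(2,3)]
    have "rpot t f z - rpot t f z' = (LINT x|lborel. f x * rker t (x - z) - f x * rker t (x - z'))"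
      unfolding rpot_def by (rule Bochner_Integration.integral_diff[symmetric]) (rule i)+
    also have "\<bar>\<dots>\<bar> \<le> (LINT x|lborel. \<bar>f x * rker t (x - z) - f x * rker t (x - z')\<bar>)"
      by (rule integral_abs_bound)
    also have "\<dots> \<le> (LINT x|lborel. ?c * (g x * rker (t+1) (x - z) + g x * rker (t+1) (x - z')))"
    proof (rule integral_mono)
      show "integrable lborel (\<lambda>x. \<bar>f x * rker t (x - z) - f x * rker t (x - z')\<bar>)"
        by (intro integrable_abs Bochner_Integration.integrable_diff i)
      show "integrable lborel (\<lambda>x. ?c * (g x * rker (t+1) (x - z) + g x * rker (t+1) (x - z')))"
        by (intro integrable_mult_right Bochner_Integration.integrable_add ig)
      fix x
      have "\<bar>f x * rker t (x - z) - f x * rker t (x - z')\<bar> = g x * \<bar>rker t (x - z) - rker t (x - z')\<bar>"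
        by (simp add: g_def right_diff_distrib[symmetric] abs_mult)
      also have "\<dots> \<le> g x * (max 1 t * norm ((x - z) - (x - z')) * (rker (t+1) (x - z) + rker (t+1) (x - z')))"
        by (intro mult_left_mono rker_diff_bound1 t) (simp add: g_def)
      also have "norm ((x - z) - (x - z')) = norm (z - z')" by (simp add: norm_minus_commute)
      finally show "\<bar>f x * rker t (x - z) - f x * rker t (x - z')\<bar> \<le> ?c * (g x * rker (t+1) (x - z) + g x * rker (t+1) (x - z'))"
        by (simp only: distrib_left ac_simps)
    qed
    also have "\<dots> = ?c * ((LINT x|lborel. g x * rker (t+1) (x - z)) + (LINT x|lborel. g x * rker (t+1) (x - z')))"
      using ig by simp
    also have "\<dots> \<le> ?c * (M * S + M * S)"
      using ig(2)[of z] ig(2)[of z'] by (intro mult_left_mono add_mono) auto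
    finally show ?thesis by (simp only: ac_simps)
  qed
  then show ?thesis by (rule that)
qed

lemma rpot_continuous:
  assumes f: "bounded_supp \<rho> f" and t: "0 < t" "t + 1 < real DIM('a::euclidean_space)"
  shows "continuous_on UNIV (rpot t f :: 'a \<Rightarrow> real)"
proof -
  obtain L where L: "\<And>z z'::'a. \<bar>rpot t f z - rpot t f z'\<bar> \<le> L * norm (z - z')"
    by (rule rpot_lipschitz[OF f t], rule that)
  have "(max L 0)-lipschitz_on UNIV (rpot t f)"
  proof (rule lipschitz_onI)
    fix x y :: 'a
    have "L * norm (x - y) \<le> max L 0 * norm (x - y)" by (intro mult_right_mono) auto
    then show "dist (rpot t f x) (rpot t f y) \<le> max L 0 * dist x y"
      using L[of x y] by (simp add: dist_norm)
  qed simp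
  then show ?thesis by (rule lipschitz_on_continuous_on)
qed

lemma rpot_measurable:
  assumes f: "bounded_supp \<rho> f" and t: "0 < t" "t + 1 < real DIM('a::euclidean_space)"
  shows "(rpot t f :: 'a \<Rightarrow> real) \<in> borel_measurable borel"
  by (intro borel_measurable_continuous_onI rpot_continuous[OF assms])

lemma bounded_supp_restrict:
  assumes "g \<in> borel_measurable borel" "\<And>x. norm x < \<rho> \<Longrightarrow> \<bar>g x\<bar> \<le> M"
  shows "bounded_supp \<rho> (\<lambda>x. indicator (ball 0 \<rho>) x * g x)"
  unfolding bounded_supp_def
proof (intro conjI exI allI)
  show "(\<lambda>x. indicator (ball 0 \<rho>) x * g x) \<in> borel_measurable borel"
    using assms by (intro borel_measurable_times borel_measurable_indicator) auto
  show "\<bar>indicator (ball 0 \<rho>) x * g x\<bar> \<le> max M 0" for x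
    using assms(2)[of x] by (auto simp: indicator_def)
qed (auto simp: indicator_def)

lemma bounded_supp_continuous_restrict:
  assumes "continuous_on UNIV g"
  shows "bounded_supp \<rho> (\<lambda>x. indicator (ball 0 \<rho>) x * g x)"
proof -
  have "bounded (g ` cball 0 \<rho>)"
    by (intro compact_imp_bounded compact_continuous_image continuous_on_subset[OF assms]) auto
  then obtain M where "\<forall>x\<in>cball 0 \<rho>. \<bar>g x\<bar> \<le> M" by (auto simp: bounded_iff)
  then show ?thesis using assms
    by (intro bounded_supp_restrict[of _ _ M] borel_measurable_continuous_onI) auto
qed

lemma bounded_supp_integrable_mult:
  assumes f: "bounded_supp \<rho> f" and g: "g \<in> borel_measurable borel" "\<And>x. norm x < \<rho> \<Longrightarrow> \<bar>g x\<bar> \<le> M"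
  shows "integrable lborel (\<lambda>x. f x * g x)"
proof -
  note [measurable] = bounded_supp_measurable[OF f] g(1)
  obtain K where K: "0 \<le> K" "\<And>x. \<bar>f x\<bar> \<le> K" "\<And>x. \<bar>f x\<bar> \<le> K * indicator (ball 0 \<rho>) x"
    by (rule bounded_supp_boundE[OF f], rule that)
  show ?thesis
  proof (rule Bochner_Integration.integrable_bound)
    show "integrable lborel (\<lambda>x. (K * max M 0) * indicator (ball 0 \<rho>) x)"
      by (intro integrable_mult_right integrable_real_indicator emeasure_lborel_ball_finite) simp
    show "AE x in lborel. norm (f x * g x) \<le> norm ((K * max M 0) * indicator (ball 0 \<rho>) x)"
    proof (rule AE_I2)
      fix x
      show "norm (f x * g x) \<le> norm ((K * max M 0) * indicator (ball 0 \<rho>) x)"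
      proof (cases "x \<in> ball 0 \<rho>")
        case True
        then have "\<bar>f x\<bar> * \<bar>g x\<bar> \<le> K * max M 0"
          using K(1,2) g(2)[of x] by (intro mult_mono) auto
        then show ?thesis using True K(1) by (simp add: abs_mult)
      next
        case False
        then show ?thesis using K(3)[of x] by simp
      qed
    qed
  qed measurable
qed

lemma bounded_supp_mult_continuous_integrable:
  assumes f: "bounded_supp \<rho> f" and g: "continuous_on UNIV g"
  shows "integrable lborel (\<lambda>x. f x * g x)"
proof -
  have "bounded (g ` cball 0 \<rho>)"
    by (intro compact_imp_bounded compact_continuous_image continuous_on_subset[OF g]) auto
  then obtain M where "\<forall>x\<in>cball 0 \<rho>. \<bar>g x\<bar> \<le> M" by (auto simp: bounded_iff)
  then show ?thesis using g
    by (intro bounded_supp_integrable_mult[OF f, of _ M] borel_measurable_continuous_onI) auto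
qed

lemma bounded_supp_square_integrable:
  assumes f: "bounded_supp \<rho> f"
  shows "integrable lborel (\<lambda>x. (f x)\<^sup>2)"
proof -
  obtain K where K: "0 \<le> K" "\<And>x. \<bar>f x\<bar> \<le> K" "\<And>x. \<bar>f x\<bar> \<le> K * indicator (ball 0 \<rho>) x"
    by (rule bounded_supp_boundE[OF f], rule that)
  show ?thesis unfolding power2_eq_square
    by (rule bounded_supp_integrable_mult[OF f bounded_supp_measurable[OF f], of K]) (rule K)
qed

lemma Cauchy_Schwarz_integral_real:
  fixes f g :: "'a \<Rightarrow> real"
  assumes [measurable]: "f \<in> borel_measurable M" "g \<in> borel_measurable M"
    and f: "integrable M (\<lambda>x. (f x)\<^sup>2)" and g: "integrable M (\<lambda>x. (g x)\<^sup>2)"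
  shows "integrable M (\<lambda>x. f x * g x)"
    and "(LINT x|M. f x * g x)\<^sup>2 \<le> (LINT x|M. (f x)\<^sup>2) * (LINT x|M. (g x)\<^sup>2)"
proof -
  let ?F = "LINT x|M. (f x)\<^sup>2" and ?G = "LINT x|M. (g x)\<^sup>2"
  have eqs: "(\<integral>\<^sup>+x. (ennreal \<bar>f x\<bar>)\<^sup>2 \<partial>M) = ennreal ?F" "(\<integral>\<^sup>+x. (ennreal \<bar>g x\<bar>)\<^sup>2 \<partial>M) = ennreal ?G"
    using nn_integral_eq_integral[OF f] nn_integral_eq_integral[OF g] by (simp_all add: ennreal_power)
  have CS: "(\<integral>\<^sup>+x. ennreal \<bar>f x * g x\<bar> \<partial>M)\<^sup>2 \<le> ennreal ?F * ennreal ?G"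
    using Cauchy_Schwarz_nn_integral[of "\<lambda>x. ennreal \<bar>f x\<bar>" M "\<lambda>x. ennreal \<bar>g x\<bar>"]
    by (simp add: eqs abs_mult ennreal_mult')
  then have fin: "(\<integral>\<^sup>+x. ennreal \<bar>f x * g x\<bar> \<partial>M) < \<infinity>"
    by (auto simp: less_top[symmetric] power2_eq_square ennreal_mult_eq_top_iff top_unique ennreal_mult'[symmetric])
  then show i: "integrable M (\<lambda>x. f x * g x)"
    by (intro integrableI_bounded) auto
  have "ennreal ((LINT x|M. \<bar>f x * g x\<bar>)\<^sup>2) \<le> ennreal (?F * ?G)"
    using CS nn_integral_eq_integral[OF integrable_abs[OF i]]
    by (simp add: ennreal_power ennreal_mult')
  then have "(LINT x|M. \<bar>f x * g x\<bar>)\<^sup>2 \<le> ?F * ?G" by (simp add: ennreal_le_iff)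
  moreover have "(LINT x|M. f x * g x)\<^sup>2 \<le> (LINT x|M. \<bar>f x * g x\<bar>)\<^sup>2"
    using integral_abs_bound[of M "\<lambda>x. f x * g x"] by (metis abs_ge_zero abs_le_square_iff abs_of_nonneg order_trans)
  ultimately show "(LINT x|M. f x * g x)\<^sup>2 \<le> ?F * ?G" by linarith
qed

lemma rker_pair_integrable:
  assumes f: "bounded_supp \<rho> f" and g: "bounded_supp \<rho> g" and t: "0 \<le> t" "t < real DIM('a::euclidean_space)"
  shows "integrable (lborel \<Otimes>\<^sub>M lborel) (\<lambda>(x::'a, y). f x * g y * rker t (y - x))"
proof (rule lborel_pair.Fubini_integrable)
  note [measurable] = bounded_supp_measurable[OF f] bounded_supp_measurable[OF g]
  show "(\<lambda>(x, y). f x * g y * rker t (y - x)) \<in> borel_measurable (lborel \<Otimes>\<^sub>M lborel)" by measurable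
  have ag: "bounded_supp \<rho> (\<lambda>x. \<bar>g x\<bar>)" using g unfolding bounded_supp_def by auto
  have i: "integrable lborel (\<lambda>y. g y * rker t (y - x))" for x by (rule rker_integrable[OF g t])
  show "AE x in lborel. integrable lborel (\<lambda>y. case (x, y) of (x, y) \<Rightarrow> f x * g y * rker t (y - x))"
    using i by (simp add: mult.assoc)
  obtain S where S: "0 < S" "\<And>z::'a. (\<integral>\<^sup>+x. ennreal (rker t (x - z)) * indicator (ball 0 \<rho>) x \<partial>lborel) \<le> ennreal S"
    by (rule kernel_ball_bound[OF t], rule that)
  obtain M where M: "0 \<le> M" "\<And>x. \<bar>g x\<bar> \<le> M" "\<And>x. \<bar>g x\<bar> \<le> M * indicator (ball 0 \<rho>) x"
    by (rule bounded_supp_boundE[OF g], rule that)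
  have b: "\<bar>LINT y|lborel. \<bar>g y\<bar> * rker t (y - x)\<bar> \<le> M * S" for x
    using S M by (intro kernel_potential_bound(3)[OF ag M(1)]) auto
  have "integrable lborel (\<lambda>x. \<bar>f x\<bar> * (LINT y|lborel. \<bar>g y\<bar> * rker t (y - x)))"
  proof (rule bounded_supp_integrable_mult)
    show "bounded_supp \<rho> (\<lambda>x. \<bar>f x\<bar>)" using f unfolding bounded_supp_def by auto
    show "(\<lambda>x. LINT y|lborel. \<bar>g y\<bar> * rker t (y - x)) \<in> borel_measurable borel" by measurable
  qed (rule b)
  then show "integrable lborel (\<lambda>x. LINT y|lborel. norm (case (x, y) of (x, y) \<Rightarrow> f x * g y * rker t (y - x)))"
    by (simp add: abs_mult mult.assoc)
qed

lemma rpot_pair_integral: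
  assumes f: "bounded_supp \<rho> f" and g: "bounded_supp \<rho> g" and t: "0 \<le> t" "t < real DIM('a::euclidean_space)"
  shows "(LINT (x, y)|(lborel \<Otimes>\<^sub>M lborel). f x * g y * rker t (y - x)) = (LINT x|lborel. f (x::'a) * rpot t g x)"
  using lborel_pair.integral_fst'[OF rker_pair_integrable[OF assms]]
  by (simp add: rpot_def mult.assoc)

lemma rpot_symmetric:
  assumes f: "bounded_supp \<rho> f" and g: "bounded_supp \<rho> g" and t: "0 \<le> t" "t < real DIM('a::euclidean_space)"
  shows "(LINT x|lborel. f (x::'a) * rpot t g x) = (LINT x|lborel. g x * rpot t f x)"
proof -
  have "(LINT x|lborel. f (x::'a) * rpot t g x) = (LINT y|lborel. LINT x|lborel. f x * g y * rker t (y - x))"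
    using lborel_pair.integral_snd[OF rker_pair_integrable[OF assms]] rpot_pair_integral[OF assms] by simp
  also have "\<dots> = (LINT y|lborel. g y * rpot t f y)"
  proof (rule Bochner_Integration.integral_cong[OF refl])
    fix y
    have "(LINT x|lborel. f x * g y * rker t (y - x)) = (LINT x|lborel. g y * (f x * rker t (x - y)))"
      by (intro Bochner_Integration.integral_cong refl) (simp add: rker_commute[of t y] ac_simps)
    then show "(LINT x|lborel. f x * g y * rker t (y - x)) = g y * rpot t f y" by (simp add: rpot_def)
  qed
  finally show ?thesis .
qed

text \<open>Schur's test. The kernel is a product of two square roots, to which Cauchy-Schwarz
  applies at each point; the bound \<open>S\<close> on the potential of the indicator is then used
  twice, the second time after moving the kernel by symmetry.\<close>

lemma rpot_L2:
  assumes t: "0 < t" "t + 1 < real DIM('a::euclidean_space)"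
  obtains S where "0 < S" "\<And>f :: 'a \<Rightarrow> real. bounded_supp \<rho> f \<Longrightarrow>
    (LINT z|lborel. indicator (ball 0 \<rho>) z * (rpot t f z)\<^sup>2) \<le> S\<^sup>2 * (LINT x|lborel. (f x)\<^sup>2)"
proof -
  have t': "0 \<le> t" "t < real DIM('a)" using t by auto
  obtain S where S: "0 < S" "\<And>z::'a. (\<integral>\<^sup>+x. ennreal (rker t (x - z)) * indicator (ball 0 \<rho>) x \<partial>lborel) \<le> ennreal S"
    by (rule kernel_ball_bound[OF t'], rule that)
  have one: "bounded_supp \<rho> (\<lambda>x::'a. indicator (ball 0 \<rho>) x)"
    using bounded_supp_restrict[of "\<lambda>_. 1" \<rho> 1] by simp
  have S1: "rpot t (indicator (ball 0 \<rho>)) z \<le> S" for z :: 'a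
    using kernel_potential_bound(3)[OF one, of 1 t z S] S by (auto simp: rpot_def)
  have "(LINT z|lborel. indicator (ball 0 \<rho>) z * (rpot t f z)\<^sup>2) \<le> S\<^sup>2 * (LINT x|lborel. (f x)\<^sup>2)"
    if f: "bounded_supp \<rho> f" for f :: "'a \<Rightarrow> real"
  proof -
    note [measurable] = bounded_supp_measurable[OF f] bounded_supp_measurable[OF one]
    have f2: "bounded_supp \<rho> (\<lambda>x. (f x)\<^sup>2)"
    proof -
      obtain M where M: "0 \<le> M" "\<And>x. \<bar>f x\<bar> \<le> M" "\<And>x. \<bar>f x\<bar> \<le> M * indicator (ball 0 \<rho>) x"
        by (rule bounded_supp_boundE[OF f], rule that)
      have "(f x)\<^sup>2 \<le> M\<^sup>2" for x using power_mono[OF M(2)[of x], of 2] by simp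
      then show ?thesis using f unfolding bounded_supp_def by auto
    qed
    have pw: "(rpot t f z)\<^sup>2 \<le> S * rpot t (\<lambda>x. (f x)\<^sup>2) z" for z
    proof -
      let ?a = "\<lambda>x. f x * sqrt (rker t (x - z))" and ?b = "\<lambda>x. indicator (ball 0 \<rho>) x * sqrt (rker t (x - z))"
      have z: "f x * indicator (ball 0 \<rho>) x = f x" for x
        using f by (auto simp: bounded_supp_def indicator_def)
      have e1: "f x * rker t (x - z) = ?a x * ?b x" for x
        using z[of x] by (simp add: algebra_simps) (metis mult.assoc mult.commute)
      have e2: "(?a x)\<^sup>2 = (f x)\<^sup>2 * rker t (x - z)" for x by (simp add: power_mult_distrib)
      have e3: "(?b x)\<^sup>2 = indicator (ball 0 \<rho>) x * rker t (x - z)" for x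
        by (simp add: power_mult_distrib indicator_def)
      have "(rpot t f z)\<^sup>2 = (LINT x|lborel. ?a x * ?b x)\<^sup>2" unfolding rpot_def e1 ..
      also have "\<dots> \<le> (LINT x|lborel. (?a x)\<^sup>2) * (LINT x|lborel. (?b x)\<^sup>2)"
      proof (rule Cauchy_Schwarz_integral_real(2))
        show "?b \<in> borel_measurable lborel" using bounded_supp_measurable[OF one] by measurable
        show "integrable lborel (\<lambda>x. (?a x)\<^sup>2)" unfolding e2 by (rule rker_integrable[OF f2 t'])
        show "integrable lborel (\<lambda>x. (?b x)\<^sup>2)" unfolding e3 by (rule rker_integrable[OF one t'])
      qed measurable
      also have "\<dots> = rpot t (\<lambda>x. (f x)\<^sup>2) z * rpot t (indicator (ball 0 \<rho>)) z" unfolding e2 e3 rpot_def ..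
      also have "\<dots> \<le> rpot t (\<lambda>x. (f x)\<^sup>2) z * S"
        using S1 by (intro mult_left_mono) (auto simp: rpot_def intro!: integral_nonneg_AE)
      finally show ?thesis by (simp add: mult.commute)
    qed
    have c: "continuous_on UNIV (rpot t f)" "continuous_on UNIV (rpot t (\<lambda>x. (f x)\<^sup>2))" "continuous_on UNIV (rpot t (indicator (ball 0 \<rho>)) :: 'a \<Rightarrow> real)"
      by (rule rpot_continuous[OF _ t], fact)+
    have "(LINT z|lborel. indicator (ball 0 \<rho>) z * (rpot t f z)\<^sup>2) \<le> (LINT z|lborel. S * (indicator (ball 0 \<rho>) z * rpot t (\<lambda>x. (f x)\<^sup>2) z))"
    proof (rule integral_mono)
      show "integrable lborel (\<lambda>z. indicator (ball 0 \<rho>) z * (rpot t f z)\<^sup>2)"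
        by (intro bounded_supp_mult_continuous_integrable[OF one] continuous_intros c)
      show "integrable lborel (\<lambda>z. S * (indicator (ball 0 \<rho>) z * rpot t (\<lambda>x. (f x)\<^sup>2) z))"
        by (intro integrable_mult_right bounded_supp_mult_continuous_integrable[OF one] c)
      show "indicator (ball 0 \<rho>) z * (rpot t f z)\<^sup>2 \<le> S * (indicator (ball 0 \<rho>) z * rpot t (\<lambda>x. (f x)\<^sup>2) z)" for z
        using pw[of z] by (auto simp: indicator_def)
    qed
    also have "\<dots> = S * (LINT x|lborel. (f x)\<^sup>2 * rpot t (indicator (ball 0 \<rho>)) x)"
      using rpot_symmetric[OF one f2 t'] by simp
    also have "\<dots> \<le> S * (LINT x|lborel. S * (f x)\<^sup>2)"
    proof (intro mult_left_mono integral_mono)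
      show "integrable lborel (\<lambda>x. (f x)\<^sup>2 * rpot t (indicator (ball 0 \<rho>)) x)"
        by (intro bounded_supp_mult_continuous_integrable[OF f2] c)
      show "integrable lborel (\<lambda>x. S * (f x)\<^sup>2)" by (intro integrable_mult_right bounded_supp_square_integrable[OF f])
      show "(f x)\<^sup>2 * rpot t (indicator (ball 0 \<rho>)) x \<le> S * (f x)\<^sup>2" for x
        using mult_left_mono[OF S1[of x], of "(f x)\<^sup>2"] by (simp add: mult.commute)
    qed (use S in simp)
    also have "\<dots> = S\<^sup>2 * (LINT x|lborel. (f x)\<^sup>2)" by (simp add: power2_eq_square)
    finally show ?thesis .
  qed
  then show ?thesis using S(1) by (intro that[of S]) auto
qed

section \<open>The energy identity and duality for potentials\<close>

lemma AE_lborel_pair_neq: "AE p in lborel \<Otimes>\<^sub>M lborel. fst p \<noteq> (snd p :: 'a::euclidean_space)"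
proof (rule lborel_pair.AE_pair_measure)
  show "{p \<in> space (lborel \<Otimes>\<^sub>M lborel). fst p \<noteq> (snd p :: 'a)} \<in> sets (lborel \<Otimes>\<^sub>M lborel)" by measurable
  show "AE x in lborel. AE y in lborel. fst (x, y) \<noteq> (snd (x, y) :: 'a)"
  proof (rule AE_I2)
    fix x :: 'a
    show "AE y in lborel. fst (x, y) \<noteq> snd (x, y)"
      using AE_lborel_singleton[of x] by eventually_elim simp
  qed
qed

lemma
  fixes f :: "'a::euclidean_space \<Rightarrow> real" and g :: "'b::euclidean_space \<Rightarrow> real"
  assumes f: "integrable lborel f" and g: "integrable lborel g"
  shows integrable_pair_product: "integrable (lborel \<Otimes>\<^sub>M lborel) (\<lambda>(x, y). f x * g y)"
    and integral_pair_product: "(LINT (x, y)|(lborel \<Otimes>\<^sub>M lborel). f x * g y) = (LINT x|lborel. f x) * (LINT y|lborel. g y)"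
proof -
  have [measurable]: "f \<in> borel_measurable borel" "g \<in> borel_measurable borel" using f g by auto
  show i: "integrable (lborel \<Otimes>\<^sub>M lborel) (\<lambda>(x, y). f x * g y)"
  proof (rule lborel_pair.Fubini_integrable)
    show "integrable lborel (\<lambda>x. LINT y|lborel. norm (case (x, y) of (x, y) \<Rightarrow> f x * g y))"
      using f by (simp add: abs_mult)
    show "AE x in lborel. integrable lborel (\<lambda>y. case (x, y) of (x, y) \<Rightarrow> f x * g y)"
      using g by simp
  qed measurable
  show "(LINT (x, y)|(lborel \<Otimes>\<^sub>M lborel). f x * g y) = (LINT x|lborel. f x) * (LINT y|lborel. g y)"
    using lborel_pair.integral_fst'[OF i] by simp
qed

text \<open>\<open>b\<close> is the full exponent N + 2s. A Bochner integral would be 0 for infinite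
  energy, so \<open>riesz_energy_identity\<close> records integrability as well.\<close>

definition gag_energy :: "real \<Rightarrow> ('a::euclidean_space \<Rightarrow> real) \<Rightarrow> real" where
  "gag_energy b v = (LINT z|(lborel \<Otimes>\<^sub>M lborel). (v (fst z) - v (snd z))\<^sup>2 * norm (fst z - snd z) powr (-b))"

text \<open>The kernel \<open>E(P,Q)\<close> of the quadratic form \<open>f \<mapsto> [\<Gamma> * f]\<^sup>2\<close> is absolutely
  convergent and covariant under similarities, hence a multiple of \<open>\<Gamma>(P - Q)\<close>. This replaces
  the identity \<open>(-\<Delta>)\<^sup>s \<Gamma> = \<delta>\<close>; the value of the constant is irrelevant.\<close>

lemma riesz_energy_identity:
  assumes s: "1/2 < s" "s < 1" "2 \<le> DIM('a::euclidean_space)"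
  defines "t \<equiv> real DIM('a) - 2 * s" and "b \<equiv> real DIM('a) + 2 * s"
  obtains c where "\<And>\<rho> f :: 'a \<Rightarrow> real. bounded_supp \<rho> f \<Longrightarrow>
      integrable (lborel \<Otimes>\<^sub>M lborel) (\<lambda>z. (rpot t f (fst z) - rpot t f (snd z))\<^sup>2 * norm (fst z - snd z) powr (-b))"
    "\<And>\<rho> f :: 'a \<Rightarrow> real. bounded_supp \<rho> f \<Longrightarrow> gag_energy b (rpot t f) = c * (LINT x|lborel. f x * rpot t f x)"
proof -
  let ?M = "lborel \<Otimes>\<^sub>M lborel :: ('a \<times> 'a) measure"
  interpret M2: pair_sigma_finite ?M ?M ..
  have t: "0 \<le> t" "t < real DIM('a)" "0 < t" using s by (auto simp: t_def)
  obtain K where K: "0 \<le> K" "\<And>P Q :: 'a. P \<noteq> Q \<Longrightarrow>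
    (\<integral>\<^sup>+z. ennreal \<bar>ekern t b P Q (fst z) (snd z)\<bar> \<partial>?M) \<le> ennreal (K * norm (P - Q) powr (-t))"
    by (rule energy_kernel_finite[OF s, folded t_def b_def], rule that)
  obtain c where c: "\<And>P Q :: 'a. P \<noteq> Q \<Longrightarrow>
    (LINT x|lborel. LINT y|lborel. ekern t b P Q x y) = c * norm (P - Q) powr (2 * real DIM('a) - 2 * t - b)"
    by (rule energy_kernel_homogeneous, rule that)
  have ex: "2 * real DIM('a) - 2 * t - b = - t" by (simp add: t_def b_def)
  have main: "integrable ?M (\<lambda>z. (rpot t f (fst z) - rpot t f (snd z))\<^sup>2 * norm (fst z - snd z) powr (-b)) \<and>
      gag_energy b (rpot t f) = c * (LINT x|lborel. f x * rpot t f x)" if f: "bounded_supp \<rho> f" for \<rho> and f :: "'a \<Rightarrow> real"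
  proof -
    note [measurable] = bounded_supp_measurable[OF f]
    \<comment> \<open>\<open>p\<close> holds the positions of the two densities, \<open>z\<close>
      the pair of points in the energy. Integrating in \<open>p\<close> first produces the squared
      difference of the potential, in \<open>z\<close> first the kernel of the quadratic
      form.\<close>
    define H where "H z p = f (fst p) * f (snd p) * ekern t b (fst p) (snd p) (fst z) (snd z)" for z p
    have Hm: "case_prod H \<in> borel_measurable (?M \<Otimes>\<^sub>M ?M)" unfolding H_def by measurable
    note fint = rker_pair_integrable[OF f f t(1,2)]
    have ekm: "(\<lambda>z. ennreal \<bar>ekern t b P Q (fst z) (snd z)\<bar>) \<in> borel_measurable ?M" for P Q by measurable
    have ek: "integrable ?M (\<lambda>z. ekern t b P Q (fst z) (snd z))" if "P \<noteq> Q" for P Q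
      by (rule integrableI_bounded) (use K(2)[OF that] in \<open>auto intro: le_less_trans\<close>)
    have ekv: "(LINT z|?M. ekern t b P Q (fst z) (snd z)) = c * rker t (P - Q)" if "P \<noteq> Q" for P Q
      using lborel_pair.integral_fst'[OF ek[OF that]] c[OF that] by (simp add: ex rker_def)
    have Hint: "integrable (?M \<Otimes>\<^sub>M ?M) (case_prod H)"
    proof (rule integrableI_bounded[OF Hm])
      have "(\<integral>\<^sup>+q. ennreal (norm (case_prod H q)) \<partial>(?M \<Otimes>\<^sub>M ?M)) = (\<integral>\<^sup>+p. \<integral>\<^sup>+z. ennreal (norm (case_prod H (z, p))) \<partial>?M \<partial>?M)"
        by (intro M2.nn_integral_snd[symmetric] measurable_compose[OF Hm, of "\<lambda>r. ennreal (norm r)"]) measurable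
      also have "\<dots> \<le> (\<integral>\<^sup>+p. ennreal (K * \<bar>f (fst p) * f (snd p) * rker t (snd p - fst p)\<bar>) \<partial>?M)"
      proof (rule nn_integral_mono_AE)
        show "AE p in ?M. (\<integral>\<^sup>+z. ennreal (norm (case_prod H (z, p))) \<partial>?M) \<le> ennreal (K * \<bar>f (fst p) * f (snd p) * rker t (snd p - fst p)\<bar>)"
          using AE_lborel_pair_neq
        proof eventually_elim
          case (elim p)
          have "(\<integral>\<^sup>+z. ennreal (norm (case_prod H (z, p))) \<partial>?M) = (\<integral>\<^sup>+z. ennreal \<bar>f (fst p) * f (snd p)\<bar> * ennreal \<bar>ekern t b (fst p) (snd p) (fst z) (snd z)\<bar> \<partial>?M)"
            by (intro nn_integral_cong) (simp add: H_def abs_mult ennreal_mult')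
          also have "\<dots> \<le> ennreal (\<bar>f (fst p) * f (snd p)\<bar> * (K * norm (fst p - snd p) powr (-t)))"
            by (intro nn_integral_cmult_le K(2)[OF elim] ekm abs_ge_zero)
          also have "\<bar>f (fst p) * f (snd p)\<bar> * (K * norm (fst p - snd p) powr (-t)) = K * \<bar>f (fst p) * f (snd p) * rker t (snd p - fst p)\<bar>"
            by (simp add: abs_mult rker_def norm_minus_commute)
          finally show ?case .
        qed
      qed
      also have "\<dots> < \<infinity>"
      proof -
        have "integrable ?M (\<lambda>p. K * \<bar>f (fst p) * f (snd p) * rker t (snd p - fst p)\<bar>)"
          using fint by (intro integrable_mult_right integrable_abs) (simp add: case_prod_beta')
        from integrableD(2)[OF this] show ?thesis using K(1)
          by (simp add: abs_mult less_top)
      qed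
      finally show "(\<integral>\<^sup>+q. ennreal (norm (case_prod H q)) \<partial>(?M \<Otimes>\<^sub>M ?M)) < \<infinity>" .
    qed
    have inner: "(LINT p|?M. H z p) = (rpot t f (fst z) - rpot t f (snd z))\<^sup>2 * norm (fst z - snd z) powr (-b)" for z
    proof -
      obtain x y where z: "z = (x, y)" by (cases z)
      define a where "a P = f P * rker t (P - x) - f P * rker t (P - y)" for P
      have ia: "integrable lborel a" unfolding a_def
        by (intro Bochner_Integration.integrable_diff rker_integrable[OF f t(1,2)])
      have va: "(LINT P|lborel. a P) = rpot t f x - rpot t f y"
        unfolding a_def rpot_def by (intro Bochner_Integration.integral_diff rker_integrable[OF f t(1,2)])
      have "(LINT p|?M. H z p) = (LINT (P, Q)|?M. (a P * a Q) * norm (x - y) powr (-b))"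
        by (intro Bochner_Integration.integral_cong refl)
          (auto simp: H_def a_def z ekern_def rker_commute[of t _ x] rker_commute[of t _ y] algebra_simps)
      also have "\<dots> = (LINT (P, Q)|?M. a P * a Q) * norm (x - y) powr (-b)"
        by (simp add: case_prod_beta')
      also have "(LINT (P, Q)|?M. a P * a Q) = (rpot t f x - rpot t f y)\<^sup>2"
        using integral_pair_product[OF ia ia] by (simp add: va power2_eq_square)
      finally show ?thesis by (simp add: z)
    qed
    have "integrable ?M (\<lambda>z. LINT p|?M. H z p)" by (rule M2.integrable_fst[OF Hint])
    then have i: "integrable ?M (\<lambda>z. (rpot t f (fst z) - rpot t f (snd z))\<^sup>2 * norm (fst z - snd z) powr (-b))"
      by (simp add: inner)
    have "gag_energy b (rpot t f) = (LINT z|?M. LINT p|?M. H z p)" by (simp add: gag_energy_def inner)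
    also have "\<dots> = (LINT p|?M. LINT z|?M. H z p)" by (rule M2.Fubini_integral[OF Hint, symmetric])
    also have "\<dots> = (LINT p|?M. c * (f (fst p) * f (snd p) * rker t (snd p - fst p)))"
    proof (rule integral_cong_AE)
      show "(\<lambda>p. LINT z|?M. H z p) \<in> borel_measurable ?M"
        using M2.integrable_snd[OF Hint] by auto
      show "AE p in ?M. (LINT z|?M. H z p) = c * (f (fst p) * f (snd p) * rker t (snd p - fst p))"
        using AE_lborel_pair_neq
      proof eventually_elim
        case (elim p)
        show ?case unfolding H_def using ekv[OF elim] by (simp add: rker_commute[of t "snd p"])
      qed
    qed measurable
    also have "\<dots> = c * (LINT p|?M. f (fst p) * f (snd p) * rker t (snd p - fst p))" by simp
    also have "(LINT p|?M. f (fst p) * f (snd p) * rker t (snd p - fst p)) = (LINT x|lborel. f x * rpot t f x)"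
      using rpot_pair_integral[OF f f t(1,2)] by (simp add: case_prod_beta')
    finally show ?thesis using i by simp
  qed
  show ?thesis by (rule that[of c]) (use main in blast)+
qed

lemma gag_energy_nonneg: "0 \<le> gag_energy b v"
  unfolding gag_energy_def by (intro integral_nonneg_AE) simp

text \<open>Taking \<open>h = f\<close> in the duality hypothesis bounds the energy of \<open>\<Gamma> * f\<close>, and \<open>h = (\<Gamma> * f) 1\<^sub>B\<close>
  bounds its \<open>L\<^sup>2(B)\<close> norm.\<close>

lemma rpot_dual_bound:
  assumes s: "1/2 < s" "s < 1" "2 \<le> DIM('a::euclidean_space)"
  defines "t \<equiv> real DIM('a) - 2 * s" and "b \<equiv> real DIM('a) + 2 * s"
  obtains C where "0 \<le> C" "\<And>(f :: 'a \<Rightarrow> real) A. bounded_supp \<rho> f \<Longrightarrow> 0 \<le> A \<Longrightarrow>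
      (\<And>h. bounded_supp \<rho> h \<Longrightarrow> (LINT x|lborel. f x * rpot t h x)\<^sup>2 \<le> A * gag_energy b (rpot t h)) \<Longrightarrow>
      gag_energy b (rpot t f) + (LINT z|lborel. indicator (ball 0 \<rho>) z * (rpot t f z)\<^sup>2) \<le> C * A"
    "\<And>f :: 'a \<Rightarrow> real. bounded_supp \<rho> f \<Longrightarrow>
      gag_energy b (rpot t f) + (LINT z|lborel. indicator (ball 0 \<rho>) z * (rpot t f z)\<^sup>2) \<le> C * (LINT x|lborel. (f x)\<^sup>2)"
proof -
  have t: "0 \<le> t" "t < real DIM('a)" "0 < t" "t + 1 < real DIM('a)" using s by (auto simp: t_def)
  obtain c where c: "\<And>\<rho> f :: 'a \<Rightarrow> real. bounded_supp \<rho> f \<Longrightarrow>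
      integrable (lborel \<Otimes>\<^sub>M lborel) (\<lambda>z. (rpot t f (fst z) - rpot t f (snd z))\<^sup>2 * norm (fst z - snd z) powr (-b))"
    "\<And>\<rho> f :: 'a \<Rightarrow> real. bounded_supp \<rho> f \<Longrightarrow> gag_energy b (rpot t f) = c * (LINT x|lborel. f x * rpot t f x)"
    by (rule riesz_energy_identity[OF s, folded t_def b_def], rule that)
  obtain S where S: "0 < S" "\<And>f :: 'a \<Rightarrow> real. bounded_supp \<rho> f \<Longrightarrow>
    (LINT z|lborel. indicator (ball 0 \<rho>) z * (rpot t f z)\<^sup>2) \<le> S\<^sup>2 * (LINT x|lborel. (f x)\<^sup>2)"
    by (rule rpot_L2[OF t(3,4)], rule that)
  have one: "bounded_supp \<rho> (\<lambda>x::'a. indicator (ball 0 \<rho>) x)"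
    using bounded_supp_restrict[of "\<lambda>_. 1" \<rho> 1] by simp
  have sq_le: "X \<le> B" if "X\<^sup>2 \<le> B * X" "0 \<le> X" "0 \<le> B" for X B :: real
    using that mult_right_le_imp_le[of X X B] by (cases "X = 0") (simp_all add: power2_eq_square)
  \<comment> \<open>The bound by the L^2 norm of the density comes first because the dual estimate
    applies it to its own density \<open>?g\<close>.\<close>
  have E: "gag_energy b (rpot t f) \<le> \<bar>c\<bar> * S * (LINT x|lborel. (f x)\<^sup>2)" if f: "bounded_supp \<rho> f" for f :: "'a \<Rightarrow> real"
  proof -
    let ?g = "\<lambda>x. indicator (ball 0 \<rho>) x * rpot t f x"
    note [measurable] = bounded_supp_measurable[OF f]
    have cont: "continuous_on UNIV (rpot t f)" by (rule rpot_continuous[OF f t(3,4)])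
    have g: "bounded_supp \<rho> ?g" by (rule bounded_supp_continuous_restrict[OF cont])
    have g2: "(?g x)\<^sup>2 = indicator (ball 0 \<rho>) x * (rpot t f x)\<^sup>2" for x by (auto simp: indicator_def)
    have fg: "f x * ?g x = f x * rpot t f x" for x using f by (auto simp: bounded_supp_def indicator_def)
    have "(LINT x|lborel. f x * rpot t f x)\<^sup>2 \<le> (LINT x|lborel. (f x)\<^sup>2) * (LINT x|lborel. (?g x)\<^sup>2)"
      using Cauchy_Schwarz_integral_real(2)[OF _ _ bounded_supp_square_integrable[OF f] bounded_supp_square_integrable[OF g]]
        bounded_supp_measurable[OF f] bounded_supp_measurable[OF g] by (simp add: fg)
    also have "\<dots> \<le> (LINT x|lborel. (f x)\<^sup>2) * (S\<^sup>2 * (LINT x|lborel. (f x)\<^sup>2))"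
      using S(2)[OF f] unfolding g2 by (intro mult_left_mono integral_nonneg_AE) auto
    finally have "(LINT x|lborel. f x * rpot t f x)\<^sup>2 \<le> (S * (LINT x|lborel. (f x)\<^sup>2))\<^sup>2"
      by (simp add: power2_eq_square ac_simps)
    then have "\<bar>LINT x|lborel. f x * rpot t f x\<bar> \<le> \<bar>S * (LINT x|lborel. (f x)\<^sup>2)\<bar>"
      by (simp only: abs_le_square_iff)
    also have "\<dots> = S * (LINT x|lborel. (f x)\<^sup>2)"
      using S(1) by (intro abs_of_nonneg mult_nonneg_nonneg integral_nonneg_AE) auto
    finally have "\<bar>LINT x|lborel. f x * rpot t f x\<bar> \<le> S * (LINT x|lborel. (f x)\<^sup>2)" .
    then have "\<bar>c\<bar> * \<bar>LINT x|lborel. f x * rpot t f x\<bar> \<le> \<bar>c\<bar> * (S * (LINT x|lborel. (f x)\<^sup>2))"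
      by (rule mult_left_mono) simp
    moreover have "c * (LINT x|lborel. f x * rpot t f x) \<le> \<bar>c\<bar> * \<bar>LINT x|lborel. f x * rpot t f x\<bar>"
      unfolding abs_mult[symmetric] by (rule abs_ge_self)
    ultimately show ?thesis unfolding c(2)[OF f] by (simp add: mult.assoc)
  qed
  define C where "C = c\<^sup>2 + \<bar>c\<bar> * S + S\<^sup>2"
  show ?thesis
  proof (rule that[of C])
    show "0 \<le> C" using S(1) by (simp add: C_def)
  next
    fix f :: "'a \<Rightarrow> real" assume f: "bounded_supp \<rho> f"
    have "0 \<le> c\<^sup>2 * (LINT x|lborel. (f x)\<^sup>2)" by (intro mult_nonneg_nonneg integral_nonneg_AE) auto
    then show "gag_energy b (rpot t f) + (LINT z|lborel. indicator (ball 0 \<rho>) z * (rpot t f z)\<^sup>2) \<le> C * (LINT x|lborel. (f x)\<^sup>2)"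
      using E[OF f] S(2)[OF f] unfolding C_def distrib_right by linarith
  next
    fix f :: "'a \<Rightarrow> real" and A
    assume f: "bounded_supp \<rho> f" and A: "0 \<le> A"
      and dual: "\<And>h. bounded_supp \<rho> h \<Longrightarrow> (LINT x|lborel. f x * rpot t h x)\<^sup>2 \<le> A * gag_energy b (rpot t h)"
    let ?X = "gag_energy b (rpot t f)"
    have X: "?X \<le> c\<^sup>2 * A"
    proof (rule sq_le)
      have "?X\<^sup>2 = c\<^sup>2 * (LINT x|lborel. f x * rpot t f x)\<^sup>2" by (simp add: c(2)[OF f] power_mult_distrib)
      also have "\<dots> \<le> c\<^sup>2 * (A * ?X)" by (intro mult_left_mono dual f) simp
      finally show "?X\<^sup>2 \<le> c\<^sup>2 * A * ?X" by (simp add: mult.assoc)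
    qed (use A in \<open>auto simp: gag_energy_nonneg\<close>)
    let ?g = "\<lambda>x. indicator (ball 0 \<rho>) x * rpot t f x"
    let ?Y = "LINT z|lborel. indicator (ball 0 \<rho>) z * (rpot t f z)\<^sup>2"
    have cont: "continuous_on UNIV (rpot t f)" by (rule rpot_continuous[OF f t(3,4)])
    have g: "bounded_supp \<rho> ?g" by (rule bounded_supp_continuous_restrict[OF cont])
    have g2: "(?g x)\<^sup>2 = indicator (ball 0 \<rho>) x * (rpot t f x)\<^sup>2" for x by (auto simp: indicator_def)
    have Y: "?Y \<le> A * (\<bar>c\<bar> * S)"
    proof (rule sq_le)
      have "?Y = (LINT x|lborel. ?g x * rpot t f x)" by (simp add: power2_eq_square mult.assoc)
      \<comment> \<open>Symmetry of the kernel moves the potential from \<open>f\<close> to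
        \<open>?g\<close>, which puts the pairing into the shape of the hypothesis.\<close>
      also have "\<dots> = (LINT x|lborel. f x * rpot t ?g x)" by (rule rpot_symmetric[OF g f t(1,2)])
      finally have "?Y\<^sup>2 \<le> A * gag_energy b (rpot t ?g)" using dual[OF g] by simp
      also have "\<dots> \<le> A * (\<bar>c\<bar> * S * ?Y)" using E[OF g] A unfolding g2 by (intro mult_left_mono) auto
      finally show "?Y\<^sup>2 \<le> A * (\<bar>c\<bar> * S) * ?Y" by (simp add: mult.assoc)
    qed (use A S in \<open>auto intro!: integral_nonneg_AE\<close>)
    have "0 \<le> S\<^sup>2 * A" using A by simp
    then show "?X + ?Y \<le> C * A" using X Y unfolding C_def distrib_right by (simp only: ac_simps)
  qed
qed

text \<open>Integration by parts for the nonlocal divergence: in the double integral of g(x,y) (v(x)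
  - v(y)), swapping the variables in the second term and using antisymmetry reproduces the first.
  Hence the factor 2 in \<open>f\<close>.\<close>

lemma antisymmetric_divergence:
  fixes g :: "'a::euclidean_space \<Rightarrow> 'a \<Rightarrow> real"
  assumes m: "case_prod g \<in> borel_measurable (lborel \<Otimes>\<^sub>M lborel)"
    and bd: "\<And>x y. \<bar>g x y\<bar> \<le> M" and supp: "\<And>x y. \<rho> \<le> norm x \<or> \<rho> \<le> norm y \<Longrightarrow> g x y = 0"
    and anti: "\<And>x y. g y x = - g x y"
  defines "f \<equiv> \<lambda>x. 2 * (LINT y|lborel. g x y)"
  shows "bounded_supp \<rho> f"
    and "\<And>v K. v \<in> borel_measurable borel \<Longrightarrow> (\<And>x. norm x < \<rho> \<Longrightarrow> \<bar>v x\<bar> \<le> K) \<Longrightarrow>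
      (LINT x|lborel. f x * v x) = (LINT z|(lborel \<Otimes>\<^sub>M lborel). g (fst z) (snd z) * (v (fst z) - v (snd z)))"
proof -
  let ?M = "lborel \<Otimes>\<^sub>M lborel :: ('a \<times> 'a) measure"
  note [measurable] = m
  have M0: "0 \<le> M" using bd[of 0 0] by linarith
  have ib: "integrable lborel (indicator (ball (0::'a) \<rho>) :: 'a \<Rightarrow> real)"
    by (intro integrable_real_indicator emeasure_lborel_ball_finite) simp
  define V where "V = (LINT x|lborel. indicator (ball (0::'a) \<rho>) x :: real)"
  have gi: "\<bar>g x y\<bar> \<le> M * (indicator (ball 0 \<rho>) x * indicator (ball 0 \<rho>) y)" for x y
    using bd[of x y] supp[of x y] by (auto simp: indicator_def)
  have gi1: "\<bar>g x y\<bar> \<le> M * indicator (ball 0 \<rho>) y" for x y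
    using bd[of x y] supp[of x y] M0 by (auto simp: indicator_def)
  have gx: "integrable lborel (\<lambda>y. g x y)" for x
    by (rule Bochner_Integration.integrable_bound[of _ "\<lambda>y. M * indicator (ball 0 \<rho>) y"])
      (use gi1[of x] M0 ib in \<open>auto intro!: integrable_mult_right\<close>)
  show bs: "bounded_supp \<rho> f" unfolding bounded_supp_def
  proof (intro conjI exI allI impI)
    show "f \<in> borel_measurable borel" unfolding f_def by measurable
    fix x
    have "\<bar>LINT y|lborel. g x y\<bar> \<le> (LINT y|lborel. \<bar>g x y\<bar>)" by (rule integral_abs_bound)
    also have "\<dots> \<le> (LINT y|lborel. M * indicator (ball (0::'a) \<rho>) y)"
    proof (rule integral_mono)
      show "integrable lborel (\<lambda>y. \<bar>g x y\<bar>)" using gx by (rule integrable_abs)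
      show "integrable lborel (\<lambda>y. M * indicator (ball (0::'a) \<rho>) y)" using ib by (rule integrable_mult_right)
    qed (rule gi1)
    finally show "\<bar>f x\<bar> \<le> 2 * (M * V)" unfolding f_def V_def by simp
  next
    fix x :: 'a assume "\<rho> \<le> norm x"
    then have "g x = (\<lambda>_. 0)" using supp[of x] by auto
    then show "f x = 0" by (simp add: f_def)
  qed
  fix v :: "'a \<Rightarrow> real" and K
  assume v [measurable]: "v \<in> borel_measurable borel" and K: "\<And>x. norm x < \<rho> \<Longrightarrow> \<bar>v x\<bar> \<le> K"
  have gv: "\<bar>g x y * v x\<bar> \<le> (M * max K 0) * (indicator (ball 0 \<rho>) x * indicator (ball 0 \<rho>) y)" for x y
  proof (cases "norm x < \<rho> \<and> norm y < \<rho>")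
    case True
    then have "\<bar>g x y\<bar> * \<bar>v x\<bar> \<le> M * max K 0" using K[of x] bd M0 by (intro mult_mono) auto
    then show ?thesis using True by (simp add: abs_mult)
  qed (use supp[of x y] M0 in \<open>auto simp: indicator_def\<close>)
  have pi: "integrable ?M (\<lambda>(x, y). (indicator (ball 0 \<rho>) x :: real) * indicator (ball 0 \<rho>) y)"
    by (rule integrable_pair_product[OF ib ib])
  have i1: "integrable ?M (\<lambda>(x, y). g x y * v x)"
    by (rule Bochner_Integration.integrable_bound[OF integrable_mult_right[OF pi, of "M * max K 0"]])
      (use gv M0 in \<open>auto simp: case_prod_beta' abs_mult\<close>)
  have i2: "integrable ?M (\<lambda>(x, y). g y x * v y)"
    using lborel_pair.integrable_product_swap[OF i1] by simp
  have sw: "(LINT (x, y)|?M. g y x * v y) = (LINT (x, y)|?M. g x y * v x)"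
    using lborel_pair.integral_product_swap[of "\<lambda>(x, y). g x y * v x"] by (simp add: case_prod_beta')
  have "(LINT z|?M. g (fst z) (snd z) * (v (fst z) - v (snd z))) = (LINT z|?M. (\<lambda>(x, y). g x y * v x) z + (\<lambda>(x, y). g y x * v y) z)"
  proof (intro Bochner_Integration.integral_cong refl)
    fix z :: "'a \<times> 'a"
    show "g (fst z) (snd z) * (v (fst z) - v (snd z)) = (\<lambda>(x, y). g x y * v x) z + (\<lambda>(x, y). g y x * v y) z"
      using anti[of "fst z" "snd z"] by (simp add: case_prod_beta right_diff_distrib)
  qed
  also have "\<dots> = 2 * (LINT (x, y)|?M. g x y * v x)"
    using i1 i2 sw by simp
  also have "\<dots> = 2 * (LINT x|lborel. LINT y|lborel. g x y * v x)"
    using lborel_pair.integral_fst'[OF i1] by simp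
  also have "\<dots> = (LINT x|lborel. f x * v x)" by (simp add: f_def mult.assoc)
  finally show "(LINT x|lborel. f x * v x) = (LINT z|?M. g (fst z) (snd z) * (v (fst z) - v (snd z)))" ..
qed

subsection \<open>The trace inequality\<close>

text \<open>An integral over the ball rather than a mean, which avoids division in
  \<open>ennreal\<close>; the factors \<open>2 ^ DIM('a)\<close> in the later weights restore the
  normalisation.\<close>

definition sq_osc :: "real \<Rightarrow> ('a::euclidean_space \<Rightarrow> real) \<Rightarrow> 'a \<Rightarrow> ennreal" where
  "sq_osc r v P = (\<integral>\<^sup>+x. ennreal ((v P - v x)\<^sup>2) * (if dist P x < r then 1 else 0) \<partial>lborel)"

definition dbl_osc :: "real \<Rightarrow> ('a::euclidean_space \<Rightarrow> real) \<Rightarrow> 'a \<Rightarrow> ennreal" where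
  "dbl_osc r v P = (\<integral>\<^sup>+z. ennreal ((v (fst z) - v (snd z))\<^sup>2) *
     (if dist P (fst z) < r \<and> dist P (snd z) < r then 1 else 0) \<partial>(lborel \<Otimes>\<^sub>M lborel))"

lemma sq_osc_measurable [measurable]:
  assumes [measurable]: "v \<in> borel_measurable borel"
  shows "sq_osc r v \<in> borel_measurable borel"
  unfolding sq_osc_def[abs_def] by measurable

lemma dbl_osc_measurable [measurable]:
  assumes [measurable]: "v \<in> borel_measurable borel"
  shows "dbl_osc r v \<in> borel_measurable borel"
  unfolding dbl_osc_def[abs_def] by measurable

lemma nn_integral_ball_if:
  fixes P :: "'a::euclidean_space"
  assumes "0 \<le> r"
  shows "(\<integral>\<^sup>+x. (if dist P x < r then 1 else 0) \<partial>lborel) = ennreal (unit_ball_vol (real DIM('a)) * r ^ DIM('a))"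
proof -
  have "(if dist P x < r then 1 else 0) = (indicator (ball P r) x :: ennreal)" for x
    by (simp add: indicator_def)
  then show ?thesis using assms by (simp add: emeasure_ball)
qed

text \<open>Young's inequality with a coefficient of x^2 as close to 1 as desired. The usual
  coefficient 2 would exceed the growth rate a < 2 of the weights in \<open>sq_osc_sum\<close> and
  spoil the absorption.\<close>

lemma sq_add_le_weighted:
  fixes x y :: real assumes "1 < q"
  shows "(x + y)\<^sup>2 \<le> q * x\<^sup>2 + q / (q - 1) * y\<^sup>2"
proof -
  have "0 \<le> ((q - 1) * x - y)\<^sup>2 / (q - 1)" using assms by (intro divide_nonneg_pos) auto
  also have "\<dots> = (q - 1) * x\<^sup>2 - 2 * x * y + y\<^sup>2 / (q - 1)"
    using assms by (simp add: power2_eq_square field_simps)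
  finally have "0 \<le> (q - 1) * x\<^sup>2 - 2 * x * y + y\<^sup>2 / (q - 1)" .
  moreover have "q / (q - 1) * y\<^sup>2 = y\<^sup>2 + y\<^sup>2 / (q - 1)" using assms by (simp add: field_simps)
  ultimately show ?thesis by (simp add: power2_eq_square algebra_simps)
qed

text \<open>For y in the smaller ball, insert v(y) between v(P) and v(x) and integrate over both
  balls. Each volume factor comes from the variable that its term does not involve.\<close>

lemma sq_osc_recursion:
  fixes P :: "'a::euclidean_space"
  assumes v [measurable]: "v \<in> borel_measurable borel" and q: "1 < q" and r: "0 < r'" "r' \<le> r"
  defines "\<omega> \<equiv> unit_ball_vol (real DIM('a))"
  shows "ennreal (\<omega> * r' ^ DIM('a)) * sq_osc r v P
     \<le> ennreal q * (ennreal (\<omega> * r ^ DIM('a)) * sq_osc r' v P) + ennreal (q / (q - 1)) * dbl_osc r v P"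
proof -
  let ?\<chi> = "\<lambda>x. if dist P x < r then 1 else (0::ennreal)" and ?\<chi>' = "\<lambda>x. if dist P x < r' then 1 else (0::ennreal)"
  define q' where "q' = q / (q - 1)"
  have q': "0 \<le> q'" using q by (simp add: q'_def)
  have r0: "0 \<le> r" "0 \<le> r'" using r by auto
  have "ennreal (\<omega> * r' ^ DIM('a)) * sq_osc r v P = (\<integral>\<^sup>+x. \<integral>\<^sup>+y. ennreal ((v P - v x)\<^sup>2) * ?\<chi> x * ?\<chi>' y \<partial>lborel \<partial>lborel)"
  proof -
    have "(\<integral>\<^sup>+x. \<integral>\<^sup>+y. ennreal ((v P - v x)\<^sup>2) * ?\<chi> x * ?\<chi>' y \<partial>lborel \<partial>lborel) = (\<integral>\<^sup>+x. ennreal ((v P - v x)\<^sup>2) * ?\<chi> x * (\<integral>\<^sup>+y. ?\<chi>' y \<partial>lborel) \<partial>lborel)"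
      by (intro nn_integral_cong nn_integral_cmult) measurable
    also have "\<dots> = sq_osc r v P * (\<integral>\<^sup>+y. ?\<chi>' y \<partial>lborel)"
      unfolding sq_osc_def by (intro nn_integral_multc) measurable
    finally show ?thesis
      unfolding \<omega>_def nn_integral_ball_if[OF r0(2), of P, symmetric] by (simp add: mult.commute)
  qed
  also have "\<dots> \<le> (\<integral>\<^sup>+x. \<integral>\<^sup>+y. ennreal q * (ennreal ((v P - v y)\<^sup>2) * ?\<chi>' y * ?\<chi> x)
      + ennreal q' * (ennreal ((v x - v y)\<^sup>2) * (if dist P x < r \<and> dist P y < r then 1 else 0)) \<partial>lborel \<partial>lborel)"
  proof (intro nn_integral_mono)
    fix x y
    have "(v P - v x)\<^sup>2 = ((v P - v y) + (v y - v x))\<^sup>2" by simp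
    also have "\<dots> \<le> q * (v P - v y)\<^sup>2 + q' * (v y - v x)\<^sup>2" unfolding q'_def by (rule sq_add_le_weighted[OF q])
    finally have "ennreal ((v P - v x)\<^sup>2) \<le> ennreal q * ennreal ((v P - v y)\<^sup>2) + ennreal q' * ennreal ((v x - v y)\<^sup>2)"
      using q q' by (simp add: ennreal_mult'[symmetric] ennreal_plus[symmetric] power2_commute[of "v y"] ennreal_leI del: ennreal_plus)
    then show "ennreal ((v P - v x)\<^sup>2) * ?\<chi> x * ?\<chi>' y \<le> ennreal q * (ennreal ((v P - v y)\<^sup>2) * ?\<chi>' y * ?\<chi> x)
      + ennreal q' * (ennreal ((v x - v y)\<^sup>2) * (if dist P x < r \<and> dist P y < r then 1 else 0))"
      using r by auto
  qed
  also have "\<dots> = (\<integral>\<^sup>+x. ennreal q * (\<integral>\<^sup>+y. ennreal ((v P - v y)\<^sup>2) * ?\<chi>' y * ?\<chi> x \<partial>lborel) +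
      ennreal q' * (\<integral>\<^sup>+y. ennreal ((v x - v y)\<^sup>2) * (if dist P x < r \<and> dist P y < r then 1 else 0) \<partial>lborel) \<partial>lborel)"
    by (intro nn_integral_cong) (simp add: nn_integral_add nn_integral_cmult)
  also have "\<dots> = ennreal q * (\<integral>\<^sup>+x. \<integral>\<^sup>+y. ennreal ((v P - v y)\<^sup>2) * ?\<chi>' y * ?\<chi> x \<partial>lborel \<partial>lborel) +
      ennreal q' * (\<integral>\<^sup>+x. \<integral>\<^sup>+y. ennreal ((v x - v y)\<^sup>2) * (if dist P x < r \<and> dist P y < r then 1 else 0) \<partial>lborel \<partial>lborel)"
    by (subst nn_integral_add, measurable) (simp add: nn_integral_cmult)
  also have "(\<integral>\<^sup>+x. \<integral>\<^sup>+y. ennreal ((v P - v y)\<^sup>2) * ?\<chi>' y * ?\<chi> x \<partial>lborel \<partial>lborel) = ennreal (\<omega> * r ^ DIM('a)) * sq_osc r' v P"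
    unfolding \<omega>_def sq_osc_def nn_integral_ball_if[OF r0(1), of P, symmetric]
    by (simp add: nn_integral_multc nn_integral_cmult mult.commute)
  also have "(\<integral>\<^sup>+x. \<integral>\<^sup>+y. ennreal ((v x - v y)\<^sup>2) * (if dist P x < r \<and> dist P y < r then 1 else 0) \<partial>lborel \<partial>lborel) = dbl_osc r v P"
    unfolding dbl_osc_def by (subst lborel.nn_integral_fst[symmetric]) simp_all
  finally show ?thesis by (simp add: q'_def)
qed

text \<open>Finiteness of \<open>T\<close> is what permits subtracting \<theta> T from both sides;
  for \<open>T\<close> infinite the hypothesis would carry no information.\<close>

lemma ennreal_absorb:
  assumes "T \<le> ennreal \<theta> * T + X" "T < \<infinity>" "0 \<le> \<theta>" "\<theta> < 1"
  shows "T \<le> ennreal (1 / (1 - \<theta>)) * X"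
proof (cases X)
  case (real x)
  obtain \<tau> where \<tau>: "T = ennreal \<tau>" "0 \<le> \<tau>" using assms(2) by (cases T) auto
  have "ennreal \<tau> \<le> ennreal (\<theta> * \<tau> + x)" using assms(1,3) real \<tau> by (simp add: ennreal_mult')
  then have "\<tau> \<le> \<theta> * \<tau> + x"
    by (rule ennreal_le_iff[THEN iffD1, rotated]) (use real \<tau> assms in simp)
  then have "\<tau> \<le> 1 / (1 - \<theta>) * x" using assms by (simp add: field_simps)
  then show ?thesis using real \<tau> assms by (simp add: ennreal_mult'[symmetric] ennreal_leI)
next
  case top
  then show ?thesis using assms by (simp add: ennreal_mult_top)
qed

text \<open>By the recursion the weighted sum is at most \<open>q/a < 1\<close> times itself plus the double oscillations. It
  is finite because \<open>v\<close> is Lipschitz, so it can be absorbed.\<close>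

lemma sq_osc_sum:
  assumes a: "1 < a" "a < 2"
  obtains C where "0 \<le> C" "\<And>(v :: 'a::euclidean_space \<Rightarrow> real) L P. v \<in> borel_measurable borel \<Longrightarrow>
      (\<And>x y. \<bar>v x - v y\<bar> \<le> L * dist x y) \<Longrightarrow>
      (\<Sum>k. ennreal ((a * 2 ^ DIM('a)) ^ k) * sq_osc (1 / 2 ^ k) v P)
       \<le> ennreal C * (\<Sum>k. ennreal ((a * 2 ^ DIM('a) * 2 ^ DIM('a)) ^ k) * dbl_osc (1 / 2 ^ k) v P)"
proof -
  \<comment> \<open>Any q with 1 < q < a serves: q > 1 for the weighted inequality, q < a for the
    contraction factor q / a.\<close>
  define q where "q = (1 + a) / 2"
  define \<omega> where "\<omega> = unit_ball_vol (real DIM('a))"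
  define M where "M = (2::real) ^ DIM('a)"
  define c where "c = q / (q - 1) * M / \<omega>"
  have q: "1 < q" "q < a" using a by (auto simp: q_def)
  have \<omega>: "0 < \<omega>" by (simp add: \<omega>_def)
  have M: "0 < M" by (simp add: M_def)
  have c: "0 \<le> c" using q \<omega> M by (simp add: c_def)
  have M': "(1 / 2 ^ k) ^ DIM('a) = 1 / M ^ k" for k
    unfolding M_def by (simp add: power_divide power_mult[symmetric] mult.commute)
  show ?thesis
  proof (rule that[of "1 / (1 - q / a) * c"])
    show "0 \<le> 1 / (1 - q / a) * c" using c q a by simp
  next
    fix v :: "'a \<Rightarrow> real" and L P
    assume v [measurable]: "v \<in> borel_measurable borel" and L: "\<And>x y. \<bar>v x - v y\<bar> \<le> L * dist x y"
    define e where "e k = sq_osc (1 / 2 ^ k) v P" for k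
    define \<psi> where "\<psi> k = dbl_osc (1 / 2 ^ k) v P" for k
    define T where "T = (\<Sum>k. ennreal ((a * M) ^ k) * e k)"
    define X where "X = (\<Sum>k. ennreal ((a * M * M) ^ k) * \<psi> k)"
    have step: "ennreal ((a * M) ^ k) * e k \<le> ennreal (q / a) * (ennreal ((a * M) ^ Suc k) * e (Suc k)) + ennreal c * (ennreal ((a * M * M) ^ k) * \<psi> k)" for k
    proof -
      have "ennreal (\<omega> * (1 / 2 ^ Suc k) ^ DIM('a)) * e k
         \<le> ennreal q * (ennreal (\<omega> * (1 / 2 ^ k) ^ DIM('a)) * e (Suc k)) + ennreal (q / (q - 1)) * \<psi> k"
        unfolding e_def \<psi>_def \<omega>_def by (rule sq_osc_recursion[OF v q(1)]) (auto simp: field_simps)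
      \<comment> \<open>The multiplier turns the left side into the k-th weighted term. Passing to
        scale k + 1 costs the factor q and gains 1 / a from the larger weight there.\<close>
      then have "ennreal (a ^ k * (M * M) ^ k * M / \<omega>) * (ennreal (\<omega> * (1 / M ^ Suc k)) * e k)
         \<le> ennreal (a ^ k * (M * M) ^ k * M / \<omega>) * (ennreal q * (ennreal (\<omega> * (1 / M ^ k)) * e (Suc k)) + ennreal (q / (q - 1)) * \<psi> k)"
        unfolding M' by (rule mult_left_mono) simp
      also have "ennreal (a ^ k * (M * M) ^ k * M / \<omega>) * (ennreal (\<omega> * (1 / M ^ Suc k)) * e k) = ennreal ((a * M) ^ k) * e k"
      proof -
        have "a ^ k * (M * M) ^ k * M / \<omega> * (\<omega> * (1 / M ^ Suc k)) = (a * M) ^ k"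
          using M \<omega> by (simp add: power_mult_distrib field_simps)
        then show ?thesis using a M \<omega> by (simp add: ennreal_mult'[symmetric] mult.assoc[symmetric] del: times_divide_eq_right)
      qed
      also have "ennreal (a ^ k * (M * M) ^ k * M / \<omega>) * (ennreal q * (ennreal (\<omega> * (1 / M ^ k)) * e (Suc k)) + ennreal (q / (q - 1)) * \<psi> k)
         = ennreal (q / a) * (ennreal ((a * M) ^ Suc k) * e (Suc k)) + ennreal c * (ennreal ((a * M * M) ^ k) * \<psi> k)"
      proof -
        have 1: "a ^ k * (M * M) ^ k * M / \<omega> * (q * (\<omega> * (1 / M ^ k))) = q / a * (a * M) ^ Suc k"
          using M \<omega> a by (simp add: power_mult_distrib field_simps)
        have 2: "a ^ k * (M * M) ^ k * M / \<omega> * (q / (q - 1)) = c * (a * M * M) ^ k"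
          using M \<omega> a q by (simp add: power_mult_distrib c_def field_simps)
        have nn: "0 \<le> a ^ k * (M * M) ^ k * M / \<omega>" "0 \<le> q" "0 \<le> q / a" "0 \<le> \<omega> * (1 / M ^ k)" using a M \<omega> q by auto
        have "ennreal (a ^ k * (M * M) ^ k * M / \<omega>) * (ennreal q * (ennreal (\<omega> * (1 / M ^ k)) * e (Suc k))) =
            ennreal (a ^ k * (M * M) ^ k * M / \<omega> * (q * (\<omega> * (1 / M ^ k)))) * e (Suc k)"
          using nn by (simp only: ennreal_mult' mult.assoc)
        moreover have "ennreal (a ^ k * (M * M) ^ k * M / \<omega>) * (ennreal (q / (q - 1)) * \<psi> k) =
            ennreal (a ^ k * (M * M) ^ k * M / \<omega> * (q / (q - 1))) * \<psi> k"
          using nn by (simp only: ennreal_mult' mult.assoc)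
        ultimately show ?thesis
          unfolding distrib_left 1 2 using nn c by (simp only: ennreal_mult' mult.assoc)
      qed
      finally show ?thesis .
    qed
    \<comment> \<open>A Lipschitz function has squared oscillation of order 4^(-k) at radius 2^(-k),
      against the normalised weight a^k. Only this finiteness depends on \<open>L\<close>, so the
      final constant does not contain it.\<close>
    have fin: "T < \<infinity>"
    proof -
      have "ennreal ((a * M) ^ k) * e k \<le> ennreal (\<omega> * L\<^sup>2 * (a / 4) ^ k)" for k
      proof -
        have "e k \<le> (\<integral>\<^sup>+x. ennreal (L\<^sup>2 * (1 / 2 ^ k)\<^sup>2) * (if dist P x < 1 / 2 ^ k then 1 else 0) \<partial>lborel)"
          unfolding e_def sq_osc_def
        proof (intro nn_integral_mono)
          fix x
          show "ennreal ((v P - v x)\<^sup>2) * (if dist P x < 1 / 2 ^ k then 1 else 0) \<le> ennreal (L\<^sup>2 * (1 / 2 ^ k)\<^sup>2) * (if dist P x < 1 / 2 ^ k then 1 else 0)"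
          proof (cases "dist P x < 1 / 2 ^ k")
            case True
            have "\<bar>v P - v x\<bar> \<le> \<bar>L\<bar> * (1 / 2 ^ k)"
              using L[of P x] True by (meson abs_ge_self abs_ge_zero less_imp_le mult_mono order_trans zero_le_dist)
            then have "\<bar>v P - v x\<bar>\<^sup>2 \<le> (\<bar>L\<bar> * (1 / 2 ^ k))\<^sup>2" by (rule power_mono) simp
            then have "(v P - v x)\<^sup>2 \<le> L\<^sup>2 * (1 / 2 ^ k)\<^sup>2" by (simp only: power_mult_distrib power2_abs)
            then show ?thesis using True by (simp add: ennreal_leI)
          qed simp
        qed
        also have "\<dots> = ennreal (L\<^sup>2 * (1 / 2 ^ k)\<^sup>2) * ennreal (\<omega> * (1 / 2 ^ k) ^ DIM('a))"
          unfolding \<omega>_def by (subst nn_integral_cmult, measurable) (subst nn_integral_ball_if, simp_all)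
        finally have "ennreal ((a * M) ^ k) * e k \<le> ennreal ((a * M) ^ k) * (ennreal (L\<^sup>2 * (1 / 2 ^ k)\<^sup>2) * ennreal (\<omega> * (1 / 2 ^ k) ^ DIM('a)))"
          by (rule mult_left_mono) simp
        also have "\<dots> = ennreal ((a * M) ^ k * (L\<^sup>2 * (1 / 2 ^ k)\<^sup>2 * (\<omega> * (1 / M ^ k))))"
          unfolding M' using a M \<omega> by (simp only: ennreal_mult'[symmetric] zero_le_power mult_nonneg_nonneg less_imp_le zero_le_power2)
        also have "(a * M) ^ k * (L\<^sup>2 * (1 / 2 ^ k)\<^sup>2 * (\<omega> * (1 / M ^ k))) = \<omega> * L\<^sup>2 * (a / 4) ^ k"
        proof -
          have "((2::real) ^ k)\<^sup>2 = 4 ^ k" by (simp add: power2_eq_square power_mult_distrib[symmetric])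
          then show ?thesis using M by (simp add: power_mult_distrib power_divide field_simps)
        qed
        finally show ?thesis .
      qed
      then have "T \<le> (\<Sum>k. ennreal (\<omega> * L\<^sup>2 * (a / 4) ^ k))" unfolding T_def by (intro suminf_le) auto
      also have "\<dots> = ennreal (\<omega> * L\<^sup>2 / (1 - a / 4))"
        using a \<omega> by (intro suminf_ennreal_geometric) auto
      finally show ?thesis by (simp add: le_less_trans)
    qed
    have "T \<le> (\<Sum>k. ennreal (q / a) * (ennreal ((a * M) ^ Suc k) * e (Suc k)) + ennreal c * (ennreal ((a * M * M) ^ k) * \<psi> k))"
      unfolding T_def by (intro suminf_le step) auto
    also have "\<dots> = ennreal (q / a) * (\<Sum>k. ennreal ((a * M) ^ Suc k) * e (Suc k)) + ennreal c * X"
      unfolding X_def by (simp add: suminf_add[symmetric] del: power_Suc)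
    also have "\<dots> \<le> ennreal (q / a) * T + ennreal c * X"
    proof -
      have "(\<Sum>k. ennreal ((a * M) ^ Suc k) * e (Suc k)) \<le> T"
        unfolding T_def by (subst (2) suminf_offset[of _ 1]) (auto simp: add_increasing)
      then show ?thesis by (intro add_right_mono mult_left_mono) auto
    qed
    finally have "T \<le> ennreal (1 / (1 - q / a)) * (ennreal c * X)"
      using fin q a by (intro ennreal_absorb) auto
    also have "\<dots> = ennreal (1 / (1 - q / a) * c) * X"
    proof -
      have "0 \<le> 1 / (1 - q / a)" using q a by simp
      then show ?thesis by (simp only: ennreal_mult' mult.assoc)
    qed
    finally show "(\<Sum>k. ennreal ((a * 2 ^ DIM('a)) ^ k) * sq_osc (1 / 2 ^ k) v P)
       \<le> ennreal (1 / (1 - q / a) * c) * (\<Sum>k. ennreal ((a * 2 ^ DIM('a) * 2 ^ DIM('a)) ^ k) * dbl_osc (1 / 2 ^ k) v P)"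
      unfolding T_def X_def e_def \<psi>_def M_def .
  qed
qed

section \<open>Dyadic sums against a measure of dimension N - 1\<close>

lemma geometric_sum_below:
  assumes b: "0 < b" and z: "0 < z"
  shows "(\<Sum>k. ennreal ((2 powr b) ^ k) * (if 2 ^ k < z then 1 else 0)) \<le> ennreal (1 / (1 - 2 powr (-b)) * z powr b)"
proof (cases "1 \<le> z")
  case False
  then have "\<not> 2 ^ k < z" for k using one_le_power[of "2::real" k] by linarith
  then show ?thesis by simp
next
  case True
  then obtain m where m: "2 ^ m \<le> z" "z < 2 ^ Suc m" using dyadic_ex by blast
  \<comment> \<open>With 2^m \<le> z < 2^(m+1) no term beyond m survives, and a growing geometric
    sum is comparable to its last term.\<close>
  have "(\<Sum>k. ennreal ((2 powr b) ^ k) * (if 2 ^ k < z then 1 else 0)) = (\<Sum>k\<le>m. ennreal ((2 powr b) ^ k) * (if 2 ^ k < z then 1 else 0))"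
  proof (rule suminf_finite)
    fix k assume "k \<notin> {..m}"
    then have "Suc m \<le> k" by simp
    then have "(2::real) ^ Suc m \<le> 2 ^ k" by (intro power_increasing) auto
    then show "ennreal ((2 powr b) ^ k) * (if 2 ^ k < z then 1 else 0) = 0" using m by auto
  qed simp
  also have "\<dots> \<le> (\<Sum>k\<le>m. ennreal ((2 powr b) ^ k))" by (intro sum_mono) auto
  also have "\<dots> = ennreal (\<Sum>k\<le>m. (2 powr b) ^ k)" by (subst sum_ennreal) auto
  also have "\<dots> \<le> ennreal (1 / (1 - 2 powr (-b)) * z powr b)"
  proof (rule ennreal_leI)
    have B: "1 < 2 powr b" using b by simp
    have "(\<Sum>k\<le>m. (2 powr b) ^ k) = ((2 powr b) ^ Suc m - 1) / (2 powr b - 1)"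
      using B by (subst lessThan_Suc_atMost[symmetric], subst geometric_sum) auto
    also have "\<dots> \<le> (2 powr b) ^ Suc m / (2 powr b - 1)" using B by (intro divide_right_mono) auto
    also have "\<dots> = 1 / (1 - 2 powr (-b)) * (2 ^ m) powr b"
      using B by (simp add: powr_minus_divide two_powr_power field_simps)
    also have "\<dots> \<le> 1 / (1 - 2 powr (-b)) * z powr b"
      using m b by (intro mult_left_mono powr_mono2) (auto simp: powr_minus_divide field_simps)
    finally show "(\<Sum>k\<le>m. (2 powr b) ^ k) \<le> 1 / (1 - 2 powr (-b)) * z powr b" .
  qed
  finally show ?thesis .
qed

locale growth_measure =
  fixes \<mu> :: "'a::euclidean_space measure" and A \<rho> :: real
  assumes sets_mu [measurable_cong]: "sets \<mu> = sets borel" and A: "0 \<le> A"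
    and growth: "\<And>x r. 0 < r \<Longrightarrow> emeasure \<mu> (cball x r) \<le> ennreal (A * r powr (real DIM('a) - 1))"
    and supp: "AE P in \<mu>. norm P \<le> \<rho>" and rho: "0 < \<rho>"
begin

lemma space_mu [simp]: "space \<mu> = UNIV"
  using sets_eq_imp_space_eq[OF sets_mu] by simp

lemma finite_mu: "emeasure \<mu> UNIV < \<infinity>"
proof -
  have "emeasure \<mu> UNIV = emeasure \<mu> (cball 0 \<rho>)"
    using supp by (intro emeasure_eq_AE) (auto simp: sets_mu)
  then show ?thesis using growth[OF rho, of 0] by (simp add: le_less_trans)
qed

sublocale finite_measure \<mu>
  by standard (use finite_mu in simp)

sublocale mu_lborel: pair_sigma_finite \<mu> "lborel \<Otimes>\<^sub>M lborel :: ('a \<times> 'a) measure" ..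

sublocale mu_mu: pair_sigma_finite \<mu> \<mu> ..

text \<open>After exchanging the integrals, \<open>P\<close> has to lie within r of both x and y.
  This forces |x - y| < 2r, and the set of such \<open>P\<close> has measure of order
  r^(N-1).\<close>

lemma dbl_osc_integral:
  assumes v [measurable]: "v \<in> borel_measurable borel" and r: "0 < r"
  shows "(\<integral>\<^sup>+P. dbl_osc r v P \<partial>\<mu>) \<le> (\<integral>\<^sup>+z. ennreal ((v (fst z) - v (snd z))\<^sup>2) *
     (ennreal (A * r powr (real DIM('a) - 1)) * (if dist (fst z) (snd z) < 2 * r then 1 else 0)) \<partial>(lborel \<Otimes>\<^sub>M lborel))"
proof -
  let ?D = "\<lambda>z. ennreal ((v (fst z) - v (snd z))\<^sup>2)"
  let ?\<chi> = "\<lambda>P z. if dist P (fst z) < r \<and> dist P (snd z) < r then 1 else (0::ennreal)"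
  have "(\<integral>\<^sup>+P. dbl_osc r v P \<partial>\<mu>) = (\<integral>\<^sup>+z. \<integral>\<^sup>+P. ?D z * ?\<chi> P z \<partial>\<mu> \<partial>(lborel \<Otimes>\<^sub>M lborel))"
    unfolding dbl_osc_def by (rule mu_lborel.Fubini'[symmetric]) measurable
  also have "\<dots> = (\<integral>\<^sup>+z. ?D z * (\<integral>\<^sup>+P. ?\<chi> P z \<partial>\<mu>) \<partial>(lborel \<Otimes>\<^sub>M lborel))"
    by (intro nn_integral_cong nn_integral_cmult) measurable
  also have "\<dots> \<le> (\<integral>\<^sup>+z. ?D z * (ennreal (A * r powr (real DIM('a) - 1)) * (if dist (fst z) (snd z) < 2 * r then 1 else 0)) \<partial>(lborel \<Otimes>\<^sub>M lborel))"
  proof (intro nn_integral_mono mult_left_mono)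
    fix z :: "'a \<times> 'a"
    have "(\<integral>\<^sup>+P. ?\<chi> P z \<partial>\<mu>) \<le> (\<integral>\<^sup>+P. (if dist (fst z) (snd z) < 2 * r then 1 else 0) * indicator (cball (fst z) r) P \<partial>\<mu>)"
    proof (intro nn_integral_mono)
      fix P
      show "?\<chi> P z \<le> (if dist (fst z) (snd z) < 2 * r then 1 else 0) * indicator (cball (fst z) r) P"
        using dist_triangle[of "fst z" "snd z" P] by (auto simp: dist_commute indicator_def)
    qed
    also have "\<dots> = (if dist (fst z) (snd z) < 2 * r then 1 else 0) * emeasure \<mu> (cball (fst z) r)"
      by (intro nn_integral_cmult_indicator) (simp add: sets_mu)
    also have "\<dots> \<le> (if dist (fst z) (snd z) < 2 * r then 1 else 0) * ennreal (A * r powr (real DIM('a) - 1))"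
      by (intro mult_left_mono growth r) simp
    finally show "(\<integral>\<^sup>+P. ?\<chi> P z \<partial>\<mu>) \<le> ennreal (A * r powr (real DIM('a) - 1)) * (if dist (fst z) (snd z) < 2 * r then 1 else 0)"
      by (simp add: mult.commute)
  qed simp
  finally show ?thesis .
qed

end

lemma pow2_facts:
  fixes N :: nat and s :: real
  shows "(1 / 2 ^ k) powr (real N - 1) = (2 / 2 ^ N) ^ k"
    and "(2 * (2 powr (2 * s - 1)) * 2 ^ N) = 2 powr (real N + 2 * s)"
    and "2 powr (real N + 2 * s - 2) = 2 powr (2 * s - 1) * 2 ^ N / 2"
proof -
  have "(1 / 2 ^ k :: real) powr (real N - 1) = 1 / (2 powr (real N - 1)) ^ k"
    by (simp add: powr_divide two_powr_power)
  also have "(2::real) powr (real N - 1) = 2 ^ N / 2" by (simp add: powr_diff powr_realpow)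
  finally show "(1 / 2 ^ k) powr (real N - 1) = (2 / 2 ^ N :: real) ^ k" by (simp add: power_divide)
  have N: "(2::real) ^ N = 2 powr real N" by (simp add: powr_realpow)
  have "2 * (2 powr (2 * s - 1)) * 2 ^ N = 2 powr 1 * 2 powr (2 * s - 1) * 2 powr real N" by (simp add: N)
  also have "\<dots> = 2 powr (1 + (2 * s - 1) + real N)" by (simp only: powr_add)
  also have "1 + (2 * s - 1) + real N = real N + 2 * s" by simp
  finally show 2: "2 * (2 powr (2 * s - 1)) * 2 ^ N = 2 powr (real N + 2 * s)" .
  show "2 powr (real N + 2 * s - 2) = 2 powr (2 * s - 1) * 2 ^ N / 2"
    using 2 by (simp add: powr_diff)
qed

text \<open>A pair \<open>x, y\<close> contributes at all dyadic scales exceeding \<open>|x - y| / 2\<close>, which gives a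
  geometric sum comparable to \<open>|x - y|\<close> to the power \<open>-(N + 2s)\<close>.\<close>

lemma (in growth_measure) dbl_osc_sum:
  assumes s: "1/2 < s" "s < 1"
  obtains C where "0 \<le> C" "\<And>v :: 'a \<Rightarrow> real. v \<in> borel_measurable borel \<Longrightarrow>
    (\<integral>\<^sup>+P. (\<Sum>k. ennreal ((2 powr (2 * s - 1) * 2 ^ DIM('a) * 2 ^ DIM('a)) ^ k) * dbl_osc (1 / 2 ^ k) v P) \<partial>\<mu>)
    \<le> ennreal C * (\<integral>\<^sup>+z. ennreal ((v (fst z) - v (snd z))\<^sup>2 * norm (fst z - snd z) powr (- (real DIM('a) + 2 * s))) \<partial>(lborel \<Otimes>\<^sub>M lborel))"
proof -
  let ?N = "DIM('a)"
  define a where "a = (2::real) powr (2 * s - 1)"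
  define M where "M = (2::real) ^ ?N"
  define b where "b = real ?N + 2 * s"
  have pos: "0 < a" "0 < M" "0 < b" using s by (auto simp: a_def M_def b_def)
  define G where "G = 1 / (1 - 2 powr (-b))"
  have "2 powr (-b) < (1::real)" using pos by (intro powr_less_one) auto
  then have G: "0 \<le> G" by (simp add: G_def)
  define C where "C = A * (G * 2 powr b)"
  have "(\<integral>\<^sup>+P. (\<Sum>k. ennreal ((a * M * M) ^ k) * dbl_osc (1 / 2 ^ k) v P) \<partial>\<mu>)
    \<le> ennreal C * (\<integral>\<^sup>+z. ennreal ((v (fst z) - v (snd z))\<^sup>2 * norm (fst z - snd z) powr (-b)) \<partial>(lborel \<Otimes>\<^sub>M lborel))"
    if v [measurable]: "v \<in> borel_measurable borel" for v :: "'a \<Rightarrow> real"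
  proof -
    let ?D = "\<lambda>z. ennreal ((v (fst z) - v (snd z))\<^sup>2)"
    let ?\<chi> = "\<lambda>k z. if 2 ^ k < 2 / dist (fst z) (snd z) then 1 else (0::ennreal)"
    have "(\<integral>\<^sup>+P. (\<Sum>k. ennreal ((a * M * M) ^ k) * dbl_osc (1 / 2 ^ k) v P) \<partial>\<mu>) = (\<Sum>k. \<integral>\<^sup>+P. ennreal ((a * M * M) ^ k) * dbl_osc (1 / 2 ^ k) v P \<partial>\<mu>)"
      by (intro nn_integral_suminf) measurable
    also have "\<dots> = (\<Sum>k. ennreal ((a * M * M) ^ k) * (\<integral>\<^sup>+P. dbl_osc (1 / 2 ^ k) v P \<partial>\<mu>))"
      by (intro suminf_cong nn_integral_cmult) measurable
    also have "\<dots> \<le> (\<Sum>k. \<integral>\<^sup>+z. ennreal A * (?D z * (ennreal ((2 powr b) ^ k) * ?\<chi> k z)) \<partial>(lborel \<Otimes>\<^sub>M lborel))"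
    proof (intro suminf_le)
      fix k
      have "ennreal ((a * M * M) ^ k) * (\<integral>\<^sup>+P. dbl_osc (1 / 2 ^ k) v P \<partial>\<mu>) \<le> ennreal ((a * M * M) ^ k) *
         (\<integral>\<^sup>+z. ?D z * (ennreal (A * (1 / 2 ^ k) powr (real ?N - 1)) * (if dist (fst z) (snd z) < 2 * (1 / 2 ^ k) then 1 else 0)) \<partial>(lborel \<Otimes>\<^sub>M lborel))"
        by (intro mult_left_mono dbl_osc_integral v) auto
      also have "\<dots> = (\<integral>\<^sup>+z. ennreal ((a * M * M) ^ k) * (?D z * (ennreal (A * (1 / 2 ^ k) powr (real ?N - 1)) * (if dist (fst z) (snd z) < 2 * (1 / 2 ^ k) then 1 else 0))) \<partial>(lborel \<Otimes>\<^sub>M lborel))"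
        by (intro nn_integral_cmult[symmetric]) measurable
      also have "\<dots> \<le> (\<integral>\<^sup>+z. ennreal A * (?D z * (ennreal ((2 powr b) ^ k) * ?\<chi> k z)) \<partial>(lborel \<Otimes>\<^sub>M lborel))"
      proof (intro nn_integral_mono)
        fix z :: "'a \<times> 'a"
        \<comment> \<open>The growth factor r^(N-1) at r = 2^(-k) is (2 / M)^k, so the weight
          becomes (2 a M)^k, and 2 a M = 2^(N + 2s).\<close>
        have e: "(a * M * M) ^ k * (A * (1 / 2 ^ k) powr (real ?N - 1)) = A * (2 powr b) ^ k"
        proof -
          have "2 powr b = 2 * a * M" using pow2_facts(2)[of s ?N] by (simp add: a_def M_def b_def)
          moreover have "(1 / 2 ^ k) powr (real ?N - 1) = (2 / M) ^ k" unfolding M_def by (rule pow2_facts(1))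
          ultimately show ?thesis using pos by (simp add: power_mult_distrib power_divide)
        qed
        show "ennreal ((a * M * M) ^ k) * (?D z * (ennreal (A * (1 / 2 ^ k) powr (real ?N - 1)) * (if dist (fst z) (snd z) < 2 * (1 / 2 ^ k) then 1 else 0)))
          \<le> ennreal A * (?D z * (ennreal ((2 powr b) ^ k) * ?\<chi> k z))"
        proof (cases "dist (fst z) (snd z) < 2 * (1 / 2 ^ k) \<and> fst z \<noteq> snd z")
          case True
          then have chi: "?\<chi> k z = 1" by (simp add: field_simps)
          have "ennreal ((a * M * M) ^ k) * (?D z * (ennreal (A * (1 / 2 ^ k) powr (real ?N - 1)) * 1)) = ?D z * ennreal ((a * M * M) ^ k * (A * (1 / 2 ^ k) powr (real ?N - 1)))"
            using pos A by (simp add: ennreal_mult' ac_simps)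
          also have "\<dots> = ennreal A * (?D z * ennreal ((2 powr b) ^ k))"
            unfolding e using A by (simp add: ennreal_mult' ac_simps)
          finally show ?thesis using True chi by simp
        qed auto
      qed
      finally show "ennreal ((a * M * M) ^ k) * (\<integral>\<^sup>+P. dbl_osc (1 / 2 ^ k) v P \<partial>\<mu>) \<le> (\<integral>\<^sup>+z. ennreal A * (?D z * (ennreal ((2 powr b) ^ k) * ?\<chi> k z)) \<partial>(lborel \<Otimes>\<^sub>M lborel))" .
    qed auto
    also have "\<dots> = (\<integral>\<^sup>+z. (\<Sum>k. ennreal A * (?D z * (ennreal ((2 powr b) ^ k) * ?\<chi> k z))) \<partial>(lborel \<Otimes>\<^sub>M lborel))"
      by (intro nn_integral_suminf[symmetric]) measurable
    also have "\<dots> \<le> (\<integral>\<^sup>+z. ennreal C * ennreal ((v (fst z) - v (snd z))\<^sup>2 * norm (fst z - snd z) powr (-b)) \<partial>(lborel \<Otimes>\<^sub>M lborel))"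
    proof (intro nn_integral_mono)
      fix z :: "'a \<times> 'a"
      show "(\<Sum>k. ennreal A * (?D z * (ennreal ((2 powr b) ^ k) * ?\<chi> k z))) \<le> ennreal C * ennreal ((v (fst z) - v (snd z))\<^sup>2 * norm (fst z - snd z) powr (-b))"
      proof (cases "fst z = snd z")
        case False
        have "(\<Sum>k. ennreal A * (?D z * (ennreal ((2 powr b) ^ k) * ?\<chi> k z))) = ennreal A * (?D z * (\<Sum>k. ennreal ((2 powr b) ^ k) * ?\<chi> k z))"
          by simp
        also have "\<dots> \<le> ennreal A * (?D z * ennreal (G * (2 / dist (fst z) (snd z)) powr b))"
          unfolding G_def using False pos by (intro mult_left_mono geometric_sum_below) auto
        also have "\<dots> = ennreal (A * ((v (fst z) - v (snd z))\<^sup>2 * (G * (2 / dist (fst z) (snd z)) powr b)))"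
          using A by (simp only: ennreal_mult' zero_le_power2)
        also have "A * ((v (fst z) - v (snd z))\<^sup>2 * (G * (2 / dist (fst z) (snd z)) powr b)) = C * ((v (fst z) - v (snd z))\<^sup>2 * norm (fst z - snd z) powr (-b))"
          by (simp add: C_def powr_divide dist_norm powr_minus_divide)
        also have "ennreal \<dots> = ennreal C * ennreal ((v (fst z) - v (snd z))\<^sup>2 * norm (fst z - snd z) powr (-b))"
          using A G by (intro ennreal_mult') (simp add: C_def)
        finally show ?thesis .
      qed simp
    qed
    also have "\<dots> = ennreal C * (\<integral>\<^sup>+z. ennreal ((v (fst z) - v (snd z))\<^sup>2 * norm (fst z - snd z) powr (-b)) \<partial>(lborel \<Otimes>\<^sub>M lborel))"
      by (intro nn_integral_cmult) measurable
    finally show ?thesis .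
  qed
  then show ?thesis using A G unfolding a_def M_def b_def by (intro that[of C]) (auto simp: C_def)
qed

text \<open>The ball of radius r / 2 around \<open>Q\<close> lies in both balls of radius r, so v(x)
  for x in it can be inserted between v(P) and v(Q).\<close>

lemma sq_osc_pointwise:
  fixes P Q :: "'a::euclidean_space"
  assumes v [measurable]: "v \<in> borel_measurable borel" and r: "0 < r" and PQ: "dist P Q \<le> r / 2"
  shows "ennreal ((v P - v Q)\<^sup>2 * (unit_ball_vol (real DIM('a)) * (r / 2) ^ DIM('a))) \<le> 2 * (sq_osc r v P + sq_osc r v Q)"
proof -
  let ?\<chi> = "\<lambda>r P x. if dist P x < r then 1 else (0::ennreal)"
  have r2: "0 \<le> r / 2" using r by simp
  have "ennreal ((v P - v Q)\<^sup>2 * (unit_ball_vol (real DIM('a)) * (r / 2) ^ DIM('a))) = ennreal ((v P - v Q)\<^sup>2) * (\<integral>\<^sup>+x. ?\<chi> (r / 2) Q x \<partial>lborel)"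
    unfolding nn_integral_ball_if[OF r2] by (simp add: ennreal_mult')
  also have "\<dots> = (\<integral>\<^sup>+x. ennreal ((v P - v Q)\<^sup>2) * ?\<chi> (r / 2) Q x \<partial>lborel)"
    by (intro nn_integral_cmult[symmetric]) measurable
  also have "\<dots> \<le> (\<integral>\<^sup>+x. 2 * (ennreal ((v P - v x)\<^sup>2) * ?\<chi> r P x + ennreal ((v Q - v x)\<^sup>2) * ?\<chi> r Q x) \<partial>lborel)"
  proof (intro nn_integral_mono)
    fix x
    show "ennreal ((v P - v Q)\<^sup>2) * ?\<chi> (r / 2) Q x \<le> 2 * (ennreal ((v P - v x)\<^sup>2) * ?\<chi> r P x + ennreal ((v Q - v x)\<^sup>2) * ?\<chi> r Q x)"
    proof (cases "dist Q x < r / 2")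
      case True
      then have "dist P x < r" "dist Q x < r" using PQ r dist_triangle[of P x Q] by auto
      moreover have "(v P - v Q)\<^sup>2 \<le> 2 * ((v P - v x)\<^sup>2 + (v Q - v x)\<^sup>2)"
        using sum_squares_ge_zero[of "(v P - v x) + (v Q - v x)" 0] by (simp add: power2_eq_square algebra_simps)
      then have "ennreal ((v P - v Q)\<^sup>2) \<le> ennreal (2 * ((v P - v x)\<^sup>2 + (v Q - v x)\<^sup>2))" by (rule ennreal_leI)
      ultimately show ?thesis using True by (simp add: ennreal_mult')
    qed simp
  qed
  also have "\<dots> = 2 * (sq_osc r v P + sq_osc r v Q)"
    unfolding sq_osc_def by (subst nn_integral_cmult, measurable) (subst nn_integral_add, measurable)
  finally show ?thesis .
qed

text \<open>The same comparison at scale 1, with the size of v(x) in place of a second boundary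
  value. The radius \<rho> + 1 of the volume term originates here.\<close>

lemma sq_value_pointwise:
  fixes P :: "'a::euclidean_space"
  assumes v [measurable]: "v \<in> borel_measurable borel" and P: "norm P \<le> \<rho>"
  shows "ennreal ((v P)\<^sup>2 * unit_ball_vol (real DIM('a))) \<le> 2 * (sq_osc 1 v P + (\<integral>\<^sup>+x. ennreal ((v x)\<^sup>2) * (if norm x < \<rho> + 1 then 1 else 0) \<partial>lborel))"
proof -
  let ?\<chi> = "\<lambda>r P x. if dist P x < r then 1 else (0::ennreal)"
  have "ennreal ((v P)\<^sup>2 * unit_ball_vol (real DIM('a))) = ennreal ((v P)\<^sup>2) * (\<integral>\<^sup>+x. ?\<chi> 1 P x \<partial>lborel)"
    by (subst nn_integral_ball_if) (simp_all add: ennreal_mult')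
  also have "\<dots> = (\<integral>\<^sup>+x. ennreal ((v P)\<^sup>2) * ?\<chi> 1 P x \<partial>lborel)"
    by (intro nn_integral_cmult[symmetric]) measurable
  also have "\<dots> \<le> (\<integral>\<^sup>+x. 2 * (ennreal ((v P - v x)\<^sup>2) * ?\<chi> 1 P x + ennreal ((v x)\<^sup>2) * (if norm x < \<rho> + 1 then 1 else 0)) \<partial>lborel)"
  proof (intro nn_integral_mono)
    fix x
    show "ennreal ((v P)\<^sup>2) * ?\<chi> 1 P x \<le> 2 * (ennreal ((v P - v x)\<^sup>2) * ?\<chi> 1 P x + ennreal ((v x)\<^sup>2) * (if norm x < \<rho> + 1 then 1 else 0))"
    proof (cases "dist P x < 1")
      case True
      then have "norm x < \<rho> + 1" using P norm_triangle_sub[of x P] by (simp add: dist_norm norm_minus_commute)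
      moreover have "(v P)\<^sup>2 \<le> 2 * ((v P - v x)\<^sup>2 + (v x)\<^sup>2)"
        using sum_squares_ge_zero[of "v P - v x - v x" 0] by (simp add: power2_eq_square algebra_simps)
      then have "ennreal ((v P)\<^sup>2) \<le> ennreal (2 * ((v P - v x)\<^sup>2 + (v x)\<^sup>2))" by (rule ennreal_leI)
      ultimately show ?thesis using True by (simp add: ennreal_mult')
    qed simp
  qed
  also have "\<dots> = 2 * (sq_osc 1 v P + (\<integral>\<^sup>+x. ennreal ((v x)\<^sup>2) * (if norm x < \<rho> + 1 then 1 else 0) \<partial>lborel))"
    unfolding sq_osc_def by (subst nn_integral_cmult, measurable) (subst nn_integral_add, measurable)
  finally show ?thesis .
qed

text \<open>A pair at distance between 2^(-k-2) and 2^(-k-1) is assigned to scale k, where the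
  radius 2^(-k) is at least twice the distance, as \<open>sq_osc_pointwise\<close> requires. Pairs
  farther apart than 1/2 are charged to the values of \<open>v\<close> alone.\<close>

lemma seminorm_kernel_dyadic:
  fixes v :: "'a::euclidean_space \<Rightarrow> real"
  assumes v [measurable]: "v \<in> borel_measurable borel" and \<kappa>: "0 \<le> \<kappa>"
  defines "\<omega> \<equiv> unit_ball_vol (real DIM('a))" and "M \<equiv> (2::real) ^ DIM('a)"
  shows "ennreal ((v P - v Q)\<^sup>2 / norm (P - Q) powr \<kappa>)
    \<le> (\<Sum>k. ennreal (2 * ((2 powr \<kappa>) ^ (k + 2) * M ^ (k + 1) / \<omega>)) *
          ((sq_osc (1 / 2 ^ k) v P + sq_osc (1 / 2 ^ k) v Q) * (if dist P Q \<le> 1 / 2 ^ (k + 1) then 1 else 0)))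
      + ennreal (2 * 2 powr \<kappa>) * (ennreal ((v P)\<^sup>2) + ennreal ((v Q)\<^sup>2))" (is "?L \<le> (\<Sum>k. ?S k) + ?F")
proof -
  have \<omega>: "0 < \<omega>" by (simp add: \<omega>_def)
  have M: "0 < M" by (simp add: M_def)
  consider "P = Q" | "1/2 < dist P Q" | "P \<noteq> Q" "dist P Q \<le> 1/2" by linarith
  then show ?thesis
  proof cases
    case 1
    then show ?thesis by simp
  next
    case 2
    have "(v P - v Q)\<^sup>2 / norm (P - Q) powr \<kappa> = (v P - v Q)\<^sup>2 * norm (P - Q) powr (-\<kappa>)"
      by (simp add: powr_minus_divide)
    also have "\<dots> \<le> (2 * ((v P)\<^sup>2 + (v Q)\<^sup>2)) * 2 powr \<kappa>"
    proof (intro mult_mono)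
      show "(v P - v Q)\<^sup>2 \<le> 2 * ((v P)\<^sup>2 + (v Q)\<^sup>2)"
        using sum_squares_ge_zero[of "v P + v Q" 0] by (simp add: power2_eq_square algebra_simps)
      have "norm (P - Q) powr (-\<kappa>) \<le> (1/2) powr (-\<kappa>)"
        using 2 \<kappa> by (intro powr_mono2') (auto simp: dist_norm)
      then show "norm (P - Q) powr (-\<kappa>) \<le> 2 powr \<kappa>" by (simp add: powr_minus powr_divide)
    qed auto
    finally have "?L \<le> ennreal ((2 * 2 powr \<kappa>) * ((v P)\<^sup>2 + (v Q)\<^sup>2))" by (intro ennreal_leI) (simp only: ac_simps)
    also have "\<dots> = ?F" by (simp add: ennreal_mult')
    finally show ?thesis by (simp add: add_increasing)
  next
    case 3
    then have d: "0 < dist P Q" by simp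
    obtain k where k: "2 ^ k \<le> 1 / (2 * dist P Q)" "1 / (2 * dist P Q) < 2 ^ Suc k"
      using dyadic_ex[of "1 / (2 * dist P Q)"] 3 d by (auto simp: field_simps)
    have le: "dist P Q \<le> 1 / 2 ^ (k + 1)" using k(1) d by (simp add: field_simps)
    have ge: "1 / 2 ^ (k + 2) \<le> dist P Q" using k(2) d by (simp add: field_simps)
    define c where "c = (2 powr \<kappa>) ^ (k + 2) * M ^ (k + 1) / \<omega>"
    have c: "0 \<le> c" using M \<omega> by (simp add: c_def)
    have "norm (P - Q) powr (-\<kappa>) \<le> (1 / 2 ^ (k + 2)) powr (-\<kappa>)"
      using ge \<kappa> by (intro powr_mono2') (auto simp: dist_norm)
    also have "\<dots> = (2 ^ (k + 2)) powr \<kappa>" by (simp add: powr_minus powr_divide)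
    also have "\<dots> = (2 powr \<kappa>) ^ (k + 2)" by (rule two_powr_power)
    finally have n: "norm (P - Q) powr (-\<kappa>) \<le> (2 powr \<kappa>) ^ (k + 2)" .
    have MM: "(1 / 2 ^ k / 2) ^ DIM('a) = 1 / M ^ (k + 1)"
    proof -
      have "(1 / 2 ^ k / 2 :: real) = 1 / 2 ^ (k + 1)" by simp
      then show ?thesis unfolding M_def by (simp only: power_divide power_one power_mult[symmetric] mult.commute)
    qed
    have "?L = ennreal ((v P - v Q)\<^sup>2 * norm (P - Q) powr (-\<kappa>))"
      by (simp add: powr_minus_divide)
    also have "\<dots> \<le> ennreal ((v P - v Q)\<^sup>2 * (2 powr \<kappa>) ^ (k + 2))"
      by (intro ennreal_leI mult_left_mono n) simp
    also have "(v P - v Q)\<^sup>2 * (2 powr \<kappa>) ^ (k + 2) = c * ((v P - v Q)\<^sup>2 * (\<omega> * (1 / 2 ^ k / 2) ^ DIM('a)))"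
      unfolding MM using M \<omega> by (simp add: c_def)
    also have "ennreal \<dots> = ennreal c * ennreal ((v P - v Q)\<^sup>2 * (\<omega> * (1 / 2 ^ k / 2) ^ DIM('a)))"
      by (rule ennreal_mult'[OF c])
    also have "\<dots> \<le> ennreal c * (2 * (sq_osc (1 / 2 ^ k) v P + sq_osc (1 / 2 ^ k) v Q))"
      unfolding \<omega>_def using le by (intro mult_left_mono sq_osc_pointwise v) auto
    also have "\<dots> = ?S k" unfolding c_def[symmetric] using le c by (simp add: ennreal_mult' mult.assoc mult.left_commute)
    also have "\<dots> \<le> (\<Sum>k. ?S k)" by (rule ennreal_le_suminf)
    finally show ?thesis by (simp add: add_increasing2)
  qed
qed

context growth_measure
begin

text \<open>For fixed \<open>P\<close> the admissible \<open>Q\<close> form a ball of measure at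
  most A r^(N-1); Tonelli gives the same for the term in \<open>Q\<close>.\<close>

lemma near_diagonal_integral:
  assumes g [measurable]: "g \<in> borel_measurable borel" and r: "0 < r"
  shows "(\<integral>\<^sup>+P. \<integral>\<^sup>+Q. (g P + g Q) * (if dist P Q \<le> r then 1 else 0) \<partial>\<mu> \<partial>\<mu>)
     \<le> ennreal (2 * (A * r powr (real DIM('a) - 1))) * (\<integral>\<^sup>+P. g P \<partial>\<mu>)"
proof -
  let ?\<chi> = "\<lambda>P Q. if dist P Q \<le> r then 1 else (0::ennreal)"
  let ?B = "ennreal (A * r powr (real DIM('a) - 1))"
  have I: "(\<integral>\<^sup>+P. \<integral>\<^sup>+Q. g P * ?\<chi> P Q \<partial>\<mu> \<partial>\<mu>) \<le> ?B * (\<integral>\<^sup>+P. g P \<partial>\<mu>)"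
  proof -
    have "(\<integral>\<^sup>+Q. g P * ?\<chi> P Q \<partial>\<mu>) \<le> ?B * g P" for P
    proof -
      have "(\<integral>\<^sup>+Q. g P * ?\<chi> P Q \<partial>\<mu>) = (\<integral>\<^sup>+Q. g P * indicator (cball P r) Q \<partial>\<mu>)"
        by (intro nn_integral_cong) (simp add: indicator_def)
      also have "\<dots> = g P * emeasure \<mu> (cball P r)" by (intro nn_integral_cmult_indicator) (simp add: sets_mu)
      also have "\<dots> \<le> g P * ?B" by (intro mult_left_mono growth r) simp
      finally show ?thesis by (simp add: mult.commute)
    qed
    then have "(\<integral>\<^sup>+P. \<integral>\<^sup>+Q. g P * ?\<chi> P Q \<partial>\<mu> \<partial>\<mu>) \<le> (\<integral>\<^sup>+P. ?B * g P \<partial>\<mu>)" by (intro nn_integral_mono)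
    also have "\<dots> = ?B * (\<integral>\<^sup>+P. g P \<partial>\<mu>)" by (intro nn_integral_cmult) measurable
    finally show ?thesis .
  qed
  have J: "(\<integral>\<^sup>+P. \<integral>\<^sup>+Q. g Q * ?\<chi> P Q \<partial>\<mu> \<partial>\<mu>) \<le> ?B * (\<integral>\<^sup>+P. g P \<partial>\<mu>)"
  proof -
    have "(\<integral>\<^sup>+P. \<integral>\<^sup>+Q. g Q * ?\<chi> P Q \<partial>\<mu> \<partial>\<mu>) = (\<integral>\<^sup>+Q. \<integral>\<^sup>+P. g Q * ?\<chi> P Q \<partial>\<mu> \<partial>\<mu>)"
      by (rule mu_mu.Fubini'[symmetric]) measurable
    also have "\<dots> = (\<integral>\<^sup>+P. \<integral>\<^sup>+Q. g P * ?\<chi> P Q \<partial>\<mu> \<partial>\<mu>)" by (simp add: dist_commute)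
    finally show ?thesis using I by simp
  qed
  have "(\<integral>\<^sup>+P. \<integral>\<^sup>+Q. (g P + g Q) * ?\<chi> P Q \<partial>\<mu> \<partial>\<mu>) = (\<integral>\<^sup>+P. (\<integral>\<^sup>+Q. g P * ?\<chi> P Q \<partial>\<mu>) + (\<integral>\<^sup>+Q. g Q * ?\<chi> P Q \<partial>\<mu>) \<partial>\<mu>)"
    unfolding distrib_right by (intro nn_integral_cong nn_integral_add) measurable
  also have "\<dots> = (\<integral>\<^sup>+P. \<integral>\<^sup>+Q. g P * ?\<chi> P Q \<partial>\<mu> \<partial>\<mu>) + (\<integral>\<^sup>+P. \<integral>\<^sup>+Q. g Q * ?\<chi> P Q \<partial>\<mu> \<partial>\<mu>)"
    by (intro nn_integral_add) measurable
  also have "\<dots> \<le> ?B * (\<integral>\<^sup>+P. g P \<partial>\<mu>) + ?B * (\<integral>\<^sup>+P. g P \<partial>\<mu>)" by (rule add_mono[OF I J])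
  also have "\<dots> = 2 * ?B * (\<integral>\<^sup>+P. g P \<partial>\<mu>)" by (simp only: mult_2 distrib_right)
  also have "2 * ?B = ennreal (2 * (A * r powr (real DIM('a) - 1)))" using A by (simp add: ennreal_mult')
  finally show ?thesis .
qed

text \<open>At scale k the near-diagonal pairs bring 2^(\<kappa> k) from the seminorm, M^k from the
  volume of the averaging ball and (2 / M)^k from the measure. Since 2^\<kappa> = a M / 2, the
  product is (a M)^k, exactly the weight in \<open>sq_osc_sum\<close>.\<close>

lemma seminorm_le_osc_sum:
  assumes s: "1/2 < s" "s < 1" and v [measurable]: "v \<in> borel_measurable borel" and N: "2 \<le> DIM('a)"
  defines "a \<equiv> (2::real) powr (2 * s - 1)" and "M \<equiv> (2::real) ^ DIM('a)" and "\<kappa> \<equiv> real DIM('a) + 2 * s - 2"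
    and "\<omega> \<equiv> unit_ball_vol (real DIM('a))"
  shows "(\<integral>\<^sup>+P. \<integral>\<^sup>+Q. ennreal ((v P - v Q)\<^sup>2 / norm (P - Q) powr \<kappa>) \<partial>\<mu> \<partial>\<mu>)
    \<le> ennreal (2 * A / \<omega> * (a * M)\<^sup>2) * (\<integral>\<^sup>+P. (\<Sum>k. ennreal ((a * M) ^ k) * sq_osc (1 / 2 ^ k) v P) \<partial>\<mu>)
     + ennreal (4 * 2 powr \<kappa> * measure \<mu> UNIV) * (\<integral>\<^sup>+P. ennreal ((v P)\<^sup>2) \<partial>\<mu>)"
proof -
  have \<omega>: "0 < \<omega>" by (simp add: \<omega>_def)
  have M: "0 < M" by (simp add: M_def)
  have a: "0 < a" by (simp add: a_def)
  have \<kappa>: "0 \<le> \<kappa>" using s N by (simp add: \<kappa>_def)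
  have k2: "2 powr \<kappa> = a * M / 2" unfolding \<kappa>_def a_def M_def by (rule pow2_facts(3))
  define d where "d k = 2 * ((2 powr \<kappa>) ^ (k + 2) * M ^ (k + 1) / \<omega>)" for k
  have d: "0 \<le> d k" for k using M \<omega> by (simp add: d_def)
  define S where "S k P Q = (sq_osc (1 / 2 ^ k) v P + sq_osc (1 / 2 ^ k) v Q) * (if dist P Q \<le> 1 / 2 ^ (k + 1) then 1 else 0)" for k P Q
  have Sm [measurable]: "case_prod (S k) \<in> borel_measurable (\<mu> \<Otimes>\<^sub>M \<mu>)" for k unfolding S_def by measurable
  have Sm2 [measurable]: "S k P \<in> borel_measurable \<mu>" for k P unfolding S_def[abs_def] by measurable
  have m: "emeasure \<mu> UNIV = ennreal (measure \<mu> UNIV)" by (rule emeasure_eq_measure)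
  have "(\<integral>\<^sup>+P. \<integral>\<^sup>+Q. ennreal ((v P - v Q)\<^sup>2 / norm (P - Q) powr \<kappa>) \<partial>\<mu> \<partial>\<mu>)
     \<le> (\<integral>\<^sup>+P. \<integral>\<^sup>+Q. (\<Sum>k. ennreal (d k) * S k P Q) + ennreal (2 * 2 powr \<kappa>) * (ennreal ((v P)\<^sup>2) + ennreal ((v Q)\<^sup>2)) \<partial>\<mu> \<partial>\<mu>)"
    unfolding d_def S_def \<omega>_def M_def by (intro nn_integral_mono seminorm_kernel_dyadic v \<kappa>)
  also have "\<dots> = (\<integral>\<^sup>+P. (\<Sum>k. ennreal (d k) * (\<integral>\<^sup>+Q. S k P Q \<partial>\<mu>)) + (\<integral>\<^sup>+Q. ennreal (2 * 2 powr \<kappa>) * (ennreal ((v P)\<^sup>2) + ennreal ((v Q)\<^sup>2)) \<partial>\<mu>) \<partial>\<mu>)"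
  proof (intro nn_integral_cong)
    fix P
    have "(\<integral>\<^sup>+Q. (\<Sum>k. ennreal (d k) * S k P Q) \<partial>\<mu>) = (\<Sum>k. \<integral>\<^sup>+Q. ennreal (d k) * S k P Q \<partial>\<mu>)"
      by (intro nn_integral_suminf) measurable
    also have "\<dots> = (\<Sum>k. ennreal (d k) * (\<integral>\<^sup>+Q. S k P Q \<partial>\<mu>))"
      by (intro suminf_cong nn_integral_cmult) measurable
    finally have e: "(\<integral>\<^sup>+Q. (\<Sum>k. ennreal (d k) * S k P Q) \<partial>\<mu>) = (\<Sum>k. ennreal (d k) * (\<integral>\<^sup>+Q. S k P Q \<partial>\<mu>))" .
    have m1: "(\<lambda>Q. \<Sum>k. ennreal (d k) * S k P Q) \<in> borel_measurable \<mu>" by measurable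
    have m2: "(\<lambda>Q. ennreal (2 * 2 powr \<kappa>) * (ennreal ((v P)\<^sup>2) + ennreal ((v Q)\<^sup>2))) \<in> borel_measurable \<mu>" by measurable
    show "(\<integral>\<^sup>+Q. (\<Sum>k. ennreal (d k) * S k P Q) + ennreal (2 * 2 powr \<kappa>) * (ennreal ((v P)\<^sup>2) + ennreal ((v Q)\<^sup>2)) \<partial>\<mu>)
      = (\<Sum>k. ennreal (d k) * (\<integral>\<^sup>+Q. S k P Q \<partial>\<mu>)) + (\<integral>\<^sup>+Q. ennreal (2 * 2 powr \<kappa>) * (ennreal ((v P)\<^sup>2) + ennreal ((v Q)\<^sup>2)) \<partial>\<mu>)"
      by (simp only: nn_integral_add[OF m1 m2] e)
  qed
  also have "\<dots> = (\<integral>\<^sup>+P. (\<Sum>k. ennreal (d k) * (\<integral>\<^sup>+Q. S k P Q \<partial>\<mu>)) \<partial>\<mu>) + (\<integral>\<^sup>+P. \<integral>\<^sup>+Q. ennreal (2 * 2 powr \<kappa>) * (ennreal ((v P)\<^sup>2) + ennreal ((v Q)\<^sup>2)) \<partial>\<mu> \<partial>\<mu>)"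
    by (intro nn_integral_add) measurable
  also have "(\<integral>\<^sup>+P. (\<Sum>k. ennreal (d k) * (\<integral>\<^sup>+Q. S k P Q \<partial>\<mu>)) \<partial>\<mu>) = (\<Sum>k. \<integral>\<^sup>+P. ennreal (d k) * (\<integral>\<^sup>+Q. S k P Q \<partial>\<mu>) \<partial>\<mu>)"
    by (intro nn_integral_suminf) measurable
  also have "\<dots> = (\<Sum>k. ennreal (d k) * (\<integral>\<^sup>+P. \<integral>\<^sup>+Q. S k P Q \<partial>\<mu> \<partial>\<mu>))"
    by (intro suminf_cong nn_integral_cmult) measurable
  also have "\<dots> \<le> (\<Sum>k. ennreal (2 * A / \<omega> * (a * M)\<^sup>2) * (ennreal ((a * M) ^ k) * (\<integral>\<^sup>+P. sq_osc (1 / 2 ^ k) v P \<partial>\<mu>)))"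
  proof (intro suminf_le)
    fix k
    have "ennreal (d k) * (\<integral>\<^sup>+P. \<integral>\<^sup>+Q. S k P Q \<partial>\<mu> \<partial>\<mu>)
       \<le> ennreal (d k) * (ennreal (2 * (A * (1 / 2 ^ (k + 1)) powr (real DIM('a) - 1))) * (\<integral>\<^sup>+P. sq_osc (1 / 2 ^ k) v P \<partial>\<mu>))"
      unfolding S_def by (intro mult_left_mono near_diagonal_integral) auto
    also have "\<dots> = ennreal (d k * (2 * (A * (1 / 2 ^ (k + 1)) powr (real DIM('a) - 1)))) * (\<integral>\<^sup>+P. sq_osc (1 / 2 ^ k) v P \<partial>\<mu>)"
      by (simp only: ennreal_mult'[OF d] mult.assoc)
    also have "d k * (2 * (A * (1 / 2 ^ (k + 1)) powr (real DIM('a) - 1))) = 2 * A / \<omega> * (a * M)\<^sup>2 * (a * M) ^ k"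
    proof -
      have p: "(1 / 2 ^ (k + 1)) powr (real DIM('a) - 1) = (2 / M) ^ (k + 1)" unfolding M_def by (rule pow2_facts(1))
      have gen: "2 * (X * Y / \<omega>) * (2 * (A * Z)) = (4 * A / \<omega>) * (X * (Y * Z))" for X Y Z :: real by simp
      have "M * (2 / M) = 2" using M by simp
      then have 1: "M ^ (k + 1) * (2 / M) ^ (k + 1) = 2 ^ (k + 1)" by (simp only: power_mult_distrib[symmetric])
      have 2: "(x / 2) ^ (k + 2) * 2 ^ (k + 1) = x\<^sup>2 * x ^ k / 2" for x :: real
        by (simp add: power_divide power2_eq_square)
      show ?thesis unfolding d_def p k2 gen 1 2 by simp
    qed
    also have "ennreal \<dots> = ennreal (2 * A / \<omega> * (a * M)\<^sup>2) * ennreal ((a * M) ^ k)"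
      using A \<omega> by (intro ennreal_mult') auto
    finally show "ennreal (d k) * (\<integral>\<^sup>+P. \<integral>\<^sup>+Q. S k P Q \<partial>\<mu> \<partial>\<mu>) \<le> ennreal (2 * A / \<omega> * (a * M)\<^sup>2) * (ennreal ((a * M) ^ k) * (\<integral>\<^sup>+P. sq_osc (1 / 2 ^ k) v P \<partial>\<mu>))"
      by (simp only: mult.assoc)
  qed auto
  also have "\<dots> = ennreal (2 * A / \<omega> * (a * M)\<^sup>2) * (\<Sum>k. \<integral>\<^sup>+P. ennreal ((a * M) ^ k) * sq_osc (1 / 2 ^ k) v P \<partial>\<mu>)"
    by (simp add: nn_integral_cmult)
  also have "(\<Sum>k. \<integral>\<^sup>+P. ennreal ((a * M) ^ k) * sq_osc (1 / 2 ^ k) v P \<partial>\<mu>) = (\<integral>\<^sup>+P. (\<Sum>k. ennreal ((a * M) ^ k) * sq_osc (1 / 2 ^ k) v P) \<partial>\<mu>)"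
    by (intro nn_integral_suminf[symmetric]) measurable
  also have "(\<integral>\<^sup>+P. \<integral>\<^sup>+Q. ennreal (2 * 2 powr \<kappa>) * (ennreal ((v P)\<^sup>2) + ennreal ((v Q)\<^sup>2)) \<partial>\<mu> \<partial>\<mu>) = ennreal (4 * 2 powr \<kappa> * measure \<mu> UNIV) * (\<integral>\<^sup>+P. ennreal ((v P)\<^sup>2) \<partial>\<mu>)"
  proof -
    let ?V = "\<integral>\<^sup>+P. ennreal ((v P)\<^sup>2) \<partial>\<mu>" and ?c = "ennreal (2 * 2 powr \<kappa>)" and ?m = "ennreal (measure \<mu> UNIV)"
    have "(\<integral>\<^sup>+Q. ?c * (ennreal ((v P)\<^sup>2) + ennreal ((v Q)\<^sup>2)) \<partial>\<mu>) = ?c * (?m * ennreal ((v P)\<^sup>2) + ?V)" for P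
      by (subst nn_integral_cmult, measurable) (subst nn_integral_add, measurable, simp add: m mult.commute)
    then have "(\<integral>\<^sup>+P. \<integral>\<^sup>+Q. ?c * (ennreal ((v P)\<^sup>2) + ennreal ((v Q)\<^sup>2)) \<partial>\<mu> \<partial>\<mu>) = (\<integral>\<^sup>+P. ?c * (?m * ennreal ((v P)\<^sup>2) + ?V) \<partial>\<mu>)" by simp
    also have "\<dots> = ?c * (?m * ?V + ?V * ?m)"
      by (subst nn_integral_cmult, measurable) (subst nn_integral_add, measurable, simp add: m nn_integral_cmult)
    also have "\<dots> = ?c * (2 * ?m) * ?V" by (simp only: mult_2 distrib_left distrib_right ac_simps)
    also have "2 * ?m = ennreal (2 * measure \<mu> UNIV)" by (simp add: ennreal_mult')
    also have "?c * \<dots> = ennreal ((2 * 2 powr \<kappa>) * (2 * measure \<mu> UNIV))" by (rule ennreal_mult'[symmetric]) simp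
    also have "(2 * 2 powr \<kappa>) * (2 * measure \<mu> UNIV) = 4 * 2 powr \<kappa> * measure \<mu> UNIV" by simp
    finally show ?thesis .
  qed
  finally show ?thesis by (simp add: add_right_mono)
qed

text \<open>The trace loses half a derivative: the boundary exponent N + 2s - 2 is (N - 1) + 2 (s -
  1/2). The constant is fixed before \<open>v\<close> and \<open>L\<close>, so it is uniform over
  all Lipschitz functions.\<close>

lemma trace_inequality:
  assumes s: "1/2 < s" "s < 1" and N: "2 \<le> DIM('a)"
  obtains C where "0 \<le> C" "\<And>(v :: 'a \<Rightarrow> real) L. v \<in> borel_measurable borel \<Longrightarrow> (\<And>x y. \<bar>v x - v y\<bar> \<le> L * dist x y) \<Longrightarrow>
      (\<integral>\<^sup>+P. ennreal ((v P)\<^sup>2) \<partial>\<mu>) + (\<integral>\<^sup>+P. \<integral>\<^sup>+Q. ennreal ((v P - v Q)\<^sup>2 / norm (P - Q) powr (real DIM('a) + 2 * s - 2)) \<partial>\<mu> \<partial>\<mu>)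
      \<le> ennreal C * ((\<integral>\<^sup>+x. ennreal ((v x)\<^sup>2) * (if norm x < \<rho> + 1 then 1 else 0) \<partial>lborel) +
          (\<integral>\<^sup>+z. ennreal ((v (fst z) - v (snd z))\<^sup>2 * norm (fst z - snd z) powr (- (real DIM('a) + 2 * s))) \<partial>(lborel \<Otimes>\<^sub>M lborel)))"
proof -
  define a where "a = (2::real) powr (2 * s - 1)"
  define M where "M = (2::real) ^ DIM('a)"
  define \<omega> where "\<omega> = unit_ball_vol (real DIM('a))"
  define m where "m = measure \<mu> UNIV"
  have \<omega>: "0 < \<omega>" by (simp add: \<omega>_def)
  \<comment> \<open>The range of s translates exactly into 1 < a < 2, the hypothesis of
    \<open>sq_osc_sum\<close>.\<close>
  have "2 powr (2 * s - 1) < (2::real) powr 1" using s by (intro powr_less_mono) auto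
  then have a: "1 < a" "a < 2" using s by (auto simp: a_def)
  obtain C1 where C1: "0 \<le> C1" "\<And>(v :: 'a \<Rightarrow> real) L P. v \<in> borel_measurable borel \<Longrightarrow>
      (\<And>x y. \<bar>v x - v y\<bar> \<le> L * dist x y) \<Longrightarrow>
      (\<Sum>k. ennreal ((a * M) ^ k) * sq_osc (1 / 2 ^ k) v P)
       \<le> ennreal C1 * (\<Sum>k. ennreal ((a * M * M) ^ k) * dbl_osc (1 / 2 ^ k) v P)"
    by (rule sq_osc_sum[OF a, where 'a='a, folded M_def], erule that, blast)
  obtain C2 where C2: "0 \<le> C2" "\<And>v :: 'a \<Rightarrow> real. v \<in> borel_measurable borel \<Longrightarrow>
    (\<integral>\<^sup>+P. (\<Sum>k. ennreal ((a * M * M) ^ k) * dbl_osc (1 / 2 ^ k) v P) \<partial>\<mu>)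
    \<le> ennreal C2 * (\<integral>\<^sup>+z. ennreal ((v (fst z) - v (snd z))\<^sup>2 * norm (fst z - snd z) powr (- (real DIM('a) + 2 * s))) \<partial>(lborel \<Otimes>\<^sub>M lborel))"
    by (rule dbl_osc_sum[OF s, folded a_def M_def], rule that)
  define F where "F = 2 * A / \<omega> * (a * M)\<^sup>2"
  define E where "E = 4 * 2 powr (real DIM('a) + 2 * s - 2) * m"
  define c3 where "c3 = 2 / \<omega> * (C1 * C2 + m)"
  define C where "C = c3 + (F * (C1 * C2) + E * c3)"
  have nn: "0 \<le> F" "0 \<le> E" "0 \<le> c3" "0 \<le> m" "0 \<le> C1 * C2"
    using A \<omega> C1(1) C2(1) by (auto simp: F_def E_def c3_def m_def)
  have "0 \<le> C" using nn by (simp add: C_def)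
  moreover have "(\<integral>\<^sup>+P. ennreal ((v P)\<^sup>2) \<partial>\<mu>) + (\<integral>\<^sup>+P. \<integral>\<^sup>+Q. ennreal ((v P - v Q)\<^sup>2 / norm (P - Q) powr (real DIM('a) + 2 * s - 2)) \<partial>\<mu> \<partial>\<mu>)
      \<le> ennreal C * ((\<integral>\<^sup>+x. ennreal ((v x)\<^sup>2) * (if norm x < \<rho> + 1 then 1 else 0) \<partial>lborel) +
          (\<integral>\<^sup>+z. ennreal ((v (fst z) - v (snd z))\<^sup>2 * norm (fst z - snd z) powr (- (real DIM('a) + 2 * s))) \<partial>(lborel \<Otimes>\<^sub>M lborel)))" (is "?L2 + ?SN \<le> ennreal C * (?V + ?G)")
    if v [measurable]: "v \<in> borel_measurable borel" and L: "\<And>x y. \<bar>v x - v y\<bar> \<le> L * dist x y" for v :: "'a \<Rightarrow> real" and L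
  proof -
    define H where "H = ?V + ?G"
    define T where "T = (\<integral>\<^sup>+P. (\<Sum>k. ennreal ((a * M) ^ k) * sq_osc (1 / 2 ^ k) v P) \<partial>\<mu>)"
    have T: "T \<le> ennreal (C1 * C2) * H"
    proof -
      have "T \<le> (\<integral>\<^sup>+P. ennreal C1 * (\<Sum>k. ennreal ((a * M * M) ^ k) * dbl_osc (1 / 2 ^ k) v P) \<partial>\<mu>)"
        unfolding T_def by (intro nn_integral_mono C1(2)[OF v L])
      also have "\<dots> = ennreal C1 * (\<integral>\<^sup>+P. (\<Sum>k. ennreal ((a * M * M) ^ k) * dbl_osc (1 / 2 ^ k) v P) \<partial>\<mu>)"
        by (intro nn_integral_cmult) measurable
      also have "\<dots> \<le> ennreal C1 * (ennreal C2 * ?G)" by (intro mult_left_mono C2(2) v) simp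
      also have "\<dots> \<le> ennreal C1 * (ennreal C2 * H)" unfolding H_def by (intro mult_left_mono) (simp_all add: add_increasing)
      finally show ?thesis using C1(1) by (simp add: ennreal_mult' mult.assoc)
    qed
    have L2: "?L2 \<le> ennreal c3 * H"
    proof -
      have "AE P in \<mu>. ennreal ((v P)\<^sup>2) \<le> ennreal (2 / \<omega>) * (sq_osc 1 v P + ?V)"
        using supp
      proof eventually_elim
        case (elim P)
        have "ennreal ((v P)\<^sup>2) = ennreal (1 / \<omega> * ((v P)\<^sup>2 * \<omega>))" using \<omega> by simp
        also have "\<dots> = ennreal (1 / \<omega>) * ennreal ((v P)\<^sup>2 * \<omega>)" using \<omega> by (intro ennreal_mult') simp
        also have "\<dots> \<le> ennreal (1 / \<omega>) * (2 * (sq_osc 1 v P + ?V))"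
          unfolding \<omega>_def by (intro mult_left_mono sq_value_pointwise v elim) simp
        also have "\<dots> = ennreal (2 / \<omega>) * (sq_osc 1 v P + ?V)"
        proof -
          have "ennreal (2 / \<omega>) = ennreal (1 / \<omega>) * 2" using \<omega> ennreal_mult'[of "1 / \<omega>" 2] by simp
          then show ?thesis by (simp only: mult.assoc)
        qed
        finally show ?case .
      qed
      then have "?L2 \<le> (\<integral>\<^sup>+P. ennreal (2 / \<omega>) * (sq_osc 1 v P + ?V) \<partial>\<mu>)" by (rule nn_integral_mono_AE)
      also have "\<dots> = ennreal (2 / \<omega>) * ((\<integral>\<^sup>+P. sq_osc 1 v P \<partial>\<mu>) + ?V * ennreal m)"
        by (subst nn_integral_cmult, measurable) (subst nn_integral_add, measurable, simp add: m_def emeasure_eq_measure)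
      also have "\<dots> \<le> ennreal (2 / \<omega>) * (T + H * ennreal m)"
      proof (intro mult_left_mono add_mono mult_right_mono)
        show "(\<integral>\<^sup>+P. sq_osc 1 v P \<partial>\<mu>) \<le> T" unfolding T_def
        proof (intro nn_integral_mono)
          fix P
          \<comment> \<open>The oscillation at scale 1 is the term k = 0 of the sum.\<close>
          show "sq_osc 1 v P \<le> (\<Sum>k. ennreal ((a * M) ^ k) * sq_osc (1 / 2 ^ k) v P)"
            using ennreal_le_suminf[of "\<lambda>k. ennreal ((a * M) ^ k) * sq_osc (1 / 2 ^ k) v P" 0] by simp
        qed
        show "?V \<le> H" unfolding H_def by (simp add: add_increasing2)
      qed auto
      also have "\<dots> \<le> ennreal (2 / \<omega>) * (ennreal (C1 * C2) * H + H * ennreal m)"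
        by (intro mult_left_mono add_mono T) auto
      also have "\<dots> = ennreal (2 / \<omega>) * ((ennreal (C1 * C2) + ennreal m) * H)" by (simp only: distrib_right mult.commute[of H])
      also have "\<dots> = ennreal c3 * H"
      proof -
        have "ennreal c3 = ennreal (2 / \<omega>) * ennreal (C1 * C2 + m)" unfolding c3_def using \<omega> by (intro ennreal_mult') simp
        also have "ennreal (C1 * C2 + m) = ennreal (C1 * C2) + ennreal m" using nn by (intro ennreal_plus)
        finally show ?thesis by (simp only: mult.assoc)
      qed
      finally show ?thesis .
    qed
    have "?SN \<le> ennreal F * T + ennreal E * ?L2"
      unfolding F_def E_def T_def a_def M_def \<omega>_def m_def by (rule seminorm_le_osc_sum[OF s v N])
    also have "\<dots> \<le> ennreal F * (ennreal (C1 * C2) * H) + ennreal E * (ennreal c3 * H)"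
      by (intro add_mono mult_left_mono T L2) auto
    finally have SN: "?SN \<le> ennreal F * (ennreal (C1 * C2) * H) + ennreal E * (ennreal c3 * H)" .
    have "ennreal c3 * H + (ennreal F * (ennreal (C1 * C2) * H) + ennreal E * (ennreal c3 * H)) = ennreal C * H"
      unfolding C_def using nn by (simp only: ennreal_plus ennreal_mult' mult_nonneg_nonneg add_nonneg_nonneg distrib_right mult.assoc)
    then show ?thesis using add_mono[OF L2 SN] by (simp add: H_def)
  qed
  ultimately show ?thesis by (rule that)
qed

end

subsection \<open>Boundaries of Lipschitz domains\<close>

text \<open>A frontier point of an open set is not in the set, so it does not lie above the graph; a
  point strictly below the graph has a neighbourhood free of the set, so it is not in the
  closure.\<close>

lemma frontier_on_graph:
  fixes \<Omega> C :: "'a::real_inner set"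
  assumes \<Omega>: "open \<Omega>" and C: "open C" and g: "continuous_on UNIV g"
    and eq: "\<Omega> \<inter> C = {x \<in> C. x \<bullet> e > g (x - (x \<bullet> e) *\<^sub>R e)}"
    and x: "x \<in> frontier \<Omega>" "x \<in> C"
  shows "x \<bullet> e = g (x - (x \<bullet> e) *\<^sub>R e)"
proof (rule ccontr)
  assume ne: "x \<bullet> e \<noteq> g (x - (x \<bullet> e) *\<^sub>R e)"
  have "x \<notin> \<Omega>" using x \<Omega> by (simp add: frontier_def interior_open)
  then have "\<not> x \<bullet> e > g (x - (x \<bullet> e) *\<^sub>R e)" using eq x by auto
  with ne have lt: "x \<bullet> e < g (x - (x \<bullet> e) *\<^sub>R e)" by simp
  define U where "U = C \<inter> {y. y \<bullet> e < g (y - (y \<bullet> e) *\<^sub>R e)}"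
  have o: "open {y. y \<bullet> e < g (y - (y \<bullet> e) *\<^sub>R e)}"
    by (intro open_Collect_less continuous_intros continuous_on_compose2[OF g]) auto
  have U: "open U" unfolding U_def by (rule open_Int[OF C o])
  have "U \<inter> \<Omega> = {}"
  proof (rule equals0I)
    fix y assume "y \<in> U \<inter> \<Omega>"
    then have "y \<in> \<Omega> \<inter> C" "y \<bullet> e < g (y - (y \<bullet> e) *\<^sub>R e)" by (auto simp: U_def)
    then show False unfolding eq by simp
  qed
  then have "U \<inter> closure \<Omega> = {}" using open_Int_closure_eq_empty[OF U] by auto
  moreover have "x \<in> U" "x \<in> closure \<Omega>" using x lt by (auto simp: U_def frontier_def)
  ultimately show False by auto
qed

text \<open>A scale invariant covering condition in the spirit of Assouad dimension at most N - 1: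
  \<open>J\<close> and \<open>D\<close> serve all centres, radii and meshes at once. It passes to
  finite unions and yields both the growth of the surface measure and the vanishing of the Lebesgue
  measure. Diameters are expressed through pairs of points, which treats empty pieces
  uniformly.\<close>

definition codim1_coverable :: "'a::euclidean_space set \<Rightarrow> bool" where
  "codim1_coverable S \<longleftrightarrow> (\<exists>J::nat. \<exists>D\<ge>0. \<forall>x0 \<rho>. \<forall>m::nat. 0 < \<rho> \<longrightarrow> 0 < m \<longrightarrow>
     (\<exists>\<C>. finite \<C> \<and> card \<C> \<le> J * m ^ (DIM('a) - 1) \<and> S \<inter> cball x0 \<rho> \<subseteq> \<Union>\<C> \<and>
        (\<forall>A\<in>\<C>. \<forall>x\<in>A. \<forall>y\<in>A. dist x y \<le> D * \<rho> / real m)))"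

lemma codim1_coverableE:
  assumes "codim1_coverable (S :: 'a::euclidean_space set)"
  obtains J D where "0 \<le> D" "\<And>x0 \<rho> m. 0 < \<rho> \<Longrightarrow> 0 < m \<Longrightarrow>
     (\<exists>\<C>. finite \<C> \<and> card \<C> \<le> J * m ^ (DIM('a) - 1) \<and> S \<inter> cball x0 \<rho> \<subseteq> \<Union>\<C> \<and>
        (\<forall>A\<in>\<C>. \<forall>x\<in>A. \<forall>y\<in>A. dist x y \<le> D * \<rho> / real m))"
proof -
  obtain J where "\<exists>D\<ge>0. \<forall>x0 \<rho>. \<forall>m::nat. 0 < \<rho> \<longrightarrow> 0 < m \<longrightarrow>
     (\<exists>\<C>. finite \<C> \<and> card \<C> \<le> J * m ^ (DIM('a) - 1) \<and> S \<inter> cball x0 \<rho> \<subseteq> \<Union>\<C> \<and>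
        (\<forall>A\<in>\<C>. \<forall>x\<in>A. \<forall>y\<in>A. dist x y \<le> D * \<rho> / real m))"
    using assms unfolding codim1_coverable_def by (rule exE)
  then obtain D where D: "0 \<le> D" "\<forall>x0 \<rho>. \<forall>m::nat. 0 < \<rho> \<longrightarrow> 0 < m \<longrightarrow>
     (\<exists>\<C>. finite \<C> \<and> card \<C> \<le> J * m ^ (DIM('a) - 1) \<and> S \<inter> cball x0 \<rho> \<subseteq> \<Union>\<C> \<and>
        (\<forall>A\<in>\<C>. \<forall>x\<in>A. \<forall>y\<in>A. dist x y \<le> D * \<rho> / real m))"
    by (elim exE conjE)
  show ?thesis by (rule that[OF D(1)]) (rule D(2)[rule_format])
qed

lemma codim1_coverableI:
  assumes "0 \<le> D" "\<And>x0 \<rho> m. 0 < \<rho> \<Longrightarrow> 0 < m \<Longrightarrow>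
     (\<exists>\<C>. finite \<C> \<and> card \<C> \<le> J * m ^ (DIM('a) - 1) \<and> S \<inter> cball x0 \<rho> \<subseteq> \<Union>\<C> \<and>
        (\<forall>A\<in>\<C>. \<forall>x\<in>A. \<forall>y\<in>A. dist x y \<le> D * \<rho> / real m))"
  shows "codim1_coverable (S :: 'a::euclidean_space set)"
  unfolding codim1_coverable_def
  by (rule exI[of _ J], rule exI[of _ D], intro conjI allI impI assms)

lemma codim1_coverable_subset:
  assumes "codim1_coverable T" "S \<subseteq> (T :: 'a::euclidean_space set)"
  shows "codim1_coverable S"
proof -
  obtain J D where D: "0 \<le> D" and cov: "\<And>x0 \<rho> m. 0 < \<rho> \<Longrightarrow> 0 < m \<Longrightarrow>
     (\<exists>\<C>. finite \<C> \<and> card \<C> \<le> J * m ^ (DIM('a) - 1) \<and> T \<inter> cball x0 \<rho> \<subseteq> \<Union>\<C> \<and>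
        (\<forall>A\<in>\<C>. \<forall>x\<in>A. \<forall>y\<in>A. dist x y \<le> D * \<rho> / real m))"
    by (rule codim1_coverableE[OF assms(1)], rule that)
  show ?thesis
  proof (rule codim1_coverableI[OF D])
    fix x0 \<rho> and m :: nat assume "(0::real) < \<rho>" "0 < m"
    from cov[OF this, of x0] obtain \<C> where "finite \<C>" "card \<C> \<le> J * m ^ (DIM('a) - 1)" "T \<inter> cball x0 \<rho> \<subseteq> \<Union>\<C>"
        "\<forall>A\<in>\<C>. \<forall>x\<in>A. \<forall>y\<in>A. dist x y \<le> D * \<rho> / real m" by (elim exE conjE)
    then show "\<exists>\<C>. finite \<C> \<and> card \<C> \<le> J * m ^ (DIM('a) - 1) \<and> S \<inter> cball x0 \<rho> \<subseteq> \<Union>\<C> \<and>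
        (\<forall>A\<in>\<C>. \<forall>x\<in>A. \<forall>y\<in>A. dist x y \<le> D * \<rho> / real m)"
      using assms(2) by (intro exI[of _ \<C>] conjI) auto
  qed
qed

lemma codim1_coverable_empty: "codim1_coverable {}"
  by (rule codim1_coverableI[of 0 0], simp, rule exI[of _ "{}"], simp)

lemma codim1_coverable_Un:
  fixes S T :: "'a::euclidean_space set"
  assumes "codim1_coverable S" "codim1_coverable T"
  shows "codim1_coverable (S \<union> T)"
proof -
  obtain J1 D1 where 1: "0 \<le> D1" "\<And>x0 \<rho> m. 0 < \<rho> \<Longrightarrow> 0 < m \<Longrightarrow>
     (\<exists>\<C>. finite \<C> \<and> card \<C> \<le> J1 * m ^ (DIM('a) - 1) \<and> S \<inter> cball x0 \<rho> \<subseteq> \<Union>\<C> \<and>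
        (\<forall>A\<in>\<C>. \<forall>x\<in>A. \<forall>y\<in>A. dist x y \<le> D1 * \<rho> / real m))"
    by (rule codim1_coverableE[OF assms(1)], rule that)
  obtain J2 D2 where 2: "0 \<le> D2" "\<And>x0 \<rho> m. 0 < \<rho> \<Longrightarrow> 0 < m \<Longrightarrow>
     (\<exists>\<C>. finite \<C> \<and> card \<C> \<le> J2 * m ^ (DIM('a) - 1) \<and> T \<inter> cball x0 \<rho> \<subseteq> \<Union>\<C> \<and>
        (\<forall>A\<in>\<C>. \<forall>x\<in>A. \<forall>y\<in>A. dist x y \<le> D2 * \<rho> / real m))"
    by (rule codim1_coverableE[OF assms(2)], rule that)
  have "\<exists>\<C>. finite \<C> \<and> card \<C> \<le> (J1 + J2) * m ^ (DIM('a) - 1) \<and> (S \<union> T) \<inter> cball x0 \<rho> \<subseteq> \<Union>\<C> \<and>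
        (\<forall>A\<in>\<C>. \<forall>x\<in>A. \<forall>y\<in>A. dist x y \<le> max D1 D2 * \<rho> / real m)"
    if r: "0 < \<rho>" "0 < m" for x0 \<rho> m
  proof -
    obtain C1 where C1: "finite C1" "card C1 \<le> J1 * m ^ (DIM('a) - 1)" "S \<inter> cball x0 \<rho> \<subseteq> \<Union>C1"
       "\<And>A x y. A \<in> C1 \<Longrightarrow> x \<in> A \<Longrightarrow> y \<in> A \<Longrightarrow> dist x y \<le> D1 * \<rho> / real m" using 1(2)[OF r, of x0] by (elim exE conjE) (rule that, auto)
    obtain C2 where C2: "finite C2" "card C2 \<le> J2 * m ^ (DIM('a) - 1)" "T \<inter> cball x0 \<rho> \<subseteq> \<Union>C2"
       "\<And>A x y. A \<in> C2 \<Longrightarrow> x \<in> A \<Longrightarrow> y \<in> A \<Longrightarrow> dist x y \<le> D2 * \<rho> / real m" using 2(2)[OF r, of x0] by (elim exE conjE) (rule that, auto)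
    have le: "D1 * \<rho> / real m \<le> max D1 D2 * \<rho> / real m" "D2 * \<rho> / real m \<le> max D1 D2 * \<rho> / real m"
      using r by (auto intro!: divide_right_mono mult_right_mono)
    have "card (C1 \<union> C2) \<le> (J1 + J2) * m ^ (DIM('a) - 1)"
      using card_Un_le[of C1 C2] C1(2) C2(2) by (simp add: distrib_right)
    moreover have "(S \<union> T) \<inter> cball x0 \<rho> \<subseteq> \<Union>(C1 \<union> C2)" using C1(3) C2(3) by auto
    moreover have "\<forall>A\<in>C1 \<union> C2. \<forall>x\<in>A. \<forall>y\<in>A. dist x y \<le> max D1 D2 * \<rho> / real m"
    proof (intro ballI)
      fix A x y assume A: "A \<in> C1 \<union> C2" and xy: "x \<in> A" "y \<in> A"
      show "dist x y \<le> max D1 D2 * \<rho> / real m"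
      proof (cases "A \<in> C1")
        case True then show ?thesis using C1(4)[OF _ xy] le(1) by linarith
      next
        case False then show ?thesis using C2(4)[OF _ xy] A le(2) by force
      qed
    qed
    ultimately show ?thesis using C1(1) C2(1) by (intro exI[of _ "C1 \<union> C2"]) auto
  qed
  then show ?thesis using 1(1) by (intro codim1_coverableI[of "max D1 D2" "J1 + J2"]) auto
qed

lemma codim1_coverable_Union:
  assumes "finite F" "\<And>S. S \<in> F \<Longrightarrow> codim1_coverable S"
  shows "codim1_coverable (\<Union>F)"
  using assms by (induction F rule: finite_induct) (auto intro: codim1_coverable_empty codim1_coverable_Un)

text \<open>Rotate the vertical direction \<open>e\<close> to a coordinate vector and box only the
  other N - 1 coordinates, which gives m^(N-1) cells. Within a cell the projections differ by
  O(\<rho> / m), and the Lipschitz bound extends this to the height.\<close>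

lemma codim1_coverable_graph:
  fixes e :: "'a::euclidean_space" and g :: "'a \<Rightarrow> real"
  assumes e: "norm e = 1" and g: "L-lipschitz_on UNIV g"
  shows "codim1_coverable {x. x \<bullet> e = g (x - (x \<bullet> e) *\<^sub>R e)}"
proof -
  define S where "S = {x. x \<bullet> e = g (x - (x \<bullet> e) *\<^sub>R e)}"
  have L: "0 \<le> L" using g by (rule lipschitz_on_nonneg)
  obtain b :: 'a where b: "b \<in> Basis" by (meson ex_in_conv nonempty_Basis)
  obtain T where T: "orthogonal_transformation T" "T e = b"
    using ex_orthogonal_transformation[of e b] e b by auto
  have lin: "linear T" using T(1) by (rule orthogonal_transformation_linear)
  have Tb: "T x \<bullet> b = x \<bullet> e" for x using T by (metis orthogonal_transformation_def)
  define B where "B = Basis - {b}"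
  have B: "finite B" "card B = DIM('a) - 1" using b by (auto simp: B_def)
  define pr where "pr x = x - (x \<bullet> e) *\<^sub>R e" for x
  have Tpr: "T (pr x) = T x - (T x \<bullet> b) *\<^sub>R b" for x
    by (simp add: pr_def linear_diff[OF lin] linear_scale[OF lin] T(2) Tb)
  define D where "D = (1 + L) * (2 * real DIM('a))"
  have "\<exists>\<C>. finite \<C> \<and> card \<C> \<le> 1 * m ^ (DIM('a) - 1) \<and> S \<inter> cball x0 \<rho> \<subseteq> \<Union>\<C> \<and>
        (\<forall>A\<in>\<C>. \<forall>x\<in>A. \<forall>y\<in>A. dist x y \<le> D * \<rho> / real m)"
    if r: "0 < \<rho>" and m: "0 < m" for x0 \<rho> and m :: nat
  proof -
    define q where "q x i = ((T x - T x0) \<bullet> i + \<rho>) * real m / (2 * \<rho>)" for x i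
    \<comment> \<open>The value q = m, possible at the right end, goes into the last box m - 1; so
      idx \<le> q \<le> idx + 1 on the whole ball.\<close>
    define idx where "idx x i = min (m - 1) (nat \<lfloor>q x i\<rfloor>)" for x i
    define cell where "cell f = {x \<in> S \<inter> cball x0 \<rho>. \<forall>i\<in>B. idx x i = f i}" for f
    define \<C> where "\<C> = cell ` (B \<rightarrow>\<^sub>E {..<m})"
    have "finite \<C>" unfolding \<C>_def using B by (intro finite_imageI finite_PiE) auto
    moreover have "card \<C> \<le> 1 * m ^ (DIM('a) - 1)"
    proof -
      have "card \<C> \<le> card (B \<rightarrow>\<^sub>E {..<m})" unfolding \<C>_def using B by (intro card_image_le finite_PiE) auto
      then show ?thesis using B by (simp add: card_PiE)
    qed
    moreover have "S \<inter> cball x0 \<rho> \<subseteq> \<Union>\<C>"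
    proof
      fix x assume x: "x \<in> S \<inter> cball x0 \<rho>"
      have "restrict (idx x) B \<in> B \<rightarrow>\<^sub>E {..<m}" using m by (auto simp: idx_def)
      moreover have "x \<in> cell (restrict (idx x) B)" using x by (auto simp: cell_def)
      ultimately show "x \<in> \<Union>\<C>" unfolding \<C>_def by blast
    qed
    moreover have "dist x y \<le> D * \<rho> / real m" if A: "A \<in> \<C>" "x \<in> A" "y \<in> A" for A x y
    proof -
      obtain f where "A = cell f" using A by (auto simp: \<C>_def)
      then have x: "x \<in> S" "x \<in> cball x0 \<rho>" and y: "y \<in> S" "y \<in> cball x0 \<rho>" and i: "\<And>i. i \<in> B \<Longrightarrow> idx x i = idx y i"
        using A by (auto simp: cell_def)
      have comp: "\<bar>(T x - T y) \<bullet> i\<bar> \<le> 2 * \<rho> / real m" if "i \<in> B" for i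
      proof -
        have rng: "0 \<le> q z i \<and> q z i \<le> real m" if "z \<in> cball x0 \<rho>" for z
        proof -
          have "\<bar>(T z - T x0) \<bullet> i\<bar> \<le> norm (T (z - x0))"
            using Basis_le_norm[of i "T (z - x0)"] \<open>i \<in> B\<close> by (simp add: B_def linear_diff[OF lin])
          also have "\<dots> \<le> \<rho>" using that orthogonal_transformation_norm[OF T(1)] by (simp add: dist_norm norm_minus_commute)
          finally have a: "0 \<le> (T z - T x0) \<bullet> i + \<rho>" "(T z - T x0) \<bullet> i + \<rho> \<le> 2 * \<rho>" by auto
          have "((T z - T x0) \<bullet> i + \<rho>) * real m \<le> 2 * \<rho> * real m" using a(2) by (rule mult_right_mono) simp
          then show ?thesis unfolding q_def using a r by (simp add: divide_le_eq mult.commute)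
        qed
        have near: "real (idx z i) \<le> q z i \<and> q z i \<le> real (idx z i) + 1" if "z \<in> cball x0 \<rho>" for z
        proof (cases "nat \<lfloor>q z i\<rfloor> \<le> m - 1")
          case True
          then show ?thesis using rng[OF that] by (simp add: idx_def min_def)
        next
          case False
          then have "idx z i = m - 1" by (simp add: idx_def min_def)
          moreover have "real (m - 1) \<le> real (nat \<lfloor>q z i\<rfloor>)" using False by simp
          moreover have "real (nat \<lfloor>q z i\<rfloor>) \<le> q z i" using rng[OF that] by (intro of_nat_floor) simp
          moreover have "real (m - 1) + 1 = real m" using m by simp
          ultimately show ?thesis using rng[OF that] by linarith
        qed
        have "\<bar>q x i - q y i\<bar> \<le> 1" using near[OF x(2)] near[OF y(2)] i[OF \<open>i \<in> B\<close>] by linarith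
        moreover have "q x i - q y i = ((T x - T y) \<bullet> i) * (real m / (2 * \<rho>))"
          by (simp add: q_def inner_diff_left diff_divide_distrib[symmetric] algebra_simps)
        ultimately have "\<bar>(T x - T y) \<bullet> i\<bar> * (real m / (2 * \<rho>)) \<le> 1" using r by (simp add: abs_mult)
        then show ?thesis using r m by (simp add: field_simps)
      qed
      have "norm (pr x - pr y) = norm (T (pr x - pr y))" by (simp add: orthogonal_transformation_norm[OF T(1)])
      also have "\<dots> \<le> (\<Sum>i\<in>Basis. \<bar>T (pr x - pr y) \<bullet> i\<bar>)" by (rule norm_le_l1)
      also have "\<dots> \<le> (\<Sum>i\<in>(Basis :: 'a set). 2 * \<rho> / real m)"
      proof (rule sum_mono)
        fix i :: 'a assume i: "i \<in> Basis"
        have Tp: "T (pr x - pr y) \<bullet> i = (T x - T y) \<bullet> i - ((T x - T y) \<bullet> b) * (b \<bullet> i)"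
          by (simp add: linear_diff[OF lin] Tpr inner_diff_left algebra_simps)
        show "\<bar>T (pr x - pr y) \<bullet> i\<bar> \<le> 2 * \<rho> / real m"
        proof (cases "i = b")
          case True
          then show ?thesis unfolding Tp using b r by simp
        next
          case False
          then have "i \<in> B" "b \<bullet> i = 0" using i b by (auto simp: B_def inner_Basis)
          then show ?thesis unfolding Tp using comp by simp
        qed
      qed
      also have "\<dots> = real DIM('a) * (2 * \<rho> / real m)" by simp
      finally have n: "norm (pr x - pr y) \<le> real DIM('a) * (2 * \<rho> / real m)" .
      have xe: "x \<bullet> e = g (pr x)" "y \<bullet> e = g (pr y)" using x(1) y(1) by (auto simp: S_def pr_def)
      have "\<bar>g (pr x) - g (pr y)\<bar> \<le> L * norm (pr x - pr y)"
        using lipschitz_onD[OF g, of "pr x" "pr y"] by (simp add: dist_norm)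
      moreover have "x - y = (pr x - pr y) + (x \<bullet> e - y \<bullet> e) *\<^sub>R e" by (simp add: pr_def algebra_simps)
      then have "norm (x - y) \<le> norm (pr x - pr y) + norm ((x \<bullet> e - y \<bullet> e) *\<^sub>R e)" by (metis norm_triangle_ineq)
      moreover have "norm ((x \<bullet> e - y \<bullet> e) *\<^sub>R e) = \<bar>g (pr x) - g (pr y)\<bar>" using e xe by simp
      ultimately have "norm (x - y) \<le> (1 + L) * norm (pr x - pr y)" unfolding distrib_right by linarith
      also have "\<dots> \<le> (1 + L) * (real DIM('a) * (2 * \<rho> / real m))" using L by (intro mult_left_mono n) auto
      also have "\<dots> = D * \<rho> / real m" by (simp add: D_def)
      finally show ?thesis by (simp add: dist_norm)
    qed
    ultimately show ?thesis by (intro exI[of _ \<C>]) blast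
  qed
  then show ?thesis unfolding S_def[symmetric] using L
    by (intro codim1_coverableI[of D 1]) (auto simp: D_def)
qed

text \<open>Compactness of the frontier leaves finitely many charts. In each of them the frontier
  lies on a global Lipschitz graph, and coverability passes to subsets.\<close>

lemma codim1_coverable_frontier:
  fixes \<Omega> :: "(real^'n) set"
  assumes "bounded \<Omega>" "lipschitz_domain \<Omega>"
  shows "codim1_coverable (frontier \<Omega>)"
proof -
  have op: "open \<Omega>" using assms(2) by (simp add: lipschitz_domain_def)
  have chart: "\<exists>U. open U \<and> P \<in> U \<and> codim1_coverable (frontier \<Omega> \<inter> U)" if P: "P \<in> frontier \<Omega>" for P
  proof -
    obtain e :: "real^'n" and r h L :: real and g :: "real^'n \<Rightarrow> real" where
      ch: "norm e = 1" "r > 0" "h > 0" "L-lipschitz_on UNIV g" and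
      eq: "let C = {x. norm ((x - P) - ((x - P) \<bullet> e) *\<^sub>R e) < r \<and> \<bar>(x - P) \<bullet> e\<bar> < h}
        in \<Omega> \<inter> C = {x \<in> C. x \<bullet> e > g (x - (x \<bullet> e) *\<^sub>R e)}"
      using assms(2) P unfolding lipschitz_domain_def by blast
    define U where "U = {x. norm ((x - P) - ((x - P) \<bullet> e) *\<^sub>R e) < r \<and> \<bar>(x - P) \<bullet> e\<bar> < h}"
    have U: "open U" unfolding U_def
      by (intro open_Collect_conj open_Collect_less continuous_intros)
    have eq': "\<Omega> \<inter> U = {x \<in> U. x \<bullet> e > g (x - (x \<bullet> e) *\<^sub>R e)}" using eq unfolding U_def Let_def .
    have "frontier \<Omega> \<inter> U \<subseteq> {x. x \<bullet> e = g (x - (x \<bullet> e) *\<^sub>R e)}"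
      using frontier_on_graph[OF op U lipschitz_on_continuous_on[OF ch(4)] eq'] by auto
    then have "codim1_coverable (frontier \<Omega> \<inter> U)"
      using codim1_coverable_subset[OF codim1_coverable_graph[OF ch(1,4)]] by blast
    then show ?thesis using U ch by (intro exI[of _ U]) (auto simp: U_def)
  qed
  then obtain U where U: "\<And>P. P \<in> frontier \<Omega> \<Longrightarrow> open (U P) \<and> P \<in> U P \<and> codim1_coverable (frontier \<Omega> \<inter> U P)" by metis
  have "compact (frontier \<Omega>)" using assms(1) by (rule compact_frontier_bounded)
  then obtain F where F: "F \<subseteq> frontier \<Omega>" "finite F" "frontier \<Omega> \<subseteq> (\<Union>P\<in>F. U P)"
    by (rule compactE_image[of _ "frontier \<Omega>" U]) (use U in auto)
  have "codim1_coverable (\<Union>((\<lambda>P. frontier \<Omega> \<inter> U P) ` F))"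
    using F U by (intro codim1_coverable_Union) auto
  then show ?thesis by (rule codim1_coverable_subset) (use F(3) in auto)
qed

text \<open>A mesh m fine enough for \<delta> gives at most J m^(N-1) pieces of diameter at most D
  \<rho> / m. Their contributions total a multiple of \<rho>^(N-1) in which m cancels, so the bound
  survives the supremum over \<delta>.\<close>

lemma hausdorff_outer_codim1_growth:
  fixes S :: "'a::euclidean_space set"
  assumes S: "codim1_coverable S" and N: "2 \<le> DIM('a)"
  obtains A where "0 \<le> A" "\<And>x0 \<rho>. 0 < \<rho> \<Longrightarrow> hausdorff_outer (real DIM('a) - 1) (S \<inter> cball x0 \<rho>) \<le> ennreal (A * \<rho> powr (real DIM('a) - 1))"
proof -
  define d where "d = real DIM('a) - 1"
  have d: "0 < d" using N by (simp add: d_def)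
  obtain J D where D: "0 \<le> D" and cov: "\<And>x0 \<rho> m. 0 < \<rho> \<Longrightarrow> 0 < m \<Longrightarrow>
     (\<exists>\<C>. finite \<C> \<and> card \<C> \<le> J * m ^ (DIM('a) - 1) \<and> S \<inter> cball x0 \<rho> \<subseteq> \<Union>\<C> \<and>
        (\<forall>A\<in>\<C>. \<forall>x\<in>A. \<forall>y\<in>A. dist x y \<le> D * \<rho> / real m))"
    by (rule codim1_coverableE[OF S], rule that)
  define w where "w = unit_ball_vol d"
  have w: "0 \<le> w" using d by (simp add: w_def)
  define A where "A = real J * (w * (D / 2) powr d)"
  have "hausdorff_pre d \<delta> (S \<inter> cball x0 \<rho>) \<le> ennreal (A * \<rho> powr d)" if r: "0 < \<rho>" and \<delta>: "0 < \<delta>" for x0 \<rho> \<delta>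
  proof -
    obtain m :: nat where m: "D * \<rho> / \<delta> < real m" using reals_Archimedean2 by blast
    have "0 \<le> D * \<rho> / \<delta>" using D r \<delta> by simp
    then have m0: "0 < m" using m by linarith
    have small: "D * \<rho> / real m < \<delta>" using m m0 \<delta> by (simp add: field_simps)
    obtain \<C> where C: "finite \<C>" "card \<C> \<le> J * m ^ (DIM('a) - 1)" "S \<inter> cball x0 \<rho> \<subseteq> \<Union>\<C>"
      "\<And>A x y. A \<in> \<C> \<Longrightarrow> x \<in> A \<Longrightarrow> y \<in> A \<Longrightarrow> dist x y \<le> D * \<rho> / real m"
      using cov[OF r m0, of x0] by (elim exE conjE) (rule that, auto)
    obtain xs where xs: "set xs = \<C>" "distinct xs" using finite_distinct_list[OF C(1)] by blast
    \<comment> \<open>The premeasure asks for a sequence of sets; the finite cover is padded with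
      empty sets, whose terms are \<open>0 powr d = 0\<close>.\<close>
    define E where "E i = (if i < length xs then xs ! i else {})" for i
    have Ein: "E i \<in> \<C>" if "i < length xs" for i using that xs by (auto simp: E_def)
    have bd: "bounded (E i) \<and> diameter (E i) \<le> D * \<rho> / real m" for i
    proof (cases "i < length xs")
      case True
      have "bounded (E i)" unfolding bounded_two_points using C(4)[OF Ein[OF True]] by blast
      moreover have "diameter (E i) \<le> D * \<rho> / real m"
        using C(4)[OF Ein[OF True]] D r by (intro diameter_le) (auto simp: dist_norm)
      ultimately show ?thesis by simp
    qed (use D r in \<open>auto simp: E_def\<close>)
    have "hausdorff_pre d \<delta> (S \<inter> cball x0 \<rho>) \<le> (\<Sum>i. ennreal (unit_ball_vol d * (diameter (E i) / 2) powr d))"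
      unfolding hausdorff_pre_def
    proof (rule INF_lower)
      have "diameter (E i) < \<delta>" for i using bd[of i] small by linarith
      moreover have "\<Union>\<C> \<subseteq> (\<Union>i. E i)" using xs by (force simp: E_def in_set_conv_nth)
      ultimately show "E \<in> {C. S \<inter> cball x0 \<rho> \<subseteq> (\<Union>i. C i) \<and> (\<forall>i. bounded (C i) \<and> diameter (C i) < \<delta>)}"
        using C(3) bd by auto
    qed
    also have "\<dots> = (\<Sum>i<length xs. ennreal (unit_ball_vol d * (diameter (E i) / 2) powr d))"
      using d by (intro suminf_finite) (auto simp: E_def)
    also have "\<dots> \<le> (\<Sum>i<length xs. ennreal (w * (D * \<rho> / real m / 2) powr d))"
      unfolding w_def using bd d w
      by (intro sum_mono ennreal_leI mult_left_mono powr_mono2) (auto intro!: divide_right_mono diameter_ge_0 simp: w_def)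
    also have "\<dots> = ennreal (real (length xs) * (w * (D * \<rho> / real m / 2) powr d))"
      using w by (simp add: ennreal_mult' ennreal_of_nat_eq_real_of_nat)
    also have "\<dots> \<le> ennreal (real (J * m ^ (DIM('a) - 1)) * (w * (D * \<rho> / real m / 2) powr d))"
      using C(2) xs w distinct_card[OF xs(2)] by (intro ennreal_leI mult_right_mono) (auto simp del: of_nat_mult)
    also have "real (J * m ^ (DIM('a) - 1)) * (w * (D * \<rho> / real m / 2) powr d) = A * \<rho> powr d"
    proof -
      have "real (m ^ (DIM('a) - 1)) = real m powr d"
        using m0 N unfolding d_def by (simp add: powr_realpow[symmetric] of_nat_diff)
      moreover have "(D * \<rho> / real m / 2) powr d = (D / 2) powr d * \<rho> powr d / real m powr d"
        using D r m0 by (simp add: powr_mult powr_divide)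
      ultimately show ?thesis using m0 by (simp add: A_def)
    qed
    finally show ?thesis .
  qed
  then have "hausdorff_outer d (S \<inter> cball x0 \<rho>) \<le> ennreal (A * \<rho> powr d)" if "0 < \<rho>" for x0 \<rho>
    unfolding hausdorff_outer_def using that by (intro SUP_least) auto
  then show ?thesis using w unfolding d_def by (intro that[of A]) (auto simp: A_def)
qed

text \<open>A number of balls of order m^(N-1), each of radius of order 1 / m, has total volume of
  order 1 / m.\<close>

lemma codim1_coverable_null:
  fixes S :: "'a::euclidean_space set"
  assumes S: "codim1_coverable S" and bd: "bounded S" and meas: "S \<in> sets borel"
  shows "S \<in> null_sets lborel"
proof -
  obtain J D where D: "0 \<le> D" and cov: "\<And>x0 \<rho> m. 0 < \<rho> \<Longrightarrow> 0 < m \<Longrightarrow>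
     (\<exists>\<C>. finite \<C> \<and> card \<C> \<le> J * m ^ (DIM('a) - 1) \<and> S \<inter> cball x0 \<rho> \<subseteq> \<Union>\<C> \<and>
        (\<forall>A\<in>\<C>. \<forall>x\<in>A. \<forall>y\<in>A. dist x y \<le> D * \<rho> / real m))"
    by (rule codim1_coverableE[OF S], rule that)
  obtain \<rho> where \<rho>: "0 < \<rho>" "S \<subseteq> cball 0 \<rho>" using bd by (auto simp: bounded_pos subset_eq)
  define w where "w = unit_ball_vol (real DIM('a))"
  define K where "K = real J * (w * (D * \<rho>) ^ DIM('a))"
  have bound: "emeasure lborel S \<le> ennreal (K / real m)" if m: "0 < m" for m :: nat
  proof -
    obtain \<C> where C: "finite \<C>" "card \<C> \<le> J * m ^ (DIM('a) - 1)" "S \<inter> cball 0 \<rho> \<subseteq> \<Union>\<C>"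
      "\<And>A x y. A \<in> \<C> \<Longrightarrow> x \<in> A \<Longrightarrow> y \<in> A \<Longrightarrow> dist x y \<le> D * \<rho> / real m"
      using cov[OF \<rho>(1) m, of 0] by (elim exE conjE) (rule that, auto)
    define p where "p A = (SOME x. x \<in> A)" for A :: "'a set"
    have "A \<subseteq> cball (p A) (D * \<rho> / real m)" if "A \<in> \<C>" for A
    proof
      fix x assume "x \<in> A"
      then have "p A \<in> A" unfolding p_def by (rule someI)
      then show "x \<in> cball (p A) (D * \<rho> / real m)" using C(4)[OF that _ \<open>x \<in> A\<close>] by simp
    qed
    then have "S \<subseteq> (\<Union>A\<in>\<C>. cball (p A) (D * \<rho> / real m))" using C(3) \<rho>(2) by blast
    then have "emeasure lborel S \<le> emeasure lborel (\<Union>A\<in>\<C>. cball (p A) (D * \<rho> / real m))"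
      using C(1) by (intro emeasure_mono) auto
    also have "\<dots> \<le> (\<Sum>A\<in>\<C>. emeasure lborel (cball (p A) (D * \<rho> / real m)))"
      using C(1) by (intro emeasure_subadditive_finite) auto
    also have "\<dots> = (\<Sum>A\<in>\<C>. ennreal (w * (D * \<rho> / real m) ^ DIM('a)))"
      using D \<rho> unfolding w_def by (intro sum.cong refl emeasure_cball) auto
    also have "\<dots> = ennreal (real (card \<C>) * (w * (D * \<rho> / real m) ^ DIM('a)))"
      by (simp add: ennreal_mult' ennreal_of_nat_eq_real_of_nat)
    also have "\<dots> \<le> ennreal (real (J * m ^ (DIM('a) - 1)) * (w * (D * \<rho> / real m) ^ DIM('a)))"
      using C(2) D \<rho> by (intro ennreal_leI mult_right_mono) (auto simp: w_def simp del: of_nat_mult)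
    also have "real (J * m ^ (DIM('a) - 1)) * (w * (D * \<rho> / real m) ^ DIM('a)) = K / real m"
    proof -
      have "real m ^ DIM('a) = real m ^ (DIM('a) - 1) * real m" by (metis DIM_positive power_minus_mult)
      then show ?thesis using m by (simp add: K_def power_divide)
    qed
    finally show ?thesis .
  qed
  have "(\<lambda>m. ennreal (K / real (Suc m))) \<longlonglongrightarrow> ennreal 0"
    by (intro tendsto_ennrealI LIMSEQ_Suc lim_const_over_n)
  then have "emeasure lborel S \<le> ennreal 0"
    by (rule LIMSEQ_le_const) (intro exI[of _ 0] allI impI bound zero_less_Suc)
  then show ?thesis using meas by (auto simp: null_sets_def)
qed

subsection \<open>The layer potential of a bounded functional\<close>

text \<open>\<open>R\<close> is both the radius of the ball in the theorem and a bound for the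
  support of the measure. The exponents \<open>t\<close>, \<open>b\<close> and \<kappa> are
  parameters with defining equations, which keeps them atomic in the proofs.\<close>

locale layer = growth_measure \<mu> A R for \<mu> :: "'a::euclidean_space measure" and A R :: real +
  fixes s t b \<kappa> :: real and S :: "'a set"
  assumes s: "1/2 < s" "s < 1" and N: "2 \<le> DIM('a)"
    and closed_S: "closed S" and S_sub: "S \<subseteq> cball 0 R" and AE_S: "AE P in \<mu>. P \<in> S"
    and null_S: "S \<in> null_sets lborel"
    and t_eq: "t = real DIM('a) - 2 * s" and b_eq: "b = real DIM('a) + 2 * s" and \<kappa>_eq: "\<kappa> = real DIM('a) + 2 * s - 2"
begin

lemma t_facts: "0 < t" "0 \<le> t" "t < real DIM('a)" "t + 1 < real DIM('a)"
  using s N by (auto simp: t_eq)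

text \<open>The squared norm of H^(s-1/2) for a Borel measure on the whole space, as \<kappa> = (N -
  1) + 2 (s - 1/2).\<close>

definition Hsq :: "('a \<Rightarrow> real) \<Rightarrow> ennreal" where
  "Hsq \<psi> = (\<integral>\<^sup>+P. ennreal ((\<psi> P)\<^sup>2) \<partial>\<mu>) +
     (\<integral>\<^sup>+P. \<integral>\<^sup>+Q. ennreal ((\<psi> P - \<psi> Q)\<^sup>2 / norm (P - Q) powr \<kappa>) \<partial>\<mu> \<partial>\<mu>)"

text \<open>Hoelder order 1/2 gains one power of the distance in the squared difference. The
  remaining exponent \<kappa> - 1 = N + 2s - 3 is less than N - 1 since s < 1, so the boundary
  measure integrates it near each point.\<close>

lemma Hsq_holder:
  obtains C where "0 \<le> C" "\<And>\<psi> K. 0 \<le> K \<Longrightarrow> (\<And>P. P \<in> S \<Longrightarrow> \<bar>\<psi> P\<bar> \<le> K) \<Longrightarrow>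
     (\<And>P Q. P \<in> S \<Longrightarrow> Q \<in> S \<Longrightarrow> \<bar>\<psi> P - \<psi> Q\<bar> \<le> K * sqrt (dist P Q)) \<Longrightarrow> Hsq \<psi> \<le> ennreal ((C * K)\<^sup>2)"
proof -
  define m where "m = measure \<mu> UNIV"
  have m: "emeasure \<mu> UNIV = ennreal m" "0 \<le> m" by (auto simp: m_def emeasure_eq_measure)
  define d where "d = real DIM('a) - 1"
  define C0 where "C0 = A * 2 powr (\<kappa> - 1) / (1 - 2 powr ((\<kappa> - 1) - d)) * (2 * R) powr (d - (\<kappa> - 1))"
  have k: "0 \<le> \<kappa> - 1" "\<kappa> - 1 < d" using s N by (auto simp: d_def \<kappa>_eq)
  have rad: "(\<integral>\<^sup>+Q. ennreal (dist P Q powr (-(\<kappa> - 1))) * indicator (cball P (2 * R)) Q \<partial>\<mu>) \<le> ennreal C0" for P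
    unfolding C0_def by (rule nn_integral_radial_inside[OF sets_mu A _ k]) (use rho growth in \<open>auto simp: d_def\<close>)
  have "2 powr ((\<kappa> - 1) - d) < (1::real)" using k by (intro powr_less_one) auto
  then have C0: "0 \<le> C0" using A by (simp add: C0_def)
  define C where "C = sqrt (m + C0 * m)"
  have "Hsq \<psi> \<le> ennreal ((C * K)\<^sup>2)"
    if K: "0 \<le> K" and b: "\<And>P. P \<in> S \<Longrightarrow> \<bar>\<psi> P\<bar> \<le> K"
      and h: "\<And>P Q. P \<in> S \<Longrightarrow> Q \<in> S \<Longrightarrow> \<bar>\<psi> P - \<psi> Q\<bar> \<le> K * sqrt (dist P Q)" for \<psi> K
  proof -
    have "(\<integral>\<^sup>+P. ennreal ((\<psi> P)\<^sup>2) \<partial>\<mu>) \<le> (\<integral>\<^sup>+P. ennreal (K\<^sup>2) \<partial>\<mu>)"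
    proof (rule nn_integral_mono_AE)
      show "AE P in \<mu>. ennreal ((\<psi> P)\<^sup>2) \<le> ennreal (K\<^sup>2)" using AE_S
      proof eventually_elim
        case (elim P)
        show ?case using power_mono[OF b[OF elim], of 2] by (simp add: ennreal_leI)
      qed
    qed
    also have "\<dots> = ennreal (K\<^sup>2 * m)" using m by (simp add: ennreal_mult')
    finally have 1: "(\<integral>\<^sup>+P. ennreal ((\<psi> P)\<^sup>2) \<partial>\<mu>) \<le> ennreal (K\<^sup>2 * m)" .
    have "(\<integral>\<^sup>+P. \<integral>\<^sup>+Q. ennreal ((\<psi> P - \<psi> Q)\<^sup>2 / norm (P - Q) powr \<kappa>) \<partial>\<mu> \<partial>\<mu>) \<le> (\<integral>\<^sup>+P. ennreal (K\<^sup>2 * C0) \<partial>\<mu>)"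
    proof (rule nn_integral_mono_AE)
      show "AE P in \<mu>. (\<integral>\<^sup>+Q. ennreal ((\<psi> P - \<psi> Q)\<^sup>2 / norm (P - Q) powr \<kappa>) \<partial>\<mu>) \<le> ennreal (K\<^sup>2 * C0)" using AE_S
      proof eventually_elim
        case P: (elim P)
        have "(\<integral>\<^sup>+Q. ennreal ((\<psi> P - \<psi> Q)\<^sup>2 / norm (P - Q) powr \<kappa>) \<partial>\<mu>)
           \<le> (\<integral>\<^sup>+Q. ennreal (K\<^sup>2) * (ennreal (dist P Q powr (-(\<kappa> - 1))) * indicator (cball P (2 * R)) Q) \<partial>\<mu>)"
        proof (rule nn_integral_mono_AE)
          show "AE Q in \<mu>. ennreal ((\<psi> P - \<psi> Q)\<^sup>2 / norm (P - Q) powr \<kappa>) \<le> ennreal (K\<^sup>2) * (ennreal (dist P Q powr (-(\<kappa> - 1))) * indicator (cball P (2 * R)) Q)"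
            using AE_S
          proof eventually_elim
            case Q: (elim Q)
            have "P \<in> cball 0 R" "Q \<in> cball 0 R" using P Q S_sub by auto
            then have in_ball: "Q \<in> cball P (2 * R)" using dist_triangle[of P Q 0] by simp
            have "(\<psi> P - \<psi> Q)\<^sup>2 / norm (P - Q) powr \<kappa> \<le> K\<^sup>2 * dist P Q powr (-(\<kappa> - 1))"
            proof (cases "P = Q")
              case False
              have "(\<psi> P - \<psi> Q)\<^sup>2 \<le> (K * sqrt (dist P Q))\<^sup>2"
                using power_mono[OF h[OF P Q], of 2] by simp
              also have "\<dots> = K\<^sup>2 * dist P Q" by (simp add: power_mult_distrib)
              finally have "(\<psi> P - \<psi> Q)\<^sup>2 / norm (P - Q) powr \<kappa> \<le> K\<^sup>2 * dist P Q / norm (P - Q) powr \<kappa>"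
                by (rule divide_right_mono) simp
              also have "\<dots> = K\<^sup>2 * (dist P Q powr 1 * dist P Q powr (-\<kappa>))"
                by (simp add: powr_minus_divide dist_norm)
              also have "dist P Q powr 1 * dist P Q powr (-\<kappa>) = dist P Q powr (1 + -\<kappa>)" by (simp only: powr_add)
              finally show ?thesis by simp
            qed simp
            then show ?case using in_ball by (simp add: ennreal_mult'[symmetric] ennreal_leI)
          qed
        qed
        also have "\<dots> \<le> ennreal (K\<^sup>2 * C0)"
          by (intro nn_integral_cmult_le rad borel_measurable_times_ennreal borel_measurable_indicator) (auto simp: sets_mu)
        finally show ?case .
      qed
    qed
    also have "\<dots> = ennreal (K\<^sup>2 * C0 * m)" using m by (simp add: ennreal_mult'[symmetric] C0)
    finally have "Hsq \<psi> \<le> ennreal (K\<^sup>2 * m + K\<^sup>2 * C0 * m)" unfolding Hsq_def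
      using 1 m C0 by (intro ennreal_add_le) auto
    also have "K\<^sup>2 * m + K\<^sup>2 * C0 * m = (C * K)\<^sup>2" using m C0 by (simp add: C_def power_mult_distrib algebra_simps)
    finally show ?thesis .
  qed
  then show ?thesis using m C0 by (intro that[of C]) (auto simp: C_def)
qed

text \<open>The trace inequality bounds \<open>Hsq\<close> by the energy plus the L^2 norm on the
  ball of radius R + 1, which explains the support radius of the densities;
  \<open>rpot_dual_bound\<close> then estimates both.\<close>

lemma rpot_Hsq_bounds:
  obtains C where "0 \<le> C" "\<And>f B. bounded_supp (R + 1) f \<Longrightarrow> 0 \<le> B \<Longrightarrow>
      (\<And>h. bounded_supp (R + 1) h \<Longrightarrow> (LINT x|lborel. f x * rpot t h x)\<^sup>2 \<le> B * gag_energy b (rpot t h)) \<Longrightarrow>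
      Hsq (rpot t f) \<le> ennreal (C * B)"
    "\<And>f. bounded_supp (R + 1) f \<Longrightarrow> Hsq (rpot t f) \<le> ennreal (C * (LINT x|lborel. (f x)\<^sup>2))"
proof -
  obtain C1 where C1: "0 \<le> C1" "\<And>(v :: 'a \<Rightarrow> real) L. v \<in> borel_measurable borel \<Longrightarrow> (\<And>x y. \<bar>v x - v y\<bar> \<le> L * dist x y) \<Longrightarrow>
      (\<integral>\<^sup>+P. ennreal ((v P)\<^sup>2) \<partial>\<mu>) + (\<integral>\<^sup>+P. \<integral>\<^sup>+Q. ennreal ((v P - v Q)\<^sup>2 / norm (P - Q) powr \<kappa>) \<partial>\<mu> \<partial>\<mu>)
      \<le> ennreal C1 * ((\<integral>\<^sup>+x. ennreal ((v x)\<^sup>2) * (if norm x < R + 1 then 1 else 0) \<partial>lborel) +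
          (\<integral>\<^sup>+z. ennreal ((v (fst z) - v (snd z))\<^sup>2 * norm (fst z - snd z) powr (- b)) \<partial>(lborel \<Otimes>\<^sub>M lborel)))"
    by (rule trace_inequality[OF s N, folded \<kappa>_eq, folded b_eq], erule that, blast)
  obtain c where c: "\<And>\<rho> f :: 'a \<Rightarrow> real. bounded_supp \<rho> f \<Longrightarrow>
      integrable (lborel \<Otimes>\<^sub>M lborel) (\<lambda>z. (rpot t f (fst z) - rpot t f (snd z))\<^sup>2 * norm (fst z - snd z) powr (-b))"
    "\<And>\<rho> f :: 'a \<Rightarrow> real. bounded_supp \<rho> f \<Longrightarrow> gag_energy b (rpot t f) = c * (LINT x|lborel. f x * rpot t f x)"
    by (rule riesz_energy_identity[OF s N, folded t_eq b_eq], rule that)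
  obtain C2 where C2: "0 \<le> C2" "\<And>(f :: 'a \<Rightarrow> real) B. bounded_supp (R + 1) f \<Longrightarrow> 0 \<le> B \<Longrightarrow>
      (\<And>h. bounded_supp (R + 1) h \<Longrightarrow> (LINT x|lborel. f x * rpot t h x)\<^sup>2 \<le> B * gag_energy b (rpot t h)) \<Longrightarrow>
      gag_energy b (rpot t f) + (LINT z|lborel. indicator (ball 0 (R + 1)) z * (rpot t f z)\<^sup>2) \<le> C2 * B"
    "\<And>f :: 'a \<Rightarrow> real. bounded_supp (R + 1) f \<Longrightarrow>
      gag_energy b (rpot t f) + (LINT z|lborel. indicator (ball 0 (R + 1)) z * (rpot t f z)\<^sup>2) \<le> C2 * (LINT x|lborel. (f x)\<^sup>2)"
    by (rule rpot_dual_bound[OF s N, of "R + 1", folded t_eq b_eq], erule that, blast, blast)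
  have tr: "Hsq (rpot t f) \<le> ennreal (C1 * (gag_energy b (rpot t f) + (LINT z|lborel. indicator (ball 0 (R + 1)) z * (rpot t f z)\<^sup>2)))"
    if f: "bounded_supp (R + 1) f" for f
  proof -
    obtain L where L: "\<And>z z'::'a. \<bar>rpot t f z - rpot t f z'\<bar> \<le> L * norm (z - z')"
      by (rule rpot_lipschitz[OF f t_facts(1,4)], rule that)
    have cont: "continuous_on UNIV (rpot t f)" by (rule rpot_continuous[OF f t_facts(1,4)])
    have one: "bounded_supp (R + 1) (\<lambda>x::'a. indicator (ball 0 (R + 1)) x)"
      using bounded_supp_restrict[of "\<lambda>_. 1" "R + 1" 1] by simp
    have i: "integrable lborel (\<lambda>z. indicator (ball 0 (R + 1)) z * (rpot t f z)\<^sup>2)"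
      by (intro bounded_supp_mult_continuous_integrable[OF one] continuous_intros cont)
    have "Hsq (rpot t f) \<le> ennreal C1 * ((\<integral>\<^sup>+x. ennreal ((rpot t f x)\<^sup>2) * (if norm x < R + 1 then 1 else 0) \<partial>lborel) +
          (\<integral>\<^sup>+z. ennreal ((rpot t f (fst z) - rpot t f (snd z))\<^sup>2 * norm (fst z - snd z) powr (- b)) \<partial>(lborel \<Otimes>\<^sub>M lborel)))"
      unfolding Hsq_def by (rule C1(2)[of _ L]) (use L rpot_measurable[OF f t_facts(1,4)] in \<open>auto simp: dist_norm\<close>)
    also have "(\<integral>\<^sup>+z. ennreal ((rpot t f (fst z) - rpot t f (snd z))\<^sup>2 * norm (fst z - snd z) powr (- b)) \<partial>(lborel \<Otimes>\<^sub>M lborel)) = ennreal (gag_energy b (rpot t f))"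
      unfolding gag_energy_def by (rule nn_integral_eq_integral[OF c(1)[OF f]]) simp
    also have "(\<integral>\<^sup>+x. ennreal ((rpot t f x)\<^sup>2) * (if norm x < R + 1 then 1 else 0) \<partial>lborel) = (\<integral>\<^sup>+x. ennreal (indicator (ball 0 (R + 1)) x * (rpot t f x)\<^sup>2) \<partial>lborel)"
      by (intro nn_integral_cong) (simp add: indicator_def)
    also have "\<dots> = ennreal (LINT z|lborel. indicator (ball 0 (R + 1)) z * (rpot t f z)\<^sup>2)"
      by (rule nn_integral_eq_integral[OF i]) (simp add: indicator_def)
    also have "ennreal C1 * (ennreal (LINT z|lborel. indicator (ball 0 (R + 1)) z * (rpot t f z)\<^sup>2) + ennreal (gag_energy b (rpot t f)))
       = ennreal (C1 * (gag_energy b (rpot t f) + (LINT z|lborel. indicator (ball 0 (R + 1)) z * (rpot t f z)\<^sup>2)))"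
    proof -
      have "0 \<le> (LINT z|lborel. indicator (ball 0 (R + 1)) z * (rpot t f z)\<^sup>2)" by (intro integral_nonneg_AE) auto
      then show ?thesis using C1(1) gag_energy_nonneg[of b "rpot t f"]
        by (simp add: ennreal_mult' ennreal_plus[symmetric] add.commute del: ennreal_plus)
    qed
    finally show ?thesis .
  qed
  show ?thesis
  proof (rule that[of "C1 * C2"])
    show "0 \<le> C1 * C2" using C1 C2 by simp
    show "Hsq (rpot t f) \<le> ennreal (C1 * C2 * B)" if "bounded_supp (R + 1) f" "0 \<le> B"
      "\<And>h. bounded_supp (R + 1) h \<Longrightarrow> (LINT x|lborel. f x * rpot t h x)\<^sup>2 \<le> B * gag_energy b (rpot t h)" for f B
      unfolding mult.assoc by (rule order_trans[OF tr[OF that(1)]]) (intro ennreal_leI mult_left_mono C2(2) that C1(1))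
    show "Hsq (rpot t f) \<le> ennreal (C1 * C2 * (LINT x|lborel. (f x)\<^sup>2))" if "bounded_supp (R + 1) f" for f
      unfolding mult.assoc by (rule order_trans[OF tr[OF that(1)]]) (intro ennreal_leI mult_left_mono C2(3) that C1(1))
  qed
qed

text \<open>A functional is defined on all functions but constrained only on Borel functions of
  finite \<open>Hsq\<close>. Its bound \<Lambda> is an explicit number, which makes visible that
  later constants do not depend on the functional.\<close>

definition bfun :: "(('a \<Rightarrow> real) \<Rightarrow> real) \<Rightarrow> real \<Rightarrow> bool" where
  "bfun l \<Lambda> \<longleftrightarrow> 0 \<le> \<Lambda> \<and>
     (\<forall>\<psi>1 \<psi>2 c d. \<psi>1 \<in> borel_measurable borel \<longrightarrow> Hsq \<psi>1 < \<infinity> \<longrightarrow> \<psi>2 \<in> borel_measurable borel \<longrightarrow> Hsq \<psi>2 < \<infinity> \<longrightarrow>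
        l (\<lambda>P. c * \<psi>1 P + d * \<psi>2 P) = c * l \<psi>1 + d * l \<psi>2) \<and>
     (\<forall>\<psi>. \<psi> \<in> borel_measurable borel \<longrightarrow> Hsq \<psi> < \<infinity> \<longrightarrow> \<bar>l \<psi>\<bar> \<le> \<Lambda> * sqrt (enn2real (Hsq \<psi>)))"

lemma bfun_le:
  assumes "bfun l \<Lambda>" "\<psi> \<in> borel_measurable borel" "Hsq \<psi> \<le> ennreal (B\<^sup>2)" "0 \<le> B"
  shows "\<bar>l \<psi>\<bar> \<le> \<Lambda> * B"
proof -
  have fin: "Hsq \<psi> < \<infinity>" using assms(3) by (simp add: le_less_trans)
  have "enn2real (Hsq \<psi>) \<le> B\<^sup>2" using assms(3) by (metis enn2real_ennreal enn2real_mono ennreal_less_top zero_le_power2)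
  then have "sqrt (enn2real (Hsq \<psi>)) \<le> B" using assms(4) by (intro real_le_lsqrt) auto
  then have "\<Lambda> * sqrt (enn2real (Hsq \<psi>)) \<le> \<Lambda> * B" using assms(1) by (intro mult_left_mono) (auto simp: bfun_def)
  moreover have "\<bar>l \<psi>\<bar> \<le> \<Lambda> * sqrt (enn2real (Hsq \<psi>))" using assms(1,2) fin unfolding bfun_def by blast
  ultimately show ?thesis by linarith
qed

lemma bfun_lin:
  assumes "bfun l \<Lambda>" "\<psi>1 \<in> borel_measurable borel" "Hsq \<psi>1 < \<infinity>" "\<psi>2 \<in> borel_measurable borel" "Hsq \<psi>2 < \<infinity>"
  shows "l (\<lambda>P. c * \<psi>1 P + d * \<psi>2 P) = c * l \<psi>1 + d * l \<psi>2"
  using assms unfolding bfun_def by blast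

lemma bfun_add:
  assumes "bfun l \<Lambda>" "\<psi>1 \<in> borel_measurable borel" "Hsq \<psi>1 < \<infinity>" "\<psi>2 \<in> borel_measurable borel" "Hsq \<psi>2 < \<infinity>"
  shows "l (\<lambda>P. \<psi>1 P + \<psi>2 P) = l \<psi>1 + l \<psi>2"
  using bfun_lin[OF assms, of 1 1] by simp

lemma bfun_diff:
  assumes "bfun l \<Lambda>" "\<psi>1 \<in> borel_measurable borel" "Hsq \<psi>1 < \<infinity>" "\<psi>2 \<in> borel_measurable borel" "Hsq \<psi>2 < \<infinity>"
  shows "l (\<lambda>P. \<psi>1 P - \<psi>2 P) = l \<psi>1 - l \<psi>2"
  using bfun_lin[OF assms, of 1 "-1"] by simp

definition Kset :: "real \<Rightarrow> 'a set" where
  "Kset \<delta> = {x \<in> cball 0 R. \<forall>Q\<in>S. \<delta> \<le> dist x Q}"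

lemma compact_Kset: "compact (Kset \<delta>)"
proof -
  have "Kset \<delta> = cball 0 R \<inter> (\<Inter>Q\<in>S. {x. \<delta> \<le> dist x Q})" by (auto simp: Kset_def)
  moreover have "closed (\<Inter>Q\<in>S. {x. \<delta> \<le> dist x Q})"
    by (intro closed_INT ballI closed_Collect_le continuous_intros)
  ultimately show ?thesis by (simp add: compact_Int_closed)
qed

lemma Kset_borel [measurable]: "Kset \<delta> \<in> sets borel"
  by (intro borel_closed compact_imp_closed compact_Kset)

lemma rker_shift_measurable [measurable]: "(\<lambda>Q. rker t (x - Q)) \<in> borel_measurable borel"
  by (intro measurable_compose[OF _ rker_measurable] borel_measurable_continuous_onI continuous_intros)

text \<open>Away from \<open>S\<close> the kernel \<open>x \<mapsto> \<Gamma>(x - \<cdot>)\<close> is Hoelder continuous of order \<open>1/2\<close> with values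
  in the Hoelder space \<open>C\<^sup>1\<^sup>/\<^sup>2(S)\<close>; the order \<open>1/2\<close> exceeds \<open>s - 1/2\<close>, so this space embeds
  into \<open>H\<^sup>s\<^sup>-\<^sup>1\<^sup>/\<^sup>2\<close>.\<close>

lemma Kset_kernel_bounds:
  assumes \<delta>: "0 < \<delta>"
  obtains c where "0 \<le> c"
    "\<And>x P. x \<in> Kset \<delta> \<Longrightarrow> P \<in> S \<Longrightarrow> \<bar>rker t (x - P)\<bar> \<le> c"
    "\<And>x P Q. x \<in> Kset \<delta> \<Longrightarrow> P \<in> S \<Longrightarrow> Q \<in> S \<Longrightarrow> \<bar>rker t (x - P) - rker t (x - Q)\<bar> \<le> c * sqrt (dist P Q)"
    "\<And>x x' P. x \<in> Kset \<delta> \<Longrightarrow> x' \<in> Kset \<delta> \<Longrightarrow> P \<in> S \<Longrightarrow> \<bar>rker t (x - P) - rker t (x' - P)\<bar> \<le> c * sqrt (dist x x')"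
    "\<And>x x' P Q. x \<in> Kset \<delta> \<Longrightarrow> x' \<in> Kset \<delta> \<Longrightarrow> P \<in> S \<Longrightarrow> Q \<in> S \<Longrightarrow>
        \<bar>(rker t (x - P) - rker t (x' - P)) - (rker t (x - Q) - rker t (x' - Q))\<bar> \<le> c * sqrt (dist x x') * sqrt (dist P Q)"
proof -
  define e where "e = 2 * max 1 t * \<delta> powr (-(t+1))"
  define w where "w = sqrt (2 * R)"
  define c where "c = \<delta> powr (-t) + 2 * e + e * w"
  have nn: "0 \<le> e" "0 \<le> w" "0 \<le> \<delta> powr (-t)" using rho by (auto simp: e_def w_def)
  have ce: "e * w \<le> c" "2 * e \<le> c" "\<delta> powr (-t) \<le> c" using nn by (auto simp: c_def)
  have away: "\<delta> \<le> norm (x - P)" if "x \<in> Kset \<delta>" "P \<in> S" for x P using that by (auto simp: Kset_def dist_norm)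
  have lip: "\<bar>rker t (x - P) - rker t (x' - P')\<bar> \<le> e * norm ((x - P) - (x' - P'))"
    if "x \<in> Kset \<delta>" "P \<in> S" "x' \<in> Kset \<delta>" "P' \<in> S" for x P x' P'
    unfolding e_def using rker_lipschitz_away[OF t_facts(1) \<delta> away away] that by blast
  \<comment> \<open>At distances at most 2R a Lipschitz bound implies one of order 1/2.\<close>
  have sq: "r \<le> w * sqrt r" if "0 \<le> r" "r \<le> 2 * R" for r
  proof -
    have "r = sqrt r * sqrt r" using that by simp
    also have "\<dots> \<le> w * sqrt r" unfolding w_def using that by (intro mult_right_mono) auto
    finally show ?thesis .
  qed
  have dS: "dist P Q \<le> 2 * R" if "P \<in> cball 0 R" "Q \<in> cball 0 R" for P Q :: 'a
    using dist_triangle[of P Q 0] that by (simp add: dist_commute)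
  have KS: "Kset \<delta> \<subseteq> cball 0 R" by (auto simp: Kset_def)
  show ?thesis
  proof (rule that[of c])
    show "0 \<le> c" using nn by (simp add: c_def)
    show "\<bar>rker t (x - P)\<bar> \<le> c" if "x \<in> Kset \<delta>" "P \<in> S" for x P
      using rker_bound_away[OF \<delta> away[OF that] t_facts(2)] ce by simp
    show "\<bar>rker t (x - P) - rker t (x - Q)\<bar> \<le> c * sqrt (dist P Q)" if "x \<in> Kset \<delta>" "P \<in> S" "Q \<in> S" for x P Q
    proof -
      have "\<bar>rker t (x - P) - rker t (x - Q)\<bar> \<le> e * dist P Q"
        using lip[OF that(1,2,1,3)] by (simp add: dist_norm norm_minus_commute)
      also have "\<dots> \<le> e * (w * sqrt (dist P Q))" using that S_sub nn by (intro mult_left_mono sq dS) auto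
      also have "\<dots> \<le> c * sqrt (dist P Q)" unfolding mult.assoc[symmetric] by (intro mult_right_mono ce) simp
      finally show ?thesis .
    qed
    show 4: "\<bar>rker t (x - P) - rker t (x' - P)\<bar> \<le> c * sqrt (dist x x')" if "x \<in> Kset \<delta>" "x' \<in> Kset \<delta>" "P \<in> S" for x x' P
    proof -
      have "\<bar>rker t (x - P) - rker t (x' - P)\<bar> \<le> e * dist x x'"
        using lip[OF that(1,3,2,3)] by (simp add: dist_norm)
      also have "\<dots> \<le> e * (w * sqrt (dist x x'))" using that KS nn by (intro mult_left_mono sq dS) auto
      also have "\<dots> \<le> c * sqrt (dist x x')" unfolding mult.assoc[symmetric] by (intro mult_right_mono ce) simp
      finally show ?thesis .
    qed
    show "\<bar>(rker t (x - P) - rker t (x' - P)) - (rker t (x - Q) - rker t (x' - Q))\<bar> \<le> c * sqrt (dist x x') * sqrt (dist P Q)"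
      if "x \<in> Kset \<delta>" "x' \<in> Kset \<delta>" "P \<in> S" "Q \<in> S" for x x' P Q
    proof -
      let ?D = "\<bar>(rker t (x - P) - rker t (x' - P)) - (rker t (x - Q) - rker t (x' - Q))\<bar>"
      have "?D \<le> \<bar>rker t (x - P) - rker t (x' - P)\<bar> + \<bar>rker t (x - Q) - rker t (x' - Q)\<bar>" by linarith
      also have "\<dots> \<le> e * dist x x' + e * dist x x'"
        using lip[OF that(1,3,2,3)] lip[OF that(1,4,2,4)] by (intro add_mono) (auto simp: dist_norm)
      finally have 1: "?D \<le> 2 * e * dist x x'" by simp
      have "?D \<le> \<bar>rker t (x - P) - rker t (x - Q)\<bar> + \<bar>rker t (x' - P) - rker t (x' - Q)\<bar>" by linarith
      also have "\<dots> \<le> e * dist P Q + e * dist P Q"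
        using lip[OF that(1,3,1,4)] lip[OF that(2,3,2,4)] by (intro add_mono) (auto simp: dist_norm norm_minus_commute)
      finally have 2: "?D \<le> 2 * e * dist P Q" by simp
      \<comment> \<open>The double difference is Lipschitz in each pair of variables separately; the
        geometric mean of the two bounds is of order 1/2 in both at once.\<close>
      have "?D\<^sup>2 \<le> (2 * e * dist x x') * (2 * e * dist P Q)" unfolding power2_eq_square
        using nn by (intro mult_mono 1 2) auto
      also have "\<dots> = (2 * e * (sqrt (dist x x') * sqrt (dist P Q)))\<^sup>2"
          by (simp only: power_mult_distrib real_sqrt_pow2 zero_le_dist) (simp add: power2_eq_square)
      finally have "?D \<le> 2 * e * (sqrt (dist x x') * sqrt (dist P Q))"
        by (rule power2_le_imp_le) (use nn in simp)
      also have "\<dots> \<le> c * (sqrt (dist x x') * sqrt (dist P Q))" by (intro mult_right_mono ce) simp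
      finally show ?thesis by (simp add: mult.assoc)
    qed
  qed
qed

end

lemma bounded_pair_integrable:
  fixes h :: "'a::euclidean_space \<times> 'a \<Rightarrow> real"
  assumes [measurable]: "h \<in> borel_measurable (lborel \<Otimes>\<^sub>M lborel)"
    and bd: "\<And>z. \<bar>h z\<bar> \<le> M" and supp: "\<And>z. \<rho> \<le> norm (fst z) \<or> \<rho> \<le> norm (snd z) \<Longrightarrow> h z = 0"
  shows "integrable (lborel \<Otimes>\<^sub>M lborel) h"
proof -
  have M0: "0 \<le> M" using bd[of 0] by linarith
  have ib: "integrable lborel (indicator (ball (0::'a) \<rho>) :: 'a \<Rightarrow> real)"
    by (intro integrable_real_indicator emeasure_lborel_ball_finite) simp
  show ?thesis
  proof (rule Bochner_Integration.integrable_bound)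
    show "integrable (lborel \<Otimes>\<^sub>M lborel) (\<lambda>z. M * (\<lambda>(x, y). indicator (ball (0::'a) \<rho>) x * indicator (ball (0::'a) \<rho>) y) z :: real)"
      by (intro integrable_mult_right integrable_pair_product ib)
    show "AE z in lborel \<Otimes>\<^sub>M lborel. norm (h z) \<le> norm (M * (\<lambda>(x, y). indicator (ball (0::'a) \<rho>) x * indicator (ball (0::'a) \<rho>) y) z :: real)"
    proof (rule AE_I2)
      fix z :: "'a \<times> 'a"
      show "norm (h z) \<le> norm (M * (\<lambda>(x, y). indicator (ball (0::'a) \<rho>) x * indicator (ball (0::'a) \<rho>) y) z :: real)"
        using bd[of z] supp[of z] M0 by (cases "norm (fst z) < \<rho> \<and> norm (snd z) < \<rho>") (auto simp: case_prod_beta indicator_def)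
    qed
  qed fact
qed

lemma holder_half_continuous:
  fixes u :: "'a::metric_space \<Rightarrow> real"
  assumes "\<And>x y. x \<in> K \<Longrightarrow> y \<in> K \<Longrightarrow> \<bar>u x - u y\<bar> \<le> M * sqrt (dist x y)"
  shows "continuous_on K u"
  unfolding continuous_on_def
proof
  fix x assume x: "x \<in> K"
  have "((\<lambda>y. u y - u x) \<longlongrightarrow> 0) (at x within K)"
  proof (rule Lim_null_comparison)
    show "\<forall>\<^sub>F y in at x within K. norm (u y - u x) \<le> M * sqrt (dist y x)"
      unfolding eventually_at_filter using assms x by (auto intro!: always_eventually)
    have "((\<lambda>y. M * sqrt (dist y x)) \<longlongrightarrow> M * sqrt (dist x x)) (at x within K)"
      by (intro tendsto_intros)
    then show "((\<lambda>y. M * sqrt (dist y x)) \<longlongrightarrow> 0) (at x within K)" by simp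
  qed
  then show "(u \<longlongrightarrow> u x) (at x within K)" by (simp add: LIM_zero_iff)
qed

section \<open>Exchanging the functional with integrals away from \<open>S\<close>\<close>

context layer
begin

text \<open>The last bound is the error of concentrating the density \<open>g\<close> at the point
  \<open>p\<close>. It is proportional to the L^1 norm of \<open>g\<close>, so that such errors add
  up over a partition.\<close>

lemma Kset_Hsq_bounds:
  assumes \<delta>: "0 < \<delta>"
  obtains c where "0 \<le> c"
    "\<And>x. x \<in> Kset \<delta> \<Longrightarrow> Hsq (\<lambda>Q. rker t (x - Q)) \<le> ennreal (c\<^sup>2)"
    "\<And>x x'. x \<in> Kset \<delta> \<Longrightarrow> x' \<in> Kset \<delta> \<Longrightarrow> Hsq (\<lambda>Q. rker t (x - Q) - rker t (x' - Q)) \<le> ennreal ((c * sqrt (dist x x'))\<^sup>2)"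
    "\<And>g p \<eta>. bounded_supp (R + 1) g \<Longrightarrow> p \<in> Kset \<delta> \<Longrightarrow> 0 \<le> \<eta> \<Longrightarrow> (\<And>x. g x \<noteq> 0 \<Longrightarrow> x \<in> Kset \<delta> \<and> dist x p \<le> \<eta>) \<Longrightarrow>
       Hsq (\<lambda>Q. rpot t g Q - (LINT x|lborel. g x) * rker t (p - Q)) \<le> ennreal ((c * sqrt \<eta> * (LINT x|lborel. \<bar>g x\<bar>))\<^sup>2)"
proof -
  obtain C where C: "0 \<le> C" "\<And>\<psi> K. 0 \<le> K \<Longrightarrow> (\<And>P. P \<in> S \<Longrightarrow> \<bar>\<psi> P\<bar> \<le> K) \<Longrightarrow>
     (\<And>P Q. P \<in> S \<Longrightarrow> Q \<in> S \<Longrightarrow> \<bar>\<psi> P - \<psi> Q\<bar> \<le> K * sqrt (dist P Q)) \<Longrightarrow> Hsq \<psi> \<le> ennreal ((C * K)\<^sup>2)"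
    by (rule Hsq_holder, erule that, blast)
  obtain c where c: "0 \<le> c"
    "\<And>x P. x \<in> Kset \<delta> \<Longrightarrow> P \<in> S \<Longrightarrow> \<bar>rker t (x - P)\<bar> \<le> c"
    "\<And>x P Q. x \<in> Kset \<delta> \<Longrightarrow> P \<in> S \<Longrightarrow> Q \<in> S \<Longrightarrow> \<bar>rker t (x - P) - rker t (x - Q)\<bar> \<le> c * sqrt (dist P Q)"
    "\<And>x x' P. x \<in> Kset \<delta> \<Longrightarrow> x' \<in> Kset \<delta> \<Longrightarrow> P \<in> S \<Longrightarrow> \<bar>rker t (x - P) - rker t (x' - P)\<bar> \<le> c * sqrt (dist x x')"
    "\<And>x x' P Q. x \<in> Kset \<delta> \<Longrightarrow> x' \<in> Kset \<delta> \<Longrightarrow> P \<in> S \<Longrightarrow> Q \<in> S \<Longrightarrow>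
        \<bar>(rker t (x - P) - rker t (x' - P)) - (rker t (x - Q) - rker t (x' - Q))\<bar> \<le> c * sqrt (dist x x') * sqrt (dist P Q)"
    by (rule Kset_kernel_bounds[OF \<delta>], erule that, blast+)
  show ?thesis
  proof (rule that[of "C * c"])
    show "0 \<le> C * c" using C(1) c(1) by simp
    show "Hsq (\<lambda>Q. rker t (x - Q)) \<le> ennreal ((C * c)\<^sup>2)" if "x \<in> Kset \<delta>" for x
      using C(2)[of c "\<lambda>Q. rker t (x - Q)"] c that by blast
    show "Hsq (\<lambda>Q. rker t (x - Q) - rker t (x' - Q)) \<le> ennreal ((C * c * sqrt (dist x x'))\<^sup>2)" if "x \<in> Kset \<delta>" "x' \<in> Kset \<delta>" for x x'
    proof -
      have "0 \<le> c * sqrt (dist x x')" using c(1) by simp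
      then show ?thesis
        using C(2)[of "c * sqrt (dist x x')" "\<lambda>Q. rker t (x - Q) - rker t (x' - Q)"] c(4,5) that by (simp add: mult.assoc)
    qed
    fix g p \<eta>
    assume g: "bounded_supp (R + 1) g" and p: "p \<in> Kset \<delta>" and \<eta>: "0 \<le> \<eta>"
      and supp: "\<And>x. g x \<noteq> 0 \<Longrightarrow> x \<in> Kset \<delta> \<and> dist x p \<le> \<eta>"
    let ?I = "LINT x|lborel. \<bar>g x\<bar>"
    have gi: "integrable lborel g"
      using bounded_supp_integrable_mult[OF g, of "\<lambda>_. 1" 1] by simp
    have ik: "integrable lborel (\<lambda>x. g x * rker t (x - Q))" for Q by (rule rker_integrable[OF g t_facts(2,3)])
    have repr: "rpot t g Q - (LINT x|lborel. g x) * rker t (p - Q) = (LINT x|lborel. g x * (rker t (x - Q) - rker t (p - Q)))" for Q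
    proof -
      have "(LINT x|lborel. g x * (rker t (x - Q) - rker t (p - Q))) = (LINT x|lborel. g x * rker t (x - Q) - g x * rker t (p - Q))"
        by (simp only: right_diff_distrib)
      also have "\<dots> = rpot t g Q - (LINT x|lborel. g x * rker t (p - Q))" unfolding rpot_def
        by (intro Bochner_Integration.integral_diff ik integrable_mult_left gi)
      finally show ?thesis by simp
    qed
    have ibound: "\<bar>LINT x|lborel. g x * k x\<bar> \<le> B * ?I" if k: "\<And>x. g x \<noteq> 0 \<Longrightarrow> \<bar>k x\<bar> \<le> B" and B: "0 \<le> B" for k B
    proof -
      have le: "\<bar>g x * k x\<bar> \<le> B * \<bar>g x\<bar>" for x
        using mult_left_mono[OF k, of x "\<bar>g x\<bar>"] by (cases "g x = 0") (auto simp: abs_mult mult.commute)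
      show ?thesis
      proof (cases "integrable lborel (\<lambda>x. g x * k x)")
        case True
        have "\<bar>LINT x|lborel. g x * k x\<bar> \<le> (LINT x|lborel. \<bar>g x * k x\<bar>)" by (rule integral_abs_bound)
        also have "\<dots> \<le> (LINT x|lborel. B * \<bar>g x\<bar>)"
          by (rule integral_mono) (use True gi le in auto)
        finally show ?thesis by simp
      next
        \<comment> \<open>A non-integrable product has Bochner integral 0, so the bound covers every
          \<open>k\<close>, measurable or not.\<close>
        case False
        then show ?thesis using B by (simp add: not_integrable_integral_eq)
      qed
    qed
    have I0: "0 \<le> ?I" by simp
    have sq: "sqrt (dist x p) \<le> sqrt \<eta>" if "g x \<noteq> 0" for x using supp[OF that] by simp
    have "Hsq (\<lambda>Q. rpot t g Q - (LINT x|lborel. g x) * rker t (p - Q)) \<le> ennreal ((C * (c * sqrt \<eta> * ?I))\<^sup>2)"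
    proof (rule C(2))
      show "0 \<le> c * sqrt \<eta> * ?I" using c(1) \<eta> by simp
      show "\<bar>rpot t g P - (LINT x|lborel. g x) * rker t (p - P)\<bar> \<le> c * sqrt \<eta> * ?I" if P: "P \<in> S" for P
        unfolding repr
      proof (rule ibound)
        fix x assume x: "g x \<noteq> 0"
        have "\<bar>rker t (x - P) - rker t (p - P)\<bar> \<le> c * sqrt (dist x p)" using c(4) supp[OF x] p P by blast
        also have "\<dots> \<le> c * sqrt \<eta>" using sq[OF x] c(1) by (intro mult_left_mono)
        finally show "\<bar>rker t (x - P) - rker t (p - P)\<bar> \<le> c * sqrt \<eta>" .
      qed (use c(1) \<eta> in simp)
      show "\<bar>(rpot t g P - (LINT x|lborel. g x) * rker t (p - P)) - (rpot t g Q - (LINT x|lborel. g x) * rker t (p - Q))\<bar> \<le> c * sqrt \<eta> * ?I * sqrt (dist P Q)"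
        if PQ: "P \<in> S" "Q \<in> S" for P Q
      proof -
        have ii: "integrable lborel (\<lambda>x. g x * (rker t (x - Q) - rker t (p - Q)))" for Q
          unfolding right_diff_distrib by (intro Bochner_Integration.integrable_diff ik integrable_mult_left gi)
        have "(rpot t g P - (LINT x|lborel. g x) * rker t (p - P)) - (rpot t g Q - (LINT x|lborel. g x) * rker t (p - Q))
          = (LINT x|lborel. g x * (rker t (x - P) - rker t (p - P)) - g x * (rker t (x - Q) - rker t (p - Q)))"
          unfolding repr by (rule Bochner_Integration.integral_diff[symmetric]) (rule ii)+
        also have "\<dots> = (LINT x|lborel. g x * ((rker t (x - P) - rker t (p - P)) - (rker t (x - Q) - rker t (p - Q))))"
          by (simp only: right_diff_distrib)
        also have "\<bar>\<dots>\<bar> \<le> (c * sqrt \<eta> * sqrt (dist P Q)) * ?I"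
        proof (rule ibound)
          fix x assume x: "g x \<noteq> 0"
          have "\<bar>(rker t (x - P) - rker t (p - P)) - (rker t (x - Q) - rker t (p - Q))\<bar> \<le> c * sqrt (dist x p) * sqrt (dist P Q)"
            using c(5) supp[OF x] p PQ by blast
          also have "\<dots> \<le> c * sqrt \<eta> * sqrt (dist P Q)" using sq[OF x] c(1) by (intro mult_right_mono mult_left_mono) auto
          finally show "\<bar>(rker t (x - P) - rker t (p - P)) - (rker t (x - Q) - rker t (p - Q))\<bar> \<le> c * sqrt \<eta> * sqrt (dist P Q)" .
        qed (use c(1) \<eta> in simp)
        finally show ?thesis by (simp only: ac_simps)
      qed
    qed
    then show "Hsq (\<lambda>Q. rpot t g Q - (LINT x|lborel. g x) * rker t (p - Q)) \<le> ennreal ((C * c * sqrt \<eta> * ?I)\<^sup>2)"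
      by (simp only: mult.assoc)
  qed
qed

text \<open>Zero outside \<open>Kset \<delta>\<close>, which makes it a bounded density that can
  itself be fed into \<open>rpot\<close>.\<close>

definition lay :: "(('a \<Rightarrow> real) \<Rightarrow> real) \<Rightarrow> real \<Rightarrow> 'a \<Rightarrow> real" where
  "lay l \<delta> x = indicator (Kset \<delta>) x * l (\<lambda>Q. rker t (x - Q))"

text \<open>As the functional is abstract, measurability in x is obtained from continuity: the
  kernel depends on x in a Hoelder way with respect to the norm of \<open>Hsq\<close>, and
  \<open>l\<close> preserves this.\<close>

lemma lay_regular:
  assumes l: "bfun l \<Lambda>" and \<delta>: "0 < \<delta>"
  shows "bounded_supp (R + 1) (lay l \<delta>)" and "continuous_on (Kset \<delta>) (\<lambda>x. l (\<lambda>Q. rker t (x - Q)))"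
proof -
  obtain c where c: "0 \<le> c"
    "\<And>x. x \<in> Kset \<delta> \<Longrightarrow> Hsq (\<lambda>Q. rker t (x - Q)) \<le> ennreal (c\<^sup>2)"
    "\<And>x x'. x \<in> Kset \<delta> \<Longrightarrow> x' \<in> Kset \<delta> \<Longrightarrow> Hsq (\<lambda>Q. rker t (x - Q) - rker t (x' - Q)) \<le> ennreal ((c * sqrt (dist x x'))\<^sup>2)"
    by (rule Kset_Hsq_bounds[OF \<delta>], erule that, blast+)
  have fin: "Hsq (\<lambda>Q. rker t (x - Q)) < \<infinity>" if "x \<in> Kset \<delta>" for x
    using c(2)[OF that] by (simp add: le_less_trans)
  have hol: "\<bar>l (\<lambda>Q. rker t (x - Q)) - l (\<lambda>Q. rker t (y - Q))\<bar> \<le> (\<Lambda> * c) * sqrt (dist x y)" if "x \<in> Kset \<delta>" "y \<in> Kset \<delta>" for x y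
  proof -
    have "l (\<lambda>Q. rker t (x - Q)) - l (\<lambda>Q. rker t (y - Q)) = l (\<lambda>Q. rker t (x - Q) - rker t (y - Q))"
      by (rule bfun_diff[OF l, symmetric]) (use fin that in auto)
    also have "\<bar>\<dots>\<bar> \<le> \<Lambda> * (c * sqrt (dist x y))"
      by (rule bfun_le[OF l _ c(3)[OF that]]) (use c(1) in auto)
    finally show ?thesis by simp
  qed
  show cont: "continuous_on (Kset \<delta>) (\<lambda>x. l (\<lambda>Q. rker t (x - Q)))"
    by (rule holder_half_continuous[OF hol])
  have "(\<lambda>x. indicator (Kset \<delta>) x *\<^sub>R l (\<lambda>Q. rker t (x - Q))) \<in> borel_measurable borel"
    by (intro borel_measurable_continuous_on_indicator cont) simp
  then have m: "lay l \<delta> \<in> borel_measurable borel" unfolding lay_def[abs_def] by simp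
  have bd: "\<bar>lay l \<delta> x\<bar> \<le> \<Lambda> * c" for x
  proof (cases "x \<in> Kset \<delta>")
    case True
    then show ?thesis using bfun_le[OF l _ c(2)[OF True] c(1)] by (simp add: lay_def)
  next
    case False
    then show ?thesis using l c(1) by (simp add: lay_def bfun_def)
  qed
  show "bounded_supp (R + 1) (lay l \<delta>)" unfolding bounded_supp_def
  proof (intro conjI exI[of _ "\<Lambda> * c"] allI impI m bd)
    fix x :: 'a assume "R + 1 \<le> norm x"
    then show "lay l \<delta> x = 0" by (simp add: lay_def Kset_def indicator_def)
  qed
qed

lemma rpot_Hsq_finite:
  assumes "bounded_supp (R + 1) f"
  shows "Hsq (rpot t f) < \<infinity>"
proof -
  obtain C where "0 \<le> C" "\<And>f. bounded_supp (R + 1) f \<Longrightarrow> Hsq (rpot t f) \<le> ennreal (C * (LINT x|lborel. (f x)\<^sup>2))"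
    by (rule rpot_Hsq_bounds, erule that, blast)
  from this(2)[OF assms] show ?thesis by (simp add: le_less_trans)
qed

lemma bounded_supp_indicator:
  assumes f: "bounded_supp \<rho> f" and A: "A' \<in> sets borel"
  shows "bounded_supp \<rho> (\<lambda>x. f x * indicator A' x)"
proof -
  obtain M where M: "0 \<le> M" "\<And>x. \<bar>f x\<bar> \<le> M" "\<And>x. \<bar>f x\<bar> \<le> M * indicator (ball 0 \<rho>) x"
    by (rule bounded_supp_boundE[OF f], rule that)
  have "(\<lambda>x. f x * indicator A' x) \<in> borel_measurable borel"
    using bounded_supp_measurable[OF f] A by (intro borel_measurable_times borel_measurable_indicator)
  moreover have "\<bar>f x * indicator A' x\<bar> \<le> M" for x using M(1) M(2)[of x] by (simp add: indicator_def)
  ultimately show ?thesis using f unfolding bounded_supp_def by auto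
qed

text \<open>Both sides of the interchange are additive in the domain of integration, and on a piece of
  diameter \<open>\<eta>\<close> they differ by \<open>O(\<eta>\<^sup>1\<^sup>/\<^sup>2)\<close> times the \<open>L\<^sup>1\<close> norm of \<open>f\<close> there.\<close>

lemma layer_interchange:
  assumes l: "bfun l \<Lambda>" and \<delta>: "0 < \<delta>" and f: "bounded_supp (R + 1) f" and supp: "\<And>x. x \<notin> Kset \<delta> \<Longrightarrow> f x = 0"
  shows "l (rpot t f) = (LINT x|lborel. f x * lay l \<delta> x)"
proof -
  let ?u = "lay l \<delta>"
  obtain c where c: "0 \<le> c"
    "\<And>x. x \<in> Kset \<delta> \<Longrightarrow> Hsq (\<lambda>Q. rker t (x - Q)) \<le> ennreal (c\<^sup>2)"
    "\<And>x x'. x \<in> Kset \<delta> \<Longrightarrow> x' \<in> Kset \<delta> \<Longrightarrow> Hsq (\<lambda>Q. rker t (x - Q) - rker t (x' - Q)) \<le> ennreal ((c * sqrt (dist x x'))\<^sup>2)"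
    "\<And>g p \<eta>. bounded_supp (R + 1) g \<Longrightarrow> p \<in> Kset \<delta> \<Longrightarrow> 0 \<le> \<eta> \<Longrightarrow> (\<And>x. g x \<noteq> 0 \<Longrightarrow> x \<in> Kset \<delta> \<and> dist x p \<le> \<eta>) \<Longrightarrow>
       Hsq (\<lambda>Q. rpot t g Q - (LINT x|lborel. g x) * rker t (p - Q)) \<le> ennreal ((c * sqrt \<eta> * (LINT x|lborel. \<bar>g x\<bar>))\<^sup>2)"
    by (rule Kset_Hsq_bounds[OF \<delta>], erule that, blast+)
  have \<Lambda>: "0 \<le> \<Lambda>" using l by (simp add: bfun_def)
  have fin: "Hsq (\<lambda>Q. rker t (x - Q)) < \<infinity>" if "x \<in> Kset \<delta>" for x
    using c(2)[OF that] by (simp add: le_less_trans)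
  have u: "bounded_supp (R + 1) ?u" by (rule lay_regular[OF l \<delta>])
  obtain Mu where Mu: "0 \<le> Mu" "\<And>x. \<bar>?u x\<bar> \<le> Mu" "\<And>x. \<bar>?u x\<bar> \<le> Mu * indicator (ball 0 (R + 1)) x"
    by (rule bounded_supp_boundE[OF u], rule that)
  have iu: "integrable lborel (\<lambda>x. g x * ?u x)" if "bounded_supp (R + 1) g" for g
    by (rule bounded_supp_integrable_mult[OF that bounded_supp_measurable[OF u]]) (rule Mu(2))
  have i1: "integrable lborel g" if "bounded_supp (R + 1) g" for g :: "'a \<Rightarrow> real"
    using bounded_supp_integrable_mult[OF that, of "\<lambda>_. 1" 1] by simp
  have rm: "rpot t g \<in> borel_measurable borel" if "bounded_supp (R + 1) g" for g :: "'a \<Rightarrow> real"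
    by (rule rpot_measurable[OF that t_facts(1,4)])
  \<comment> \<open>The defect of the interchange, additive in the density. On a small piece both of
    its terms are compared with the same point mass at \<open>p\<close>.\<close>
  define \<Phi> where "\<Phi> g = (LINT x|lborel. g x * ?u x) - l (rpot t g)" for g
  have add: "\<Phi> (\<lambda>x. g x + h x) = \<Phi> g + \<Phi> h" if g: "bounded_supp (R + 1) g" and h: "bounded_supp (R + 1) h" for g h
  proof -
    have "rpot t (\<lambda>x. g x + h x) = (\<lambda>P. rpot t g P + rpot t h P)"
      unfolding rpot_def distrib_right
      by (intro ext Bochner_Integration.integral_add rker_integrable[OF g t_facts(2,3)] rker_integrable[OF h t_facts(2,3)])
    then have "l (rpot t (\<lambda>x. g x + h x)) = l (rpot t g) + l (rpot t h)"
      using bfun_add[OF l rm[OF g] rpot_Hsq_finite[OF g] rm[OF h] rpot_Hsq_finite[OF h]] by simp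
    moreover have "(LINT x|lborel. (g x + h x) * ?u x) = (LINT x|lborel. g x * ?u x) + (LINT x|lborel. h x * ?u x)"
      unfolding distrib_right by (intro Bochner_Integration.integral_add iu g h)
    ultimately show ?thesis by (simp add: \<Phi>_def)
  qed
  have small: "\<bar>\<Phi> g\<bar> \<le> 2 * \<Lambda> * c * sqrt \<eta> * (LINT x|lborel. \<bar>g x\<bar>)"
    if g: "bounded_supp (R + 1) g" and p: "p \<in> Kset \<delta>" and \<eta>: "0 \<le> \<eta>" and sg: "\<And>x. g x \<noteq> 0 \<Longrightarrow> x \<in> Kset \<delta> \<and> dist x p \<le> \<eta>" for g p \<eta>
  proof -
    let ?I = "LINT x|lborel. \<bar>g x\<bar>" and ?G = "LINT x|lborel. g x"
    let ?up = "l (\<lambda>Q. rker t (p - Q))"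
    have "\<bar>l (rpot t g) - ?G * ?up\<bar> \<le> \<Lambda> * (c * sqrt \<eta> * ?I)"
    proof -
      have "l (rpot t g) - ?G * ?up = l (\<lambda>P. 1 * rpot t g P + (- ?G) * rker t (p - P))"
        using bfun_lin[OF l rm[OF g] rpot_Hsq_finite[OF g] _ fin[OF p], of 1 "- ?G"] by simp
      also have "\<dots> = l (\<lambda>P. rpot t g P - ?G * rker t (p - P))" by simp
      also have "\<bar>\<dots>\<bar> \<le> \<Lambda> * (c * sqrt \<eta> * ?I)"
        by (rule bfun_le[OF l _ c(4)[OF g p \<eta> sg]])
          (use c(1) \<eta> rm[OF g] in \<open>auto intro!: borel_measurable_diff borel_measurable_times\<close>)
      finally show ?thesis .
    qed
    moreover have "\<bar>(LINT x|lborel. g x * ?u x) - ?G * ?up\<bar> \<le> \<Lambda> * (c * sqrt \<eta> * ?I)"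
    proof -
      have "(LINT x|lborel. g x * ?u x) - ?G * ?up = (LINT x|lborel. g x * ?u x - g x * ?up)"
        using iu[OF g] i1[OF g] by (subst Bochner_Integration.integral_diff) auto
      also have "\<bar>\<dots>\<bar> \<le> (LINT x|lborel. \<bar>g x * ?u x - g x * ?up\<bar>)" by (rule integral_abs_bound)
      also have "\<dots> \<le> (LINT x|lborel. (\<Lambda> * (c * sqrt \<eta>)) * \<bar>g x\<bar>)"
      proof (rule integral_mono)
        show "integrable lborel (\<lambda>x. \<bar>g x * ?u x - g x * ?up\<bar>)" using iu[OF g] i1[OF g] by auto
        show "integrable lborel (\<lambda>x. (\<Lambda> * (c * sqrt \<eta>)) * \<bar>g x\<bar>)" using i1[OF g] by auto
        fix x
        show "\<bar>g x * ?u x - g x * ?up\<bar> \<le> (\<Lambda> * (c * sqrt \<eta>)) * \<bar>g x\<bar>"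
        proof (cases "g x = 0")
          case False
          then have x: "x \<in> Kset \<delta>" "dist x p \<le> \<eta>" using sg by auto
          have "?u x - ?up = l (\<lambda>Q. rker t (x - Q) - rker t (p - Q))"
            using bfun_diff[OF l _ fin[OF x(1)] _ fin[OF p]] x(1) by (simp add: lay_def)
          also have "\<bar>\<dots>\<bar> \<le> \<Lambda> * (c * sqrt (dist x p))"
            by (rule bfun_le[OF l _ c(3)[OF x(1) p]]) (use c(1) in auto)
          also have "\<dots> \<le> \<Lambda> * (c * sqrt \<eta>)" using x \<Lambda> c(1) by (intro mult_left_mono) auto
          finally have "\<bar>g x\<bar> * \<bar>?u x - ?up\<bar> \<le> \<bar>g x\<bar> * (\<Lambda> * (c * sqrt \<eta>))" by (rule mult_left_mono) simp
          then show ?thesis by (simp only: right_diff_distrib[symmetric] abs_mult mult.commute)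
        qed simp
      qed
      finally show ?thesis by simp
    qed
    ultimately show ?thesis unfolding \<Phi>_def by (simp add: algebra_simps)
  qed
  \<comment> \<open>Induction on the cover, splitting off one ball at a time. The pieces are
    disjoint, so their L^1 norms add exactly and the error does not grow with the number of
    balls.\<close>
  have cover: "\<bar>\<Phi> (\<lambda>x. f x * indicator A' x)\<bar> \<le> 2 * \<Lambda> * c * sqrt \<eta> * (LINT x|lborel. \<bar>f x * indicator A' x\<bar>)"
    if "finite F" "F \<subseteq> Kset \<delta>" "A' \<in> sets borel" "A' \<subseteq> (\<Union>p\<in>F. ball p \<eta>)" "0 \<le> \<eta>" for F A' \<eta>
    using that
  proof (induction F arbitrary: A' rule: finite_induct)
    case empty
    then have "A' = {}" by simp
    have "\<bar>\<Phi> (\<lambda>x. f x * indicator {} x)\<bar> \<le> 0"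
    proof -
      have z: "bounded_supp (R + 1) (\<lambda>x::'a. 0)" by (simp add: bounded_supp_def) auto
      then have "\<Phi> (\<lambda>x. 0) = \<Phi> (\<lambda>x. 0) + \<Phi> (\<lambda>x. 0)" using add[OF z z] by simp
      then show ?thesis by simp
    qed
    then show ?case using \<open>A' = {}\<close> by simp
  next
    case (insert p F)
    let ?A1 = "A' \<inter> ball p \<eta>" and ?A2 = "A' - ball p \<eta>"
    have m: "?A1 \<in> sets borel" "?A2 \<in> sets borel" using insert.prems by auto
    have b1: "bounded_supp (R + 1) (\<lambda>x. f x * indicator ?A1 x)" and b2: "bounded_supp (R + 1) (\<lambda>x. f x * indicator ?A2 x)"
      by (intro bounded_supp_indicator f m)+
    have split: "(f x * indicator A' x :: real) = f x * indicator ?A1 x + f x * indicator ?A2 x" for x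
      by (simp add: indicator_def)
    have "\<bar>\<Phi> (\<lambda>x. f x * indicator ?A1 x)\<bar> \<le> 2 * \<Lambda> * c * sqrt \<eta> * (LINT x|lborel. \<bar>f x * indicator ?A1 x\<bar>)"
    proof (rule small[OF b1, of p])
      show "p \<in> Kset \<delta>" using insert.prems by simp
      fix x assume "f x * indicator ?A1 x \<noteq> 0"
      then have "f x \<noteq> 0" "x \<in> ball p \<eta>" by (auto simp: indicator_def split: if_splits)
      then show "x \<in> Kset \<delta> \<and> dist x p \<le> \<eta>" using supp[of x] by (auto simp: dist_commute)
    qed (use insert.prems in simp)
    moreover have "\<bar>\<Phi> (\<lambda>x. f x * indicator ?A2 x)\<bar> \<le> 2 * \<Lambda> * c * sqrt \<eta> * (LINT x|lborel. \<bar>f x * indicator ?A2 x\<bar>)"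
      using insert.prems m by (intro insert.IH) auto
    moreover have "\<Phi> (\<lambda>x. f x * indicator A' x) = \<Phi> (\<lambda>x. f x * indicator ?A1 x) + \<Phi> (\<lambda>x. f x * indicator ?A2 x)"
      unfolding split by (rule add[OF b1 b2])
    moreover have "(LINT x|lborel. \<bar>f x * indicator A' x\<bar>) = (LINT x|lborel. \<bar>f x * indicator ?A1 x\<bar>) + (LINT x|lborel. \<bar>f x * indicator ?A2 x\<bar>)"
    proof -
      have "\<bar>f x * indicator A' x\<bar> = \<bar>f x * indicator ?A1 x\<bar> + \<bar>f x * indicator ?A2 x\<bar>" for x by (simp add: indicator_def)
      then show ?thesis using i1[OF b1] i1[OF b2] by simp
    qed
    ultimately show ?case by (simp only: distrib_left)
  qed
  define I where "I = (LINT x|lborel. \<bar>f x\<bar>)"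
  have fK: "(\<lambda>x. f x * indicator (Kset \<delta>) x) = f"
  proof (rule ext)
    show "f x * indicator (Kset \<delta>) x = f x" for x using supp[of x] by (cases "x \<in> Kset \<delta>") auto
  qed
  have "\<bar>\<Phi> f\<bar> \<le> 2 * \<Lambda> * c * I * e" if e: "0 < e" for e
  proof -
    \<comment> \<open>Radius e^2, so that an error of order 1/2 in the radius is of order e.\<close>
    obtain F where F: "F \<subseteq> Kset \<delta>" "finite F" "Kset \<delta> \<subseteq> (\<Union>p\<in>F. ball p (e\<^sup>2))"
      by (rule compactE_image[OF compact_Kset, of "Kset \<delta>" "\<lambda>p. ball p (e\<^sup>2)"]) (use e in auto)
    have "\<bar>\<Phi> (\<lambda>x. f x * indicator (Kset \<delta>) x)\<bar> \<le> 2 * \<Lambda> * c * sqrt (e\<^sup>2) * (LINT x|lborel. \<bar>f x * indicator (Kset \<delta>) x\<bar>)"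
      by (rule cover[OF F(2,1) Kset_borel F(3)]) simp
    moreover have "(LINT x|lborel. \<bar>f x * indicator (Kset \<delta>) x\<bar>) = I" unfolding I_def
      by (intro Bochner_Integration.integral_cong refl) (use supp in \<open>auto simp: indicator_def\<close>)
    ultimately show ?thesis using e unfolding fK by (simp add: ac_simps)
  qed
  then have "\<bar>\<Phi> f\<bar> \<le> 2 * \<Lambda> * c * I * e" if "0 < e" for e using that by blast
  then have "\<bar>\<Phi> f\<bar> \<le> 0"
  proof -
    assume H: "\<And>e. 0 < e \<Longrightarrow> \<bar>\<Phi> f\<bar> \<le> 2 * \<Lambda> * c * I * e"
    define X where "X = 2 * \<Lambda> * c * I"
    have X: "0 \<le> X" using \<Lambda> c(1) by (simp add: X_def I_def)
    show ?thesis
    proof (rule field_le_epsilon)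
      fix e :: real assume e: "0 < e"
      have "0 < e / (X + 1)" using e X by simp
      from H[OF this] have "\<bar>\<Phi> f\<bar> \<le> X * (e / (X + 1))" unfolding X_def .
      also have "\<dots> \<le> e" using e X by (simp add: field_simps)
      finally show "\<bar>\<Phi> f\<bar> \<le> 0 + e" by simp
    qed
  qed
  then show ?thesis by (simp add: \<Phi>_def)
qed

text \<open>One factor sqrt B cancels. That \<open>B\<close> is a real number, hence finite, is what
  the truncation provides in the applications.\<close>

lemma self_bound:
  fixes B C \<Lambda> :: real
  assumes "B \<le> \<Lambda> * sqrt (C * B)" "0 \<le> B" "0 \<le> C" "0 \<le> \<Lambda>"
  shows "B \<le> C * \<Lambda>\<^sup>2"
proof (cases "B = 0")
  case False
  have "B\<^sup>2 \<le> (\<Lambda> * sqrt (C * B))\<^sup>2" using assms by (intro power_mono) auto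
  also have "\<dots> = C * \<Lambda>\<^sup>2 * B" using assms by (simp add: power_mult_distrib)
  finally have "B * B \<le> C * \<Lambda>\<^sup>2 * B" by (simp add: power2_eq_square)
  then show ?thesis using assms False by (simp add: mult_le_cancel_right)
qed (use assms in simp)

text \<open>The truncated potential is tested against itself: once as a density, once through the
  fractional divergence of its own truncated difference quotient. In both cases
  \<open>layer_interchange\<close> converts the pairing into a value of \<open>l\<close>,
  \<open>rpot_Hsq_bounds\<close> estimates that value, and \<open>self_bound\<close> closes with a
  constant chosen before \<delta>.\<close>

lemma layer_bounds:
  obtains C where "0 \<le> C"
    "\<And>l \<Lambda> \<delta>. bfun l \<Lambda> \<Longrightarrow> 0 < \<delta> \<Longrightarrow> (\<integral>\<^sup>+x. ennreal ((lay l \<delta> x)\<^sup>2) \<partial>lborel) \<le> ennreal (C * \<Lambda>\<^sup>2)"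
    "\<And>l \<Lambda> \<delta>. bfun l \<Lambda> \<Longrightarrow> 0 < \<delta> \<Longrightarrow> (\<integral>\<^sup>+z. ennreal ((lay l \<delta> (fst z) - lay l \<delta> (snd z))\<^sup>2 * norm (fst z - snd z) powr (-b) *
        (indicator (Kset \<delta>) (fst z) * indicator (Kset \<delta>) (snd z) * (if \<delta> \<le> norm (fst z - snd z) then 1 else 0))) \<partial>(lborel \<Otimes>\<^sub>M lborel)) \<le> ennreal (C * \<Lambda>\<^sup>2)"
proof -
  obtain C where C: "0 \<le> C" "\<And>f B. bounded_supp (R + 1) f \<Longrightarrow> 0 \<le> B \<Longrightarrow>
      (\<And>h. bounded_supp (R + 1) h \<Longrightarrow> (LINT x|lborel. f x * rpot t h x)\<^sup>2 \<le> B * gag_energy b (rpot t h)) \<Longrightarrow>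
      Hsq (rpot t f) \<le> ennreal (C * B)"
    "\<And>f. bounded_supp (R + 1) f \<Longrightarrow> Hsq (rpot t f) \<le> ennreal (C * (LINT x|lborel. (f x)\<^sup>2))"
    by (rule rpot_Hsq_bounds, erule that, blast, blast)
  obtain c0 where en: "\<And>\<rho> f :: 'a \<Rightarrow> real. bounded_supp \<rho> f \<Longrightarrow>
      integrable (lborel \<Otimes>\<^sub>M lborel) (\<lambda>z. (rpot t f (fst z) - rpot t f (snd z))\<^sup>2 * norm (fst z - snd z) powr (-b))"
    "\<And>\<rho> f :: 'a \<Rightarrow> real. bounded_supp \<rho> f \<Longrightarrow> gag_energy b (rpot t f) = c0 * (LINT x|lborel. f x * rpot t f x)"
    by (rule riesz_energy_identity[OF s N, folded t_eq b_eq], rule that)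
  show ?thesis
  proof (rule that[of C])
    show "0 \<le> C" by (rule C(1))
  next
    fix l \<Lambda> and \<delta> :: real assume l: "bfun l \<Lambda>" and \<delta>: "0 < \<delta>"
    let ?u = "lay l \<delta>"
    have \<Lambda>: "0 \<le> \<Lambda>" using l by (simp add: bfun_def)
    have u: "bounded_supp (R + 1) ?u" by (rule lay_regular[OF l \<delta>])
    define B where "B = (LINT x|lborel. (?u x)\<^sup>2)"
    have B: "0 \<le> B" by (simp add: B_def)
    have "B = (LINT x|lborel. ?u x * ?u x)" by (simp add: B_def power2_eq_square)
    also have "\<dots> = l (rpot t ?u)"
      by (rule layer_interchange[OF l \<delta> u, symmetric]) (simp add: lay_def)
    also have "\<dots> \<le> \<Lambda> * sqrt (C * B)"
      using bfun_le[OF l rpot_measurable[OF u t_facts(1,4)], of "sqrt (C * B)"] C(3)[OF u] B C(1) by (auto simp: B_def)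
    finally have "B \<le> C * \<Lambda>\<^sup>2" by (rule self_bound) (fact B C(1) \<Lambda>)+
    then show "(\<integral>\<^sup>+x. ennreal ((?u x)\<^sup>2) \<partial>lborel) \<le> ennreal (C * \<Lambda>\<^sup>2)"
      using nn_integral_eq_integral[OF bounded_supp_square_integrable[OF u]] by (simp add: B_def ennreal_leI)
  next
    fix l \<Lambda> and \<delta> :: real assume l: "bfun l \<Lambda>" and \<delta>: "0 < \<delta>"
    let ?u = "lay l \<delta>"
    have \<Lambda>: "0 \<le> \<Lambda>" using l by (simp add: bfun_def)
    have u: "bounded_supp (R + 1) ?u" by (rule lay_regular[OF l \<delta>])
    note [measurable] = bounded_supp_measurable[OF u]
    obtain M where M: "0 \<le> M" "\<And>x. \<bar>?u x\<bar> \<le> M" "\<And>x. \<bar>?u x\<bar> \<le> M * indicator (ball 0 (R + 1)) x"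
      by (rule bounded_supp_boundE[OF u], rule that)
    \<comment> \<open>Pairs closer than \<delta> are removed as well, so that the difference
      quotient is bounded despite its singular weight.\<close>
    define cut :: "'a \<Rightarrow> 'a \<Rightarrow> real" where "cut x y = indicator (Kset \<delta>) x * indicator (Kset \<delta>) y * (if \<delta> \<le> norm (x - y) then 1 else 0)" for x y
    have cut01: "cut x y = 0 \<or> cut x y = 1" for x y by (auto simp: cut_def indicator_def)
    have cutsym: "cut x y = cut y x" for x y by (simp add: cut_def norm_minus_commute mult.commute)
    have [measurable]: "(\<lambda>z. cut (fst z) (snd z)) \<in> borel_measurable (lborel \<Otimes>\<^sub>M lborel)" unfolding cut_def by measurable
    have b0: "0 \<le> b" using s by (simp add: b_eq)
    \<comment> \<open>\<open>g\<close> carries the full weight |x - y|^(-b), while \<open>G\<close>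
      carries half of it and has the square norm to be estimated. Pairing \<open>g\<close> with a
      difference is thus pairing \<open>G\<close> with the Gagliardo quotient of that
      difference.\<close>
    define g where "g x y = (?u x - ?u y) * norm (x - y) powr (-b) * cut x y" for x y
    define G where "G z = (?u (fst z) - ?u (snd z)) * norm (fst z - snd z) powr (-(b/2)) * cut (fst z) (snd z)" for z
    have wle: "norm (x - y) powr (-e) * cut x y \<le> \<delta> powr (-e)" if "0 \<le> e" for x y e
      using \<delta> that by (auto simp: cut_def indicator_def intro!: powr_mono2')
    have bnd: "\<bar>(?u x - ?u y) * norm (x - y) powr (-e) * cut x y\<bar> \<le> 2 * M * \<delta> powr (-e)" if "0 \<le> e" for x y e
    proof -
      have "\<bar>?u x - ?u y\<bar> \<le> 2 * M" using M(2)[of x] M(2)[of y] by linarith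
      moreover have "0 \<le> norm (x - y) powr (-e) * cut x y" using cut01[of x y] by auto
      ultimately have "\<bar>?u x - ?u y\<bar> * (norm (x - y) powr (-e) * cut x y) \<le> 2 * M * \<delta> powr (-e)"
        using wle[OF that, of x y] M(1) by (intro mult_mono) auto
      then show ?thesis using cut01[of x y] by (auto simp: abs_mult)
    qed
    have out: "cut x y = 0" if "R + 1 \<le> norm x \<or> R + 1 \<le> norm y" for x y
      using that by (auto simp: cut_def Kset_def indicator_def)
    define f where "f x = 2 * (LINT y|lborel. g x y)" for x
    have gm: "case_prod g \<in> borel_measurable (lborel \<Otimes>\<^sub>M lborel)"
      unfolding g_def case_prod_beta' by measurable
    have g_bd: "\<bar>g x y\<bar> \<le> 2 * M * \<delta> powr (-b)" for x y unfolding g_def by (rule bnd[OF b0])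
    have g_supp: "g x y = 0" if "R + 1 \<le> norm x \<or> R + 1 \<le> norm y" for x y using out[OF that] by (simp add: g_def)
    have g_anti: "g y x = - g x y" for x y by (simp add: g_def cutsym[of y x] norm_minus_commute algebra_simps)
    have f: "bounded_supp (R + 1) f" unfolding f_def
      by (rule antisymmetric_divergence(1)[OF gm g_bd g_supp g_anti])
    have div: "(LINT x|lborel. f x * v x) = (LINT z|(lborel \<Otimes>\<^sub>M lborel). g (fst z) (snd z) * (v (fst z) - v (snd z)))"
      if "v \<in> borel_measurable borel" "\<And>x. norm x < R + 1 \<Longrightarrow> \<bar>v x\<bar> \<le> K" for v K
      unfolding f_def by (rule antisymmetric_divergence(2)[OF gm g_bd g_supp g_anti that])
    have fz: "f x = 0" if "x \<notin> Kset \<delta>" for x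
    proof -
      have "g x = (\<lambda>_. 0)" using that by (auto simp: g_def cut_def)
      then show ?thesis by (simp add: f_def)
    qed
    define B where "B = (LINT z|(lborel \<Otimes>\<^sub>M lborel). (G z)\<^sup>2)"
    have B: "0 \<le> B" by (simp add: B_def)
    have Gm [measurable]: "G \<in> borel_measurable (lborel \<Otimes>\<^sub>M lborel)" unfolding G_def by measurable
    have Gi: "integrable (lborel \<Otimes>\<^sub>M lborel) (\<lambda>z. (G z)\<^sup>2)"
    proof (rule bounded_pair_integrable)
      show "(\<lambda>z. (G z)\<^sup>2) \<in> borel_measurable (lborel \<Otimes>\<^sub>M lborel)" by measurable
      show "\<bar>(G z)\<^sup>2\<bar> \<le> (2 * M * \<delta> powr (-(b/2)))\<^sup>2" for z
      proof -
        have "\<bar>G z\<bar> \<le> 2 * M * \<delta> powr (-(b/2))" unfolding G_def by (rule bnd) (use b0 in simp)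
        from power_mono[OF this, of 2] show ?thesis by simp
      qed
      show "(G z)\<^sup>2 = 0" if "R + 1 \<le> norm (fst z) \<or> R + 1 \<le> norm (snd z)" for z using out[OF that] by (simp add: G_def)
    qed
    have half: "norm z powr (-(b/2)) * norm z powr (-(b/2)) = norm z powr (-b)" for z :: 'a
      by (simp add: powr_add[symmetric])
    have gG: "g (fst z) (snd z) * (v (fst z) - v (snd z)) = G z * ((v (fst z) - v (snd z)) * norm (fst z - snd z) powr (-(b/2)))" for v z
      unfolding g_def G_def half[symmetric] by (simp only: ac_simps)
    \<comment> \<open>Cauchy-Schwarz on pairs gives the duality hypothesis of
      \<open>rpot_Hsq_bounds\<close>, with \<open>B\<close> the squared norm of
      \<open>G\<close>.\<close>
    have dual: "(LINT x|lborel. f x * rpot t h x)\<^sup>2 \<le> B * gag_energy b (rpot t h)" if h: "bounded_supp (R + 1) h" for h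
    proof -
      let ?v = "rpot t h"
      have vm [measurable]: "?v \<in> borel_measurable borel" by (rule rpot_measurable[OF h t_facts(1,4)])
      have "bounded (?v ` cball 0 (R + 1))"
        by (intro compact_imp_bounded compact_continuous_image continuous_on_subset[OF rpot_continuous[OF h t_facts(1,4)]]) auto
      then obtain K where "\<forall>x\<in>cball 0 (R + 1). \<bar>?v x\<bar> \<le> K" by (auto simp: bounded_iff)
      then have K: "\<bar>?v x\<bar> \<le> K" if "norm x < R + 1" for x using that by auto
      have sq: "((?v (fst z) - ?v (snd z)) * norm (fst z - snd z) powr (-(b/2)))\<^sup>2 = (?v (fst z) - ?v (snd z))\<^sup>2 * norm (fst z - snd z) powr (-b)" for z :: "'a \<times> 'a"
        unfolding power_mult_distrib by (simp only: power2_eq_square half)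
      have "(LINT x|lborel. f x * ?v x)\<^sup>2 = (LINT z|(lborel \<Otimes>\<^sub>M lborel). G z * ((?v (fst z) - ?v (snd z)) * norm (fst z - snd z) powr (-(b/2))))\<^sup>2"
      proof -
        have "(LINT x|lborel. f x * ?v x) = (LINT z|(lborel \<Otimes>\<^sub>M lborel). g (fst z) (snd z) * (?v (fst z) - ?v (snd z)))"
          by (rule div[OF vm K])
        then show ?thesis unfolding gG by (rule arg_cong)
      qed
      also have "\<dots> \<le> B * (LINT z|(lborel \<Otimes>\<^sub>M lborel). ((?v (fst z) - ?v (snd z)) * norm (fst z - snd z) powr (-(b/2)))\<^sup>2)"
        unfolding B_def
      proof (rule Cauchy_Schwarz_integral_real(2)[OF Gm _ Gi])
        show "(\<lambda>z. (?v (fst z) - ?v (snd z)) * norm (fst z - snd z) powr (-(b/2))) \<in> borel_measurable (lborel \<Otimes>\<^sub>M lborel)" by measurable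
        show "integrable (lborel \<Otimes>\<^sub>M lborel) (\<lambda>z. ((?v (fst z) - ?v (snd z)) * norm (fst z - snd z) powr (-(b/2)))\<^sup>2)"
          unfolding sq by (rule en(1)[OF h])
      qed
      finally show ?thesis unfolding sq gag_energy_def .
    qed
    \<comment> \<open>For the potential \<open>?u\<close> itself the pairing with \<open>g\<close>
      reproduces the squared norm of \<open>G\<close>, because \<open>cut\<close> takes only the
      values 0 and 1.\<close>
    have "B = (LINT z|(lborel \<Otimes>\<^sub>M lborel). g (fst z) (snd z) * (?u (fst z) - ?u (snd z)))"
      unfolding B_def gG
    proof (intro Bochner_Integration.integral_cong refl)
      fix z
      show "(G z)\<^sup>2 = G z * ((?u (fst z) - ?u (snd z)) * norm (fst z - snd z) powr (-(b/2)))"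
        using cut01[of "fst z" "snd z"] by (auto simp: G_def power2_eq_square)
    qed
    also have "\<dots> = (LINT x|lborel. f x * ?u x)" by (rule div[symmetric, of _ M]) (use M(2) in auto)
    also have "\<dots> = l (rpot t f)" by (rule layer_interchange[OF l \<delta> f fz, symmetric])
    also have "\<dots> \<le> \<Lambda> * sqrt (C * B)"
      using bfun_le[OF l rpot_measurable[OF f t_facts(1,4)], of "sqrt (C * B)"] C(2)[OF f B dual] B C(1) by auto
    finally have le: "B \<le> C * \<Lambda>\<^sup>2" by (rule self_bound) (fact B C(1) \<Lambda>)+
    have "(\<integral>\<^sup>+z. ennreal ((?u (fst z) - ?u (snd z))\<^sup>2 * norm (fst z - snd z) powr (-b) * cut (fst z) (snd z)) \<partial>(lborel \<Otimes>\<^sub>M lborel))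
       = (\<integral>\<^sup>+z. ennreal ((G z)\<^sup>2) \<partial>(lborel \<Otimes>\<^sub>M lborel))"
    proof (intro nn_integral_cong arg_cong[where f=ennreal])
      fix z :: "'a \<times> 'a"
      show "(?u (fst z) - ?u (snd z))\<^sup>2 * norm (fst z - snd z) powr (-b) * cut (fst z) (snd z) = (G z)\<^sup>2"
        unfolding G_def half[symmetric] using cut01[of "fst z" "snd z"] by (auto simp: power2_eq_square)
    qed
    also have "\<dots> = ennreal B" unfolding B_def by (rule nn_integral_eq_integral[OF Gi]) simp
    also have "\<dots> \<le> ennreal (C * \<Lambda>\<^sup>2)" by (rule ennreal_leI[OF le])
    finally show "(\<integral>\<^sup>+z. ennreal ((?u (fst z) - ?u (snd z))\<^sup>2 * norm (fst z - snd z) powr (-b) *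
        (indicator (Kset \<delta>) (fst z) * indicator (Kset \<delta>) (snd z) * (if \<delta> \<le> norm (fst z - snd z) then 1 else 0))) \<partial>(lborel \<Otimes>\<^sub>M lborel)) \<le> ennreal (C * \<Lambda>\<^sup>2)"
      unfolding cut_def .
  qed
qed

end

section \<open>Removing the truncation\<close>

lemma nn_integral_limit_le:
  fixes f :: "nat \<Rightarrow> 'b \<Rightarrow> ennreal"
  assumes "\<And>m. f m \<in> borel_measurable M" "\<And>x. (\<lambda>m. f m x) \<longlonglongrightarrow> g x" "\<And>m. (\<integral>\<^sup>+x. f m x \<partial>M) \<le> B"
  shows "(\<integral>\<^sup>+x. g x \<partial>M) \<le> B"
proof -
  have "(\<integral>\<^sup>+x. g x \<partial>M) = (\<integral>\<^sup>+x. liminf (\<lambda>m. f m x) \<partial>M)"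
    by (intro nn_integral_cong lim_imp_Liminf[symmetric] assms) simp
  also have "\<dots> \<le> liminf (\<lambda>m. \<integral>\<^sup>+x. f m x \<partial>M)" by (rule nn_integral_liminf) (rule assms)
  also have "\<dots> \<le> B" by (rule Liminf_le) (use assms in auto)
  finally show ?thesis .
qed

context layer
begin

definition dl :: "nat \<Rightarrow> real" where "dl m = 1 / real (Suc m)"

lemma dl_pos: "0 < dl m" by (simp add: dl_def)

lemma dl_small: "0 < e \<Longrightarrow> \<exists>m0. \<forall>m\<ge>m0. dl m \<le> e"
proof -
  assume e: "0 < e"
  obtain m0 where m0: "1 / e < real m0" using reals_Archimedean2 by blast
  have "dl m \<le> e" if "m0 \<le> m" for m
  proof -
    have "1 / e < real (Suc m)" using m0 that by simp
    then show ?thesis using e by (simp add: dl_def field_simps)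
  qed
  then show ?thesis by blast
qed

lemma Kset_exhausts:
  assumes "norm x \<le> R" "x \<notin> S"
  shows "\<exists>m0. \<forall>m\<ge>m0. x \<in> Kset (dl m)"
proof -
  have "open (- S)" by (rule open_Compl[OF closed_S])
  then obtain e where e: "0 < e" "ball x e \<subseteq> - S" using assms(2) by (meson ComplI openE)
  obtain m0 where m0: "\<forall>m\<ge>m0. dl m \<le> e" using dl_small[OF e(1)] by blast
  have "x \<in> Kset (dl m)" if "m0 \<le> m" for m
  proof -
    have "e \<le> dist x Q" if "Q \<in> S" for Q using e(2) that by (force simp: subset_eq not_less[symmetric])
    then show ?thesis using m0 that assms(1) by (force simp: Kset_def intro: order_trans)
  qed
  then show ?thesis by blast
qed

lemma Kset_disjoint: "0 < \<delta> \<Longrightarrow> x \<in> S \<Longrightarrow> x \<notin> Kset \<delta>"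
  by (force simp: Kset_def)

text \<open>\<open>S\<close> is removed because for x in \<open>S\<close> the kernel is singular on
  the support and may have infinite \<open>Hsq\<close>, which leaves the value of \<open>l\<close>
  uncontrolled.\<close>

definition Dom :: "'a set" where "Dom = ball 0 R - S"

lemma Dom_borel [measurable]: "Dom \<in> sets borel"
  unfolding Dom_def using closed_S by auto

definition Lay :: "(('a \<Rightarrow> real) \<Rightarrow> real) \<Rightarrow> 'a \<Rightarrow> real" where
  "Lay l x = indicator Dom x * l (\<lambda>Q. rker t (x - Q))"

lemma lay_eventually: "\<forall>\<^sub>F m in sequentially. indicator Dom x * lay l (dl m) x = Lay l x"
proof (cases "x \<in> Dom")
  case True
  then obtain m0 where "\<forall>m\<ge>m0. x \<in> Kset (dl m)" using Kset_exhausts[of x] by (auto simp: Dom_def)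
  then show ?thesis unfolding eventually_sequentially by (intro exI[of _ m0]) (auto simp: Lay_def lay_def)
qed (simp add: Lay_def)

lemma Lay_measurable:
  assumes l: "bfun l \<Lambda>"
  shows "Lay l \<in> borel_measurable borel"
proof (rule borel_measurable_LIMSEQ_real)
  show "(\<lambda>x. indicator Dom x * lay l (dl m) x) \<in> borel_measurable borel" for m
    by (intro borel_measurable_times borel_measurable_indicator Dom_borel bounded_supp_measurable[OF lay_regular(1)[OF l dl_pos]])
  show "(\<lambda>m. indicator Dom x * lay l (dl m) x) \<longlonglongrightarrow> Lay l x" for x
    by (rule tendsto_eventually[OF lay_eventually])
qed

text \<open>Fatou's lemma along \<delta> = 1 / (m + 1): the truncated bounds are uniform, and at
  each pair of distinct points of \<open>Dom\<close> the truncated integrand eventually equals the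
  full one.\<close>

lemma Lay_bounds:
  obtains C where "0 \<le> C"
    "\<And>l \<Lambda>. bfun l \<Lambda> \<Longrightarrow> (\<integral>\<^sup>+x. ennreal ((Lay l x)\<^sup>2) \<partial>lborel) \<le> ennreal (C * \<Lambda>\<^sup>2)"
    "\<And>l \<Lambda>. bfun l \<Lambda> \<Longrightarrow> (\<integral>\<^sup>+z. ennreal ((Lay l (fst z) - Lay l (snd z))\<^sup>2 * norm (fst z - snd z) powr (-b)) *
        (indicator Dom (fst z) * indicator Dom (snd z)) \<partial>(lborel \<Otimes>\<^sub>M lborel)) \<le> ennreal (C * \<Lambda>\<^sup>2)"
proof -
  obtain C where C: "0 \<le> C"
    "\<And>l \<Lambda> \<delta>. bfun l \<Lambda> \<Longrightarrow> 0 < \<delta> \<Longrightarrow> (\<integral>\<^sup>+x. ennreal ((lay l \<delta> x)\<^sup>2) \<partial>lborel) \<le> ennreal (C * \<Lambda>\<^sup>2)"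
    "\<And>l \<Lambda> \<delta>. bfun l \<Lambda> \<Longrightarrow> 0 < \<delta> \<Longrightarrow> (\<integral>\<^sup>+z. ennreal ((lay l \<delta> (fst z) - lay l \<delta> (snd z))\<^sup>2 * norm (fst z - snd z) powr (-b) *
        (indicator (Kset \<delta>) (fst z) * indicator (Kset \<delta>) (snd z) * (if \<delta> \<le> norm (fst z - snd z) then 1 else 0))) \<partial>(lborel \<Otimes>\<^sub>M lborel)) \<le> ennreal (C * \<Lambda>\<^sup>2)"
    by (rule layer_bounds, erule that, blast, blast)
  show ?thesis
  proof (rule that[OF C(1)])
    fix l \<Lambda> assume l: "bfun l \<Lambda>"
    note lm [measurable] = bounded_supp_measurable[OF lay_regular(1)[OF l dl_pos]]
    show "(\<integral>\<^sup>+x. ennreal ((Lay l x)\<^sup>2) \<partial>lborel) \<le> ennreal (C * \<Lambda>\<^sup>2)"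
    proof (rule nn_integral_limit_le[where f = "\<lambda>m x. ennreal ((indicator Dom x * lay l (dl m) x)\<^sup>2)"])
      show "(\<lambda>x. ennreal ((indicator Dom x * lay l (dl m) x)\<^sup>2)) \<in> borel_measurable lborel" for m by measurable
      show "(\<lambda>m. ennreal ((indicator Dom x * lay l (dl m) x)\<^sup>2)) \<longlonglongrightarrow> ennreal ((Lay l x)\<^sup>2)" for x
        by (rule tendsto_eventually, rule eventually_mono[OF lay_eventually[of x l]]) simp
      have "(\<integral>\<^sup>+x. ennreal ((indicator Dom x * lay l (dl m) x)\<^sup>2) \<partial>lborel) \<le> (\<integral>\<^sup>+x. ennreal ((lay l (dl m) x)\<^sup>2) \<partial>lborel)" for m
        by (intro nn_integral_mono ennreal_leI) (auto simp: indicator_def)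
      then show "(\<integral>\<^sup>+x. ennreal ((indicator Dom x * lay l (dl m) x)\<^sup>2) \<partial>lborel) \<le> ennreal (C * \<Lambda>\<^sup>2)" for m
        using C(2)[OF l dl_pos] by (rule order_trans)
    qed
    let ?f = "\<lambda>m z. ennreal ((lay l (dl m) (fst z) - lay l (dl m) (snd z))\<^sup>2 * norm (fst z - snd z) powr (-b) *
        (indicator (Kset (dl m)) (fst z) * indicator (Kset (dl m)) (snd z) * (if dl m \<le> norm (fst z - snd z) then 1 else 0))) * (indicator Dom (fst z) * indicator Dom (snd z))"
    let ?g = "\<lambda>z. ennreal ((Lay l (fst z) - Lay l (snd z))\<^sup>2 * norm (fst z - snd z) powr (-b)) * (indicator Dom (fst z) * indicator Dom (snd z))"
    show "(\<integral>\<^sup>+z. ?g z \<partial>(lborel \<Otimes>\<^sub>M lborel)) \<le> ennreal (C * \<Lambda>\<^sup>2)"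
    proof (rule nn_integral_limit_le[where f = ?f])
      show "?f m \<in> borel_measurable (lborel \<Otimes>\<^sub>M lborel)" for m by measurable
      show "(\<lambda>m. ?f m z) \<longlonglongrightarrow> ?g z" for z
      proof (cases "fst z \<in> Dom \<and> snd z \<in> Dom \<and> fst z \<noteq> snd z")
        case True
        then obtain m1 m2 where m12: "\<forall>m\<ge>m1. fst z \<in> Kset (dl m)" "\<forall>m\<ge>m2. snd z \<in> Kset (dl m)"
          using Kset_exhausts[of "fst z"] Kset_exhausts[of "snd z"] by (auto simp: Dom_def)
        obtain m3 where m3: "\<forall>m\<ge>m3. dl m \<le> norm (fst z - snd z)" using dl_small[of "norm (fst z - snd z)"] True by auto
        have ev: "?f m z = ?g z" if "max m1 (max m2 m3) \<le> m" for m
          using m12 m3 True that by (simp add: lay_def Lay_def)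
        show ?thesis by (rule tendsto_eventually, rule eventually_sequentiallyI[of "max m1 (max m2 m3)"], rule ev)
      qed (auto simp: indicator_def)
      have "(\<integral>\<^sup>+z. ?f m z \<partial>(lborel \<Otimes>\<^sub>M lborel)) \<le> (\<integral>\<^sup>+z. ennreal ((lay l (dl m) (fst z) - lay l (dl m) (snd z))\<^sup>2 * norm (fst z - snd z) powr (-b) *
        (indicator (Kset (dl m)) (fst z) * indicator (Kset (dl m)) (snd z) * (if dl m \<le> norm (fst z - snd z) then 1 else 0))) \<partial>(lborel \<Otimes>\<^sub>M lborel))" for m
        by (intro nn_integral_mono) (auto simp: indicator_def)
      then show "(\<integral>\<^sup>+z. ?f m z \<partial>(lborel \<Otimes>\<^sub>M lborel)) \<le> ennreal (C * \<Lambda>\<^sup>2)" for m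
        using C(3)[OF l dl_pos] by (rule order_trans)
    qed
  qed
qed

lemma rpot_diff:
  fixes f g :: "'a \<Rightarrow> real"
  assumes "bounded_supp \<rho> f" "bounded_supp \<rho> g"
  shows "rpot t (\<lambda>x. f x - g x) = (\<lambda>P. rpot t f P - rpot t g P)"
  unfolding rpot_def left_diff_distrib
  by (intro ext Bochner_Integration.integral_diff rker_integrable[OF assms(1) t_facts(2,3)] rker_integrable[OF assms(2) t_facts(2,3)])

lemma bounded_supp_diff:
  fixes f g :: "'a \<Rightarrow> real"
  assumes "bounded_supp \<rho> f" "bounded_supp \<rho> g"
  shows "bounded_supp \<rho> (\<lambda>x. f x - g x)"
proof -
  obtain M1 where M1: "0 \<le> M1" "\<And>x. \<bar>f x\<bar> \<le> M1" "\<And>x. \<bar>f x\<bar> \<le> M1 * indicator (ball 0 \<rho>) x"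
    by (rule bounded_supp_boundE[OF assms(1)], rule that)
  obtain M2 where M2: "0 \<le> M2" "\<And>x. \<bar>g x\<bar> \<le> M2" "\<And>x. \<bar>g x\<bar> \<le> M2 * indicator (ball 0 \<rho>) x"
    by (rule bounded_supp_boundE[OF assms(2)], rule that)
  have "\<bar>f x - g x\<bar> \<le> M1 + M2" for x using M1(2)[of x] M2(2)[of x] by linarith
  then show ?thesis using assms unfolding bounded_supp_def by auto
qed

text \<open>For \<open>N \<ge> 4\<close> the kernel need not be Bochner integrable up to \<open>S\<close>, so the identity is obtained
  on \<open>Kset \<delta>\<close> and extended by \<open>L\<^sup>2\<close> continuity of \<open>f \<mapsto> \<Gamma> * f\<close>.\<close>

lemma layer_test_identity:
  assumes l: "bfun l \<Lambda>" and f: "bounded_supp (R + 1) f" and supp: "\<And>x. x \<notin> ball 0 R \<Longrightarrow> f x = 0"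
  shows "l (rpot t f) = (LINT x|lborel. f x * Lay l x)"
proof -
  obtain C where C: "0 \<le> C" "\<And>f. bounded_supp (R + 1) f \<Longrightarrow> Hsq (rpot t f) \<le> ennreal (C * (LINT x|lborel. (f x)\<^sup>2))"
    by (rule rpot_Hsq_bounds, erule that, blast)
  obtain C' where C': "0 \<le> C'" "\<And>l \<Lambda>. bfun l \<Lambda> \<Longrightarrow> (\<integral>\<^sup>+x. ennreal ((Lay l x)\<^sup>2) \<partial>lborel) \<le> ennreal (C' * \<Lambda>\<^sup>2)"
    by (rule Lay_bounds, erule that, blast)
  have \<Lambda>: "0 \<le> \<Lambda>" using l by (simp add: bfun_def)
  note [measurable] = Lay_measurable[OF l] bounded_supp_measurable[OF f]
  define F where "F m x = f x * indicator (Kset (dl m)) x" for m x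
  have F: "bounded_supp (R + 1) (F m)" for m unfolding F_def by (rule bounded_supp_indicator[OF f Kset_borel])
  have Fm [measurable]: "F m \<in> borel_measurable borel" for m by (rule bounded_supp_measurable[OF F])
  have rm: "rpot t g \<in> borel_measurable borel" if "bounded_supp (R + 1) g" for g :: "'a \<Rightarrow> real"
    by (rule rpot_measurable[OF that t_facts(1,4)])
  have notS: "AE x in lborel. x \<notin> S" using null_S by (rule AE_not_in)
  have conv: "AE x in lborel. (\<lambda>m. F m x) \<longlonglongrightarrow> f x"
    using notS
  proof eventually_elim
    case (elim x)
    show ?case
    proof (cases "x \<in> ball 0 R")
      case True
      then obtain m0 where "\<forall>m\<ge>m0. x \<in> Kset (dl m)" using Kset_exhausts[of x] elim by auto
      then show ?thesis by (intro tendsto_eventually) (auto simp: eventually_sequentially F_def intro!: exI[of _ m0])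
    qed (simp add: F_def supp)
  qed
  have Fle: "\<bar>F m x\<bar> \<le> \<bar>f x\<bar>" "\<bar>f x - F m x\<bar> \<le> \<bar>f x\<bar>" for m x by (auto simp: F_def indicator_def)
  have L2: "integrable lborel (\<lambda>x. (Lay l x)\<^sup>2)"
    by (rule integrableI_bounded) (use C'(2)[OF l] in \<open>auto intro: le_less_trans\<close>)
  \<comment> \<open>Integrability up to \<open>S\<close> comes from the L^2 bound on
    \<open>Lay l\<close>, not from a bound on the kernel.\<close>
  have fL: "integrable lborel (\<lambda>x. f x * Lay l x)"
    by (rule Cauchy_Schwarz_integral_real(1)[OF _ _ bounded_supp_square_integrable[OF f] L2]) measurable
  have eq: "l (rpot t (F m)) = (LINT x|lborel. F m x * Lay l x)" for m
  proof -
    have "l (rpot t (F m)) = (LINT x|lborel. F m x * lay l (dl m) x)"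
      by (rule layer_interchange[OF l dl_pos F]) (simp add: F_def)
    \<comment> \<open>\<open>lay\<close> and \<open>Lay\<close> agree on \<open>Kset (dl m)\<close>
      inside the open ball, and outside that ball \<open>f\<close> vanishes.\<close>
    also have "\<dots> = (LINT x|lborel. F m x * Lay l x)"
    proof (intro Bochner_Integration.integral_cong refl)
      fix x
      show "F m x * lay l (dl m) x = F m x * Lay l x"
      proof (cases "x \<in> Kset (dl m) \<and> x \<in> ball 0 R")
        case True
        then have "x \<in> Dom" using Kset_disjoint[OF dl_pos] by (auto simp: Dom_def)
        then show ?thesis using True by (simp add: lay_def Lay_def)
      qed (auto simp: F_def supp)
    qed
    finally show ?thesis .
  qed
  have lim1: "(\<lambda>m. LINT x|lborel. F m x * Lay l x) \<longlonglongrightarrow> (LINT x|lborel. f x * Lay l x)"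
  proof (rule integral_dominated_convergence)
    show "integrable lborel (\<lambda>x. \<bar>f x * Lay l x\<bar>)" using fL by (rule integrable_abs)
    show "AE x in lborel. (\<lambda>m. F m x * Lay l x) \<longlonglongrightarrow> f x * Lay l x"
      using conv by eventually_elim (intro tendsto_intros)
    show "AE x in lborel. norm (F m x * Lay l x) \<le> \<bar>f x * Lay l x\<bar>" for m
      using Fle by (intro AE_I2) (simp add: abs_mult mult_right_mono)
  qed measurable
  define e where "e m = (LINT x|lborel. (f x - F m x)\<^sup>2)" for m
  have e0: "e \<longlonglongrightarrow> 0"
  proof -
    have "(\<lambda>m. LINT x|lborel. (f x - F m x)\<^sup>2) \<longlonglongrightarrow> (LINT x|(lborel :: 'a measure). (0::real))"
    proof (rule integral_dominated_convergence)
      show "integrable lborel (\<lambda>x. (f x)\<^sup>2)" by (rule bounded_supp_square_integrable[OF f])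
      show "AE x in lborel. (\<lambda>m. (f x - F m x)\<^sup>2) \<longlonglongrightarrow> 0"
        using conv
      proof eventually_elim
        case (elim x)
        have "(\<lambda>m. (f x - F m x)\<^sup>2) \<longlonglongrightarrow> (f x - f x)\<^sup>2" by (intro tendsto_intros elim)
        then show ?case by simp
      qed
      show "AE x in lborel. norm ((f x - F m x)\<^sup>2) \<le> (f x)\<^sup>2" for m
        using Fle(2) by (intro AE_I2) (simp add: abs_le_square_iff)
    qed measurable
    then show ?thesis by (simp add: e_def[abs_def])
  qed
  have lim2: "(\<lambda>m. l (rpot t (F m))) \<longlonglongrightarrow> l (rpot t f)"
  proof (rule Lim_transform2)
    show "(\<lambda>m. l (rpot t f)) \<longlonglongrightarrow> l (rpot t f)" by simp
    show "(\<lambda>m. l (rpot t f) - l (rpot t (F m))) \<longlonglongrightarrow> 0"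
    proof (rule Lim_null_comparison)
      show "\<forall>\<^sub>F m in sequentially. norm (l (rpot t f) - l (rpot t (F m))) \<le> \<Lambda> * sqrt (C * e m)"
      proof (intro always_eventually allI)
        fix m
        have d: "bounded_supp (R + 1) (\<lambda>x. f x - F m x)" by (rule bounded_supp_diff[OF f F])
        have en: "0 \<le> C * e m" using C(1) by (simp add: e_def)
        have "l (rpot t f) - l (rpot t (F m)) = l (rpot t (\<lambda>x. f x - F m x))"
          unfolding rpot_diff[OF f F]
          by (rule bfun_diff[OF l rm[OF f] rpot_Hsq_finite[OF f] rm[OF F] rpot_Hsq_finite[OF F], symmetric])
        moreover have "\<bar>l (rpot t (\<lambda>x. f x - F m x))\<bar> \<le> \<Lambda> * sqrt (C * e m)"
          using C(2)[OF d] en by (intro bfun_le[OF l rm[OF d]]) (auto simp: e_def)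
        ultimately show "norm (l (rpot t f) - l (rpot t (F m))) \<le> \<Lambda> * sqrt (C * e m)" by simp
      qed
      have "(\<lambda>m. \<Lambda> * sqrt (C * e m)) \<longlonglongrightarrow> \<Lambda> * sqrt (C * 0)" by (intro tendsto_intros e0)
      then show "(\<lambda>m. \<Lambda> * sqrt (C * e m)) \<longlonglongrightarrow> 0" by simp
    qed
  qed
  show ?thesis using LIMSEQ_unique[OF lim2] lim1 by (simp add: eq)
qed

lemma Hsq_scale:
  assumes [measurable]: "\<psi> \<in> borel_measurable borel"
  shows "Hsq (\<lambda>P. c * \<psi> P) = ennreal (c\<^sup>2) * Hsq \<psi>"
proof -
  have 1: "ennreal ((c * \<psi> P)\<^sup>2) = ennreal (c\<^sup>2) * ennreal ((\<psi> P)\<^sup>2)" for P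
    by (simp add: power_mult_distrib ennreal_mult')
  have 2: "ennreal ((c * \<psi> P - c * \<psi> Q)\<^sup>2 / norm (P - Q) powr \<kappa>) = ennreal (c\<^sup>2) * ennreal ((\<psi> P - \<psi> Q)\<^sup>2 / norm (P - Q) powr \<kappa>)" for P Q
  proof -
    have "(c * \<psi> P - c * \<psi> Q)\<^sup>2 / norm (P - Q) powr \<kappa> = c\<^sup>2 * ((\<psi> P - \<psi> Q)\<^sup>2 / norm (P - Q) powr \<kappa>)"
      by (simp add: right_diff_distrib[symmetric] power_mult_distrib)
    then show ?thesis by (simp only: ennreal_mult' zero_le_power2)
  qed
  have m: "(\<lambda>P. \<integral>\<^sup>+Q. ennreal ((\<psi> P - \<psi> Q)\<^sup>2 / norm (P - Q) powr \<kappa>) \<partial>\<mu>) \<in> borel_measurable \<mu>" by measurable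
  have "(\<integral>\<^sup>+P. \<integral>\<^sup>+Q. ennreal (c\<^sup>2) * ennreal ((\<psi> P - \<psi> Q)\<^sup>2 / norm (P - Q) powr \<kappa>) \<partial>\<mu> \<partial>\<mu>)
    = (\<integral>\<^sup>+P. ennreal (c\<^sup>2) * (\<integral>\<^sup>+Q. ennreal ((\<psi> P - \<psi> Q)\<^sup>2 / norm (P - Q) powr \<kappa>) \<partial>\<mu>) \<partial>\<mu>)"
    by (intro nn_integral_cong nn_integral_cmult) measurable
  also have "\<dots> = ennreal (c\<^sup>2) * (\<integral>\<^sup>+P. \<integral>\<^sup>+Q. ennreal ((\<psi> P - \<psi> Q)\<^sup>2 / norm (P - Q) powr \<kappa>) \<partial>\<mu> \<partial>\<mu>)"
    by (rule nn_integral_cmult[OF m])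
  finally have e: "(\<integral>\<^sup>+P. \<integral>\<^sup>+Q. ennreal (c\<^sup>2) * ennreal ((\<psi> P - \<psi> Q)\<^sup>2 / norm (P - Q) powr \<kappa>) \<partial>\<mu> \<partial>\<mu>)
    = ennreal (c\<^sup>2) * (\<integral>\<^sup>+P. \<integral>\<^sup>+Q. ennreal ((\<psi> P - \<psi> Q)\<^sup>2 / norm (P - Q) powr \<kappa>) \<partial>\<mu> \<partial>\<mu>)" .
  have m1: "(\<lambda>P. ennreal ((\<psi> P)\<^sup>2)) \<in> borel_measurable \<mu>" by measurable
  show ?thesis unfolding Hsq_def 1 2 distrib_left e nn_integral_cmult[OF m1] ..
qed

end

subsection \<open>The surface measure and the single layer potential\<close>

lemma sets_restrict_borel_subset: "sets (restrict_space borel S) \<subseteq> Pow S"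
  using sets.space_closed[of "restrict_space borel S"] by (simp add: space_restrict_space)

lemma space_surface_measure: "space (surface_measure \<Omega>) = frontier \<Omega>"
  unfolding surface_measure_def by (rule space_measure_of[OF sets_restrict_borel_subset])

lemma sets_surface_measure: "sets (surface_measure \<Omega>) = sets (restrict_space borel (frontier \<Omega>))"
proof -
  let ?M = "restrict_space borel (frontier \<Omega>)"
  have sp: "space ?M = frontier \<Omega>" by (simp add: space_restrict_space)
  have "sets (surface_measure \<Omega>) = sigma_sets (frontier \<Omega>) (sets ?M)"
    unfolding surface_measure_def by (rule sets_measure_of[OF sets_restrict_borel_subset])
  also have "\<dots> = sets ?M" using sets.sigma_sets_eq[of ?M] by (simp add: sp)
  finally show ?thesis .
qed

text \<open>If the Hausdorff measure failed to be countably additive, \<open>measure_of\<close> would return the zero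
  measure; either way it is dominated by the outer measure, which is all that is needed.\<close>

lemma emeasure_surface_measure_le:
  "emeasure (surface_measure \<Omega>) B \<le> hausdorff_outer (real CARD('n) - 1) B" for \<Omega> :: "(real^'n) set"
  unfolding surface_measure_def by (subst emeasure_measure_of_conv) auto

text \<open>The surface measure has the frontier as its space; its pushforward under the inclusion
  is a Borel measure on the whole space, as \<open>growth_measure\<close> requires.\<close>

definition bd_measure :: "(real^'n) set \<Rightarrow> (real^'n) measure" where
  "bd_measure \<Omega> = distr (surface_measure \<Omega>) borel (\<lambda>x. x)"

lemma id_surface_measurable: "(\<lambda>x. x) \<in> measurable (surface_measure \<Omega>) borel"
  by (subst measurable_cong_sets[OF sets_surface_measure refl]) (rule measurable_restrict_space1, simp)

lemma surface_measurable: "\<psi> \<in> borel_measurable borel \<Longrightarrow> \<psi> \<in> borel_measurable (surface_measure \<Omega>)"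
  using measurable_compose[OF id_surface_measurable] by blast

lemma nn_integral_bd_measure:
  "f \<in> borel_measurable borel \<Longrightarrow> (\<integral>\<^sup>+P. f P \<partial>bd_measure \<Omega>) = (\<integral>\<^sup>+P. f P \<partial>surface_measure \<Omega>)"
  unfolding bd_measure_def by (rule nn_integral_distr[OF id_surface_measurable]) simp

lemma layer_bd_measure:
  fixes \<Omega> :: "(real^'n) set" and s R :: real
  assumes n: "CARD('n) \<ge> 2" and bd: "bounded \<Omega>" and lip: "lipschitz_domain \<Omega>"
    and s: "1/2 < s" "s < 1" and sub: "\<Omega> \<subseteq> ball 0 (R / 2)"
  obtains A where "layer (bd_measure \<Omega>) A R s (real CARD('n) - 2 * s) (real CARD('n) + 2 * s) (real CARD('n) + 2 * s - 2) (frontier \<Omega>)"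
proof -
  have ne: "\<Omega> \<noteq> {}" using lip by (simp add: lipschitz_domain_def)
  \<comment> \<open>Positivity of \<open>R\<close> is forced by \<Omega> being nonempty.\<close>
  have R: "0 < R" using ne sub by (metis ball_eq_empty half_gt_zero_iff not_le subset_empty)
  have cov: "codim1_coverable (frontier \<Omega>)" by (rule codim1_coverable_frontier[OF bd lip])
  have "frontier \<Omega> \<subseteq> closure \<Omega>" by (simp add: frontier_def)
  also have "\<dots> \<subseteq> closure (ball 0 (R / 2))" by (rule closure_mono[OF sub])
  also have "\<dots> \<subseteq> cball 0 R" using R by (auto simp: closure_ball)
  finally have fsub: "frontier \<Omega> \<subseteq> cball 0 R" .
  have dim: "2 \<le> DIM(real^'n)" using n by simp
  obtain A where A: "0 \<le> A" "\<And>x0 \<rho>. 0 < \<rho> \<Longrightarrow> hausdorff_outer (real DIM(real^'n) - 1) (frontier \<Omega> \<inter> cball x0 \<rho>) \<le> ennreal (A * \<rho> powr (real DIM(real^'n) - 1))"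
    by (rule hausdorff_outer_codim1_growth[OF cov dim], rule that)
  have AE_f: "AE P in bd_measure \<Omega>. P \<in> frontier \<Omega>"
    unfolding bd_measure_def by (subst AE_distr_iff) (auto simp: space_surface_measure intro!: AE_I2 id_surface_measurable)
  show ?thesis
  proof (rule that[of A], unfold_locales)
    show "sets (bd_measure \<Omega>) = sets borel" by (simp add: bd_measure_def)
    show "emeasure (bd_measure \<Omega>) (cball x r) \<le> ennreal (A * r powr (real DIM(real^'n) - 1))" if "0 < r" for x r
    proof -
      have "emeasure (bd_measure \<Omega>) (cball x r) = emeasure (surface_measure \<Omega>) (frontier \<Omega> \<inter> cball x r)"
        unfolding bd_measure_def by (subst emeasure_distr) (auto simp: space_surface_measure Int_commute intro!: id_surface_measurable)
      also have "\<dots> \<le> hausdorff_outer (real CARD('n) - 1) (frontier \<Omega> \<inter> cball x r)"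
        by (rule emeasure_surface_measure_le)
      finally show ?thesis using A(2)[OF that, of x] by simp
    qed
    show "AE P in bd_measure \<Omega>. norm P \<le> R" using AE_f by eventually_elim (use fsub in auto)
    show "frontier \<Omega> \<in> null_sets lborel"
      by (rule codim1_coverable_null[OF cov bounded_subset[OF bounded_cball fsub]]) (simp add: borel_closed frontier_closed)
  qed (use A R s n fsub AE_f frontier_closed in auto)
qed

section \<open>Passage to the dual of the boundary space and to the single layer potential\<close>

context
  fixes \<Omega> :: "(real^'n) set" and A s R :: real
  assumes lay: "layer (bd_measure \<Omega>) A R s (real CARD('n) - 2 * s) (real CARD('n) + 2 * s) (real CARD('n) + 2 * s - 2) (frontier \<Omega>)"
begin

interpretation layer "bd_measure \<Omega>" A R s "real CARD('n) - 2 * s" "real CARD('n) + 2 * s" "real CARD('n) + 2 * s - 2" "frontier \<Omega>"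
  by (rule lay)

lemma Hsq_bd:
  assumes [measurable]: "\<psi> \<in> borel_measurable borel"
  shows "L2sq_bd \<Omega> \<psi> + gagliardo_bd (s - 1/2) \<Omega> \<psi> = Hsq \<psi>"
proof -
  have e: "real CARD('n) - 1 + 2 * (s - 1/2) = real CARD('n) + 2 * s - 2" by simp
  have m: "(\<lambda>P. \<integral>\<^sup>+Q. ennreal ((\<psi> P - \<psi> Q)\<^sup>2 / norm (P - Q) powr (real CARD('n) + 2 * s - 2)) \<partial>bd_measure \<Omega>) \<in> borel_measurable borel"
    by measurable
  have m1: "(\<lambda>Q. ennreal ((\<psi> P - \<psi> Q)\<^sup>2 / norm (P - Q) powr (real CARD('n) + 2 * s - 2))) \<in> borel_measurable borel" for P
    by measurable
  have m2: "(\<lambda>P. ennreal ((\<psi> P)\<^sup>2)) \<in> borel_measurable borel" by measurable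
  show ?thesis unfolding L2sq_bd_def gagliardo_bd_def Hsq_def e
    unfolding nn_integral_bd_measure[OF m2] nn_integral_bd_measure[OF m] unfolding nn_integral_bd_measure[OF m1] ..
qed

lemma H_bd_borel:
  assumes "\<psi> \<in> borel_measurable borel"
  shows "\<psi> \<in> H_bd (s - 1/2) \<Omega> \<longleftrightarrow> Hsq \<psi> < \<infinity>"
  unfolding H_bd_def Hsq_bd[OF assms, symmetric] using surface_measurable[OF assms] by (auto simp: less_top)

lemma H_bd_norm_borel:
  assumes "\<psi> \<in> borel_measurable borel"
  shows "H_bd_norm (s - 1/2) \<Omega> \<psi> = sqrt (enn2real (Hsq \<psi>))"
  unfolding H_bd_norm_def Hsq_bd[OF assms] ..

text \<open>Boundedness of \<open>l\<close> keeps the supremum in the dual norm finite, and scaling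
  turns this supremum over the unit ball into a homogeneous bound.\<close>

lemma bfun_dual:
  assumes l: "l \<in> H_bd_dual (s - 1/2) \<Omega>"
  shows "bfun l (H_bd_dual_norm (s - 1/2) \<Omega> l)"
proof -
  let ?\<alpha> = "s - 1/2" and ?\<Lambda> = "H_bd_dual_norm (s - 1/2) \<Omega> l"
  have lin: "l (\<lambda>P. c * \<psi>1 P + d * \<psi>2 P) = c * l \<psi>1 + d * l \<psi>2" if "\<psi>1 \<in> H_bd ?\<alpha> \<Omega>" "\<psi>2 \<in> H_bd ?\<alpha> \<Omega>" for \<psi>1 \<psi>2 c d
    using l that unfolding H_bd_dual_def by blast
  obtain K where K: "\<And>\<psi>. \<psi> \<in> H_bd ?\<alpha> \<Omega> \<Longrightarrow> \<bar>l \<psi>\<bar> \<le> K * H_bd_norm ?\<alpha> \<Omega> \<psi>"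
    using l unfolding H_bd_dual_def by blast
  let ?S = "{\<bar>l \<psi>\<bar> | \<psi>. \<psi> \<in> H_bd ?\<alpha> \<Omega> \<and> H_bd_norm ?\<alpha> \<Omega> \<psi> \<le> 1}"
  have bdd: "bdd_above ?S"
  proof (rule bdd_aboveI)
    fix x assume "x \<in> ?S"
    then obtain \<psi> where \<psi>: "x = \<bar>l \<psi>\<bar>" "\<psi> \<in> H_bd ?\<alpha> \<Omega>" "H_bd_norm ?\<alpha> \<Omega> \<psi> \<le> 1" by auto
    have "0 \<le> H_bd_norm ?\<alpha> \<Omega> \<psi>" by (simp add: H_bd_norm_def)
    then have "K * H_bd_norm ?\<alpha> \<Omega> \<psi> \<le> \<bar>K\<bar> * 1" using \<psi>(3) by (intro mult_mono) auto
    then show "x \<le> \<bar>K\<bar>" using K[OF \<psi>(2)] \<psi>(1) by simp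
  qed
  have upper: "\<bar>l \<psi>\<bar> \<le> ?\<Lambda>" if "\<psi> \<in> H_bd ?\<alpha> \<Omega>" "H_bd_norm ?\<alpha> \<Omega> \<psi> \<le> 1" for \<psi>
    unfolding H_bd_dual_norm_def by (rule cSup_upper[OF _ bdd]) (use that in auto)
  have z: "Hsq (\<lambda>_. 0) = 0" by (simp add: Hsq_def)
  have "\<bar>l (\<lambda>_. 0)\<bar> \<le> ?\<Lambda>" by (rule upper) (simp_all add: H_bd_borel H_bd_norm_borel z)
  then have \<Lambda>: "0 \<le> ?\<Lambda>" by linarith
  have "\<bar>l \<psi>\<bar> \<le> ?\<Lambda> * sqrt (enn2real (Hsq \<psi>))" if m: "\<psi> \<in> borel_measurable borel" and fin: "Hsq \<psi> < \<infinity>" for \<psi>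
  proof -
    have mem: "\<psi> \<in> H_bd ?\<alpha> \<Omega>" using H_bd_borel[OF m] fin by simp
    define a where "a = sqrt (enn2real (Hsq \<psi>))"
    have a: "0 \<le> a" by (simp add: a_def)
    show ?thesis
    proof (cases "a = 0")
      \<comment> \<open>Norm 0 cannot be scaled to 1; here the bound with \<open>K\<close> gives l
        \<psi> = 0 directly.\<close>
      case True
      then show ?thesis using K[OF mem] unfolding H_bd_norm_borel[OF m] a_def[symmetric] by simp
    next
      case False
      let ?\<phi> = "\<lambda>P. (1 / a) * \<psi> P"
      have pm: "?\<phi> \<in> borel_measurable borel" using m by measurable
      have sc: "Hsq ?\<phi> = ennreal ((1 / a)\<^sup>2) * Hsq \<psi>" by (rule Hsq_scale[OF m])
      then have pf: "Hsq ?\<phi> < \<infinity>" using fin by (simp add: ennreal_mult_less_top)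
      have "enn2real (Hsq ?\<phi>) = (1 / a)\<^sup>2 * a\<^sup>2" unfolding sc by (simp add: enn2real_mult a_def)
      also have "\<dots> = 1" using False by (simp add: power_divide)
      finally have "H_bd_norm ?\<alpha> \<Omega> ?\<phi> \<le> 1" unfolding H_bd_norm_borel[OF pm] by simp
      then have "\<bar>l ?\<phi>\<bar> \<le> ?\<Lambda>" using H_bd_borel[OF pm] pf by (intro upper) auto
      moreover have "l ?\<phi> = (1 / a) * l \<psi>" using lin[OF mem mem, of "1 / a" 0] by simp
      ultimately have "\<bar>l \<psi>\<bar> / a \<le> ?\<Lambda>" using a by (simp add: abs_mult)
      then show ?thesis using a False unfolding a_def[symmetric] by (simp add: divide_le_eq)
    qed
  qed
  then show ?thesis unfolding bfun_def using \<Lambda> lin H_bd_borel by auto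
qed

lemma single_layer_eq:
  assumes l: "l \<in> H_bd_dual (s - 1/2) \<Omega>" and x: "x \<in> Dom"
  shows "single_layer s l x = riesz_const CARD('n) s * Lay l x"
proof -
  let ?k = "\<lambda>Q. rker (real CARD('n) - 2 * s) (x - Q)"
  obtain m where m: "x \<in> Kset (dl m)" using Kset_exhausts[of x] x by (auto simp: Dom_def)
  obtain c where "0 \<le> c" "\<And>x. x \<in> Kset (dl m) \<Longrightarrow> Hsq (\<lambda>Q. rker (real CARD('n) - 2 * s) (x - Q)) \<le> ennreal (c\<^sup>2)"
    by (rule Kset_Hsq_bounds[OF dl_pos[of m]], erule that, blast)
  from this(2)[OF m] have fin: "Hsq ?k < \<infinity>" by (simp add: le_less_trans)
  \<comment> \<open>Linearity is available for combinations of two functions; a zero multiple fills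
    the second place.\<close>
  have "single_layer s l x = l (\<lambda>Q. riesz_const CARD('n) s * ?k Q + 0 * ?k Q)"
    by (simp add: single_layer_def riesz_kernel_def rker_def)
  also have "\<dots> = riesz_const CARD('n) s * l ?k + 0 * l ?k"
    by (rule bfun_lin[OF bfun_dual[OF l]]) (use fin in auto)
  finally show ?thesis using x by (simp add: Lay_def)
qed

text \<open>On the boundary the values of the potential are arbitrary, but the boundary is null and
  Lebesgue measure is complete. Elsewhere in the ball the potential is a multiple of the Borel
  function \<open>Lay l\<close>.\<close>

lemma single_layer_measurable:
  assumes l: "l \<in> H_bd_dual (s - 1/2) \<Omega>"
  shows "single_layer s l \<in> borel_measurable (lebesgue_on (ball 0 R))"
proof (rule measurableI)
  fix B :: "real set" assume B: "B \<in> sets borel"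
  let ?W = "\<lambda>x. riesz_const CARD('n) s * Lay l x"
  have Lm: "Lay l \<in> borel_measurable borel" by (rule Lay_measurable[OF bfun_dual[OF l]])
  have W: "?W \<in> borel_measurable borel" by (rule borel_measurable_times[OF borel_measurable_const Lm])
  have eq: "single_layer s l -` B \<inter> ball 0 R = (?W -` B \<inter> Dom) \<union> (single_layer s l -` B \<inter> ball 0 R \<inter> frontier \<Omega>)"
  proof (rule set_eqI)
    fix x
    show "x \<in> single_layer s l -` B \<inter> ball 0 R \<longleftrightarrow> x \<in> (?W -` B \<inter> Dom) \<union> (single_layer s l -` B \<inter> ball 0 R \<inter> frontier \<Omega>)"
    proof (cases "x \<in> Dom")
      case True
      then have m: "x \<in> ball 0 R" "x \<notin> frontier \<Omega>" unfolding Dom_def by blast+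
      show ?thesis unfolding Int_iff Un_iff vimage_eq single_layer_eq[OF l True] using True m by (simp only: simp_thms)
    next
      case False
      then have "x \<in> ball 0 R \<Longrightarrow> x \<in> frontier \<Omega>" unfolding Dom_def by blast
      then show ?thesis unfolding Int_iff Un_iff vimage_eq using False by (simp only: simp_thms) iprover
    qed
  qed
  have "?W -` B \<in> sets borel" using measurable_sets[OF W B] by (simp only: space_borel Int_UNIV_right)
  then have "?W -` B \<inter> Dom \<in> sets lborel" unfolding sets_lborel by (rule sets.Int[OF _ Dom_borel])
  then have 1: "?W -` B \<inter> Dom \<in> sets lebesgue" by (rule sets_completionI_sets)
  have "single_layer s l -` B \<inter> ball 0 R \<inter> frontier \<Omega> \<in> null_sets lebesgue"
    by (rule null_sets_completion_subset[OF _ null_sets_completionI[OF null_S]]) blast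
  then have 2: "single_layer s l -` B \<inter> ball 0 R \<inter> frontier \<Omega> \<in> sets lebesgue" by (rule null_setsD2)
  have "single_layer s l -` B \<inter> ball 0 R \<in> sets lebesgue" using sets.Un[OF 1 2] unfolding eq[symmetric] .
  then show "single_layer s l -` B \<inter> space (lebesgue_on (ball 0 R)) \<in> sets (lebesgue_on (ball 0 R))"
    unfolding space_lebesgue_on by (intro sets_restrict_space_iff[THEN iffD2] conjI) (auto simp: Int_commute)
qed (simp only: space_borel UNIV_I)

text \<open>Stated for arbitrary \<open>f\<close>, so that it applies to \<open>single_layer\<close>
  whatever its values on the boundary.\<close>

lemma nn_integral_lebesgue_ball:
  "(\<integral>\<^sup>+x. f x \<partial>lebesgue_on (ball (0::real^'n) R)) = (\<integral>\<^sup>+x. f x * indicator Dom x \<partial>lborel)"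
proof -
  have "(\<integral>\<^sup>+x. f x \<partial>lebesgue_on (ball (0::real^'n) R)) = (\<integral>\<^sup>+x. f x * indicator (ball 0 R) x \<partial>lborel)"
    by (subst nn_integral_restrict_space) (simp_all add: nn_integral_completion)
  also have "\<dots> = (\<integral>\<^sup>+x. f x * indicator Dom x \<partial>lborel)"
  proof (rule nn_integral_cong_AE)
    show "AE x in lborel. f x * indicator (ball 0 R) x = f x * indicator Dom x"
      using AE_not_in[OF null_S] by eventually_elim (simp add: Dom_def indicator_def)
  qed
  finally show ?thesis .
qed

lemma Hs_ball_sq_single_layer:
  assumes l: "l \<in> H_bd_dual (s - 1/2) \<Omega>"
  shows "Hs_ball_sq s R (single_layer s l) = ennreal ((riesz_const CARD('n) s)\<^sup>2) *
    ((\<integral>\<^sup>+x. ennreal ((Lay l x)\<^sup>2) \<partial>lborel) +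
     (\<integral>\<^sup>+z. ennreal ((Lay l (fst z) - Lay l (snd z))\<^sup>2 * norm (fst z - snd z) powr (-(real CARD('n) + 2 * s))) *
        (indicator Dom (fst z) * indicator Dom (snd z)) \<partial>(lborel \<Otimes>\<^sub>M lborel)))"
proof -
  let ?c = "riesz_const CARD('n) s" and ?b = "real CARD('n) + 2 * s"
  note [measurable] = Lay_measurable[OF bfun_dual[OF l]]
  have 1: "(\<integral>\<^sup>+x. ennreal ((single_layer s l x)\<^sup>2) \<partial>lebesgue_on (ball 0 R)) = ennreal (?c\<^sup>2) * (\<integral>\<^sup>+x. ennreal ((Lay l x)\<^sup>2) \<partial>lborel)"
  proof -
    have "(\<integral>\<^sup>+x. ennreal ((single_layer s l x)\<^sup>2) \<partial>lebesgue_on (ball 0 R)) = (\<integral>\<^sup>+x. ennreal (?c\<^sup>2) * ennreal ((Lay l x)\<^sup>2) \<partial>lborel)"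
      unfolding nn_integral_lebesgue_ball
    proof (intro nn_integral_cong)
      fix x
      show "ennreal ((single_layer s l x)\<^sup>2) * indicator Dom x = ennreal (?c\<^sup>2) * ennreal ((Lay l x)\<^sup>2)"
        using single_layer_eq[OF l, of x]
        by (cases "x \<in> Dom") (simp_all add: power_mult_distrib ennreal_mult' Lay_def)
    qed
    then show ?thesis by (simp add: nn_integral_cmult)
  qed
  define h where "h z = ennreal ((Lay l (fst z) - Lay l (snd z))\<^sup>2 * norm (fst z - snd z) powr (-?b)) * (indicator Dom (fst z) * indicator Dom (snd z))" for z
  have hm [measurable]: "h \<in> borel_measurable (lborel \<Otimes>\<^sub>M lborel)" unfolding h_def by measurable
  have "(\<integral>\<^sup>+x. (\<integral>\<^sup>+y. ennreal ((single_layer s l x - single_layer s l y)\<^sup>2 / norm (x - y) powr ?b) \<partial>lebesgue_on (ball 0 R)) \<partial>lebesgue_on (ball 0 R))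
     = (\<integral>\<^sup>+x. (\<integral>\<^sup>+y. ennreal (?c\<^sup>2) * h (x, y) \<partial>lborel) \<partial>lborel)"
    unfolding nn_integral_lebesgue_ball
  proof (intro nn_integral_cong)
    fix x
    have "ennreal ((single_layer s l x - single_layer s l y)\<^sup>2 / norm (x - y) powr ?b) * indicator Dom y = ennreal (?c\<^sup>2) * h (x, y)" if x: "x \<in> Dom" for y
    proof (cases "y \<in> Dom")
      case True
      have "(single_layer s l x - single_layer s l y)\<^sup>2 / norm (x - y) powr ?b = ?c\<^sup>2 * ((Lay l x - Lay l y)\<^sup>2 * norm (x - y) powr (-?b))"
        unfolding single_layer_eq[OF l x] single_layer_eq[OF l True] right_diff_distrib[symmetric]
        unfolding power_mult_distrib powr_minus_divide by simp
      then show ?thesis using x True by (simp only: h_def ennreal_mult' zero_le_power2 fst_conv snd_conv indicator_simps mult_1_right)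
    qed (simp add: h_def)
    then show "(\<integral>\<^sup>+y. ennreal ((single_layer s l x - single_layer s l y)\<^sup>2 / norm (x - y) powr ?b) * indicator Dom y \<partial>lborel) * indicator Dom x = (\<integral>\<^sup>+y. ennreal (?c\<^sup>2) * h (x, y) \<partial>lborel)"
      by (cases "x \<in> Dom") (simp_all add: h_def)
  qed
  also have "\<dots> = (\<integral>\<^sup>+z. ennreal (?c\<^sup>2) * h z \<partial>(lborel \<Otimes>\<^sub>M lborel))"
    by (rule lborel.nn_integral_fst) measurable
  also have "\<dots> = ennreal (?c\<^sup>2) * (\<integral>\<^sup>+z. h z \<partial>(lborel \<Otimes>\<^sub>M lborel))" by (rule nn_integral_cmult[OF hm])
  finally show ?thesis unfolding Hs_ball_sq_def 1 h_def distrib_left by simp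
qed

lemma test_function_bounded_supp:
  assumes F: "F \<in> test_functions (ball 0 R)"
  shows "bounded_supp (R + 1) F" "\<And>x. x \<notin> ball 0 R \<Longrightarrow> F x = 0" "F \<in> borel_measurable borel"
proof -
  have "smooth_fun F" and sub: "closure {x. F x \<noteq> 0} \<subseteq> ball 0 R" using F by (auto simp: test_functions_def)
  \<comment> \<open>The empty list of indices in \<open>smooth_fun\<close> stands for
    \<open>F\<close> itself.\<close>
  then have "F differentiable (at x)" for x unfolding smooth_fun_def by (metis partial_iter.simps(1))
  then have cont: "continuous_on UNIV F"
    by (intro continuous_at_imp_continuous_on ballI differentiable_imp_continuous_within)
  show z: "F x = 0" if "x \<notin> ball 0 R" for x
    using closure_subset[of "{x. F x \<noteq> 0}"] sub that by auto
  then have "(\<lambda>x. indicator (ball 0 (R + 1)) x * F x) = F" by (auto simp: indicator_def fun_eq_iff)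
  then show "bounded_supp (R + 1) F" using bounded_supp_continuous_restrict[OF cont, of "R + 1"] by simp
  show "F \<in> borel_measurable borel" by (rule borel_measurable_continuous_onI[OF cont])
qed

lemma test_function_identity:
  assumes l: "l \<in> H_bd_dual (s - 1/2) \<Omega>" and F: "F \<in> test_functions (ball 0 R)"
  shows "(\<lambda>Q. LINT x : ball 0 R | lebesgue. F x * riesz_kernel s (x - Q)) \<in> H_bd (s - 1/2) \<Omega>"
    and "(LINT x : ball 0 R | lebesgue. F x * single_layer s l x) =
          l (\<lambda>Q. LINT x : ball 0 R | lebesgue. F x * riesz_kernel s (x - Q))"
proof -
  let ?c = "riesz_const CARD('n) s" and ?t = "real CARD('n) - 2 * s"
  \<comment> \<open>The constant of the Riesz kernel is absorbed into the density.\<close>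
  define G where "G x = ?c * F x" for x
  note Fb = test_function_bounded_supp[OF F]
  note [measurable] = Fb(3) Lay_measurable[OF bfun_dual[OF l]]
  have G: "bounded_supp (R + 1) G"
  proof -
    obtain M where M: "0 \<le> M" "\<And>x. \<bar>F x\<bar> \<le> M" "\<And>x. \<bar>F x\<bar> \<le> M * indicator (ball 0 (R + 1)) x"
      by (rule bounded_supp_boundE[OF Fb(1)], rule that)
    have "\<bar>G x\<bar> \<le> \<bar>?c\<bar> * M" for x unfolding G_def abs_mult by (intro mult_left_mono M) simp
    moreover have "G \<in> borel_measurable borel" unfolding G_def[abs_def] by measurable
    ultimately show ?thesis using Fb(1) unfolding bounded_supp_def G_def by auto
  qed
  have pot: "(LINT x : ball 0 R | lebesgue. F x * riesz_kernel s (x - Q)) = rpot ?t G Q" for Q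
  proof -
    have "(LINT x : ball 0 R | lebesgue. F x * riesz_kernel s (x - Q)) = (LINT x|lebesgue. G x * rker ?t (x - Q))"
      unfolding set_lebesgue_integral_def
      by (intro Bochner_Integration.integral_cong refl)
        (use Fb(2) in \<open>auto simp: G_def riesz_kernel_def rker_def indicator_def\<close>)
    also have "\<dots> = rpot ?t G Q" unfolding rpot_def
      by (rule integral_completion) (use bounded_supp_measurable[OF G] in \<open>auto intro!: borel_measurable_times measurable_compose[OF _ rker_measurable]\<close>)
    finally show ?thesis .
  qed
  have pm: "rpot ?t G \<in> borel_measurable borel" by (rule rpot_measurable[OF G t_facts(1,4)])
  show "(\<lambda>Q. LINT x : ball 0 R | lebesgue. F x * riesz_kernel s (x - Q)) \<in> H_bd (s - 1/2) \<Omega>"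
    unfolding pot using H_bd_borel[OF pm] rpot_Hsq_finite[OF G] by simp
  have "(LINT x : ball 0 R | lebesgue. F x * single_layer s l x) = (LINT x|lebesgue. G x * Lay l x)"
    unfolding set_lebesgue_integral_def
  proof (rule integral_cong_AE)
    have "(\<lambda>x. indicator (ball 0 R) x *\<^sub>R single_layer s l x) \<in> borel_measurable lebesgue"
      using single_layer_measurable[OF l] by (subst (asm) borel_measurable_restrict_space_iff) auto
    then have "(\<lambda>x. F x * (indicator (ball 0 R) x *\<^sub>R single_layer s l x)) \<in> borel_measurable lebesgue"
      using measurable_completion[of F lborel borel] by (intro borel_measurable_times) auto
    then show "(\<lambda>x. indicator (ball 0 R) x *\<^sub>R (F x * single_layer s l x)) \<in> borel_measurable lebesgue"
      by (simp add: mult.left_commute)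
    show "(\<lambda>x. G x * Lay l x) \<in> borel_measurable lebesgue"
      unfolding G_def by (rule measurable_completion) measurable
    have "AE x in lebesgue. x \<notin> frontier \<Omega>"
      using AE_not_in[OF null_S] by (rule AE_completion)
    then show "AE x in lebesgue. indicator (ball 0 R) x *\<^sub>R (F x * single_layer s l x) = G x * Lay l x"
    proof eventually_elim
      case (elim x)
      show ?case
      proof (cases "x \<in> ball 0 R")
        case True
        then have "x \<in> Dom" using elim by (simp add: Dom_def)
        then show ?thesis using True single_layer_eq[OF l] by (simp add: G_def)
      qed (use Fb(2) in \<open>simp add: G_def\<close>)
    qed
  qed
  also have "\<dots> = (LINT x|lborel. G x * Lay l x)"
    by (rule integral_completion) (unfold G_def, measurable)
  also have "\<dots> = l (rpot ?t G)"
    by (rule layer_test_identity[OF bfun_dual[OF l] G, symmetric]) (use Fb(2) in \<open>simp add: G_def\<close>)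
  finally show "(LINT x : ball 0 R | lebesgue. F x * single_layer s l x) =
          l (\<lambda>Q. LINT x : ball 0 R | lebesgue. F x * riesz_kernel s (x - Q))"
    unfolding pot .
qed

lemma single_layer_estimate:
  obtains c_R where "\<And>l. l \<in> H_bd_dual (s - 1/2) \<Omega> \<Longrightarrow> single_layer s l \<in> Hs_ball s R \<and>
     Hs_ball_norm s R (single_layer s l) \<le> c_R * H_bd_dual_norm (s - 1/2) \<Omega> l"
proof -
  let ?c = "riesz_const CARD('n) s"
  obtain C where C: "0 \<le> C"
    "\<And>l \<Lambda>. bfun l \<Lambda> \<Longrightarrow> (\<integral>\<^sup>+x. ennreal ((Lay l x)\<^sup>2) \<partial>lborel) \<le> ennreal (C * \<Lambda>\<^sup>2)"
    "\<And>l \<Lambda>. bfun l \<Lambda> \<Longrightarrow> (\<integral>\<^sup>+z. ennreal ((Lay l (fst z) - Lay l (snd z))\<^sup>2 * norm (fst z - snd z) powr (-(real CARD('n) + 2 * s))) *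
        (indicator Dom (fst z) * indicator Dom (snd z)) \<partial>(lborel \<Otimes>\<^sub>M lborel)) \<le> ennreal (C * \<Lambda>\<^sup>2)"
    by (rule Lay_bounds, erule that, blast, blast)
  \<comment> \<open>The L^2 part and the seminorm contribute one \<open>C\<close> each.\<close>
  define D where "D = ?c\<^sup>2 * (2 * C)"
  have D: "0 \<le> D" using C(1) by (simp add: D_def)
  show ?thesis
  proof (rule that[of "sqrt D"])
    fix l assume l: "l \<in> H_bd_dual (s - 1/2) \<Omega>"
    let ?\<Lambda> = "H_bd_dual_norm (s - 1/2) \<Omega> l"
    have b: "bfun l ?\<Lambda>" by (rule bfun_dual[OF l])
    then have \<Lambda>: "0 \<le> ?\<Lambda>" by (simp add: bfun_def)
    have "Hs_ball_sq s R (single_layer s l) \<le> ennreal (?c\<^sup>2) * ennreal (C * ?\<Lambda>\<^sup>2 + C * ?\<Lambda>\<^sup>2)"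
      unfolding Hs_ball_sq_single_layer[OF l] using C(1)
      by (intro mult_left_mono ennreal_add_le C(2)[OF b] C(3)[OF b]) auto
    also have "\<dots> = ennreal (D * ?\<Lambda>\<^sup>2)"
      by (subst ennreal_mult'[symmetric]) (simp_all add: D_def algebra_simps)
    finally have le: "Hs_ball_sq s R (single_layer s l) \<le> ennreal (D * ?\<Lambda>\<^sup>2)" .
    then have fin: "Hs_ball_sq s R (single_layer s l) < \<infinity>" by (simp add: le_less_trans)
    have "enn2real (Hs_ball_sq s R (single_layer s l)) \<le> D * ?\<Lambda>\<^sup>2"
      using enn2real_mono[OF le] D by simp
    then have "Hs_ball_norm s R (single_layer s l) \<le> sqrt (D * ?\<Lambda>\<^sup>2)"
      unfolding Hs_ball_norm_def by (rule real_sqrt_le_mono)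
    also have "\<dots> = sqrt D * ?\<Lambda>" using \<Lambda> by (simp add: real_sqrt_mult)
    finally show "single_layer s l \<in> Hs_ball s R \<and> Hs_ball_norm s R (single_layer s l) \<le> sqrt D * ?\<Lambda>"
      using fin single_layer_measurable[OF l] by (simp add: Hs_ball_def)
  qed
qed

end

theorem theorem3p6:
  fixes \<Omega> :: "(real^'n) set" and s :: real and R :: real
  assumes "CARD('n) \<ge> 2"
    and "bounded \<Omega>" and "lipschitz_domain \<Omega>"
    and "1/2 < s" and "s < 1"
    and "\<Omega> \<subseteq> ball 0 (R / 2)"
  shows "\<exists>c_R::real. \<forall>l \<in> H_bd_dual (s - 1/2) \<Omega>.
     single_layer s l \<in> Hs_ball s R \<and>
     Hs_ball_norm s R (single_layer s l) \<le> c_R * H_bd_dual_norm (s - 1/2) \<Omega> l \<and>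
     (\<forall>F \<in> test_functions (ball 0 R).
        (\<lambda>Q. LINT x : ball 0 R | lebesgue. F x * riesz_kernel s (x - Q)) \<in> H_bd (s - 1/2) \<Omega> \<and>
        (LINT x : ball 0 R | lebesgue. F x * single_layer s l x) =
          l (\<lambda>Q. LINT x : ball 0 R | lebesgue. F x * riesz_kernel s (x - Q)))"
proof -
  obtain A where A: "layer (bd_measure \<Omega>) A R s (real CARD('n) - 2 * s) (real CARD('n) + 2 * s) (real CARD('n) + 2 * s - 2) (frontier \<Omega>)"
    by (rule layer_bd_measure[OF assms], rule that)
  obtain c_R where c: "\<And>l. l \<in> H_bd_dual (s - 1/2) \<Omega> \<Longrightarrow> single_layer s l \<in> Hs_ball s R \<and>
     Hs_ball_norm s R (single_layer s l) \<le> c_R * H_bd_dual_norm (s - 1/2) \<Omega> l"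
    by (rule single_layer_estimate[OF A], rule that)
  show ?thesis
    by (intro exI[of _ c_R] ballI conjI c[THEN conjunct1] c[THEN conjunct2] test_function_identity[OF A])
qed

end
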